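(* Let $\mathcal{C}$ be an exact category such that (Ax1) arbitrary transfinite compositions of inflations exist and are again inflations, and (Ax2) every object of $\mathcal{C}$ is small relative to the class of all inflations. Let $\mathcal{I}$ be a homological set of inflations in $\mathcal{C}$, and put $\mathcal{S}=\operatorname{Coker}(\mathcal{I})$ and $\mathcal{T}=\mathcal{S}^{\perp_1}$. Then the following assertions hold: (1) The class $\mathcal{I}\text{-Cells}$ is precovering in $\mathcal{C}$. (2) $\mathcal{I}\text{-Cells}\subseteq \operatorname{Filt}\mathcal{S}$. If $\mathcal{I}$ is strongly homological, then $\mathcal{I}\text{-Cells}=\operatorname{Filt}\mathcal{S}$. (3) $\mathcal{T}=(\mathcal{I}\text{-Cells})^{\perp_1}=(\operatorname{Filt}\mathcal{S})^{\perp_1}$. (4) The class $\mathcal{T}$ is preenveloping in $\mathcal{C}$. In fact, for each object $M\in\mathcal{C}$ there is a conflation $0\to M\to T\to X\to 0$ with $T\in\mathcal{T}$ and $X\in\mathcal{I}\text{-Cells}$. (5) If the class ${}^{\perp_1}\mathcal{T}$ is generating, then for each object $M\in\mathcal{C}$ there is a conflation $0\to T'\to X'\to M\to 0$ with $T'\in\mathcal{T}$ and $X'\in{}^{\perp_1}\mathcal{T}$. In particular, $({}^{\perp_1}\mathcal{T},\mathcal{T})$ is a complete cotorsion pair in $\mathcal{C}$. (6) If $\operatorname{Filt}\mathcal{S}$ is a generating class of $\mathcal{C}$, then ${}^{\perp_1}\mathcal{T}$ consists precisely of the direct summands of $\mathcal{S}$-filtered objects.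
   Context: Exact categories are in the sense of Quillen: an additive category with a distinguished class of kernel-cokernel pairs, called conflations $0\to X\to Y\to Z\to 0$ (satisfying the usual axioms); the first map of a conflation is an inflation and the second a deflation. $\operatorname{Ext}^1_{\mathcal{C}}(X,Y)$ denotes the Yoneda Ext (equivalence classes of conflations $0\to Y\to Z\to X\to 0$). For a class $\mathcal{S}$ of objects, $\mathcal{S}^{\perp_1}=\{Y\mid \operatorname{Ext}^1_{\mathcal{C}}(S,Y)=0\ \forall S\in\mathcal{S}\}$ and ${}^{\perp_1}\mathcal{S}=\{X\mid \operatorname{Ext}^1_{\mathcal{C}}(X,S)=0\ \forall S\in\mathcal{S}\}$. Transfinite compositions. For an ordinal $\lambda$, a $\lambda$-sequence is a direct system $[(X_\alpha)_{\alpha<\lambda},(i_{\alpha\beta})_{\alpha<\beta<\lambda}]$ such that for each limit ordinal $\gamma<\lambda$ the colimit $\operatorname{colim}_{\alpha<\gamma}X_\alpha$ exists and the canonical map $\operatorname{colim}_{\alpha<\gamma}X_\alpha\to X_\gamma$ is an isomorphism. If the colimit of the whole system exists, $X_0\to\operatorname{colim}_{\alpha<\lambda}X_\alpha$ is its composition; if all $i_{\alpha,\alpha+1}$ ($\alpha+1<\lambda$) lie in a class $\mathcal{M}$, it is called a transfinite composition of morphisms of $\mathcal{M}$. Smallness. For an infinite regular cardinal $\kappa$, an object $X$ is $\kappa$-small relative to a class of morphisms $\mathcal{M}$ if for all ordinals $\lambda$ of cofinality $\ge\kappa$ and all $\lambda$-sequences $(Y_\alpha)_{\alpha<\lambda}$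 whose composition exists and with all $Y_\alpha\to Y_{\alpha+1}$ in $\mathcal{M}$, the canonical map $\operatorname{colim}_{\alpha<\lambda}\operatorname{Hom}(X,Y_\alpha)\to\operatorname{Hom}(X,\operatorname{colim}_{\alpha<\lambda}Y_\alpha)$ is an isomorphism. $X$ is small relative to $\mathcal{M}$ if it is $\kappa$-small relative to $\mathcal{M}$ for some infinite regular $\kappa$. Cells. A relative $\mathcal{I}$-cell complex is a transfinite composition of pushouts of maps from $\mathcal{I}$. An object $X$ is an $\mathcal{I}$-cell complex if $0\to X$ is a relative $\mathcal{I}$-cell complex; $\mathcal{I}\text{-Cells}$ is the class of all $\mathcal{I}$-cell complexes. Homological sets. For a set $\mathcal{I}$ of inflations, $\operatorname{Coker}(\mathcal{I})$ is the class of objects isomorphic to $\operatorname{Coker}(i)$ for some $i\in\mathcal{I}$. $\mathcal{I}$ is homological if for any object $T$ the following are equivalent: (a) $\operatorname{Ext}^1_{\mathcal{C}}(S,T)=0$ for all $S\in\operatorname{Coker}(\mathcal{I})$; (b) for every $i:A\to B$ in $\mathcal{I}$ the map $\operatorname{Hom}_{\mathcal{C}}(i,T):\operatorname{Hom}_{\mathcal{C}}(B,T)\to\operatorname{Hom}_{\mathcal{C}}(A,T)$ is surjective. $\mathcal{I}$ is strongly homological if for every inflation $j:A\to B$ whose cokernel $S$ belongs to $\operatorname{Coker}(\mathcal{I})$ there are $i:A'\to B'$ in $\mathcal{I}$ and a commutative diagram with conflations $0\to A'\xrightarrow{i}B'\to S\to 0$ and $0\to A\xrightarrow{j}B\to S\to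 0$ as rows, given by morphisms $A'\to A$, $B'\to B$ and the identity of $S$. (Every strongly homological set is homological.) Filtrations. An object $X$ is $\mathcal{S}$-filtered if $0\to X$ is the composition of a $\lambda$-sequence $(X_\alpha)_{\alpha<\lambda}$ with all $X_\alpha\to X_{\alpha+1}$ inflations with cokernel in $\mathcal{S}$. $\operatorname{Filt}\mathcal{S}$ is the class of all $\mathcal{S}$-filtered objects. Approximations. An $\mathcal{F}$-precover of $X$ is a morphism $f:F\to X$ with $F\in\mathcal{F}$ such that every $f':F'\to X$ with $F'\in\mathcal{F}$ factors through $f$; $\mathcal{F}$ is precovering if each object has an $\mathcal{F}$-precover. $\mathcal{F}$-preenvelopes and preenveloping classes are dual. A cotorsion pair is a pair $(\mathcal{X},\mathcal{Y})$ of full subcategories with $\mathcal{X}^{\perp_1}=\mathcal{Y}$ and $\mathcal{X}={}^{\perp_1}\mathcal{Y}$; it is complete if for every object $M$ there are conflations $0\to Y\to X\to M\to 0$ and $0\to M\to Y'\to X'\to 0$ with $X,X'\in\mathcal{X}$, $Y,Y'\in\mathcal{Y}$. A class $\mathcal{G}$ of objects is generating if each object $M$ admits a deflation $G\to M$ with $G$ a set-indexed coproduct of objects of $\mathcal{G}$. *)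

theory Defs
  imports "HOL-Algebra.Group" "HOL-Library.Equipollence"
begin

section \<open>Sets, classes and ordinals\<close>

text \<open>
  The distinction between sets and classes is made relative to a Grothendieck universe, given
  by its ordinals: these are the elements of a well-ordered type \<open>'u\<close> whose order type is a
  strongly inaccessible cardinal.  A collection over any type is a set of the universe (``small'')
  iff it has fewer elements than \<open>'u\<close>.  An ordinal \<open>\<Lambda>\<close> is identified with the set
  \<open>{..<\<Lambda>}\<close> of its predecessors.
\<close>

definition small :: "'u itself \<Rightarrow> 'a set \<Rightarrow> bool" where
  "small U A \<longleftrightarrow> A \<prec> (UNIV :: 'u set)"

definition inaccessible_ordinals :: "'u::wellorder itself \<Rightarrow> bool" where
  "inaccessible_ordinals U \<longleftrightarrow>
     (\<forall>\<alpha>::'u. small U {..<\<alpha>}) \<and>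
     small U (UNIV :: nat set) \<and>
     (\<forall>A::'u set. small U A \<longrightarrow> small U (Pow A)) \<and>
     (\<forall>A::'u set. small U A \<longrightarrow> (\<exists>\<beta>. \<forall>\<alpha>\<in>A. \<alpha> < \<beta>))"

definition ord_zero :: "'u::wellorder" where
  "ord_zero = (LEAST \<alpha>. True)"

definition ord_succ :: "'u::wellorder \<Rightarrow> 'u" where
  "ord_succ \<alpha> = (LEAST \<beta>. \<alpha> < \<beta>)"

definition limit_ordinal :: "'u::wellorder \<Rightarrow> bool" where
  "limit_ordinal \<gamma> \<longleftrightarrow> ord_zero < \<gamma> \<and> (\<forall>\<alpha><\<gamma>. ord_succ \<alpha> < \<gamma>)"

definition cofinality :: "'u::wellorder \<Rightarrow> 'u" where
  "cofinality \<Lambda> =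
     (LEAST \<delta>. \<exists>S\<subseteq>{..<\<Lambda>}. (\<forall>\<alpha><\<Lambda>. \<exists>\<sigma>\<in>S. \<alpha> \<le> \<sigma>) \<and> S \<approx> {..<\<delta>})"

text \<open>
  Cofinalities are initial ordinals, so the fixed points of \<open>cofinality\<close> are cardinals.
\<close>

definition infinite_regular_cardinal :: "'u::wellorder \<Rightarrow> bool" where
  "infinite_regular_cardinal \<kappa> \<longleftrightarrow> infinite {..<\<kappa>} \<and> cofinality \<kappa> = \<kappa>"


section \<open>Categories\<close>

record ('o, 'm) cat =
  Obj :: "'o set"
  Arr :: "'m set"
  Dom :: "'m \<Rightarrow> 'o"
  Cod :: "'m \<Rightarrow> 'o"
  Id :: "'o \<Rightarrow> 'm"
  Comp :: "'m \<Rightarrow> 'm \<Rightarrow> 'm"  (infixl "\<cdot>\<index>" 70)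

definition Hom :: "('o, 'm, 'z) cat_scheme \<Rightarrow> 'o \<Rightarrow> 'o \<Rightarrow> 'm set" where
  "Hom C X Y = {f \<in> Arr C. Dom C f = X \<and> Cod C f = Y}"

locale category =
  fixes C :: "('o, 'm, 'z) cat_scheme" (structure)
  assumes dom_Obj: "f \<in> Arr C \<Longrightarrow> Dom C f \<in> Obj C"
    and cod_Obj: "f \<in> Arr C \<Longrightarrow> Cod C f \<in> Obj C"
    and Id_Hom: "X \<in> Obj C \<Longrightarrow> Id C X \<in> Hom C X X"
    and Comp_Hom: "\<lbrakk>f \<in> Hom C X Y; g \<in> Hom C Y Z\<rbrakk> \<Longrightarrow> g \<cdot> f \<in> Hom C X Z"
    and Comp_Id: "f \<in> Hom C X Y \<Longrightarrow> f \<cdot> Id C X = f"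
    and Id_Comp: "f \<in> Hom C X Y \<Longrightarrow> Id C Y \<cdot> f = f"
    and Comp_assoc:
      "\<lbrakk>f \<in> Hom C W X; g \<in> Hom C X Y; h \<in> Hom C Y Z\<rbrakk> \<Longrightarrow> h \<cdot> (g \<cdot> f) = (h \<cdot> g) \<cdot> f"

definition locally_small :: "'u itself \<Rightarrow> ('o, 'm, 'z) cat_scheme \<Rightarrow> bool" where
  "locally_small U C \<longleftrightarrow> (\<forall>X\<in>Obj C. \<forall>Y\<in>Obj C. small U (Hom C X Y))"

definition iso_between :: "('o, 'm, 'z) cat_scheme \<Rightarrow> 'm \<Rightarrow> 'o \<Rightarrow> 'o \<Rightarrow> bool" where
  "iso_between C f X Y \<longleftrightarrow>
     f \<in> Hom C X Y \<and> (\<exists>g\<in>Hom C Y X. g \<cdot>\<^bsub>C\<^esub> f = Id C X \<and> f \<cdot>\<^bsub>C\<^esub> g = Id C Y)"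

definition isomorphic :: "('o, 'm, 'z) cat_scheme \<Rightarrow> 'o \<Rightarrow> 'o \<Rightarrow> bool" where
  "isomorphic C X Y \<longleftrightarrow> (\<exists>f. iso_between C f X Y)"

definition zero_object :: "('o, 'm, 'z) cat_scheme \<Rightarrow> 'o \<Rightarrow> bool" where
  "zero_object C Z \<longleftrightarrow>
     Z \<in> Obj C \<and> (\<forall>X\<in>Obj C. (\<exists>!f. f \<in> Hom C Z X) \<and> (\<exists>!f. f \<in> Hom C X Z))"

definition is_coproduct ::
  "('o, 'm, 'z) cat_scheme \<Rightarrow> 'j set \<Rightarrow> ('j \<Rightarrow> 'o) \<Rightarrow> 'o \<Rightarrow> ('j \<Rightarrow> 'm) \<Rightarrow> bool" where
  "is_coproduct C J F P e \<longleftrightarrow>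
     P \<in> Obj C \<and> (\<forall>j\<in>J. F j \<in> Obj C \<and> e j \<in> Hom C (F j) P) \<and>
     (\<forall>Y\<in>Obj C. \<forall>f. (\<forall>j\<in>J. f j \<in> Hom C (F j) Y) \<longrightarrow>
        (\<exists>!u. u \<in> Hom C P Y \<and> (\<forall>j\<in>J. u \<cdot>\<^bsub>C\<^esub> e j = f j)))"

text \<open>
  \<open>is_pushout C f g f' g'\<close>: the span \<open>f : A \<rightarrow> B\<close>, \<open>g : A \<rightarrow> A'\<close> is completed to a pushout square
  by \<open>f' : A' \<rightarrow> B'\<close> and \<open>g' : B \<rightarrow> B'\<close>; thus \<open>f'\<close> is the pushout of \<open>f\<close> along \<open>g\<close>.  Dually,
  \<open>is_pullback C f g f' g'\<close> says that \<open>f'\<close> is the pullback of \<open>f\<close> along \<open>g\<close>.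
\<close>

definition is_pushout :: "('o, 'm, 'z) cat_scheme \<Rightarrow> 'm \<Rightarrow> 'm \<Rightarrow> 'm \<Rightarrow> 'm \<Rightarrow> bool" where
  "is_pushout C f g f' g' \<longleftrightarrow>
     {f, g, f', g'} \<subseteq> Arr C \<and>
     Dom C f = Dom C g \<and> Dom C f' = Cod C g \<and> Dom C g' = Cod C f \<and> Cod C f' = Cod C g' \<and>
     g' \<cdot>\<^bsub>C\<^esub> f = f' \<cdot>\<^bsub>C\<^esub> g \<and>
     (\<forall>Y\<in>Obj C. \<forall>a\<in>Hom C (Cod C f) Y. \<forall>b\<in>Hom C (Cod C g) Y. a \<cdot>\<^bsub>C\<^esub> f = b \<cdot>\<^bsub>C\<^esub> g \<longrightarrow>
        (\<exists>!u. u \<in> Hom C (Cod C f') Y \<and> u \<cdot>\<^bsub>C\<^esub> g' = a \<and> u \<cdot>\<^bsub>C\<^esub> f' = b))"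

definition is_pullback :: "('o, 'm, 'z) cat_scheme \<Rightarrow> 'm \<Rightarrow> 'm \<Rightarrow> 'm \<Rightarrow> 'm \<Rightarrow> bool" where
  "is_pullback C f g f' g' \<longleftrightarrow>
     {f, g, f', g'} \<subseteq> Arr C \<and>
     Cod C f = Cod C g \<and> Cod C f' = Dom C g \<and> Cod C g' = Dom C f \<and> Dom C f' = Dom C g' \<and>
     f \<cdot>\<^bsub>C\<^esub> g' = g \<cdot>\<^bsub>C\<^esub> f' \<and>
     (\<forall>Y\<in>Obj C. \<forall>a\<in>Hom C Y (Dom C f). \<forall>b\<in>Hom C Y (Dom C g). f \<cdot>\<^bsub>C\<^esub> a = g \<cdot>\<^bsub>C\<^esub> b \<longrightarrow>
        (\<exists>!u. u \<in> Hom C Y (Dom C f') \<and> g' \<cdot>\<^bsub>C\<^esub> u = a \<and> f' \<cdot>\<^bsub>C\<^esub> u = b))"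


section \<open>Additive and exact categories\<close>

record ('o, 'm) add_cat = "('o, 'm) cat" +
  Add :: "'m \<Rightarrow> 'm \<Rightarrow> 'm"
  Zero :: "'o \<Rightarrow> 'o \<Rightarrow> 'm"

definition hom_group :: "('o, 'm, 'z) add_cat_scheme \<Rightarrow> 'o \<Rightarrow> 'o \<Rightarrow> 'm monoid" where
  "hom_group C X Y = \<lparr>carrier = Hom C X Y, mult = Add C, one = Zero C X Y\<rparr>"

definition is_biproduct ::
  "('o, 'm, 'z) add_cat_scheme \<Rightarrow> 'o \<Rightarrow> 'o \<Rightarrow> 'o \<Rightarrow> 'm \<Rightarrow> 'm \<Rightarrow> 'm \<Rightarrow> 'm \<Rightarrow> bool" where
  "is_biproduct C X Y P i1 i2 p1 p2 \<longleftrightarrow>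
     i1 \<in> Hom C X P \<and> i2 \<in> Hom C Y P \<and> p1 \<in> Hom C P X \<and> p2 \<in> Hom C P Y \<and>
     p1 \<cdot>\<^bsub>C\<^esub> i1 = Id C X \<and> p2 \<cdot>\<^bsub>C\<^esub> i2 = Id C Y \<and>
     p2 \<cdot>\<^bsub>C\<^esub> i1 = Zero C X Y \<and> p1 \<cdot>\<^bsub>C\<^esub> i2 = Zero C Y X \<and>
     Add C (i1 \<cdot>\<^bsub>C\<^esub> p1) (i2 \<cdot>\<^bsub>C\<^esub> p2) = Id C P"

locale additive_category = category C
  for C :: "('o, 'm, 'z) add_cat_scheme" (structure) +
  assumes hom_comm_group: "\<lbrakk>X \<in> Obj C; Y \<in> Obj C\<rbrakk> \<Longrightarrow> comm_group (hom_group C X Y)"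
    and Comp_Add_left: "\<lbrakk>f \<in> Hom C X Y; g \<in> Hom C Y Z; g' \<in> Hom C Y Z\<rbrakk>
      \<Longrightarrow> Add C g g' \<cdot> f = Add C (g \<cdot> f) (g' \<cdot> f)"
    and Comp_Add_right: "\<lbrakk>f \<in> Hom C X Y; f' \<in> Hom C X Y; g \<in> Hom C Y Z\<rbrakk>
      \<Longrightarrow> g \<cdot> Add C f f' = Add C (g \<cdot> f) (g \<cdot> f')"
    and ex_zero_object: "\<exists>Z. zero_object C Z"
    and ex_biproduct: "\<lbrakk>X \<in> Obj C; Y \<in> Obj C\<rbrakk> \<Longrightarrow> \<exists>P i1 i2 p1 p2. is_biproduct C X Y P i1 i2 p1 p2"

definition is_kernel :: "('o, 'm, 'z) add_cat_scheme \<Rightarrow> 'm \<Rightarrow> 'm \<Rightarrow> bool" where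
  "is_kernel C i p \<longleftrightarrow>
     i \<in> Arr C \<and> p \<in> Arr C \<and> Cod C i = Dom C p \<and>
     p \<cdot>\<^bsub>C\<^esub> i = Zero C (Dom C i) (Cod C p) \<and>
     (\<forall>W\<in>Obj C. \<forall>f\<in>Hom C W (Dom C p). p \<cdot>\<^bsub>C\<^esub> f = Zero C W (Cod C p) \<longrightarrow>
        (\<exists>!u. u \<in> Hom C W (Dom C i) \<and> i \<cdot>\<^bsub>C\<^esub> u = f))"

definition is_cokernel :: "('o, 'm, 'z) add_cat_scheme \<Rightarrow> 'm \<Rightarrow> 'm \<Rightarrow> bool" where
  "is_cokernel C i p \<longleftrightarrow>
     i \<in> Arr C \<and> p \<in> Arr C \<and> Cod C i = Dom C p \<and>
     p \<cdot>\<^bsub>C\<^esub> i = Zero C (Dom C i) (Cod C p) \<and>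
     (\<forall>W\<in>Obj C. \<forall>f\<in>Hom C (Cod C i) W. f \<cdot>\<^bsub>C\<^esub> i = Zero C (Dom C i) W \<longrightarrow>
        (\<exists>!u. u \<in> Hom C (Cod C p) W \<and> u \<cdot>\<^bsub>C\<^esub> p = f))"

record ('o, 'm) exact_cat = "('o, 'm) add_cat" +
  Confl :: "('m \<times> 'm) set"

definition inflations :: "('o, 'm, 'z) exact_cat_scheme \<Rightarrow> 'm set" where
  "inflations C = fst ` Confl C"

definition deflations :: "('o, 'm, 'z) exact_cat_scheme \<Rightarrow> 'm set" where
  "deflations C = snd ` Confl C"

locale exact_category = additive_category C
  for C :: "('o, 'm, 'z) exact_cat_scheme" (structure) +
  assumes Confl_kernel_cokernel:
      "(i, p) \<in> Confl C \<Longrightarrow> is_kernel C i p \<and> is_cokernel C i p"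
    and Confl_iso_closed:
      "\<lbrakk>(i, p) \<in> Confl C; i' \<in> Hom C X' Y'; p' \<in> Hom C Y' Z';
        iso_between C a (Dom C i) X'; iso_between C b (Cod C i) Y'; iso_between C c (Cod C p) Z';
        i' \<cdot> a = b \<cdot> i; p' \<cdot> b = c \<cdot> p\<rbrakk> \<Longrightarrow> (i', p') \<in> Confl C"
    and Id_inflation: "X \<in> Obj C \<Longrightarrow> Id C X \<in> inflations C"
    and Id_deflation: "X \<in> Obj C \<Longrightarrow> Id C X \<in> deflations C"
    and inflation_Comp:
      "\<lbrakk>i \<in> inflations C; j \<in> inflations C; Cod C i = Dom C j\<rbrakk> \<Longrightarrow> j \<cdot> i \<in> inflations C"
    and deflation_Comp:
      "\<lbrakk>p \<in> deflations C; q \<in> deflations C; Cod C p = Dom C q\<rbrakk> \<Longrightarrow> q \<cdot> p \<in> deflations C"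
    and inflation_pushout:
      "\<lbrakk>i \<in> inflations C; g \<in> Arr C; Dom C g = Dom C i\<rbrakk>
        \<Longrightarrow> \<exists>i' g'. is_pushout C i g i' g' \<and> i' \<in> inflations C"
    and deflation_pullback:
      "\<lbrakk>p \<in> deflations C; g \<in> Arr C; Cod C g = Cod C p\<rbrakk>
        \<Longrightarrow> \<exists>p' g'. is_pullback C p g p' g' \<and> p' \<in> deflations C"

definition direct_summand :: "('o, 'm, 'z) add_cat_scheme \<Rightarrow> 'o \<Rightarrow> 'o \<Rightarrow> bool" where
  "direct_summand C X F \<longleftrightarrow> (\<exists>Y\<in>Obj C. \<exists>i1 i2 p1 p2. is_biproduct C X Y F i1 i2 p1 p2)"


section \<open>Yoneda Ext and orthogonal classes\<close>

definition extensions :: "('o, 'm, 'z) exact_cat_scheme \<Rightarrow> 'o \<Rightarrow> 'o \<Rightarrow> ('m \<times> 'm) set" where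
  "extensions C X Y = {(i, p) \<in> Confl C. Dom C i = Y \<and> Cod C p = X}"

definition extension_equiv ::
  "('o, 'm, 'z) exact_cat_scheme \<Rightarrow> 'o \<Rightarrow> 'o \<Rightarrow> (('m \<times> 'm) \<times> ('m \<times> 'm)) set" where
  "extension_equiv C X Y =
     {((i, p), (i', p')). (i, p) \<in> extensions C X Y \<and> (i', p') \<in> extensions C X Y \<and>
        (\<exists>h. iso_between C h (Cod C i) (Cod C i') \<and> h \<cdot>\<^bsub>C\<^esub> i = i' \<and> p' \<cdot>\<^bsub>C\<^esub> h = p)}"

definition Ext1 :: "('o, 'm, 'z) exact_cat_scheme \<Rightarrow> 'o \<Rightarrow> 'o \<Rightarrow> ('m \<times> 'm) set set" where
  "Ext1 C X Y = extensions C X Y // extension_equiv C X Y"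

text \<open>
  The underlying set of the group \<open>Ext1 C X Y\<close> suffices to express its vanishing: a group is zero
  iff it has exactly one element.
\<close>

definition Ext1_vanishes :: "('o, 'm, 'z) exact_cat_scheme \<Rightarrow> 'o \<Rightarrow> 'o \<Rightarrow> bool" where
  "Ext1_vanishes C X Y \<longleftrightarrow> is_singleton (Ext1 C X Y)"

definition right_perp :: "('o, 'm, 'z) exact_cat_scheme \<Rightarrow> 'o set \<Rightarrow> 'o set" where
  "right_perp C \<S> = {Y \<in> Obj C. \<forall>S\<in>\<S>. Ext1_vanishes C S Y}"

definition left_perp :: "('o, 'm, 'z) exact_cat_scheme \<Rightarrow> 'o set \<Rightarrow> 'o set" where
  "left_perp C \<S> = {X \<in> Obj C. \<forall>S\<in>\<S>. Ext1_vanishes C X S}"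


section \<open>Transfinite compositions and smallness\<close>

text \<open>
  Systems indexed by an ordinal \<open>\<Lambda>\<close> are given by functions on all of \<open>'u\<close>, of which only the values
  at indices below \<open>\<Lambda>\<close> matter.  The transition maps include the identities \<open>i \<alpha> \<alpha>\<close>.
\<close>

definition direct_system ::
  "('o, 'm, 'z) cat_scheme \<Rightarrow> 'u::wellorder \<Rightarrow> ('u \<Rightarrow> 'o) \<Rightarrow> ('u \<Rightarrow> 'u \<Rightarrow> 'm) \<Rightarrow> bool" where
  "direct_system C \<Lambda> X i \<longleftrightarrow>
     (\<forall>\<alpha><\<Lambda>. X \<alpha> \<in> Obj C \<and> i \<alpha> \<alpha> = Id C (X \<alpha>)) \<and>
     (\<forall>\<beta><\<Lambda>. \<forall>\<alpha>\<le>\<beta>. i \<alpha> \<beta> \<in> Hom C (X \<alpha>) (X \<beta>)) \<and>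
     (\<forall>\<gamma><\<Lambda>. \<forall>\<beta>\<le>\<gamma>. \<forall>\<alpha>\<le>\<beta>. i \<beta> \<gamma> \<cdot>\<^bsub>C\<^esub> i \<alpha> \<beta> = i \<alpha> \<gamma>)"

definition is_cocone ::
  "('o, 'm, 'z) cat_scheme \<Rightarrow> 'u::wellorder \<Rightarrow> ('u \<Rightarrow> 'o) \<Rightarrow> ('u \<Rightarrow> 'u \<Rightarrow> 'm) \<Rightarrow> 'o \<Rightarrow> ('u \<Rightarrow> 'm) \<Rightarrow> bool" where
  "is_cocone C \<Lambda> X i Y c \<longleftrightarrow>
     Y \<in> Obj C \<and> (\<forall>\<alpha><\<Lambda>. c \<alpha> \<in> Hom C (X \<alpha>) Y) \<and>
     (\<forall>\<beta><\<Lambda>. \<forall>\<alpha>\<le>\<beta>. c \<beta> \<cdot>\<^bsub>C\<^esub> i \<alpha> \<beta> = c \<alpha>)"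

definition is_colimit ::
  "('o, 'm, 'z) cat_scheme \<Rightarrow> 'u::wellorder \<Rightarrow> ('u \<Rightarrow> 'o) \<Rightarrow> ('u \<Rightarrow> 'u \<Rightarrow> 'm) \<Rightarrow> 'o \<Rightarrow> ('u \<Rightarrow> 'm) \<Rightarrow> bool" where
  "is_colimit C \<Lambda> X i Y c \<longleftrightarrow>
     is_cocone C \<Lambda> X i Y c \<and>
     (\<forall>Y' c'. is_cocone C \<Lambda> X i Y' c' \<longrightarrow>
        (\<exists>!u. u \<in> Hom C Y Y' \<and> (\<forall>\<alpha><\<Lambda>. u \<cdot>\<^bsub>C\<^esub> c \<alpha> = c' \<alpha>)))"

text \<open>
  At a limit ordinal \<open>\<gamma>\<close>, a colimit \<open>(Y, c)\<close> of the system restricted to \<open>\<gamma>\<close> has to exist, and the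
  map \<open>h\<close> that the transition maps \<open>i \<alpha> \<gamma>\<close> induce on it has to be an isomorphism onto \<open>X \<gamma>\<close>.
\<close>

definition lambda_sequence ::
  "('o, 'm, 'z) cat_scheme \<Rightarrow> 'u::wellorder \<Rightarrow> ('u \<Rightarrow> 'o) \<Rightarrow> ('u \<Rightarrow> 'u \<Rightarrow> 'm) \<Rightarrow> bool" where
  "lambda_sequence C \<Lambda> X i \<longleftrightarrow>
     direct_system C \<Lambda> X i \<and>
     (\<forall>\<gamma><\<Lambda>. limit_ordinal \<gamma> \<longrightarrow>
        (\<exists>Y c h. is_colimit C \<gamma> X i Y c \<and> iso_between C h Y (X \<gamma>) \<and>
           (\<forall>\<alpha><\<gamma>. h \<cdot>\<^bsub>C\<^esub> c \<alpha> = i \<alpha> \<gamma>)))"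

definition steps_in :: "'u::wellorder \<Rightarrow> ('u \<Rightarrow> 'u \<Rightarrow> 'm) \<Rightarrow> 'm set \<Rightarrow> bool" where
  "steps_in \<Lambda> i \<M> \<longleftrightarrow> (\<forall>\<alpha>. ord_succ \<alpha> < \<Lambda> \<longrightarrow> i \<alpha> (ord_succ \<alpha>) \<in> \<M>)"

definition transfinite_composition ::
  "'u::wellorder itself \<Rightarrow> ('o, 'm, 'z) cat_scheme \<Rightarrow> 'm set \<Rightarrow> 'm \<Rightarrow> bool" where
  "transfinite_composition U C \<M> f \<longleftrightarrow>
     (\<exists>(\<Lambda>::'u) X i Y c. ord_zero < \<Lambda> \<and> lambda_sequence C \<Lambda> X i \<and> steps_in \<Lambda> i \<M> \<and>
        is_colimit C \<Lambda> X i Y c \<and> f = c ord_zero)"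

definition inflations_closed_under_transfinite_compositions ::
  "'u::wellorder itself \<Rightarrow> ('o, 'm, 'z) exact_cat_scheme \<Rightarrow> bool" where
  "inflations_closed_under_transfinite_compositions U C \<longleftrightarrow>
     (\<forall>(\<Lambda>::'u) X i. ord_zero < \<Lambda> \<and> lambda_sequence C \<Lambda> X i \<and> steps_in \<Lambda> i (inflations C) \<longrightarrow>
        (\<exists>Y c. is_colimit C \<Lambda> X i Y c)) \<and>
     (\<forall>f. transfinite_composition U C (inflations C) f \<longrightarrow> f \<in> inflations C)"

text \<open>
  The colimit of the groups \<open>Hom C X (Y \<alpha>)\<close> over \<open>\<alpha> < \<Lambda>\<close> is the usual quotient of their disjoint
  union.  The canonical map out of it is a group homomorphism, so it is an isomorphism iff it is
  bijective.
\<close>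

definition hom_colim_rel ::
  "('o, 'm, 'z) cat_scheme \<Rightarrow> 'o \<Rightarrow> 'u::wellorder \<Rightarrow> ('u \<Rightarrow> 'o) \<Rightarrow> ('u \<Rightarrow> 'u \<Rightarrow> 'm)
    \<Rightarrow> (('u \<times> 'm) \<times> ('u \<times> 'm)) set" where
  "hom_colim_rel C X \<Lambda> Y i =
     {((\<alpha>, f), (\<beta>, g)). \<alpha> < \<Lambda> \<and> \<beta> < \<Lambda> \<and> f \<in> Hom C X (Y \<alpha>) \<and> g \<in> Hom C X (Y \<beta>) \<and>
        (\<exists>\<gamma><\<Lambda>. \<alpha> \<le> \<gamma> \<and> \<beta> \<le> \<gamma> \<and> i \<alpha> \<gamma> \<cdot>\<^bsub>C\<^esub> f = i \<beta> \<gamma> \<cdot>\<^bsub>C\<^esub> g)}"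

definition hom_colim ::
  "('o, 'm, 'z) cat_scheme \<Rightarrow> 'o \<Rightarrow> 'u::wellorder \<Rightarrow> ('u \<Rightarrow> 'o) \<Rightarrow> ('u \<Rightarrow> 'u \<Rightarrow> 'm)
    \<Rightarrow> ('u \<times> 'm) set set" where
  "hom_colim C X \<Lambda> Y i = (SIGMA \<alpha>:{..<\<Lambda>}. Hom C X (Y \<alpha>)) // hom_colim_rel C X \<Lambda> Y i"

definition hom_colim_map ::
  "('o, 'm, 'z) cat_scheme \<Rightarrow> ('u \<Rightarrow> 'm) \<Rightarrow> ('u \<times> 'm) set \<Rightarrow> 'm" where
  "hom_colim_map C c E = the_elem ((\<lambda>(\<alpha>, f). c \<alpha> \<cdot>\<^bsub>C\<^esub> f) ` E)"

definition kappa_small ::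
  "('o, 'm, 'z) cat_scheme \<Rightarrow> 'm set \<Rightarrow> 'u::wellorder \<Rightarrow> 'o \<Rightarrow> bool" where
  "kappa_small C \<M> \<kappa> X \<longleftrightarrow>
     (\<forall>(\<Lambda>::'u) Y i Z c. \<kappa> \<le> cofinality \<Lambda> \<and> lambda_sequence C \<Lambda> Y i \<and> steps_in \<Lambda> i \<M> \<and>
        is_colimit C \<Lambda> Y i Z c \<longrightarrow>
        bij_betw (hom_colim_map C c) (hom_colim C X \<Lambda> Y i) (Hom C X Z))"

definition small_relative_to ::
  "'u::wellorder itself \<Rightarrow> ('o, 'm, 'z) cat_scheme \<Rightarrow> 'm set \<Rightarrow> 'o \<Rightarrow> bool" where
  "small_relative_to U C \<M> X \<longleftrightarrow>
     (\<exists>\<kappa>::'u. infinite_regular_cardinal \<kappa> \<and> kappa_small C \<M> \<kappa> X)"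


section \<open>Cell complexes, filtrations and homological sets\<close>

definition pushouts_of :: "('o, 'm, 'z) cat_scheme \<Rightarrow> 'm set \<Rightarrow> 'm set" where
  "pushouts_of C \<I> = {f. \<exists>i\<in>\<I>. \<exists>g g'. is_pushout C i g f g'}"

definition relative_cell_complex ::
  "'u::wellorder itself \<Rightarrow> ('o, 'm, 'z) cat_scheme \<Rightarrow> 'm set \<Rightarrow> 'm \<Rightarrow> bool" where
  "relative_cell_complex U C \<I> f \<longleftrightarrow> transfinite_composition U C (pushouts_of C \<I>) f"

definition Cells ::
  "'u::wellorder itself \<Rightarrow> ('o, 'm, 'z) cat_scheme \<Rightarrow> 'm set \<Rightarrow> 'o set" where
  "Cells U C \<I> = {X. \<exists>Z f. zero_object C Z \<and> f \<in> Hom C Z X \<and> relative_cell_complex U C \<I> f}"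

definition inflations_with_cokernel_in ::
  "('o, 'm, 'z) exact_cat_scheme \<Rightarrow> 'o set \<Rightarrow> 'm set" where
  "inflations_with_cokernel_in C \<S> = {j. \<exists>q. (j, q) \<in> Confl C \<and> Cod C q \<in> \<S>}"

definition Filt ::
  "'u::wellorder itself \<Rightarrow> ('o, 'm, 'z) exact_cat_scheme \<Rightarrow> 'o set \<Rightarrow> 'o set" where
  "Filt U C \<S> = {X. \<exists>Z f. zero_object C Z \<and> f \<in> Hom C Z X \<and>
     transfinite_composition U C (inflations_with_cokernel_in C \<S>) f}"

definition Coker :: "('o, 'm, 'z) add_cat_scheme \<Rightarrow> 'm set \<Rightarrow> 'o set" where
  "Coker C \<I> = {S. \<exists>i\<in>\<I>. \<exists>p. is_cokernel C i p \<and> isomorphic C S (Cod C p)}"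

definition homological ::
  "'u itself \<Rightarrow> ('o, 'm, 'z) exact_cat_scheme \<Rightarrow> 'm set \<Rightarrow> bool" where
  "homological U C \<I> \<longleftrightarrow>
     small U \<I> \<and> \<I> \<subseteq> inflations C \<and>
     (\<forall>T\<in>Obj C. (\<forall>S\<in>Coker C \<I>. Ext1_vanishes C S T) \<longleftrightarrow>
        (\<forall>i\<in>\<I>. (\<lambda>g. g \<cdot>\<^bsub>C\<^esub> i) ` Hom C (Cod C i) T = Hom C (Dom C i) T))"

definition strongly_homological ::
  "'u itself \<Rightarrow> ('o, 'm, 'z) exact_cat_scheme \<Rightarrow> 'm set \<Rightarrow> bool" where
  "strongly_homological U C \<I> \<longleftrightarrow>
     small U \<I> \<and> \<I> \<subseteq> inflations C \<and>
     (\<forall>j q. (j, q) \<in> Confl C \<and> Cod C q \<in> Coker C \<I> \<longrightarrow>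
        (\<exists>i\<in>\<I>. \<exists>q' a b. (i, q') \<in> Confl C \<and> Cod C q' = Cod C q \<and>
           a \<in> Hom C (Dom C i) (Dom C j) \<and> b \<in> Hom C (Cod C i) (Cod C j) \<and>
           b \<cdot>\<^bsub>C\<^esub> i = j \<cdot>\<^bsub>C\<^esub> a \<and> q \<cdot>\<^bsub>C\<^esub> b = q'))"


section \<open>Approximations and cotorsion pairs\<close>

definition is_precover :: "('o, 'm, 'z) cat_scheme \<Rightarrow> 'o set \<Rightarrow> 'o \<Rightarrow> 'm \<Rightarrow> bool" where
  "is_precover C \<F> X f \<longleftrightarrow>
     f \<in> Arr C \<and> Dom C f \<in> \<F> \<and> Cod C f = X \<and>
     (\<forall>F'\<in>\<F>. \<forall>f'\<in>Hom C F' X. \<exists>g\<in>Hom C F' (Dom C f). f' = f \<cdot>\<^bsub>C\<^esub> g)"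

definition precovering :: "('o, 'm, 'z) cat_scheme \<Rightarrow> 'o set \<Rightarrow> bool" where
  "precovering C \<F> \<longleftrightarrow> (\<forall>X\<in>Obj C. \<exists>f. is_precover C \<F> X f)"

definition is_preenvelope :: "('o, 'm, 'z) cat_scheme \<Rightarrow> 'o set \<Rightarrow> 'o \<Rightarrow> 'm \<Rightarrow> bool" where
  "is_preenvelope C \<F> X f \<longleftrightarrow>
     f \<in> Arr C \<and> Cod C f \<in> \<F> \<and> Dom C f = X \<and>
     (\<forall>F'\<in>\<F>. \<forall>f'\<in>Hom C X F'. \<exists>g\<in>Hom C (Cod C f) F'. f' = g \<cdot>\<^bsub>C\<^esub> f)"

definition preenveloping :: "('o, 'm, 'z) cat_scheme \<Rightarrow> 'o set \<Rightarrow> bool" where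
  "preenveloping C \<F> \<longleftrightarrow> (\<forall>X\<in>Obj C. \<exists>f. is_preenvelope C \<F> X f)"

definition cotorsion_pair :: "('o, 'm, 'z) exact_cat_scheme \<Rightarrow> 'o set \<Rightarrow> 'o set \<Rightarrow> bool" where
  "cotorsion_pair C \<X> \<Y> \<longleftrightarrow>
     \<X> \<subseteq> Obj C \<and> \<Y> \<subseteq> Obj C \<and> right_perp C \<X> = \<Y> \<and> \<X> = left_perp C \<Y>"

definition complete_cotorsion_pair ::
  "('o, 'm, 'z) exact_cat_scheme \<Rightarrow> 'o set \<Rightarrow> 'o set \<Rightarrow> bool" where
  "complete_cotorsion_pair C \<X> \<Y> \<longleftrightarrow>
     cotorsion_pair C \<X> \<Y> \<and>
     (\<forall>M\<in>Obj C.
        (\<exists>i p. (i, p) \<in> Confl C \<and> Dom C i \<in> \<Y> \<and> Cod C i \<in> \<X> \<and> Cod C p = M) \<and>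
        (\<exists>i p. (i, p) \<in> Confl C \<and> Dom C i = M \<and> Cod C i \<in> \<Y> \<and> Cod C p \<in> \<X>))"

text \<open>
  Every small set is equipollent to a subset of \<open>'u\<close>, so it is enough to index coproducts by small
  subsets of \<open>'u\<close>.
\<close>

definition generating :: "'u itself \<Rightarrow> ('o, 'm, 'z) exact_cat_scheme \<Rightarrow> 'o set \<Rightarrow> bool" where
  "generating U C \<G> \<longleftrightarrow>
     (\<forall>M\<in>Obj C. \<exists>(J::'u set) F P e d. small U J \<and> (\<forall>j\<in>J. F j \<in> \<G>) \<and>
        is_coproduct C J F P e \<and> d \<in> deflations C \<and> d \<in> Hom C P M)"

end

theory Submission
  imports Defs
begin

text \<open>
  The small object argument factors \<open>M \<rightarrow> 0\<close> through a relative \<open>\<I>\<close>-cell complex \<open>M \<rightarrow> T\<close> with \<open>T \<in> \<T>\<close>,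
  and \<open>0 \<rightarrow> M\<close> through an \<open>\<I>\<close>-cell complex whose map to \<open>M\<close> is a precover.  Eklof's lemma is a lifting
  property: a deflation with kernel in \<open>\<T>\<close> lifts against all inflations with cokernel in \<open>\<S>\<close>, hence
  against their transfinite compositions.  The special precovers come from the special preenvelopes
  by Salce's pushout.  If \<open>Filt \<S>\<close> is generating, the middle term of that pushout is \<open>\<S>\<close>-filtered,
  because transfinite compositions of transfinite compositions can be refined to a single one.
\<close>

section \<open>Small sets and ordinals\<close>

text \<open>Two features of the definitions shape the proof. A relative cell complex attaches
  pushouts of single maps, so the factorization is built one cell at a time, and its termination
  becomes a counting argument: each step uses up one lifting problem, and the stages below any bound
  have only a small set of them. Secondly, a transfinite composition of length one is an arbitrary
  isomorphism, which need not belong to the class of steps. Such trivial pieces would collapse in a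
  refined sequence, so they are split off: isomorphisms are absorbed into a neighbouring map, and
  zero summands are dropped before a coproduct is written as a transfinite composition.

  The equivalence that defines a homological set enters where the lifting property of T -> 0 against
  \<open>\<I>\<close>, which is surjectivity of Hom(i, T), is read as T \<in> \<T>. Vanishing of Ext
  is replaced early by the splitting of all extensions, so that every later argument about Ext
  consists in finding lifts and sections.\<close>

locale ordinal_universe =
  fixes U :: "'u::wellorder itself"
  assumes inaccessible: "inaccessible_ordinals U"
begin

section \<open>Small sets\<close>

lemma small_lepoll: "small U A \<Longrightarrow> B \<lesssim> A \<Longrightarrow> small U B"
  unfolding small_def by (rule lesspoll_trans1)

lemma small_subset: "small U A \<Longrightarrow> B \<subseteq> A \<Longrightarrow> small U B"
  by (erule small_lepoll) (rule subset_imp_lepoll)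

lemma small_image: "small U A \<Longrightarrow> small U (f ` A)"
  by (erule small_lepoll) (rule image_lepoll)

lemma small_initial: "small U {..<\<alpha>::'u}"
  using inaccessible unfolding inaccessible_ordinals_def by (elim conjE) (erule spec)

lemma small_nat: "small U (UNIV :: nat set)"
  using inaccessible unfolding inaccessible_ordinals_def by (elim conjE)

lemma small_Pow: "small U (A :: 'u set) \<Longrightarrow> small U (Pow A)"
  using inaccessible unfolding inaccessible_ordinals_def by (elim conjE) (erule allE, erule mp)

lemma small_bounded:
  assumes "small U (A :: 'u set)"
  obtains \<beta> where "\<And>\<alpha>. \<alpha> \<in> A \<Longrightarrow> \<alpha> < \<beta>"
proof -
  have "\<forall>A::'u set. small U A \<longrightarrow> (\<exists>\<beta>. \<forall>\<alpha>\<in>A. \<alpha> < \<beta>)"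
    using inaccessible unfolding inaccessible_ordinals_def by (elim conjE) assumption
  then show ?thesis
    using assms that by meson
qed

lemma small_finite:
  assumes "finite A"
  shows "small U A"
proof -
  have "A \<lesssim> (UNIV :: nat set)"
    using assms by (simp add: finite_lepoll_infinite)
  then show ?thesis
    using small_nat small_lepoll by blast
qed

lemma ex_greater: "\<exists>\<beta>. \<alpha> < (\<beta>::'u)"
  using small_bounded[OF small_finite[of "{\<alpha>}"]] by blast

lemma ex_infinite_initial: "\<exists>\<alpha>::'u. infinite {..<\<alpha>} \<and> \<beta> \<le> \<alpha>"
proof -
  obtain f :: "nat \<Rightarrow> 'u" where f: "inj f"
    using small_nat by (auto simp: small_def lesspoll_def lepoll_def)
  obtain \<gamma> where \<gamma>: "\<And>\<alpha>. \<alpha> \<in> range f \<Longrightarrow> \<alpha> < \<gamma>"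
    using small_bounded[OF small_image[OF small_nat]] by blast
  have "infinite {..<max \<gamma> \<beta>}"
  proof
    assume "finite {..<max \<gamma> \<beta>}"
    moreover have "range f \<subseteq> {..<max \<gamma> \<beta>}"
      using \<gamma> by (auto simp: less_max_iff_disj)
    ultimately show False
      using f finite_subset range_inj_infinite by blast
  qed
  then show ?thesis
    by (intro exI[of _ "max \<gamma> \<beta>"]) simp
qed

text \<open>Smallness gives an injection into the whole of 'u; its image is small, and regularity of
  the universe bounds it by one ordinal.\<close>

lemma small_lepoll_initial:
  assumes "small U A"
  obtains \<beta> :: 'u where "A \<lesssim> {..<\<beta>}"
proof -
  obtain f :: "_ \<Rightarrow> 'u" where f: "inj_on f A"
    using assms by (auto simp: small_def lesspoll_def lepoll_def)
  obtain \<beta> where \<beta>: "\<And>\<alpha>. \<alpha> \<in> f ` A \<Longrightarrow> \<alpha> < \<beta>"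
    using small_bounded[OF small_image[OF assms]] by blast
  then have "A \<lesssim> {..<\<beta>}"
    using f by (auto simp: lepoll_def)
  then show ?thesis ..
qed

lemma infinite_times_lepoll:
  assumes "infinite A"
  shows "A \<times> A \<lesssim> A"
  using card_of_Times_same_infinite[OF assms]
  by (metis eqpoll_iff_card_of_ordIso eqpoll_imp_lepoll)

text \<open>Injections of the base and of the fibres combine to one into
  \<open>A \<times> A\<close>, and an infinite \<open>A\<close> absorbs its square.\<close>

lemma lepoll_times_self:
  assumes "infinite A" "B \<lesssim> A" "\<And>x. x \<in> B \<Longrightarrow> F x \<lesssim> A"
  shows "Sigma B F \<lesssim> A"
proof -
  obtain f where f: "\<And>x. x \<in> B \<Longrightarrow> inj_on (f x) (F x) \<and> f x ` F x \<subseteq> A"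
    using assms(3) unfolding lepoll_def by metis
  obtain g where g: "inj_on g B" "g ` B \<subseteq> A"
    using assms(2) unfolding lepoll_def by blast
  have "inj_on (\<lambda>(x, y). (g x, f x y)) (Sigma B F)"
    using f g(1) by (auto simp: inj_on_def)
  moreover have "(\<lambda>(x, y). (g x, f x y)) ` Sigma B F \<subseteq> A \<times> A"
    using f g(2) by auto
  ultimately have "Sigma B F \<lesssim> A \<times> A"
    unfolding lepoll_def by blast
  then show ?thesis
    using infinite_times_lepoll[OF assms(1)] lepoll_trans by blast
qed

text \<open>Regularity of the universe: the ordinals that bound the fibres form a small set and are
  bounded in turn, so the base and all fibres embed into one infinite initial segment.\<close>

lemma small_Sigma:
  assumes "small U B" "\<And>x. x \<in> B \<Longrightarrow> small U (F x)"
  shows "small U (Sigma B F)"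
proof -
  have "\<exists>\<beta>::'u. F x \<lesssim> {..<\<beta>}" if "x \<in> B" for x
    using small_lepoll_initial[OF assms(2)[OF that]] by blast
  then obtain b :: "_ \<Rightarrow> 'u" where b: "\<And>x. x \<in> B \<Longrightarrow> F x \<lesssim> {..<b x}"
    by metis
  obtain \<beta>\<^sub>1 where \<beta>1: "\<And>\<alpha>. \<alpha> \<in> b ` B \<Longrightarrow> \<alpha> < \<beta>\<^sub>1"
    using small_bounded[OF small_image[OF assms(1)]] by blast
  obtain \<beta>\<^sub>2 :: 'u where \<beta>2: "B \<lesssim> {..<\<beta>\<^sub>2}"
    using small_lepoll_initial[OF assms(1)] by blast
  obtain \<gamma> :: 'u where \<gamma>: "infinite {..<\<gamma>}" "max \<beta>\<^sub>1 \<beta>\<^sub>2 \<le> \<gamma>"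
    using ex_infinite_initial by blast
  have B_le: "B \<lesssim> {..<\<gamma>}"
    using \<beta>2 \<gamma>(2) by (meson lepoll_trans lessThan_subset_iff max.boundedE subset_imp_lepoll)
  have "F x \<lesssim> {..<\<gamma>}" if "x \<in> B" for x
  proof -
    have "b x \<le> \<gamma>"
      using \<beta>1[of "b x"] that \<gamma>(2) by force
    then show ?thesis
      using b[OF that] by (meson lepoll_trans lessThan_subset_iff subset_imp_lepoll)
  qed
  then have "Sigma B F \<lesssim> {..<\<gamma>}"
    using lepoll_times_self[OF \<gamma>(1) B_le] by blast
  then show ?thesis
    using small_initial small_lepoll by blast
qed

lemma small_UN:
  assumes "small U B" "\<And>x. x \<in> B \<Longrightarrow> small U (F x)"
  shows "small U (\<Union>x\<in>B. F x)"
proof -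
  have "(\<Union>x\<in>B. F x) = snd ` Sigma B F"
    by force
  then show ?thesis
    using small_image[OF small_Sigma[OF assms], where f = snd] by simp
qed

lemma small_atMost: "small U {..\<alpha>::'u}"
proof -
  obtain \<beta> where "\<alpha> < \<beta>" using ex_greater by blast
  then have "{..\<alpha>} \<subseteq> {..<\<beta>}" by auto
  then show ?thesis using small_initial small_subset by blast
qed

section \<open>Zero, successor and limit ordinals\<close>

lemma ord_zero_le [simp]: "ord_zero \<le> (\<alpha>::'u)"
  by (simp add: ord_zero_def Least_le)

lemma not_less_ord_zero [simp]: "\<not> (\<alpha>::'u) < ord_zero"
  by (simp add: not_less)

lemma ord_zero_less_iff: "ord_zero < (\<alpha>::'u) \<longleftrightarrow> \<alpha> \<noteq> ord_zero"
  using ord_zero_le[of \<alpha>] by (metis order.order_iff_strict less_irrefl)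

lemma le_ord_zero_iff [simp]: "(\<alpha>::'u) \<le> ord_zero \<longleftrightarrow> \<alpha> = ord_zero"
  by (simp add: antisym)

lemma less_ord_succ [simp]: "(\<alpha>::'u) < ord_succ \<alpha>"
  unfolding ord_succ_def using ex_greater by (rule LeastI_ex)

lemma ord_succ_le_iff [simp]: "ord_succ \<alpha> \<le> (\<beta>::'u) \<longleftrightarrow> \<alpha> < \<beta>"
proof
  show "ord_succ \<alpha> \<le> \<beta> \<Longrightarrow> \<alpha> < \<beta>"
    using less_ord_succ less_le_trans by blast
  show "\<alpha> < \<beta> \<Longrightarrow> ord_succ \<alpha> \<le> \<beta>"
    unfolding ord_succ_def by (rule Least_le)
qed

lemma less_ord_succ_iff [simp]: "(\<beta>::'u) < ord_succ \<alpha> \<longleftrightarrow> \<beta> \<le> \<alpha>"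
  by (simp only: not_le[symmetric] ord_succ_le_iff not_not)

lemma ord_succ_inject [simp]: "ord_succ (\<alpha>::'u) = ord_succ \<beta> \<longleftrightarrow> \<alpha> = \<beta>"
  by (metis antisym less_ord_succ less_ord_succ_iff)

lemma ord_succ_less_ord_succ [simp]: "ord_succ (\<alpha>::'u) < ord_succ \<beta> \<longleftrightarrow> \<alpha> < \<beta>"
  by (metis less_ord_succ_iff ord_succ_le_iff)

lemma ord_succ_neq_zero [simp]: "ord_succ (\<alpha>::'u) \<noteq> ord_zero" "ord_zero \<noteq> ord_succ (\<alpha>::'u)"
  using less_ord_succ[of \<alpha>] by (metis not_less_ord_zero)+

lemma not_limit_ord_succ [simp]: "\<not> limit_ordinal (ord_succ (\<alpha>::'u))"
  unfolding limit_ordinal_def by (meson less_irrefl less_ord_succ)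

lemma not_limit_ord_zero [simp]: "\<not> limit_ordinal (ord_zero :: 'u)"
  unfolding limit_ordinal_def by simp

lemma ordinal_cases [case_names zero succ limit]:
  obtains "(\<alpha>::'u) = ord_zero" | \<delta> where "\<alpha> = ord_succ \<delta>" | "limit_ordinal \<alpha>"
  unfolding limit_ordinal_def
  by (metis linorder_not_less nless_le ord_succ_le_iff ord_zero_less_iff)

lemma limit_ord_succ_less: "limit_ordinal (\<gamma>::'u) \<Longrightarrow> \<alpha> < \<gamma> \<Longrightarrow> ord_succ \<alpha> < \<gamma>"
  by (simp add: limit_ordinal_def)

lemma limit_ord_zero_less: "limit_ordinal (\<gamma>::'u) \<Longrightarrow> ord_zero < \<gamma>"
  by (simp add: limit_ordinal_def)

section \<open>Cofinality\<close>

lemma cofinality_le: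
  assumes "S \<subseteq> {..<\<Lambda>}" "\<forall>\<alpha><\<Lambda>. \<exists>\<sigma>\<in>S. \<alpha> \<le> \<sigma>" "S \<approx> {..<\<delta>::'u}"
  shows "cofinality \<Lambda> \<le> \<delta>"
  unfolding cofinality_def using assms by (intro Least_le) blast

lemma cofinality_witness:
  fixes \<Lambda> :: 'u
  obtains S where "S \<subseteq> {..<\<Lambda>}" "\<forall>\<alpha><\<Lambda>. \<exists>\<sigma>\<in>S. \<alpha> \<le> \<sigma>" "S \<approx> {..<cofinality \<Lambda>}"
proof -
  have "\<exists>\<delta>::'u. \<exists>S\<subseteq>{..<\<Lambda>}. (\<forall>\<alpha><\<Lambda>. \<exists>\<sigma>\<in>S. \<alpha> \<le> \<sigma>) \<and> S \<approx> {..<\<delta>}"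
    by (rule exI[of _ \<Lambda>], rule exI[of _ "{..<\<Lambda>}"]) auto
  from LeastI_ex[OF this] show ?thesis
    using that unfolding cofinality_def by blast
qed

text \<open>Zero and successor ordinals have finite cofinality: the empty set is cofinal in the
  former, the predecessor alone in the latter.\<close>

lemma limit_if_cofinality_infinite:
  fixes \<Lambda> :: 'u
  assumes "infinite {..<\<kappa>}" "\<kappa> \<le> cofinality \<Lambda>"
  shows "limit_ordinal \<Lambda>"
proof (cases \<Lambda> rule: ordinal_cases)
  case zero
  obtain S where "S \<subseteq> {..<\<Lambda>}" "S \<approx> {..<cofinality \<Lambda>}"
    using cofinality_witness by metis
  then have "finite {..<cofinality \<Lambda>}"
    using zero eqpoll_finite_iff by (metis finite.emptyI finite_subset lessThan_subset_iff not_less_ord_zero ord_zero_le subset_empty subsetI lessThan_iff)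
  then have "finite {..<\<kappa>}"
    using assms(2) by (meson finite_subset lessThan_subset_iff)
  then show ?thesis using assms(1) by simp
next
  case (succ \<delta>)
  have "{\<delta>} \<approx> {..<ord_succ (ord_zero::'u)}"
  proof -
    have "{..<ord_succ (ord_zero::'u)} = {ord_zero}"
      by auto
    then show ?thesis by (simp add: singleton_eqpoll)
  qed
  then have "cofinality \<Lambda> \<le> ord_succ ord_zero"
    using succ by (intro cofinality_le[of "{\<delta>}"]) auto
  then have "{..<\<kappa>} \<subseteq> {ord_zero}"
    using less_le_trans[OF _ order.trans[OF assms(2)]] by fastforce
  then show ?thesis
    using assms(1) finite_subset by blast
qed

text \<open>
  \<open>\<kappa>\<close> is the successor cardinal of an infinite \<open>\<nu> \<ge> \<mu>\<close>, hence regular; \<open>\<Lambda>\<close> is the supremum of a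
  \<open>\<kappa>\<close>-sequence that outgrows \<open>F\<close> at each step.
\<close>

lemma ex_closed_ordinal_of_large_cofinality:
  fixes \<mu> :: 'u and F :: "'u \<Rightarrow> 'u"
  assumes "mono F"
  shows "\<exists>\<Lambda>. \<mu> \<le> cofinality \<Lambda> \<and> (\<forall>\<beta><\<Lambda>. F \<beta> < \<Lambda>)"
proof -
  obtain \<nu> :: 'u where \<nu>: "infinite {..<\<nu>}" "\<mu> \<le> \<nu>"
    using ex_infinite_initial by blast
  \<comment> \<open>The power set of \<nu> is small and hence embeds into an initial segment; by
    Cantor that segment cannot embed into \<nu>.\<close>
  have "\<exists>\<kappa>::'u. \<not> {..<\<kappa>} \<lesssim> {..<\<nu>}"
  proof -
    have "small U (Pow {..<\<nu>})"
      by (intro small_Pow small_initial)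
    then obtain \<kappa> :: 'u where "Pow {..<\<nu>} \<lesssim> {..<\<kappa>}"
      using small_lepoll_initial by blast
    then have "\<not> {..<\<kappa>} \<lesssim> {..<\<nu>}"
      using lesspoll_Pow_self[of "{..<\<nu>}"] lepoll_trans lesspoll_def
      by (metis lepoll_antisym lesspoll_imp_lepoll)
    then show ?thesis ..
  qed
  define \<kappa> :: 'u where "\<kappa> = (LEAST \<kappa>. \<not> {..<\<kappa>} \<lesssim> {..<\<nu>})"
  have \<kappa>: "\<not> {..<\<kappa>} \<lesssim> {..<\<nu>}"
    unfolding \<kappa>_def by (rule LeastI_ex) fact
  have below: "{..<\<xi>} \<lesssim> {..<\<nu>}" if "\<xi> < \<kappa>" for \<xi>
    using not_less_Least[of \<xi>] that unfolding \<kappa>_def by blast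
  have below': "{..\<xi>} \<lesssim> {..<\<nu>}" if "\<xi> < \<kappa>" for \<xi>
  proof -
    have "{..\<xi>} = insert \<xi> {..<\<xi>}" by auto
    then have "{..\<xi>} \<lesssim> insert \<nu> {..<\<nu>}"
      using below[OF that] insert_lepoll_cong[of "{..<\<xi>}" "{..<\<nu>}" \<nu> \<xi>] by simp
    then show ?thesis
      using infinite_insert_eqpoll[OF \<nu>(1)] lepoll_trans2 by blast
  qed
  \<comment> \<open>Regularity of \<kappa>: a cofinal subset of size \<nu> would cover \<kappa> by
    \<nu> many initial segments, each of size at most \<nu>.\<close>
  have bounded: "\<exists>\<zeta><\<kappa>. \<forall>\<xi>\<in>S. \<xi> < \<zeta>" if S: "S \<subseteq> {..<\<kappa>}" "S \<lesssim> {..<\<nu>}" for S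
  proof (rule ccontr)
    assume "\<not> ?thesis"
    then have "\<forall>\<zeta><\<kappa>. \<exists>\<xi>\<in>S. \<zeta> \<le> \<xi>"
      by (meson linorder_not_less)
    then have "{..<\<kappa>} \<subseteq> snd ` (SIGMA \<xi>:S. {..\<xi>})"
      by force
    moreover have "(SIGMA \<xi>:S. {..\<xi>}) \<lesssim> {..<\<nu>}"
      using lepoll_times_self[OF \<nu>(1) S(2)] below' S(1) by blast
    ultimately show False
      using \<kappa> by (meson lepoll_trans subset_image_lepoll)
  qed
  have "\<exists>l. \<forall>\<xi>::'u. \<forall>\<eta><\<xi>. l \<eta> < l \<xi> \<and> F (l \<eta>) < l \<xi>"
  proof (rule dependent_wellorder_choice[where P = "\<lambda>l \<xi> x. \<forall>\<eta><\<xi>. l \<eta> < x \<and> F (l \<eta>) < x"])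
    fix \<xi> :: 'u and l :: "'u \<Rightarrow> 'u"
    have "small U ((l ` {..<\<xi>}) \<union> (\<lambda>\<eta>. F (l \<eta>)) ` {..<\<xi>})"
      using small_UN[of "{True, False}" "\<lambda>b. if b then l ` {..<\<xi>} else (\<lambda>\<eta>. F (l \<eta>)) ` {..<\<xi>}"]
      by (simp add: small_finite small_image small_initial Un_commute)
    then show "\<exists>x. \<forall>\<eta><\<xi>. l \<eta> < x \<and> F (l \<eta>) < x"
      using small_bounded by (metis UnCI imageI lessThan_iff)
  qed auto
  then obtain l :: "'u \<Rightarrow> 'u" where l: "\<And>\<eta> \<xi>. \<eta> < \<xi> \<Longrightarrow> l \<eta> < l \<xi> \<and> F (l \<eta>) < l \<xi>"
    by blast
  have "\<exists>x. \<forall>\<xi><\<kappa>. l \<xi> < x"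
    using small_bounded[OF small_image[OF small_initial]] by (metis imageI lessThan_iff)
  define \<Lambda> where "\<Lambda> = (LEAST x. \<forall>\<xi><\<kappa>. l \<xi> < x)"
  have \<Lambda>: "l \<xi> < \<Lambda>" if "\<xi> < \<kappa>" for \<xi>
    using LeastI_ex[OF \<open>\<exists>x. \<forall>\<xi><\<kappa>. l \<xi> < x\<close>] that unfolding \<Lambda>_def by blast
  have \<Lambda>': "\<exists>\<xi><\<kappa>. \<beta> \<le> l \<xi>" if "\<beta> < \<Lambda>" for \<beta>
    using not_less_Least[of \<beta> "\<lambda>x. \<forall>\<xi><\<kappa>. l \<xi> < x"] that unfolding \<Lambda>_def
    by (meson linorder_not_less)
  have "F \<beta> < \<Lambda>" if "\<beta> < \<Lambda>" for \<beta>
  proof -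
    obtain \<xi> where \<xi>: "\<xi> < \<kappa>" "\<beta> \<le> l \<xi>" using \<Lambda>'[OF \<open>\<beta> < \<Lambda>\<close>] by blast
    have "{\<xi>} \<lesssim> {..<\<nu>}"
      using \<nu>(1) finite_lepoll_infinite by blast
    then obtain \<zeta> where \<zeta>: "\<zeta> < \<kappa>" "\<xi> < \<zeta>"
      using bounded[of "{\<xi>}"] \<xi>(1) by auto
    have "F \<beta> \<le> F (l \<xi>)" using \<open>mono F\<close> \<xi>(2) by (rule monoD)
    also have "\<dots> < l \<zeta>" using l[OF \<zeta>(2)] by blast
    also have "\<dots> < \<Lambda>" using \<Lambda>[OF \<zeta>(1)] .
    finally show ?thesis .
  qed
  moreover have "\<mu> \<le> cofinality \<Lambda>"
  \<comment> \<open>A cofinal subset of \<Lambda> with fewer than \<mu> elements would pull back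
    along \<open>l\<close> to a bounded subset of \<kappa>; then \<open>l \<zeta>\<close>, for a
    bound \<zeta>, exceeds the whole subset.\<close>
  proof (rule ccontr)
    assume *: "\<not> \<mu> \<le> cofinality \<Lambda>"
    obtain S where S: "S \<subseteq> {..<\<Lambda>}" "\<forall>\<alpha><\<Lambda>. \<exists>\<sigma>\<in>S. \<alpha> \<le> \<sigma>" "S \<approx> {..<cofinality \<Lambda>}"
      by (rule cofinality_witness)
    have "\<forall>\<sigma>\<in>S. \<exists>\<xi><\<kappa>. \<sigma> \<le> l \<xi>"
      using S(1) \<Lambda>' by auto
    then obtain x where x: "\<And>\<sigma>. \<sigma> \<in> S \<Longrightarrow> x \<sigma> < \<kappa> \<and> \<sigma> \<le> l (x \<sigma>)"
      by metis
    have "{..<cofinality \<Lambda>} \<subseteq> {..<\<nu>}"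
      using * \<nu>(2) by auto
    then have "S \<lesssim> {..<\<nu>}"
      using S(3) lepoll_trans1 subset_imp_lepoll by blast
    then have "x ` S \<lesssim> {..<\<nu>}"
      using image_lepoll lepoll_trans by blast
    then obtain \<zeta> where \<zeta>: "\<zeta> < \<kappa>" "\<forall>\<sigma>\<in>S. x \<sigma> < \<zeta>"
      using bounded[of "x ` S"] x by auto
    obtain \<sigma> where \<sigma>: "\<sigma> \<in> S" "l \<zeta> \<le> \<sigma>"
      using S(2) \<Lambda>[OF \<zeta>(1)] by blast
    have "\<sigma> \<le> l (x \<sigma>)" using x[OF \<sigma>(1)] by blast
    also have "\<dots> < l \<zeta>" using l \<zeta>(2) \<sigma>(1) by blast
    finally show False using \<sigma>(2) by simp
  qed
  ultimately show ?thesis by blast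
qed

text \<open>Mostowski collapse: \<open>w\<close> is sent to the least ordinal above the values at
  its predecessors in \<open>W\<close>, which exists because \<open>W\<close> is small. It provides
  the ordinal index for lexicographically ordered pairs and for the summands of a coproduct.\<close>

lemma ordinal_enumeration:
  fixes W :: "'w set" and less :: "'w \<Rightarrow> 'w \<Rightarrow> bool"
  assumes "small U W"
    and wf: "wfp less"
    and total: "\<And>v w. v \<in> W \<Longrightarrow> w \<in> W \<Longrightarrow> v \<noteq> w \<Longrightarrow> less v w \<or> less w v"
  obtains \<Theta> :: 'u and e where "bij_betw e {..<\<Theta>} W"
    "\<And>\<alpha> \<beta>. \<alpha> < \<Theta> \<Longrightarrow> \<beta> < \<Theta> \<Longrightarrow> less (e \<alpha>) (e \<beta>) \<longleftrightarrow> \<alpha> < \<beta>"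
proof -
  have "\<exists>rk. \<forall>w. rk w = (LEAST x::'u. \<forall>v\<in>W. less v w \<longrightarrow> rk v < x)"
  proof (rule dependent_wf_choice[where R = "{(v, w). less v w}"
        and P = "\<lambda>rk w y. y = (LEAST x::'u. \<forall>v\<in>W. less v w \<longrightarrow> rk v < x)"])
    show "wf {(v, w). less v w}"
      using wf by (simp add: wfp_def)
  next
    fix f g :: "'w \<Rightarrow> 'u" and w y
    assume eq: "\<And>z. (z, w) \<in> {(v, w). less v w} \<Longrightarrow> f z = g z"
    have "(\<lambda>x. \<forall>v\<in>W. less v w \<longrightarrow> f v < x) = (\<lambda>x. \<forall>v\<in>W. less v w \<longrightarrow> g v < x)"
      using eq by auto
    then show "(y = (LEAST x. \<forall>v\<in>W. less v w \<longrightarrow> f v < x)) =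
        (y = (LEAST x. \<forall>v\<in>W. less v w \<longrightarrow> g v < x))"
      by simp
  qed auto
  then obtain rk where rk: "\<And>w. rk w = (LEAST x::'u. \<forall>v\<in>W. less v w \<longrightarrow> rk v < x)"
    by blast
  have ex: "\<exists>x. \<forall>v\<in>W. less v w \<longrightarrow> rk v < x" for w
    using small_bounded[OF small_image[OF \<open>small U W\<close>]] by (metis imageI)
  have mono: "rk v < rk w" if "v \<in> W" "less v w" for v w
    using LeastI_ex[OF ex[of w]] that unfolding rk[of w, symmetric] by blast
  have mono_iff: "less v w \<longleftrightarrow> rk v < rk w" if "v \<in> W" "w \<in> W" for v w
    using mono[of v w] mono[of w v] total[of v w] that
    by (metis less_asym less_irrefl)
  \<comment> \<open>The values leave no gaps: an \<open>x\<close> below \<open>rk w\<close> does not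
    bound the values at the predecessors of \<open>w\<close>, so one of them has a value of at least
    \<open>x\<close>, and induction applies to it.\<close>
  have initial: "x \<in> rk ` W" if "w \<in> W" "x < rk w" for x w
    using that
  proof (induction "rk w" arbitrary: w rule: less_induct)
    case less
    have "\<not> (\<forall>v\<in>W. less v w \<longrightarrow> rk v < x)"
      using not_less_Least[of x "\<lambda>x. \<forall>v\<in>W. less v w \<longrightarrow> rk v < x"] less.prems(2)
      unfolding rk[of w, symmetric] by blast
    then obtain v where v: "v \<in> W" "less v w" "x \<le> rk v"
      by (meson linorder_not_less)
    then show ?case
      using less.hyps[of v] mono by (metis imageI order.order_iff_strict)
  qed
  obtain \<beta> where \<beta>: "\<And>\<alpha>. \<alpha> \<in> rk ` W \<Longrightarrow> \<alpha> < \<beta>"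
    using small_bounded[OF small_image[OF \<open>small U W\<close>]] by blast
  define \<Theta> where "\<Theta> = (LEAST \<Theta>. \<forall>\<alpha>\<in>rk ` W. \<alpha> < \<Theta>)"
  have \<Theta>: "\<alpha> < \<Theta>" if "\<alpha> \<in> rk ` W" for \<alpha>
    using LeastI[of "\<lambda>\<Theta>. \<forall>\<alpha>\<in>rk ` W. \<alpha> < \<Theta>" \<beta>] \<beta> that unfolding \<Theta>_def by blast
  have image: "rk ` W = {..<\<Theta>}"
  proof
    show "rk ` W \<subseteq> {..<\<Theta>}" using \<Theta> by auto
    show "{..<\<Theta>} \<subseteq> rk ` W"
    proof
      fix x assume "x \<in> {..<\<Theta>}"
      then have "\<not> (\<forall>\<alpha>\<in>rk ` W. \<alpha> < x)"
        using not_less_Least[of x "\<lambda>\<Theta>. \<forall>\<alpha>\<in>rk ` W. \<alpha> < \<Theta>"] unfolding \<Theta>_def by simp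
      then obtain w where "w \<in> W" "x \<le> rk w"
        by (auto simp: not_less)
      then show "x \<in> rk ` W"
        using initial by (metis imageI order.order_iff_strict)
    qed
  qed
  have inj: "inj_on rk W"
  proof (rule inj_onI, rule ccontr)
    fix v w assume "v \<in> W" "w \<in> W" "rk v = rk w" "v \<noteq> w"
    then show False
      using mono[of v w] mono[of w v] total[of v w] by auto
  qed
  have bij: "bij_betw rk W {..<\<Theta>}"
    using inj image by (simp add: bij_betw_def)
  show ?thesis
  proof
    show "bij_betw (inv_into W rk) {..<\<Theta>} W"
      using bij by (rule bij_betw_inv_into)
    fix \<alpha> \<beta> assume "\<alpha> < \<Theta>" "\<beta> < \<Theta>"
    then have "\<alpha> \<in> rk ` W" "\<beta> \<in> rk ` W"
      using image by auto
    then show "less (inv_into W rk \<alpha>) (inv_into W rk \<beta>) \<longleftrightarrow> \<alpha> < \<beta>"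
      by (simp add: mono_iff f_inv_into_f inv_into_into)
  qed
qed

end

section \<open>Categories\<close>

context category
begin

lemma HomD:
  assumes "f \<in> Hom C X Y"
  shows "f \<in> Arr C" "Dom C f = X" "Cod C f = Y" "X \<in> Obj C" "Y \<in> Obj C"
  using assms dom_Obj[of f] cod_Obj[of f] by (auto simp: Hom_def)

lemma Arr_Hom: "f \<in> Arr C \<Longrightarrow> f \<in> Hom C (Dom C f) (Cod C f)"
  by (simp add: Hom_def)

lemma Comp_Arr:
  assumes "f \<in> Arr C" "g \<in> Arr C" "Cod C f = Dom C g"
  shows "g \<cdot> f \<in> Arr C" "Dom C (g \<cdot> f) = Dom C f" "Cod C (g \<cdot> f) = Cod C g"
  using Comp_Hom[of f "Dom C f" "Cod C f" g "Cod C g"] assms by (auto simp: Hom_def)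

lemma Comp_assoc_right:
  "\<lbrakk>f \<in> Arr C; g \<in> Arr C; h \<in> Arr C; Cod C f = Dom C g; Cod C g = Dom C h\<rbrakk>
    \<Longrightarrow> (h \<cdot> g) \<cdot> f = h \<cdot> (g \<cdot> f)"
  using Comp_assoc[of f "Dom C f" "Cod C f" g "Cod C g" h "Cod C h"] by (auto simp: Hom_def)

lemma Comp_reassoc:
  "\<lbrakk>g \<cdot> f = k; f \<in> Arr C; g \<in> Arr C; Cod C f = Dom C g; x \<in> Arr C; Cod C x = Dom C f\<rbrakk>
    \<Longrightarrow> g \<cdot> (f \<cdot> x) = k \<cdot> x"
  using Comp_assoc_right[of x f g] by simp

lemma Id_Arr:
  assumes "X \<in> Obj C"
  shows "Id C X \<in> Arr C" "Dom C (Id C X) = X" "Cod C (Id C X) = X"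
  using Id_Hom[OF assms] by (auto simp: Hom_def)

lemma Id_Comp_Arr: "\<lbrakk>f \<in> Arr C; Cod C f = Y\<rbrakk> \<Longrightarrow> Id C Y \<cdot> f = f"
  using Id_Comp by (auto simp: Hom_def)

lemma Comp_Id_Arr: "\<lbrakk>f \<in> Arr C; Dom C f = X\<rbrakk> \<Longrightarrow> f \<cdot> Id C X = f"
  using Comp_Id by (auto simp: Hom_def)

lemmas cat_simps = Hom_def Comp_Arr Comp_assoc_right Id_Arr Id_Comp_Arr Comp_Id_Arr dom_Obj cod_Obj

lemma iso_betweenI:
  "\<lbrakk>f \<in> Hom C X Y; g \<in> Hom C Y X; g \<cdot> f = Id C X; f \<cdot> g = Id C Y\<rbrakk> \<Longrightarrow> iso_between C f X Y"
  unfolding iso_between_def by blast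

lemma iso_betweenE:
  assumes "iso_between C f X Y"
  obtains g where "f \<in> Hom C X Y" "g \<in> Hom C Y X" "g \<cdot> f = Id C X" "f \<cdot> g = Id C Y"
    "iso_between C g Y X"
  using assms unfolding iso_between_def by blast

lemma iso_between_Hom: "iso_between C f X Y \<Longrightarrow> f \<in> Hom C X Y"
  by (simp add: iso_between_def)

lemma iso_between_Id: "X \<in> Obj C \<Longrightarrow> iso_between C (Id C X) X X"
  by (rule iso_betweenI[where g = "Id C X"]) (simp_all add: cat_simps)

section \<open>Zero objects\<close>

lemma zero_object_unique:
  "\<lbrakk>zero_object C Z; f \<in> Hom C Z X; g \<in> Hom C Z X\<rbrakk> \<Longrightarrow> f = g"
  "\<lbrakk>zero_object C Z; f \<in> Hom C X Z; g \<in> Hom C X Z\<rbrakk> \<Longrightarrow> f = g"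
  using HomD(4,5) unfolding zero_object_def by blast+

lemma zero_object_ex:
  assumes "zero_object C Z" "X \<in> Obj C"
  obtains f g where "f \<in> Hom C Z X" "g \<in> Hom C X Z"
  using assms unfolding zero_object_def by blast

lemma zero_object_Obj: "zero_object C Z \<Longrightarrow> Z \<in> Obj C"
  by (simp add: zero_object_def)

section \<open>Pushout squares\<close>

lemma pushoutI:
  assumes "f \<in> Hom C A B" "g \<in> Hom C A A'" "f' \<in> Hom C A' B'" "g' \<in> Hom C B B'"
    and "g' \<cdot> f = f' \<cdot> g"
    and "\<And>Y a b. \<lbrakk>a \<in> Hom C B Y; b \<in> Hom C A' Y; a \<cdot> f = b \<cdot> g\<rbrakk>
      \<Longrightarrow> \<exists>u\<in>Hom C B' Y. u \<cdot> g' = a \<and> u \<cdot> f' = b"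
    and "\<And>Y u v. \<lbrakk>u \<in> Hom C B' Y; v \<in> Hom C B' Y; u \<cdot> g' = v \<cdot> g'; u \<cdot> f' = v \<cdot> f'\<rbrakk> \<Longrightarrow> u = v"
  shows "is_pushout C f g f' g'"
proof -
  have "\<exists>!u. u \<in> Hom C B' Y \<and> u \<cdot> g' = a \<and> u \<cdot> f' = b"
    if "a \<in> Hom C B Y" "b \<in> Hom C A' Y" "a \<cdot> f = b \<cdot> g" for Y a b
    using assms(6)[OF that] assms(7)[of _ Y] by (intro ex_ex1I) auto
  moreover have "f \<in> Arr C" "g \<in> Arr C" "f' \<in> Arr C" "g' \<in> Arr C"
    "Dom C f = A" "Dom C g = A" "Dom C f' = A'" "Dom C g' = B"
    "Cod C f = B" "Cod C g = A'" "Cod C f' = B'" "Cod C g' = B'"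
    using assms(1-4) by (simp_all add: Hom_def)
  ultimately show ?thesis
    using assms(5) unfolding is_pushout_def by simp
qed

lemma pushoutE:
  assumes "is_pushout C f g f' g'"
  obtains A B A' B' where "f \<in> Hom C A B" "g \<in> Hom C A A'" "f' \<in> Hom C A' B'" "g' \<in> Hom C B B'"
    "g' \<cdot> f = f' \<cdot> g"
  using assms unfolding is_pushout_def Hom_def by auto

lemma pushout_Hom:
  assumes "is_pushout C f g f' g'" "f \<in> Hom C A B" "g \<in> Hom C A A'"
  shows "f' \<in> Hom C A' (Cod C f')" "g' \<in> Hom C B (Cod C f')" "g' \<cdot> f = f' \<cdot> g"
  using assms unfolding is_pushout_def Hom_def by auto

lemma pushout_factor:
  assumes "is_pushout C f g f' g'" "f \<in> Hom C A B" "g \<in> Hom C A A'" "f' \<in> Hom C A' B'"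
    and "a \<in> Hom C B Y" "b \<in> Hom C A' Y" "a \<cdot> f = b \<cdot> g"
  shows "\<exists>u\<in>Hom C B' Y. u \<cdot> g' = a \<and> u \<cdot> f' = b"
proof -
  have "Y \<in> Obj C" "Cod C f = B" "Cod C g = A'" "Cod C f' = B'"
    using assms(2-5) by (auto simp: Hom_def cod_Obj)
  then show ?thesis
    using assms(1,5-7) unfolding is_pushout_def by blast
qed

lemma pushout_unique:
  assumes po: "is_pushout C f g f' g'" and "f' \<in> Hom C A\<^sub>0 B'" and "u \<in> Hom C B' Y" "v \<in> Hom C B' Y"
    and "u \<cdot> g' = v \<cdot> g'" "u \<cdot> f' = v \<cdot> f'"
  shows "u = v"
proof -
  obtain A B A' B'' where t: "f \<in> Hom C A B" "g \<in> Hom C A A'" "f' \<in> Hom C A' B''" "g' \<in> Hom C B B''"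
    "g' \<cdot> f = f' \<cdot> g"
    using po by (rule pushoutE)
  have [simp]: "B'' = B'" "Cod C f' = B'" using t(3) assms(2) by (simp_all add: Hom_def)
  then have *: "v \<cdot> g' \<in> Hom C (Cod C f) Y" "v \<cdot> f' \<in> Hom C (Cod C g) Y"
    "(v \<cdot> g') \<cdot> f = (v \<cdot> f') \<cdot> g"
    using t assms(4) by (simp_all add: cat_simps)
  have "Y \<in> Obj C" using assms(4) by (rule HomD)
  then have "\<exists>!u. u \<in> Hom C (Cod C f') Y \<and> u \<cdot> g' = v \<cdot> g' \<and> u \<cdot> f' = v \<cdot> f'"
    using po * unfolding is_pushout_def by blast
  then show ?thesis
    using assms by auto
qed

lemma pushout_sym:
  assumes "is_pushout C f g f' g'"
  shows "is_pushout C g f g' f'"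
proof -
  obtain A B A' B' where t: "f \<in> Hom C A B" "g \<in> Hom C A A'" "f' \<in> Hom C A' B'" "g' \<in> Hom C B B'"
    "g' \<cdot> f = f' \<cdot> g"
    using assms by (rule pushoutE)
  show ?thesis
  proof (rule pushoutI[OF t(2,1,4,3) t(5)[symmetric]])
    fix Y a b assume "a \<in> Hom C A' Y" "b \<in> Hom C B Y" "a \<cdot> g = b \<cdot> f"
    then show "\<exists>u\<in>Hom C B' Y. u \<cdot> f' = a \<and> u \<cdot> g' = b"
      using pushout_factor[OF assms t(1,2,3), of b Y a] by auto
  next
    fix Y u v assume "u \<in> Hom C B' Y" "v \<in> Hom C B' Y" "u \<cdot> f' = v \<cdot> f'" "u \<cdot> g' = v \<cdot> g'"
    then show "u = v"
      by - (rule pushout_unique[OF assms t(3)])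
  qed
qed

text \<open>Pasting law: a map out of the outer square is first factored through the left square and
  then through the right one.\<close>

lemma pushout_paste:
  assumes po1: "is_pushout C f g f' g'" and po2: "is_pushout C h g' h' g''"
  shows "is_pushout C (h \<cdot> f) g (h' \<cdot> f') g''"
proof -
  obtain A B A' B' where t: "f \<in> Hom C A B" "g \<in> Hom C A A'" "f' \<in> Hom C A' B'" "g' \<in> Hom C B B'"
    "g' \<cdot> f = f' \<cdot> g"
    using po1 by (rule pushoutE)
  obtain D D' where s: "h \<in> Hom C B D" "h' \<in> Hom C B' D'" "g'' \<in> Hom C D D'" "g'' \<cdot> h = h' \<cdot> g'"
    using po2 t(4) by (elim pushoutE) (auto simp: Hom_def)
  show ?thesis
  proof (rule pushoutI)
    show "h \<cdot> f \<in> Hom C A D" "g \<in> Hom C A A'" "h' \<cdot> f' \<in> Hom C A' D'" "g'' \<in> Hom C D D'"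
      using t s by (auto intro: Comp_Hom)
    show "g'' \<cdot> (h \<cdot> f) = h' \<cdot> f' \<cdot> g"
      using t s by (simp add: cat_simps s(4)[THEN Comp_reassoc])
  next
    fix Y a b assume ab: "a \<in> Hom C D Y" "b \<in> Hom C A' Y" "a \<cdot> (h \<cdot> f) = b \<cdot> g"
    obtain u where u: "u \<in> Hom C B' Y" "u \<cdot> g' = a \<cdot> h" "u \<cdot> f' = b"
      using pushout_factor[OF po1 t(1,2,3), of "a \<cdot> h" Y b] ab t s
      by (auto simp: cat_simps)
    obtain v where v: "v \<in> Hom C D' Y" "v \<cdot> g'' = a" "v \<cdot> h' = u"
      using pushout_factor[OF po2 s(1) t(4) s(2) ab(1) u(1)] u(2) by auto
    then show "\<exists>u\<in>Hom C D' Y. u \<cdot> g'' = a \<and> u \<cdot> (h' \<cdot> f') = b"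
      using u s t by (intro bexI[of _ v]) (simp_all add: cat_simps v(3)[THEN Comp_reassoc])
  next
    fix Y u v assume uv: "u \<in> Hom C D' Y" "v \<in> Hom C D' Y" "u \<cdot> g'' = v \<cdot> g''"
      "u \<cdot> (h' \<cdot> f') = v \<cdot> (h' \<cdot> f')"
    have "(u \<cdot> h') \<cdot> g' = (v \<cdot> h') \<cdot> g'"
    proof -
      have "(u \<cdot> h') \<cdot> g' = (u \<cdot> g'') \<cdot> h"
        using uv(1) s t by (simp add: cat_simps)
      also have "\<dots> = (v \<cdot> h') \<cdot> g'"
        unfolding uv(3) using uv(2) s t by (simp add: cat_simps)
      finally show ?thesis .
    qed
    then have "u \<cdot> h' = v \<cdot> h'"
      using uv s t by - (rule pushout_unique[OF po1 t(3)], simp_all add: cat_simps)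
    then show "u = v"
      using uv by - (rule pushout_unique[OF po2 s(2)], simp_all add: cat_simps)
  qed
qed

text \<open>The other half of the pasting law. It identifies the transition maps between pushed-out
  stages of a sequence as pushouts of the original steps.\<close>

lemma pushout_cancel:
  assumes po1: "is_pushout C f g f' g'" and po: "is_pushout C (h \<cdot> f) g k g''"
    and h: "h \<in> Hom C (Cod C f) D" and h': "h' \<in> Hom C (Cod C f') (Cod C k)"
    and k: "h' \<cdot> f' = k" and sq: "h' \<cdot> g' = g'' \<cdot> h"
  shows "is_pushout C h g' h' g''"
proof -
  obtain A B A' B' where t: "f \<in> Hom C A B" "g \<in> Hom C A A'" "f' \<in> Hom C A' B'" "g' \<in> Hom C B B'"
    "g' \<cdot> f = f' \<cdot> g"
    using po1 by (rule pushoutE)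
  have h: "h \<in> Hom C B D" and h': "h' \<in> Hom C B' (Cod C k)"
    using h h' t by (simp_all add: Hom_def)
  have hf: "h \<cdot> f \<in> Hom C A D" using h t by (auto intro: Comp_Hom)
  obtain D' where s: "g'' \<in> Hom C D D'" "D' = Cod C k" "k \<in> Hom C A' D'"
    using pushout_Hom[OF po hf t(2)] by blast
  have h': "h' \<in> Hom C B' D'" using h' s by simp
  show ?thesis
  proof (rule pushoutI[OF h t(4) h' s(1) sq[symmetric]])
    fix Y a b assume ab: "a \<in> Hom C D Y" "b \<in> Hom C B' Y" "a \<cdot> h = b \<cdot> g'"
    have "a \<cdot> (h \<cdot> f) = (b \<cdot> f') \<cdot> g"
    proof -
      have "a \<cdot> (h \<cdot> f) = (a \<cdot> h) \<cdot> f" using ab(1) h t by (simp add: cat_simps)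
      also have "\<dots> = (b \<cdot> f') \<cdot> g" unfolding ab(3) using ab(1,2) t by (simp add: cat_simps)
      finally show ?thesis .
    qed
    then obtain u where u: "u \<in> Hom C D' Y" "u \<cdot> g'' = a" "u \<cdot> k = b \<cdot> f'"
      using pushout_factor[OF po hf t(2) s(3) ab(1) Comp_Hom[OF t(3) ab(2)]] by auto
    have "(u \<cdot> h') \<cdot> g' = (u \<cdot> g'') \<cdot> h"
      using u(1) s(1) t h h' sq by (simp add: cat_simps)
    then have "(u \<cdot> h') \<cdot> g' = b \<cdot> g'"
      using u(2) ab(3) by simp
    moreover have "(u \<cdot> h') \<cdot> f' = b \<cdot> f'"
      using u t h' k by (simp add: cat_simps)
    ultimately have "u \<cdot> h' = b"
      using u ab t h' by - (rule pushout_unique[OF po1 t(3)], simp_all add: cat_simps)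
    then show "\<exists>u\<in>Hom C D' Y. u \<cdot> g'' = a \<and> u \<cdot> h' = b" using u by blast
  next
    fix Y u v assume uv: "u \<in> Hom C D' Y" "v \<in> Hom C D' Y" "u \<cdot> g'' = v \<cdot> g''" "u \<cdot> h' = v \<cdot> h'"
    have "u \<cdot> k = (u \<cdot> h') \<cdot> f'" "v \<cdot> k = (v \<cdot> h') \<cdot> f'"
      using uv(1,2) h' t k by (simp_all add: cat_simps)
    then show "u = v"
      using uv by - (rule pushout_unique[OF po s(3)], simp_all)
  qed
qed

lemma pushout_iso:
  assumes po: "is_pushout C f g f' g'" and h: "iso_between C h (Cod C f') Y"
  shows "is_pushout C f g (h \<cdot> f') (h \<cdot> g')"
proof -
  obtain A B A' B' where t: "f \<in> Hom C A B" "g \<in> Hom C A A'" "f' \<in> Hom C A' B'" "g' \<in> Hom C B B'"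
    "g' \<cdot> f = f' \<cdot> g"
    using po by (rule pushoutE)
  have "Cod C f' = B'" using t by (simp add: Hom_def)
  then obtain h' where h: "h \<in> Hom C B' Y" "h' \<in> Hom C Y B'" "h' \<cdot> h = Id C B'" "h \<cdot> h' = Id C Y"
    using h by (auto elim: iso_betweenE)
  show ?thesis
  proof (rule pushoutI[OF t(1,2)])
    show "h \<cdot> f' \<in> Hom C A' Y" "h \<cdot> g' \<in> Hom C B Y" "h \<cdot> g' \<cdot> f = h \<cdot> f' \<cdot> g"
      using h t by (simp_all add: cat_simps)
  next
    fix W a b assume ab: "a \<in> Hom C B W" "b \<in> Hom C A' W" "a \<cdot> f = b \<cdot> g"
    then obtain u where u: "u \<in> Hom C B' W" "u \<cdot> g' = a" "u \<cdot> f' = b"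
      using pushout_factor[OF po t(1,2,3)] by blast
    show "\<exists>u\<in>Hom C Y W. u \<cdot> (h \<cdot> g') = a \<and> u \<cdot> (h \<cdot> f') = b"
      using u h t by (intro bexI[of _ "u \<cdot> h'"]) (simp_all add: cat_simps h(3)[THEN Comp_reassoc])
  next
    fix W u v assume uv: "u \<in> Hom C Y W" "v \<in> Hom C Y W" "u \<cdot> (h \<cdot> g') = v \<cdot> (h \<cdot> g')"
      "u \<cdot> (h \<cdot> f') = v \<cdot> (h \<cdot> f')"
    have "u \<cdot> h = v \<cdot> h"
      using uv h t by - (rule pushout_unique[OF po t(3)], simp_all add: cat_simps)
    then have "(u \<cdot> h) \<cdot> h' = (v \<cdot> h) \<cdot> h'" by simp
    then show "u = v" using uv h by (simp add: cat_simps)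
  qed
qed

lemma pushout_unique_iso:
  assumes po1: "is_pushout C f g f' g'" and po2: "is_pushout C f g f'' g''"
  obtains h where "iso_between C h (Cod C f') (Cod C f'')" "h \<cdot> f' = f''" "h \<cdot> g' = g''"
proof -
  obtain A B A' B' where t: "f \<in> Hom C A B" "g \<in> Hom C A A'" "f' \<in> Hom C A' B'" "g' \<in> Hom C B B'"
    "g' \<cdot> f = f' \<cdot> g"
    using po1 by (rule pushoutE)
  obtain B'' where s: "f'' \<in> Hom C A' B''" "g'' \<in> Hom C B B''" "g'' \<cdot> f = f'' \<cdot> g"
    using pushout_Hom[OF po2 t(1,2)] by blast
  have cods: "Cod C f' = B'" "Cod C f'' = B''" using t s by (simp_all add: Hom_def)
  note objs = HomD(5)[OF t(3)] HomD(5)[OF s(1)]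
  obtain h where h: "h \<in> Hom C B' B''" "h \<cdot> g' = g''" "h \<cdot> f' = f''"
    using pushout_factor[OF po1 t(1,2,3) s(2,1,3)] by blast
  obtain k where k: "k \<in> Hom C B'' B'" "k \<cdot> g'' = g'" "k \<cdot> f'' = f'"
    using pushout_factor[OF po2 t(1,2) s(1) t(4,3,5)] by blast
  have "k \<cdot> h = Id C B'"
    using h k t s objs by - (rule pushout_unique[OF po1 t(3)], simp_all add: cat_simps)
  moreover have "h \<cdot> k = Id C B''"
    using h k t s objs by - (rule pushout_unique[OF po2 s(1)], simp_all add: cat_simps)
  ultimately have "iso_between C h B' B''"
    using h(1) k(1) by (intro iso_betweenI[of _ _ _ k])
  then show ?thesis
    using that h cods by simp
qed

lemma pushouts_of_iso:
  assumes "m \<in> pushouts_of C \<I>" "iso_between C h (Cod C m) Y"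
  shows "h \<cdot> m \<in> pushouts_of C \<I>"
  using assms pushout_iso unfolding pushouts_of_def by blast

text \<open>Pasting along the other direction, reached by reflecting the squares in their
  diagonal.\<close>

lemma pushouts_of_pushouts_of: "pushouts_of C (pushouts_of C \<I>) \<subseteq> pushouts_of C \<I>"
  unfolding pushouts_of_def using pushout_sym pushout_paste by blast

end

section \<open>Exact categories\<close>

context additive_category
begin

section \<open>Arithmetic of morphisms\<close>

abbreviation Add_arr (infixl "\<oplus>" 65) where "f \<oplus> g \<equiv> Add C f g"

text \<open>The group in which \<open>g\<close> is inverted is read off from \<open>f\<close>, so
  the notation needs no objects as arguments; it is meant for parallel maps.\<close>

definition Diff_arr (infixl "\<ominus>" 65) where
  "f \<ominus> g = f \<oplus> m_inv (hom_group C (Dom C f) (Cod C f)) g"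

lemma Zero_Hom:
  assumes "X \<in> Obj C" "Y \<in> Obj C"
  shows "Zero C X Y \<in> Hom C X Y"
proof -
  interpret G: comm_group "hom_group C X Y" using assms by (rule hom_comm_group)
  show ?thesis using G.one_closed by (simp add: hom_group_def)
qed

lemma Zero_Arr:
  assumes "X \<in> Obj C" "Y \<in> Obj C"
  shows "Zero C X Y \<in> Arr C" "Dom C (Zero C X Y) = X" "Cod C (Zero C X Y) = Y"
  using Zero_Hom[OF assms] by (auto simp: Hom_def)

lemma Add_Hom:
  assumes "f \<in> Hom C X Y" "g \<in> Hom C X Y"
  shows "f \<oplus> g \<in> Hom C X Y"
proof -
  interpret G: comm_group "hom_group C X Y" using HomD[OF assms(1)] by (intro hom_comm_group)
  show ?thesis using G.m_closed assms by (simp add: hom_group_def)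
qed

lemma Add_commute:
  assumes "f \<in> Hom C X Y" "g \<in> Hom C X Y"
  shows "f \<oplus> g = g \<oplus> f"
proof -
  interpret G: comm_group "hom_group C X Y" using HomD[OF assms(1)] by (intro hom_comm_group)
  show ?thesis using G.m_comm[of f g] assms by (simp add: hom_group_def)
qed

lemma Add_Zero:
  assumes "f \<in> Hom C X Y"
  shows "f \<oplus> Zero C X Y = f" "Zero C X Y \<oplus> f = f"
proof -
  interpret G: comm_group "hom_group C X Y" using HomD[OF assms(1)] by (intro hom_comm_group)
  show "f \<oplus> Zero C X Y = f" "Zero C X Y \<oplus> f = f"
    using G.r_one[of f] G.l_one[of f] assms by (simp_all add: hom_group_def)
qed

lemma
  assumes "f \<in> Hom C X Y" "g \<in> Hom C X Y"
  shows Diff_Hom: "f \<ominus> g \<in> Hom C X Y"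
    and Diff_Add: "(f \<ominus> g) \<oplus> g = f"
    and Diff_eq_Zero_iff: "f \<ominus> g = Zero C X Y \<longleftrightarrow> f = g"
proof -
  interpret G: comm_group "hom_group C X Y" using HomD[OF assms(1)] by (intro hom_comm_group)
  have fg: "f \<in> carrier (hom_group C X Y)" "g \<in> carrier (hom_group C X Y)"
    using assms by (auto simp: hom_group_def)
  have eq: "f \<ominus> g = f \<otimes>\<^bsub>hom_group C X Y\<^esub> m_inv (hom_group C X Y) g"
    using HomD[OF assms(1)] by (simp add: Diff_arr_def hom_group_def)
  show "f \<ominus> g \<in> Hom C X Y"
    using fg G.m_closed G.inv_closed unfolding eq by (simp add: hom_group_def)
  have "f \<otimes>\<^bsub>hom_group C X Y\<^esub> m_inv (hom_group C X Y) g \<otimes>\<^bsub>hom_group C X Y\<^esub> g = f"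
    using fg by (simp add: G.m_assoc)
  then show *: "(f \<ominus> g) \<oplus> g = f"
    unfolding eq by (simp add: hom_group_def)
  show "f \<ominus> g = Zero C X Y \<longleftrightarrow> f = g"
  proof
    assume "f \<ominus> g = Zero C X Y"
    then show "f = g" using * Add_Zero(2)[OF assms(2)] by simp
  next
    assume "f = g"
    then show "f \<ominus> g = Zero C X Y"
      unfolding eq using fg G.r_inv by (simp add: hom_group_def)
  qed
qed

lemma Add_left_cancel:
  assumes "f \<in> Hom C X Y" "f' \<in> Hom C X Y" "g \<in> Hom C X Y" "f \<oplus> g = f' \<oplus> g"
  shows "f = f'"
proof -
  interpret G: comm_group "hom_group C X Y" using HomD[OF assms(1)] by (intro hom_comm_group)
  show ?thesis using assms G.right_cancel[of g f f'] by (simp add: hom_group_def)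
qed

text \<open>Composition is additive, so the composite equals its own double, which in a group forces
  it to be zero.\<close>

lemma Comp_Zero_right:
  assumes "h \<in> Hom C Y Z" "X \<in> Obj C"
  shows "h \<cdot> Zero C X Y = Zero C X Z"
proof -
  have Y: "Y \<in> Obj C" "Z \<in> Obj C" using HomD[OF assms(1)] by auto
  have z: "Zero C X Y \<in> Hom C X Y" "Zero C X Z \<in> Hom C X Z" using assms Y by (auto intro: Zero_Hom)
  have hz: "h \<cdot> Zero C X Y \<in> Hom C X Z" using assms(1) z(1) by (rule Comp_Hom[rotated])
  have "(h \<cdot> Zero C X Y) \<oplus> (h \<cdot> Zero C X Y) = h \<cdot> (Zero C X Y \<oplus> Zero C X Y)"
    using Comp_Add_right[OF z(1) z(1) assms(1)] by simp
  also have "\<dots> = Zero C X Z \<oplus> (h \<cdot> Zero C X Y)"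
    using Add_Zero[OF z(1)] Add_Zero[OF hz] by simp
  finally show ?thesis using Add_left_cancel[OF hz z(2) hz] by simp
qed

lemma Comp_Zero_left:
  assumes "f \<in> Hom C X Y" "Z \<in> Obj C"
  shows "Zero C Y Z \<cdot> f = Zero C X Z"
proof -
  have Y: "Y \<in> Obj C" "X \<in> Obj C" using HomD[OF assms(1)] by auto
  have z: "Zero C Y Z \<in> Hom C Y Z" "Zero C X Z \<in> Hom C X Z" using assms Y by (auto intro: Zero_Hom)
  have hz: "Zero C Y Z \<cdot> f \<in> Hom C X Z" using assms(1) z(1) by (rule Comp_Hom)
  have "(Zero C Y Z \<cdot> f) \<oplus> (Zero C Y Z \<cdot> f) = (Zero C Y Z \<oplus> Zero C Y Z) \<cdot> f"
    using Comp_Add_left[OF assms(1) z(1) z(1)] by simp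
  also have "\<dots> = Zero C X Z \<oplus> (Zero C Y Z \<cdot> f)"
    using Add_Zero[OF z(1)] Add_Zero[OF hz] by simp
  finally show ?thesis using Add_left_cancel[OF hz z(2) hz] by simp
qed

lemma Diff_eqI:
  assumes "a \<in> Hom C X Y" "b \<in> Hom C X Y" "c \<in> Hom C X Y" "a \<oplus> b = c"
  shows "a = c \<ominus> b"
  using Add_left_cancel[OF assms(1) Diff_Hom[OF assms(3,2)] assms(2)] Diff_Add[OF assms(3,2)] assms(4)
  by simp

lemma Diff_Zero:
  assumes "f \<in> Hom C X Y"
  shows "f \<ominus> Zero C X Y = f"
  using Diff_eqI[OF assms Zero_Hom assms] HomD[OF assms] Add_Zero[OF assms] by simp

lemma Comp_Diff_right:
  assumes "f \<in> Hom C X Y" "g \<in> Hom C X Y" "h \<in> Hom C Y Z"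
  shows "h \<cdot> (f \<ominus> g) = h \<cdot> f \<ominus> h \<cdot> g"
  using Diff_Hom[OF assms(1,2)] Comp_Add_right[OF Diff_Hom[OF assms(1,2)] assms(2,3)]
    Diff_Add[OF assms(1,2)] assms
  by (intro Diff_eqI[of _ X Z]) (auto intro: Comp_Hom Add_Hom)

lemma Comp_Diff_left:
  assumes "f \<in> Hom C Y Z" "g \<in> Hom C Y Z" "h \<in> Hom C X Y"
  shows "(f \<ominus> g) \<cdot> h = f \<cdot> h \<ominus> g \<cdot> h"
  using Diff_Hom[OF assms(1,2)] Comp_Add_left[OF assms(3) Diff_Hom[OF assms(1,2)] assms(2)]
    Diff_Add[OF assms(1,2)] assms
  by (intro Diff_eqI[of _ X Z]) (auto intro: Comp_Hom Add_Hom)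

lemma zero_object_if_Id_eq_Zero:
  assumes "X \<in> Obj C" "Id C X = Zero C X X"
  shows "zero_object C X"
  unfolding zero_object_def
proof (intro conjI ballI)
  fix Y assume Y: "Y \<in> Obj C"
  have "f = Zero C X Y" if "f \<in> Hom C X Y" for f
    using Comp_Id[OF that] Comp_Zero_right[OF that assms(1)] assms(2) by simp
  then show "\<exists>!f. f \<in> Hom C X Y" using Zero_Hom[OF assms(1) Y] by blast
  have "f = Zero C Y X" if "f \<in> Hom C Y X" for f
    using Id_Comp[OF that] Comp_Zero_left[OF that assms(1)] assms(2) by simp
  then show "\<exists>!f. f \<in> Hom C Y X" using Zero_Hom[OF Y assms(1)] by blast
qed fact

lemma zero_objects_iso:
  assumes "zero_object C Z" "zero_object C Z'"
  shows "iso_between C (Zero C Z Z') Z Z'"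
proof -
  have Z: "Z \<in> Obj C" "Z' \<in> Obj C" using assms by (auto simp: zero_object_Obj)
  have h: "Zero C Z Z' \<in> Hom C Z Z'" "Zero C Z' Z \<in> Hom C Z' Z" using Z by (auto intro: Zero_Hom)
  show ?thesis
    using zero_object_unique(1)[OF assms(1) Comp_Hom[OF h] Id_Hom[OF Z(1)]]
      zero_object_unique(1)[OF assms(2) Comp_Hom[OF h(2,1)] Id_Hom[OF Z(2)]]
    by (intro iso_betweenI[OF h])
qed

section \<open>Cokernels\<close>

lemma cokernel_Hom:
  assumes "is_cokernel C i p"
  shows "i \<in> Hom C (Dom C i) (Cod C i)" "p \<in> Hom C (Cod C i) (Cod C p)"
  using assms by (auto simp: is_cokernel_def Hom_def)

text \<open>A map that factors through a zero object is zero, so a cocone over this span is just a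
  map that kills \<open>i\<close>. The point of the pushout form is that dividing by the source of a
  relative cell complex becomes a pushout and again yields a cell complex.\<close>

lemma cokernel_pushout:
  assumes "is_cokernel C i p" "i \<in> Hom C A B" "p \<in> Hom C B S" "zero_object C Z"
  shows "is_pushout C i (Zero C A Z) (Zero C Z S) p"
proof -
  have obj: "A \<in> Obj C" "S \<in> Obj C" "Z \<in> Obj C"
    using HomD[OF assms(2)] HomD[OF assms(3)] assms(4) by (auto simp: zero_object_Obj)
  have pi: "p \<cdot> i = Zero C A S"
    using assms(1-3) by (simp add: is_cokernel_def Hom_def)
  show ?thesis
  proof (rule pushoutI[OF assms(2) Zero_Hom[OF obj(1,3)] Zero_Hom[OF obj(3,2)] assms(3)])
    show "p \<cdot> i = Zero C Z S \<cdot> Zero C A Z"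
      using pi Comp_Zero_left[OF Zero_Hom[OF obj(1,3)] obj(2)] by simp
  next
    fix Y a b assume ab: "a \<in> Hom C B Y" "b \<in> Hom C Z Y" "a \<cdot> i = b \<cdot> Zero C A Z"
    then have "a \<cdot> i = Zero C A Y" using Comp_Zero_right[OF ab(2) obj(1)] by simp
    moreover have "Dom C i = A" "Cod C i = B" "Cod C p = S"
      using assms(2,3) by (simp_all add: Hom_def)
    ultimately obtain u where u: "u \<in> Hom C S Y" "u \<cdot> p = a"
      using assms(1) ab(1) HomD(5)[OF ab(1)] unfolding is_cokernel_def by blast
    moreover have "u \<cdot> Zero C Z S = b"
      using zero_object_unique(1)[OF assms(4) Comp_Hom[OF Zero_Hom[OF obj(3,2)] u(1)] ab(2)] .
    ultimately show "\<exists>u\<in>Hom C S Y. u \<cdot> p = a \<and> u \<cdot> Zero C Z S = b" by blast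
  next
    fix Y u v assume uv: "u \<in> Hom C S Y" "v \<in> Hom C S Y" "u \<cdot> p = v \<cdot> p"
    have Y: "Y \<in> Obj C" using uv(1) by (rule HomD)
    have "(u \<cdot> p) \<cdot> i = Zero C A Y"
      using Comp_assoc[OF assms(2,3) uv(1)] pi Comp_Zero_right[OF uv(1) obj(1)] by simp
    moreover have "u \<cdot> p \<in> Hom C (Cod C i) Y" using Comp_Hom[OF assms(3) uv(1)] assms(2) by (simp add: Hom_def)
    moreover have "u \<in> Hom C (Cod C p) Y" "v \<in> Hom C (Cod C p) Y" "Dom C i = A"
      using uv(1,2) assms(2,3) by (simp_all add: Hom_def)
    ultimately show "u = v"
      using assms(1) uv(3) Y unfolding is_cokernel_def by metis
  qed
qed

lemma cokernel_unique_iso: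
  assumes "is_cokernel C i p" "is_cokernel C i p'"
  obtains h where "iso_between C h (Cod C p) (Cod C p')" "h \<cdot> p = p'"
proof -
  obtain Z where Z: "zero_object C Z" using ex_zero_object by blast
  note c = cokernel_Hom[OF assms(1)] cokernel_Hom(2)[OF assms(2)]
  have Cod: "Cod C (Zero C Z (Cod C p)) = Cod C p" "Cod C (Zero C Z (Cod C p')) = Cod C p'"
    using HomD(5)[OF c(2)] HomD(5)[OF c(3)] zero_object_Obj[OF Z] by (simp_all add: Zero_Arr)
  show ?thesis
    using pushout_unique_iso[OF cokernel_pushout[OF assms(1) c(1,2) Z] cokernel_pushout[OF assms(2) c(1,3) Z]]
      that unfolding Cod by blast
qed

end

context exact_category
begin

section \<open>Conflations and their closure properties\<close>

definition conflation :: "'o \<Rightarrow> 'm \<Rightarrow> 'o \<Rightarrow> 'm \<Rightarrow> 'o \<Rightarrow> bool" where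
  "conflation A i B p S \<longleftrightarrow> (i, p) \<in> Confl C \<and> i \<in> Hom C A B \<and> p \<in> Hom C B S"

lemma conflation_Confl: "(i, p) \<in> Confl C \<Longrightarrow> conflation (Dom C i) i (Cod C i) p (Cod C p)"
  using Confl_kernel_cokernel[of i p] unfolding conflation_def is_kernel_def Hom_def by auto

lemma conflation_if_inflation:
  assumes "i \<in> inflations C" "i \<in> Hom C A B"
  obtains p S where "conflation A i B p S"
  using assms conflation_Confl unfolding inflations_def Hom_def by fastforce

lemma conflation_if_deflation:
  assumes "p \<in> deflations C" "p \<in> Hom C B S"
  obtains i A where "conflation A i B p S"
proof -
  obtain i where i: "(i, p) \<in> Confl C" using assms(1) unfolding deflations_def by auto
  then have "Cod C i = B"
    using Confl_kernel_cokernel[OF i] assms(2) by (auto simp: is_kernel_def Hom_def)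
  then show ?thesis
    using that[of "Dom C i" i] conflation_Confl[OF i] assms(2) by (simp add: Hom_def)
qed

lemma conflationD:
  assumes "conflation A i B p S"
  shows "(i, p) \<in> Confl C" "i \<in> Hom C A B" "p \<in> Hom C B S" "p \<cdot> i = Zero C A S"
    "A \<in> Obj C" "B \<in> Obj C" "S \<in> Obj C" "i \<in> inflations C" "p \<in> deflations C"
    "is_cokernel C i p" "is_kernel C i p"
proof -
  show *: "(i, p) \<in> Confl C" "i \<in> Hom C A B" "p \<in> Hom C B S"
    using assms by (auto simp: conflation_def)
  show "A \<in> Obj C" "B \<in> Obj C" "S \<in> Obj C"
    using HomD[OF *(2)] HomD[OF *(3)] by auto
  show "i \<in> inflations C" "p \<in> deflations C"
    using *(1) by (force simp: inflations_def deflations_def)+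
  show c: "is_cokernel C i p" "is_kernel C i p"
    using Confl_kernel_cokernel[OF *(1)] by auto
  show "p \<cdot> i = Zero C A S"
    using c * by (simp add: is_cokernel_def Hom_def)
qed

lemma inflation_Hom: "i \<in> inflations C \<Longrightarrow> i \<in> Hom C (Dom C i) (Cod C i)"
  using conflation_Confl conflationD(2) unfolding inflations_def by fastforce

lemma kernel_factor:
  assumes "conflation A i B p S" "f \<in> Hom C W B" "p \<cdot> f = Zero C W S"
  obtains u where "u \<in> Hom C W A" "i \<cdot> u = f"
proof -
  have "W \<in> Obj C" "Dom C p = B" "Cod C p = S" "Dom C i = A"
    using HomD[OF assms(2)] conflationD(2,3)[OF assms(1)] by (auto simp: Hom_def)
  then show ?thesis
    using assms(2,3) conflationD(11)[OF assms(1)] that unfolding is_kernel_def by blast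
qed

lemma inflation_mono:
  assumes "i \<in> inflations C" "i \<in> Hom C A B" "u \<in> Hom C W A" "v \<in> Hom C W A" "i \<cdot> u = i \<cdot> v"
  shows "u = v"
proof -
  obtain p S where c: "conflation A i B p S" using conflation_if_inflation[OF assms(1,2)] .
  have *: "W \<in> Obj C" "Dom C p = B" "Cod C p = S" "Dom C i = A"
    using HomD[OF assms(3)] conflationD(2,3)[OF c] by (auto simp: Hom_def)
  have "p \<cdot> (i \<cdot> v) = Zero C W S"
    using Comp_assoc[OF assms(4,2) conflationD(3)[OF c]] conflationD(4,7)[OF c]
      Comp_Zero_left[OF assms(4)] by simp
  moreover have "i \<cdot> v \<in> Hom C W B" using assms(4,2) by (rule Comp_Hom)
  ultimately have "\<exists>!u. u \<in> Hom C W A \<and> i \<cdot> u = i \<cdot> v"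
    using conflationD(11)[OF c] * unfolding is_kernel_def by blast
  then show ?thesis using assms by blast
qed

lemma cokernel_factor:
  assumes "conflation A i B p S" "f \<in> Hom C B W" "f \<cdot> i = Zero C A W"
  obtains u where "u \<in> Hom C S W" "u \<cdot> p = f"
proof -
  have "W \<in> Obj C" "Cod C p = S" "Dom C i = A" "Cod C i = B"
    using HomD[OF assms(2)] conflationD(2,3)[OF assms(1)] by (auto simp: Hom_def)
  then show ?thesis
    using assms(2,3) conflationD(10)[OF assms(1)] that unfolding is_cokernel_def by blast
qed

lemma deflation_epi:
  assumes "p \<in> deflations C" "p \<in> Hom C B S" "u \<in> Hom C S W" "v \<in> Hom C S W" "u \<cdot> p = v \<cdot> p"
  shows "u = v"
proof -
  obtain i A where c: "conflation A i B p S" using conflation_if_deflation[OF assms(1,2)] .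
  have *: "W \<in> Obj C" "Cod C i = B" "Cod C p = S" "Dom C i = A"
    using HomD[OF assms(3)] conflationD(2,3)[OF c] by (auto simp: Hom_def)
  have "(v \<cdot> p) \<cdot> i = Zero C A W"
    using Comp_assoc[OF conflationD(2)[OF c] assms(2,4)] conflationD(4,5)[OF c]
      Comp_Zero_right[OF assms(4)] by simp
  moreover have "v \<cdot> p \<in> Hom C B W" using assms(2,4) by (rule Comp_Hom)
  ultimately have "\<exists>!u. u \<in> Hom C S W \<and> u \<cdot> p = v \<cdot> p"
    using conflationD(10)[OF c] * unfolding is_cokernel_def by blast
  then show ?thesis using assms by blast
qed

lemma conflation_iso:
  assumes "conflation A i B p S" "iso_between C a A A'" "iso_between C b B B'" "iso_between C c S S'"
    and "i' \<in> Hom C A' B'" "p' \<in> Hom C B' S'" "i' \<cdot> a = b \<cdot> i" "p' \<cdot> b = c \<cdot> p"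
  shows "conflation A' i' B' p' S'"
  using Confl_iso_closed[OF conflationD(1)[OF assms(1)] assms(5,6), of a b c] assms
    conflationD(2,3)[OF assms(1)]
  unfolding conflation_def by (simp add: Hom_def)

text \<open>Any two cokernels of \<open>i\<close> differ by an isomorphism, and conflations are
  closed under isomorphism.\<close>

lemma conflation_if_cokernel:
  assumes "i \<in> inflations C" "is_cokernel C i p"
  shows "(i, p) \<in> Confl C"
proof -
  note t = cokernel_Hom[OF assms(2)]
  obtain q Q where c: "conflation (Dom C i) i (Cod C i) q Q"
    using conflation_if_inflation[OF assms(1) t(1)] .
  have "Cod C q = Q" using conflationD(3)[OF c] by (simp add: Hom_def)
  then obtain h where h: "iso_between C h Q (Cod C p)" "h \<cdot> q = p"
    using cokernel_unique_iso[OF conflationD(10)[OF c] assms(2)] by metis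
  have "conflation (Dom C i) i (Cod C i) p (Cod C p)"
    using conflation_iso[OF c iso_between_Id iso_between_Id h(1) t] HomD[OF t(1)]
      Comp_Id[OF t(1)] Id_Comp[OF t(1)] Comp_Id[OF t(2)] h(2) by simp
  then show ?thesis by (rule conflationD)
qed

text \<open>Two kernels of \<open>p\<close> factor through each other; the resulting isomorphism
  carries the conflation that \<open>p\<close> belongs to onto the given pair.\<close>

lemma conflation_if_kernel:
  assumes "p \<in> deflations C" "is_kernel C i p" "i \<in> Hom C A B" "p \<in> Hom C B S"
  shows "conflation A i B p S"
proof -
  obtain j K where c: "conflation K j B p S"
    using conflation_if_deflation[OF assms(1,4)] .
  have obj: "K \<in> Obj C" "A \<in> Obj C" "B \<in> Obj C" "S \<in> Obj C" using conflationD[OF c] HomD[OF assms(3)] by auto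
  have pi: "p \<cdot> i = Zero C A S" using assms(2-4) by (simp add: is_kernel_def Hom_def)
  obtain u where u: "u \<in> Hom C A K" "j \<cdot> u = i"
    using kernel_factor[OF c assms(3) pi] .
  have K: "\<exists>!u. u \<in> Hom C W A \<and> i \<cdot> u = f" if "f \<in> Hom C W B" "p \<cdot> f = Zero C W S" for f W
    using assms(2-4) that HomD(4)[OF that(1)] unfolding is_kernel_def by (auto simp: Hom_def)
  obtain v where v: "v \<in> Hom C K A" "i \<cdot> v = j"
    using K[OF conflationD(2)[OF c] conflationD(4)[OF c]] by blast
  have "u \<cdot> v = Id C K"
  proof (rule inflation_mono[OF conflationD(8,2)[OF c]])
    show "u \<cdot> v \<in> Hom C K K" "Id C K \<in> Hom C K K" using u v obj by (auto intro: Comp_Hom Id_Hom)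
    show "j \<cdot> (u \<cdot> v) = j \<cdot> Id C K"
      using Comp_assoc[OF v(1) u(1) conflationD(2)[OF c]] u(2) v(2) Comp_Id[OF conflationD(2)[OF c]] by simp
  qed
  moreover have "v \<cdot> u = Id C A"
  proof -
    have "v \<cdot> u \<in> Hom C A A" "Id C A \<in> Hom C A A" using u v obj by (auto intro: Comp_Hom Id_Hom)
    moreover have "i \<cdot> (v \<cdot> u) = i" "i \<cdot> Id C A = i"
      using Comp_assoc[OF u(1) v(1) assms(3)] u(2) v(2) Comp_Id[OF assms(3)] by simp_all
    ultimately show ?thesis using K[OF assms(3) pi] by blast
  qed
  ultimately have "iso_between C v K A" using u v by (intro iso_betweenI)
  then show ?thesis
    using v(2) Id_Comp[OF conflationD(2)[OF c]] Comp_Id[OF assms(4)] Id_Comp[OF assms(4)] obj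
    by (intro conflation_iso[OF c _ iso_between_Id iso_between_Id assms(3,4)]) simp_all
qed

lemma inflation_iso:
  assumes "i \<in> inflations C" "iso_between C h (Cod C i) Y"
  shows "h \<cdot> i \<in> inflations C"
proof -
  obtain p S where c: "conflation (Dom C i) i (Cod C i) p S"
    using conflation_if_inflation[OF assms(1) inflation_Hom[OF assms(1)]] .
  obtain g where g: "h \<in> Hom C (Cod C i) Y" "g \<in> Hom C Y (Cod C i)" "g \<cdot> h = Id C (Cod C i)" "h \<cdot> g = Id C Y"
    using assms(2) by (rule iso_betweenE)
  note ct = conflationD(2,3)[OF c]
  have "p \<cdot> g \<cdot> h = Id C S \<cdot> p"
    using Comp_assoc[OF g(1,2) ct(2)] g(3) Comp_Id[OF ct(2)] Id_Comp[OF ct(2)] by simp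
  moreover have "h \<cdot> i \<cdot> Id C (Dom C i) = h \<cdot> i"
    using Comp_Id[OF Comp_Hom[OF ct(1) g(1)]] .
  ultimately have "conflation (Dom C i) (h \<cdot> i) Y (p \<cdot> g) S"
    using conflationD(5,7)[OF c]
    by (intro conflation_iso[OF c iso_between_Id assms(2) iso_between_Id Comp_Hom[OF ct(1) g(1)] Comp_Hom[OF g(2) ct(2)]])
  then show ?thesis by (rule conflationD)
qed

text \<open>The axiom provides one pushout that is an inflation, and every other pushout of the same
  span is isomorphic to it.\<close>

lemma pushout_inflation:
  assumes "is_pushout C i g i' g'" "i \<in> inflations C"
  shows "i' \<in> inflations C"
proof -
  have "g \<in> Arr C" "Dom C g = Dom C i" using assms(1) by (auto simp: is_pushout_def)
  then obtain j g'' where j: "is_pushout C i g j g''" "j \<in> inflations C"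
    using inflation_pushout[OF assms(2)] by blast
  obtain h where "iso_between C h (Cod C j) (Cod C i')" "h \<cdot> j = i'"
    using pushout_unique_iso[OF j(1) assms(1)] .
  then show ?thesis using inflation_iso[OF j(2)] by blast
qed

text \<open>The new deflation is induced by \<open>p\<close> and zero. A map that kills
  \<open>i'\<close> kills \<open>i\<close> after composition with \<open>g'\<close>, hence factors
  through \<open>p\<close>, and the factor works for \<open>p'\<close> as well. So pushouts leave
  the cokernel unchanged.\<close>

lemma pushout_conflation:
  assumes "conflation A i B p S" "is_pushout C i g i' g'"
    and "g \<in> Hom C A A'" "i' \<in> Hom C A' B'" "g' \<in> Hom C B B'"
  obtains p' where "conflation A' i' B' p' S" "p' \<cdot> g' = p"
proof -
  note c = conflationD[OF assms(1)]
  have sq: "g' \<cdot> i = i' \<cdot> g" using assms(2) by (simp add: is_pushout_def)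
  have obj: "A' \<in> Obj C" using HomD[OF assms(3)] by auto
  have "p \<cdot> i = Zero C A' S \<cdot> g"
    using c(4) Comp_Zero_left[OF assms(3) c(7)] by simp
  then obtain p' where p': "p' \<in> Hom C B' S" "p' \<cdot> g' = p" "p' \<cdot> i' = Zero C A' S"
    using pushout_factor[OF assms(2) c(2) assms(3,4) c(3) Zero_Hom[OF obj c(7)]] by blast
  have "is_cokernel C i' p'"
    unfolding is_cokernel_def
  proof (intro conjI ballI impI)
    fix W f assume "W \<in> Obj C" "f \<in> Hom C (Cod C i') W" "f \<cdot> i' = Zero C (Dom C i') W"
    then have W: "W \<in> Obj C" and f: "f \<in> Hom C B' W" "f \<cdot> i' = Zero C A' W"
      using assms(4) by (simp_all add: Hom_def)
    have "(f \<cdot> g') \<cdot> i = (f \<cdot> i') \<cdot> g"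
      using Comp_assoc[OF c(2) assms(5) f(1)] Comp_assoc[OF assms(3,4) f(1)] sq by simp
    then have "(f \<cdot> g') \<cdot> i = Zero C A W"
      using f(2) Comp_Zero_left[OF assms(3) W] by simp
    then obtain u where u: "u \<in> Hom C S W" "u \<cdot> p = f \<cdot> g'"
      using cokernel_factor[OF assms(1) Comp_Hom[OF assms(5) f(1)]] by blast
    have up: "u \<cdot> p' = f"
    proof (rule pushout_unique[OF assms(2,4) Comp_Hom[OF p'(1) u(1)] f(1)])
      show "u \<cdot> p' \<cdot> g' = f \<cdot> g'"
        using Comp_assoc[OF assms(5) p'(1) u(1)] p'(2) u(2) by simp
      show "u \<cdot> p' \<cdot> i' = f \<cdot> i'"
        using Comp_assoc[OF assms(4) p'(1) u(1)] p'(3) f(2) Comp_Zero_right[OF u(1) obj] by simp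
    qed
    have "v = u" if "v \<in> Hom C S W" "v \<cdot> p' = f" for v
    proof (rule deflation_epi[OF c(9,3) that(1) u(1)])
      show "v \<cdot> p = u \<cdot> p"
        using Comp_assoc[OF assms(5) p'(1) that(1)] p'(2) that(2) u(2) by simp
    qed
    moreover have "Cod C p' = S" using p'(1) by (simp add: Hom_def)
    ultimately show "\<exists>!u. u \<in> Hom C (Cod C p') W \<and> u \<cdot> p' = f"
      using u(1) up by blast
  qed (use p' assms(4) in \<open>auto simp: Hom_def\<close>)
  then have "(i', p') \<in> Confl C"
    using conflation_if_cokernel pushout_inflation[OF assms(2) c(8)] by blast
  then show ?thesis using that[of p'] p' assms(4) by (simp add: conflation_def)
qed

text \<open>The identity is a deflation; its kernel map is both zero and monic, so the kernel object
  is zero and may be replaced by the given \<open>Z\<close>.\<close>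

lemma conflation_Id:
  assumes "zero_object C Z" "X \<in> Obj C"
  shows "conflation Z (Zero C Z X) X (Id C X) X"
proof -
  obtain k K where c: "conflation K k X (Id C X) X"
    using conflation_if_deflation[OF Id_deflation[OF assms(2)] Id_Hom[OF assms(2)]] .
  note ct = conflationD[OF c]
  have k: "k = Zero C K X" using ct(4) Id_Comp[OF ct(2)] by simp
  have "Id C K = Zero C K K"
    using inflation_mono[OF ct(8,2) Id_Hom[OF ct(5)] Zero_Hom[OF ct(5,5)]]
      Comp_Id[OF ct(2)] Comp_Zero_right[OF ct(2,5)] k by simp
  then have K: "zero_object C K" using zero_object_if_Id_eq_Zero[OF ct(5)] by blast
  have Z: "Z \<in> Obj C" using assms(1) by (rule zero_object_Obj)
  have *: "Zero C Z X \<cdot> Zero C K Z = Id C X \<cdot> k"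
    using zero_object_unique(1)[OF K Comp_Hom[OF Zero_Hom[OF ct(5) Z] Zero_Hom[OF Z assms(2)]]
        Comp_Hom[OF ct(2) Id_Hom[OF assms(2)]]] .
  show ?thesis
    using conflation_iso[OF c zero_objects_iso[OF K assms(1)] iso_between_Id iso_between_Id
        Zero_Hom[OF Z assms(2)] Id_Hom[OF assms(2)] *] assms(2) by simp
qed

text \<open>Pushing 0 -> S out along 0 -> T produces the direct sum as an extension; the second leg
  of the pushout is the section. This extension represents the zero of Ext.\<close>

lemma split_conflation:
  assumes "T \<in> Obj C" "S \<in> Obj C"
  obtains i E p s where "conflation T i E p S" "s \<in> Hom C S E" "p \<cdot> s = Id C S"
proof -
  obtain Z where Z: "zero_object C Z" using ex_zero_object by blast
  note ZO = zero_object_Obj[OF Z]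
  have c: "conflation Z (Zero C Z S) S (Id C S) S" using Z assms(2) by (rule conflation_Id)
  have z: "Zero C Z T \<in> Arr C" "Dom C (Zero C Z T) = Dom C (Zero C Z S)"
    using Zero_Arr ZO assms by auto
  obtain i s where po: "is_pushout C (Zero C Z S) (Zero C Z T) i s"
    using inflation_pushout[OF conflationD(8)[OF c] z] by blast
  note t = pushout_Hom[OF po Zero_Hom[OF ZO assms(2)] Zero_Hom[OF ZO assms(1)]]
  obtain p where "conflation T i (Cod C i) p S" "p \<cdot> s = Id C S"
    using pushout_conflation[OF c po Zero_Hom[OF ZO assms(1)] t(1,2)] .
  then show ?thesis using that t(2) by blast
qed

text \<open>The difference of the identity and \<open>s \<cdot> p\<close> is killed by
  \<open>p\<close>, hence factors through the kernel, and the factor is the retraction.\<close>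

lemma retraction_if_section:
  assumes "conflation T i E p S" "s \<in> Hom C S E" "p \<cdot> s = Id C S"
  obtains r where "r \<in> Hom C E T" "r \<cdot> i = Id C T" "r \<cdot> s = Zero C S T"
    "(s \<cdot> p) \<oplus> (i \<cdot> r) = Id C E"
proof -
  note c = conflationD[OF assms(1)]
  have sp: "s \<cdot> p \<in> Hom C E E" using c(3) assms(2) by (rule Comp_Hom)
  note IE = Id_Hom[OF c(6)]
  have psp: "p \<cdot> (s \<cdot> p) = p"
    using Comp_assoc[OF c(3) assms(2) c(3)] assms(3) Id_Comp[OF c(3)] by simp
  have "p \<cdot> (Id C E \<ominus> s \<cdot> p) = Zero C E S"
    using Comp_Diff_right[OF IE sp c(3)] psp Comp_Id[OF c(3)] Diff_eq_Zero_iff[OF c(3,3)] by simp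
  then obtain r where r: "r \<in> Hom C E T" "i \<cdot> r = Id C E \<ominus> s \<cdot> p"
    using kernel_factor[OF assms(1) Diff_Hom[OF IE sp]] by blast
  have "r \<cdot> i = Id C T"
  proof (rule inflation_mono[OF c(8,2) Comp_Hom[OF c(2) r(1)] Id_Hom[OF c(5)]])
    have "(s \<cdot> p) \<cdot> i = Zero C T E"
      using Comp_assoc[OF c(2,3) assms(2)] c(4) Comp_Zero_right[OF assms(2) c(5)] by simp
    then have "i \<cdot> r \<cdot> i = i"
      unfolding r(2) using Comp_Diff_left[OF IE sp c(2)] Id_Comp[OF c(2)] Diff_Zero[OF c(2)] by simp
    then show "i \<cdot> (r \<cdot> i) = i \<cdot> Id C T"
      using Comp_assoc[OF c(2) r(1) c(2)] Comp_Id[OF c(2)] by simp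
  qed
  moreover have "r \<cdot> s = Zero C S T"
  proof (rule inflation_mono[OF c(8,2) Comp_Hom[OF assms(2) r(1)] Zero_Hom[OF c(7,5)]])
    have "(s \<cdot> p) \<cdot> s = s"
      using Comp_assoc[OF assms(2) c(3) assms(2)] assms(3) Comp_Id[OF assms(2)] by simp
    then have "i \<cdot> r \<cdot> s = Zero C S E"
      unfolding r(2) using Comp_Diff_left[OF IE sp assms(2)] Id_Comp[OF assms(2)]
        Diff_eq_Zero_iff[OF assms(2,2)] by simp
    then show "i \<cdot> (r \<cdot> s) = i \<cdot> Zero C S T"
      using Comp_assoc[OF assms(2) r(1) c(2)] Comp_Zero_right[OF c(2,7)] by simp
  qed
  moreover have "(s \<cdot> p) \<oplus> (i \<cdot> r) = Id C E"
    using Add_commute[OF sp Diff_Hom[OF IE sp]] Diff_Add[OF IE sp] r(2) by simp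
  ultimately show ?thesis using that r(1) by blast
qed

text \<open>A section presents the middle term as a direct sum of \<open>T\<close> and
  \<open>S\<close>, and maps between direct sums are given by their components.\<close>

lemma extension_equiv_if_sections:
  assumes "conflation T i E p S" "s \<in> Hom C S E" "p \<cdot> s = Id C S"
    and "conflation T i' E' p' S" "s' \<in> Hom C S E'" "p' \<cdot> s' = Id C S"
  shows "\<exists>h. iso_between C h E E' \<and> h \<cdot> i = i' \<and> p' \<cdot> h = p"
proof -
  \<comment> \<open>The witness sends the summand \<open>T\<close> by \<open>i'\<close> and the
    summand \<open>S\<close> by \<open>s'\<close>.\<close>
  have map: "\<exists>h\<in>Hom C E E'. h \<cdot> i = i' \<and> h \<cdot> s = s' \<and> p' \<cdot> h = p"
    if a: "conflation T i E p S" "s \<in> Hom C S E" "p \<cdot> s = Id C S"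
      "conflation T i' E' p' S" "s' \<in> Hom C S E'" "p' \<cdot> s' = Id C S" for i E p s i' E' p' s'
  proof -
    note c = conflationD[OF a(1)] and d = conflationD[OF a(4)]
    obtain r where r: "r \<in> Hom C E T" "r \<cdot> i = Id C T" "r \<cdot> s = Zero C S T"
      using retraction_if_section[OF a(1-3)] .
    have t: "i' \<cdot> r \<in> Hom C E E'" "s' \<cdot> p \<in> Hom C E E'"
      using r(1) d(2) c(3) a(5) by (auto intro: Comp_Hom)
    have "((i' \<cdot> r) \<oplus> (s' \<cdot> p)) \<cdot> i = i'"
      using Comp_Add_left[OF c(2) t] Comp_assoc[OF c(2) r(1) d(2)] Comp_assoc[OF c(2,3) a(5)]
        r(2) c(4) Comp_Id[OF d(2)] Comp_Zero_right[OF a(5) c(5)] Add_Zero[OF d(2)] by simp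
    moreover have "((i' \<cdot> r) \<oplus> (s' \<cdot> p)) \<cdot> s = s'"
      using Comp_Add_left[OF a(2) t] Comp_assoc[OF a(2) r(1) d(2)] Comp_assoc[OF a(2) c(3) a(5)]
        r(3) a(3) Comp_Id[OF a(5)] Comp_Zero_right[OF d(2) c(7)] Add_Zero[OF a(5)] by simp
    moreover have "p' \<cdot> ((i' \<cdot> r) \<oplus> (s' \<cdot> p)) = p"
      using Comp_Add_right[OF t d(3)] Comp_assoc[OF r(1) d(2,3)] Comp_assoc[OF c(3) a(5) d(3)]
        d(4) a(6) Id_Comp[OF c(3)] Comp_Zero_left[OF r(1) d(7)] Add_Zero[OF c(3)] by simp
    ultimately show ?thesis using Add_Hom[OF t] by blast
  qed
  \<comment> \<open>An endomorphism that fixes both summands is the identity, since the identity is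
    the sum of the two projections.\<close>
  have eq: "h = Id C E" if a: "conflation T i E p S" "s \<in> Hom C S E" "p \<cdot> s = Id C S"
    and h: "h \<in> Hom C E E" "h \<cdot> i = i" "h \<cdot> s = s" for i E p s h
  proof -
    note c = conflationD[OF a(1)]
    obtain r where r: "r \<in> Hom C E T" "(s \<cdot> p) \<oplus> (i \<cdot> r) = Id C E"
      using retraction_if_section[OF a(1-3)] .
    have t: "s \<cdot> p \<in> Hom C E E" "i \<cdot> r \<in> Hom C E E"
      using r(1) c(2,3) a(2) by (auto intro: Comp_Hom)
    have "h \<cdot> ((s \<cdot> p) \<oplus> (i \<cdot> r)) = (s \<cdot> p) \<oplus> (i \<cdot> r)"
      using Comp_Add_right[OF t h(1)] Comp_assoc[OF c(3) a(2) h(1)] Comp_assoc[OF r(1) c(2) h(1)] h(2,3)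
      by simp
    then show ?thesis using r(2) Comp_Id[OF h(1)] by simp
  qed
  obtain h where h: "h \<in> Hom C E E'" "h \<cdot> i = i'" "h \<cdot> s = s'" "p' \<cdot> h = p"
    using map[OF assms] by blast
  obtain k where k: "k \<in> Hom C E' E" "k \<cdot> i' = i" "k \<cdot> s' = s"
    using map[OF assms(4-6,1-3)] by blast
  have "k \<cdot> h = Id C E"
    using Comp_assoc[OF conflationD(2)[OF assms(1)] h(1) k(1)] Comp_assoc[OF assms(2) h(1) k(1)] h k
    by (intro eq[OF assms(1-3)]) (auto intro: Comp_Hom)
  moreover have "h \<cdot> k = Id C E'"
    using Comp_assoc[OF conflationD(2)[OF assms(4)] k(1) h(1)] Comp_assoc[OF assms(5) k(1) h(1)] h k
    by (intro eq[OF assms(4-6)]) (auto intro: Comp_Hom)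
  ultimately show ?thesis using h k iso_betweenI[OF h(1) k(1)] by blast
qed

section \<open>Vanishing of Ext\<close>

lemma extensions_iff: "(i, p) \<in> extensions C X Y \<longleftrightarrow> conflation Y i (Cod C i) p X"
  using conflation_Confl[of i p] by (auto simp: extensions_def conflation_def Hom_def)

text \<open>A split extension always exists. So a single equivalence class means that every
  extension is equivalent to a split one, and the equivalence carries the section over. Conversely,
  extensions with sections are all equivalent.\<close>

lemma Ext1_vanishes_iff:
  assumes "X \<in> Obj C" "T \<in> Obj C"
  shows "Ext1_vanishes C X T \<longleftrightarrow>
    (\<forall>i E p. conflation T i E p X \<longrightarrow> (\<exists>s\<in>Hom C X E. p \<cdot> s = Id C X))"
proof
  assume "Ext1_vanishes C X T"
  then obtain K where K: "Ext1 C X T = {K}"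
    unfolding Ext1_vanishes_def is_singleton_def by blast
  show "\<forall>i E p. conflation T i E p X \<longrightarrow> (\<exists>s\<in>Hom C X E. p \<cdot> s = Id C X)"
  proof (intro allI impI)
    fix i E p assume c: "conflation T i E p X"
    obtain i' E' p' s' where d: "conflation T i' E' p' X" "s' \<in> Hom C X E'" "p' \<cdot> s' = Id C X"
      using split_conflation[OF assms(2,1)] .
    have Cods: "Cod C i = E" "Cod C i' = E'"
      using conflationD(2)[OF c] conflationD(2)[OF d(1)] by (auto simp: Hom_def)
    have e: "(i, p) \<in> extensions C X T" "(i', p') \<in> extensions C X T"
      unfolding extensions_iff Cods by fact+
    have "extension_equiv C X T `` {x} = K" if "x \<in> extensions C X T" for x
      using K that unfolding Ext1_def by (metis quotientI singletonD)
    then have eq: "extension_equiv C X T `` {(i', p')} = extension_equiv C X T `` {(i, p)}"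
      using e by simp
    have "((i, p), (i, p)) \<in> extension_equiv C X T"
      using e iso_between_Id conflationD[OF c] Cods unfolding extension_equiv_def
      by (auto intro!: exI[of _ "Id C E"] simp: Id_Comp Comp_Id)
    then have "((i', p'), (i, p)) \<in> extension_equiv C X T" using eq by blast
    then obtain h where h: "iso_between C h E' E" "p \<cdot> h = p'"
      unfolding extension_equiv_def Cods[symmetric] by auto
    have "p \<cdot> (h \<cdot> s') = Id C X"
      using Comp_assoc[OF d(2) iso_between_Hom[OF h(1)] conflationD(3)[OF c]] h(2) d(3) by simp
    then show "\<exists>s\<in>Hom C X E. p \<cdot> s = Id C X"
      using Comp_Hom[OF d(2) iso_between_Hom[OF h(1)]] by blast
  qed
next
  assume split: "\<forall>i E p. conflation T i E p X \<longrightarrow> (\<exists>s\<in>Hom C X E. p \<cdot> s = Id C X)"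
  have rel: "extension_equiv C X T = extensions C X T \<times> extensions C X T"
    unfolding extension_equiv_def using split extension_equiv_if_sections
    by (auto simp: extensions_iff) metis
  obtain i E p where "conflation T i E p X"
    using split_conflation[OF assms(2,1)] by metis
  then have "(i, p) \<in> extensions C X T"
    unfolding extensions_iff by (metis conflationD(2) HomD(3))
  then have "Ext1 C X T = {extensions C X T}"
    unfolding Ext1_def rel quotient_def by auto
  then show "Ext1_vanishes C X T"
    by (simp add: Ext1_vanishes_def)
qed

text \<open>The conflation is pushed out along \<open>r\<close>. The new extension of
  \<open>S\<close> by \<open>T\<close> splits, and its retraction composed with the pushout leg
  extends \<open>r\<close>.\<close>

lemma Hom_surjective_if_Ext1_vanishes:
  assumes "conflation K n E q S" "Ext1_vanishes C S T" "r \<in> Hom C K T"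
  obtains r' where "r' \<in> Hom C E T" "r' \<cdot> n = r"
proof -
  note c = conflationD[OF assms(1)]
  have T: "T \<in> Obj C" using assms(3) by (rule HomD)
  obtain m f where po: "is_pushout C n r m f"
    using inflation_pushout[OF c(8), of r] assms(3) c(2) by (auto simp: Hom_def)
  note t = pushout_Hom[OF po c(2) assms(3)]
  obtain p where p: "conflation T m (Cod C m) p S"
    using pushout_conflation[OF assms(1) po assms(3) t(1,2)] .
  obtain s where s: "s \<in> Hom C S (Cod C m)" "p \<cdot> s = Id C S"
    using assms(2) p unfolding Ext1_vanishes_iff[OF c(7) T] by blast
  obtain l where l: "l \<in> Hom C (Cod C m) T" "l \<cdot> m = Id C T"
    using retraction_if_section[OF p s] .
  have "(l \<cdot> f) \<cdot> n = r"
    using Comp_assoc[OF c(2) t(2) l(1)] t(3) Comp_assoc[OF assms(3) t(1) l(1)] l(2) Id_Comp[OF assms(3)]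
    by simp
  then show ?thesis using that Comp_Hom[OF t(2) l(1)] by blast
qed

text \<open>Maps into the pullback that \<open>p'\<close> kills are the same as maps into
  \<open>E\<close> that \<open>p\<close> kills, so the kernel stays the same; its inclusion has the
  components \<open>k\<close> and zero.\<close>

lemma pullback_conflation:
  assumes "conflation T k E p D" "h \<in> Hom C B D"
  obtains k' E' p' h' where "conflation T k' E' p' B" "h' \<in> Hom C E' E" "p \<cdot> h' = h \<cdot> p'" "h' \<cdot> k' = k"
    "\<And>Y a b. \<lbrakk>a \<in> Hom C Y E; b \<in> Hom C Y B; p \<cdot> a = h \<cdot> b\<rbrakk>
       \<Longrightarrow> \<exists>u\<in>Hom C Y E'. h' \<cdot> u = a \<and> p' \<cdot> u = b"
proof -
  note c = conflationD[OF assms(1)]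
  obtain p' h' where pb: "is_pullback C p h p' h'" "p' \<in> deflations C"
    using deflation_pullback[OF c(9), of h] assms(2) c(3) by (auto simp: Hom_def)
  define E' where "E' = Dom C p'"
  have t: "p' \<in> Hom C E' B" "h' \<in> Hom C E' E" "p \<cdot> h' = h \<cdot> p'"
    using pb(1) assms(2) c(3) unfolding is_pullback_def E'_def Hom_def by auto
  have uni: "\<exists>!u. u \<in> Hom C Y E' \<and> h' \<cdot> u = a \<and> p' \<cdot> u = b"
    if "a \<in> Hom C Y E" "b \<in> Hom C Y B" "p \<cdot> a = h \<cdot> b" for Y a b
  proof -
    have "Dom C p = E" "Dom C h = B" "Y \<in> Obj C" using assms(2) c(3) that(1) by (auto simp: Hom_def dom_Obj)
    then show ?thesis using pb(1) that unfolding is_pullback_def E'_def by blast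
  qed
  have obj: "B \<in> Obj C" "E' \<in> Obj C" using HomD[OF t(1)] by auto
  have "p \<cdot> k = h \<cdot> Zero C T B" using c(4) Comp_Zero_right[OF assms(2) c(5)] by simp
  then obtain k' where k': "k' \<in> Hom C T E'" "h' \<cdot> k' = k" "p' \<cdot> k' = Zero C T B"
    using uni[OF c(2) Zero_Hom[OF c(5) obj(1)]] by blast
  have "is_kernel C k' p'"
    unfolding is_kernel_def
  proof (intro conjI ballI impI)
    fix W f assume "W \<in> Obj C" "f \<in> Hom C W (Dom C p')" "p' \<cdot> f = Zero C W (Cod C p')"
    then have W: "W \<in> Obj C" and f: "f \<in> Hom C W E'" "p' \<cdot> f = Zero C W B"
      using t(1) by (simp_all add: Hom_def)
    have "p \<cdot> (h' \<cdot> f) = Zero C W D"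
      using Comp_assoc[OF f(1) t(2) c(3)] t(3) Comp_assoc[OF f(1) t(1) assms(2)] f(2)
        Comp_Zero_right[OF assms(2) W] by simp
    then obtain u where u: "u \<in> Hom C W T" "k \<cdot> u = h' \<cdot> f"
      using kernel_factor[OF assms(1) Comp_Hom[OF f(1) t(2)]] by blast
    have ku: "k' \<cdot> u \<in> Hom C W E'" using u(1) k'(1) by (rule Comp_Hom)
    have hk: "h' \<cdot> (k' \<cdot> u) = h' \<cdot> f" "p' \<cdot> (k' \<cdot> u) = p' \<cdot> f"
      using Comp_assoc[OF u(1) k'(1) t(2)] Comp_assoc[OF u(1) k'(1) t(1)] k'(2,3) u(2) f(2)
        Comp_Zero_left[OF u(1) obj(1)] by simp_all
    have "p \<cdot> (h' \<cdot> f) = h \<cdot> (p' \<cdot> f)"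
      using Comp_assoc[OF f(1) t(2) c(3)] Comp_assoc[OF f(1) t(1) assms(2)] t(3) by simp
    then have "k' \<cdot> u = f"
      using uni[OF Comp_Hom[OF f(1) t(2)] Comp_Hom[OF f(1) t(1)]] ku hk f(1) by blast
    moreover have "v = u" if "v \<in> Hom C W T" "k' \<cdot> v = f" for v
    proof (rule inflation_mono[OF c(8,2) that(1) u(1)])
      show "k \<cdot> v = k \<cdot> u"
        using Comp_assoc[OF that(1) k'(1) t(2)] k'(2) that(2) u(2) by simp
    qed
    moreover have "Dom C k' = T" using k'(1) by (simp add: Hom_def)
    ultimately show "\<exists>!u. u \<in> Hom C W (Dom C k') \<and> k' \<cdot> u = f"
      using u(1) by blast
  qed (use t k' in \<open>auto simp: Hom_def\<close>)
  then have "conflation T k' E' p' B"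
    using conflation_if_kernel[OF pb(2) _ k'(1) t(1)] by blast
  then show ?thesis using that[OF _ t(2,3) k'(2)] uni by blast
qed

text \<open>Let \<open>K\<close> be the kernel of \<open>q \<cdot> p\<close>, that is, the preimage
  of \<open>A\<close> in \<open>E\<close>. It is an extension of \<open>A\<close> by
  \<open>T\<close>, split by \<open>g\<close>, and so it has a retraction \<open>r\<close> onto
  \<open>T\<close> that vanishes on \<open>g\<close>. Since \<open>K\<close> has the cokernel
  \<open>S\<close> in \<open>E\<close>, vanishing of Ext extends \<open>r\<close> to a retraction
  \<open>r'\<close> of \<open>k\<close>. The identity minus \<open>k \<cdot> r'\<close> then
  descends along \<open>p\<close> to the required section.\<close>

lemma lifting_Id:
  assumes "conflation T k E p B" "conflation A j B q S" "Ext1_vanishes C S T"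
    and g: "g \<in> Hom C A E" "p \<cdot> g = j"
  shows "\<exists>s\<in>Hom C B E. p \<cdot> s = Id C B \<and> s \<cdot> j = g"
proof -
  note c = conflationD[OF assms(1)] and d = conflationD[OF assms(2)]
  have "Cod C p = Dom C q" using c(3) d(3) by (simp add: Hom_def)
  then have "q \<cdot> p \<in> deflations C" using c(9) d(9) by (intro deflation_Comp)
  then obtain n K where n: "conflation K n E (q \<cdot> p) S"
    using conflation_if_deflation Comp_Hom[OF c(3) d(3)] by metis
  note e = conflationD[OF n]
  have "(q \<cdot> p) \<cdot> g = Zero C A S" using Comp_assoc[OF g(1) c(3) d(3)] g(2) d(4) by simp
  then obtain g' where g': "g' \<in> Hom C A K" "n \<cdot> g' = g" using kernel_factor[OF n g(1)] by blast
  have "(q \<cdot> p) \<cdot> k = Zero C T S"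
    using Comp_assoc[OF c(2,3) d(3)] c(4) Comp_Zero_right[OF d(3) c(5)] by simp
  then obtain k' where k': "k' \<in> Hom C T K" "n \<cdot> k' = k" using kernel_factor[OF n c(2)] by blast
  have pn: "p \<cdot> n \<in> Hom C K B" using e(2) c(3) by (rule Comp_Hom)
  have "q \<cdot> (p \<cdot> n) = Zero C K S" using Comp_assoc[OF e(2) c(3) d(3)] e(4) by simp
  \<comment> \<open>\<open>p'\<close> is the restriction of \<open>p\<close> to \<open>K\<close>,
    with values in \<open>A\<close>.\<close>
  then obtain p' where p': "p' \<in> Hom C K A" "j \<cdot> p' = p \<cdot> n"
    using kernel_factor[OF assms(2) pn] by blast
  have pg: "p' \<cdot> g' = Id C A"
  proof (rule inflation_mono[OF d(8,2) Comp_Hom[OF g'(1) p'(1)] Id_Hom[OF d(5)]])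
    show "j \<cdot> (p' \<cdot> g') = j \<cdot> Id C A"
      using Comp_assoc[OF g'(1) p'(1) d(2)] p'(2) Comp_assoc[OF g'(1) e(2) c(3)] g'(2) g(2) Comp_Id[OF d(2)]
      by simp
  qed
  have pk: "p' \<cdot> k' = Zero C T A"
  proof (rule inflation_mono[OF d(8,2) Comp_Hom[OF k'(1) p'(1)] Zero_Hom[OF c(5) d(5)]])
    show "j \<cdot> (p' \<cdot> k') = j \<cdot> Zero C T A"
      using Comp_assoc[OF k'(1) p'(1) d(2)] p'(2) Comp_assoc[OF k'(1) e(2) c(3)] k'(2) c(4)
        Comp_Zero_right[OF d(2) c(5)]
      by simp
  qed
  \<comment> \<open>What remains of \<open>n\<close> after subtracting \<open>g \<cdot> p'\<close>
    is killed by \<open>p\<close>; this defines the projection \<open>r\<close> of \<open>K\<close>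
    onto \<open>T\<close> along \<open>g'\<close>.\<close>
  have gp: "g \<cdot> p' \<in> Hom C K E" using p'(1) g(1) by (rule Comp_Hom)
  have "p \<cdot> (g \<cdot> p') = p \<cdot> n" using Comp_assoc[OF p'(1) g(1) c(3)] g(2) p'(2) by simp
  then have "p \<cdot> (n \<ominus> g \<cdot> p') = Zero C K B"
    using Comp_Diff_right[OF e(2) gp c(3)] Diff_eq_Zero_iff[OF pn pn] by simp
  then obtain r where r: "r \<in> Hom C K T" "k \<cdot> r = n \<ominus> g \<cdot> p'"
    using kernel_factor[OF assms(1) Diff_Hom[OF e(2) gp]] by blast
  have rg: "r \<cdot> g' = Zero C A T"
  proof (rule inflation_mono[OF c(8,2) Comp_Hom[OF g'(1) r(1)] Zero_Hom[OF d(5) c(5)]])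
    have "(n \<ominus> g \<cdot> p') \<cdot> g' = g \<ominus> g"
      using Comp_Diff_left[OF e(2) gp g'(1)] g'(2) Comp_assoc[OF g'(1) p'(1) g(1)] pg Comp_Id[OF g(1)] by simp
    then show "k \<cdot> (r \<cdot> g') = k \<cdot> Zero C A T"
      using Comp_assoc[OF g'(1) r(1) c(2)] r(2) Diff_eq_Zero_iff[OF g(1) g(1)] Comp_Zero_right[OF c(2) d(5)] by simp
  qed
  have rk: "r \<cdot> k' = Id C T"
  proof (rule inflation_mono[OF c(8,2) Comp_Hom[OF k'(1) r(1)] Id_Hom[OF c(5)]])
    have "(n \<ominus> g \<cdot> p') \<cdot> k' = k"
      using Comp_Diff_left[OF e(2) gp k'(1)] k'(2) Comp_assoc[OF k'(1) p'(1) g(1)] pk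
        Comp_Zero_right[OF g(1) c(5)] Diff_Zero[OF c(2)] by simp
    then show "k \<cdot> (r \<cdot> k') = k \<cdot> Id C T"
      using Comp_assoc[OF k'(1) r(1) c(2)] r(2) Comp_Id[OF c(2)] by simp
  qed
  obtain r' where r': "r' \<in> Hom C E T" "r' \<cdot> n = r"
    using Hom_surjective_if_Ext1_vanishes[OF n assms(3) r(1)] .
  have r'k: "r' \<cdot> k = Id C T" using Comp_assoc[OF k'(1) e(2) r'(1)] k'(2) r'(2) rk by simp
  \<comment> \<open>Because \<open>r'\<close> vanishes on \<open>g\<close>, the section built from
    it restricts to \<open>g\<close> on \<open>A\<close>.\<close>
  have r'g: "r' \<cdot> g = Zero C A T" using Comp_assoc[OF g'(1) e(2) r'(1)] g'(2) r'(2) rg by simp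
  note IE = Id_Hom[OF c(6)]
  have kr: "k \<cdot> r' \<in> Hom C E E" using r'(1) c(2) by (rule Comp_Hom)
  have "(k \<cdot> r') \<cdot> k = k" using Comp_assoc[OF c(2) r'(1) c(2)] r'k Comp_Id[OF c(2)] by simp
  then have "(Id C E \<ominus> k \<cdot> r') \<cdot> k = Zero C T E"
    using Comp_Diff_left[OF IE kr c(2)] Id_Comp[OF c(2)] Diff_eq_Zero_iff[OF c(2,2)] by simp
  then obtain s where s: "s \<in> Hom C B E" "s \<cdot> p = Id C E \<ominus> k \<cdot> r'"
    using cokernel_factor[OF assms(1) Diff_Hom[OF IE kr]] by blast
  have "p \<cdot> s = Id C B"
  proof (rule deflation_epi[OF c(9,3) Comp_Hom[OF s(1) c(3)] Id_Hom[OF c(7)]])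
    have "p \<cdot> (k \<cdot> r') = Zero C E B"
      using Comp_assoc[OF r'(1) c(2,3)] c(4) Comp_Zero_left[OF r'(1) c(7)] by simp
    then have "p \<cdot> (Id C E \<ominus> k \<cdot> r') = p"
      using Comp_Diff_right[OF IE kr c(3)] Comp_Id[OF c(3)] Diff_Zero[OF c(3)] by simp
    then show "p \<cdot> s \<cdot> p = Id C B \<cdot> p"
      using Comp_assoc[OF c(3) s(1) c(3)] s(2) Id_Comp[OF c(3)] by simp
  qed
  moreover have "s \<cdot> j = g"
  proof -
    have "s \<cdot> j = (Id C E \<ominus> k \<cdot> r') \<cdot> g" using Comp_assoc[OF g(1) c(3) s(1)] g(2) s(2) by simp
    also have "\<dots> = g"
      using Comp_Diff_left[OF IE kr g(1)] Id_Comp[OF g(1)] Comp_assoc[OF g(1) r'(1) c(2)] r'g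
        Comp_Zero_right[OF c(2) d(5)] Diff_Zero[OF g(1)] by simp
    finally show ?thesis .
  qed
  ultimately show ?thesis using s(1) by blast
qed

text \<open>The pullback along \<open>h\<close> reduces this to the case \<open>h = Id\<close>.\<close>

lemma lifting:
  assumes "conflation T k E p D" "conflation A j B q S" "Ext1_vanishes C S T"
    and "g \<in> Hom C A E" "h \<in> Hom C B D" "p \<cdot> g = h \<cdot> j"
  obtains l where "l \<in> Hom C B E" "p \<cdot> l = h" "l \<cdot> j = g"
proof -
  note d = conflationD[OF assms(2)]
  obtain k' E' p' h' where pb: "conflation T k' E' p' B" "h' \<in> Hom C E' E" "p \<cdot> h' = h \<cdot> p'"
    "\<And>Y a b. \<lbrakk>a \<in> Hom C Y E; b \<in> Hom C Y B; p \<cdot> a = h \<cdot> b\<rbrakk>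
       \<Longrightarrow> \<exists>u\<in>Hom C Y E'. h' \<cdot> u = a \<and> p' \<cdot> u = b"
    using pullback_conflation[OF assms(1,5)] by metis
  obtain g' where g': "g' \<in> Hom C A E'" "h' \<cdot> g' = g" "p' \<cdot> g' = j"
    using pb(4)[OF assms(4) d(2) assms(6)] by blast
  obtain s where s: "s \<in> Hom C B E'" "p' \<cdot> s = Id C B" "s \<cdot> j = g'"
    using lifting_Id[OF pb(1) assms(2,3) g'(1,3)] by blast
  note c = conflationD[OF assms(1)] and e = conflationD[OF pb(1)]
  show ?thesis
  proof
    show "h' \<cdot> s \<in> Hom C B E" using s(1) pb(2) by (rule Comp_Hom)
    show "p \<cdot> (h' \<cdot> s) = h"
      using Comp_assoc[OF s(1) pb(2) c(3)] pb(3) Comp_assoc[OF s(1) e(3) assms(5)] s(2) Comp_Id[OF assms(5)] by simp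
    show "h' \<cdot> s \<cdot> j = g"
      using Comp_assoc[OF d(2) s(1) pb(2)] s(3) g'(2) by simp
  qed
qed

text \<open>This is lifting against 0 -> X, an inflation with cokernel \<open>X\<close>.\<close>

lemma lift_if_Ext1_vanishes:
  assumes "conflation T k E p D" "Ext1_vanishes C X T" "h \<in> Hom C X D"
  obtains l where "l \<in> Hom C X E" "p \<cdot> l = h"
proof -
  obtain Z where Z: "zero_object C Z" using ex_zero_object by blast
  have X: "X \<in> Obj C" using assms(3) by (rule HomD)
  note c = conflationD[OF assms(1)]
  have "p \<cdot> Zero C Z E = h \<cdot> Zero C Z X"
    using Comp_Zero_right[OF c(3) zero_object_Obj[OF Z]] Comp_Zero_right[OF assms(3) zero_object_Obj[OF Z]] by simp
  then show ?thesis
    using lifting[OF assms(1) conflation_Id[OF Z X] assms(2) Zero_Hom[OF zero_object_Obj[OF Z] c(6)] assms(3)]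
      that by blast
qed

text \<open>The pullback \<open>D\<close> of \<open>q'\<close> and \<open>q\<close> plays the role
  of the direct sum of \<open>B'\<close> and \<open>A\<close>: its components are \<pi> and the map
  \<open>r\<close> with \<open>\<rho> = b \<cdot> \<pi> - j \<cdot> r\<close>. As \<rho> is a
  deflation onto \<open>B\<close> with kernel \<open>A'\<close>, a map out of \<open>B\<close> is a
  map out of \<open>D\<close> that vanishes on \<open>A'\<close>, which is a compatible pair of maps
  out of \<open>B'\<close> and \<open>A\<close>.\<close>

lemma pushout_if_same_cokernel:
  assumes "conflation A' i B' q' S" "conflation A j B q S"
    and a: "a \<in> Hom C A' A" and b: "b \<in> Hom C B' B" and sq: "b \<cdot> i = j \<cdot> a" and qb: "q \<cdot> b = q'"
  shows "is_pushout C i a j b"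
proof -
  note c = conflationD[OF assms(1)] and d = conflationD[OF assms(2)]
  obtain k D \<rho> \<pi> where pb: "conflation A' k D \<rho> B" "\<pi> \<in> Hom C D B'" "q' \<cdot> \<pi> = q \<cdot> \<rho>" "\<pi> \<cdot> k = i"
    "\<And>Y a b. \<lbrakk>a \<in> Hom C Y B'; b \<in> Hom C Y B; q' \<cdot> a = q \<cdot> b\<rbrakk>
       \<Longrightarrow> \<exists>u\<in>Hom C Y D. \<pi> \<cdot> u = a \<and> \<rho> \<cdot> u = b"
    using pullback_conflation[OF assms(1) d(3)] by metis
  note e = conflationD[OF pb(1)]
  have b\<pi>: "b \<cdot> \<pi> \<in> Hom C D B" using pb(2) b by (rule Comp_Hom)
  have "q \<cdot> (b \<cdot> \<pi>) = q \<cdot> \<rho>" using Comp_assoc[OF pb(2) b d(3)] qb pb(3) by simp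
  then have "q \<cdot> (b \<cdot> \<pi> \<ominus> \<rho>) = Zero C D S"
    using Comp_Diff_right[OF b\<pi> e(3) d(3)] Diff_eq_Zero_iff[OF Comp_Hom[OF e(3) d(3)] Comp_Hom[OF e(3) d(3)]] by simp
  then obtain r where r: "r \<in> Hom C D A" "j \<cdot> r = b \<cdot> \<pi> \<ominus> \<rho>"
    using kernel_factor[OF assms(2) Diff_Hom[OF b\<pi> e(3)]] by blast
  have rx: "j \<cdot> (r \<cdot> x) = (b \<cdot> (\<pi> \<cdot> x)) \<ominus> (\<rho> \<cdot> x)" if x: "x \<in> Hom C W D" for x W
    using Comp_assoc[OF x r(1) d(2)] r(2) Comp_Diff_left[OF b\<pi> e(3) x] Comp_assoc[OF x pb(2) b] by simp
  have ja: "j \<cdot> a \<in> Hom C A' B" using a d(2) by (rule Comp_Hom)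
  have rk: "r \<cdot> k = a"
    using inflation_mono[OF d(8,2) Comp_Hom[OF e(2) r(1)] a] rx[OF e(2)] pb(4) e(4) sq Diff_Zero[OF ja] by simp
  show ?thesis
  proof (rule pushoutI[OF c(2) a d(2) b sq])
    fix Y x y assume x: "x \<in> Hom C B' Y" and y: "y \<in> Hom C A Y" and xy: "x \<cdot> i = y \<cdot> a"
    have Y: "Y \<in> Obj C" using x by (rule HomD)
    have t: "x \<cdot> \<pi> \<in> Hom C D Y" "y \<cdot> r \<in> Hom C D Y" using x y pb(2) r(1) by (auto intro: Comp_Hom)
    have \<phi>: "(x \<cdot> \<pi> \<ominus> y \<cdot> r) \<cdot> z = (x \<cdot> (\<pi> \<cdot> z)) \<ominus> (y \<cdot> (r \<cdot> z))" if z: "z \<in> Hom C W D" for z W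
      using Comp_Diff_left[OF t z] Comp_assoc[OF z pb(2) x] Comp_assoc[OF z r(1) y] by simp
    have xi: "x \<cdot> i \<in> Hom C A' Y" using c(2) x by (rule Comp_Hom)
    have "(x \<cdot> \<pi> \<ominus> y \<cdot> r) \<cdot> k = Zero C A' Y"
      using \<phi>[OF e(2)] pb(4) rk xy Diff_eq_Zero_iff[OF xi xi] by simp
    then obtain u where u: "u \<in> Hom C B Y" "u \<cdot> \<rho> = x \<cdot> \<pi> \<ominus> y \<cdot> r"
      using cokernel_factor[OF pb(1) Diff_Hom[OF t]] by blast
    \<comment> \<open>\<sigma> is the inclusion of the summand \<open>B'\<close> into
      \<open>D\<close>; its component in \<open>A\<close> is zero.\<close>
    obtain \<sigma> where \<sigma>: "\<sigma> \<in> Hom C B' D" "\<pi> \<cdot> \<sigma> = Id C B'" "\<rho> \<cdot> \<sigma> = b"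
      using pb(5)[OF Id_Hom[OF c(6)] b] Comp_Id[OF c(3)] qb by auto
    have "r \<cdot> \<sigma> = Zero C B' A"
    proof (rule inflation_mono[OF d(8,2) Comp_Hom[OF \<sigma>(1) r(1)] Zero_Hom[OF c(6) d(5)]])
      show "j \<cdot> (r \<cdot> \<sigma>) = j \<cdot> Zero C B' A"
        using rx[OF \<sigma>(1)] \<sigma>(2,3) Comp_Id[OF b] Diff_eq_Zero_iff[OF b b] Comp_Zero_right[OF d(2) c(6)] by simp
    qed
    then have "u \<cdot> b = x"
      using Comp_assoc[OF \<sigma>(1) e(3) u(1)] \<sigma>(2,3) u(2) \<phi>[OF \<sigma>(1)] Comp_Id[OF x]
        Comp_Zero_right[OF y c(6)] Diff_Zero[OF x] by simp
    moreover have "u \<cdot> j = y"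
    proof -
      have "q' \<cdot> Zero C A B' = q \<cdot> j" using Comp_Zero_right[OF c(3) d(5)] d(4) by simp
      \<comment> \<open>\<tau> is the inclusion of \<open>A\<close> into \<open>D\<close> up to
        sign: its \<open>A\<close>-component is minus the identity, which cancels the sign in front
        of \<open>y \<cdot> r\<close>.\<close>
      then obtain \<tau> where \<tau>: "\<tau> \<in> Hom C A D" "\<pi> \<cdot> \<tau> = Zero C A B'" "\<rho> \<cdot> \<tau> = j"
        using pb(5)[OF Zero_Hom[OF d(5) c(6)] d(2)] by blast
      note ZA = Zero_Hom[OF d(5) d(5)] and IA = Id_Hom[OF d(5)] and ZY = Zero_Hom[OF d(5) Y]
      have "r \<cdot> \<tau> = Zero C A A \<ominus> Id C A"
      proof (rule inflation_mono[OF d(8,2) Comp_Hom[OF \<tau>(1) r(1)] Diff_Hom[OF ZA IA]])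
        show "j \<cdot> (r \<cdot> \<tau>) = j \<cdot> (Zero C A A \<ominus> Id C A)"
          using rx[OF \<tau>(1)] \<tau>(2,3) Comp_Zero_right[OF b d(5)] Comp_Diff_right[OF ZA IA d(2)]
            Comp_Zero_right[OF d(2,5)] Comp_Id[OF d(2)] by simp
      qed
      then have "y \<cdot> (r \<cdot> \<tau>) = Zero C A Y \<ominus> y"
        using Comp_Diff_right[OF ZA IA y] Comp_Zero_right[OF y d(5)] Comp_Id[OF y] by simp
      then have "u \<cdot> j = Zero C A Y \<ominus> (Zero C A Y \<ominus> y)"
        using Comp_assoc[OF \<tau>(1) e(3) u(1)] \<tau>(2,3) u(2) \<phi>[OF \<tau>(1)] Comp_Zero_right[OF x d(5)] by simp
      also have "\<dots> = y"
        using Diff_eqI[OF y Diff_Hom[OF ZY y] ZY] Add_commute[OF y Diff_Hom[OF ZY y]] Diff_Add[OF ZY y] by simp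
      finally show ?thesis .
    qed
    ultimately show "\<exists>u\<in>Hom C B Y. u \<cdot> b = x \<and> u \<cdot> j = y" using u(1) by blast
  next
    fix Y u v assume uv: "u \<in> Hom C B Y" "v \<in> Hom C B Y" "u \<cdot> b = v \<cdot> b" "u \<cdot> j = v \<cdot> j"
    have Y: "Y \<in> Obj C" using uv(1) by (rule HomD)
    have zero: "(u \<ominus> v) \<cdot> z = Zero C W Y" if "z \<in> Hom C W B" "u \<cdot> z = v \<cdot> z" for z W
      using Comp_Diff_left[OF uv(1,2) that(1)] that(2)
        Diff_eq_Zero_iff[OF Comp_Hom[OF that(1) uv(1)] Comp_Hom[OF that(1) uv(2)]] by simp
    \<comment> \<open>The difference \<open>u \<ominus> v\<close> vanishes on \<open>A\<close>, so
      it factors through the common cokernel; as it also vanishes on \<open>B'\<close> and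
      \<open>q'\<close> is epic, the factor is zero.\<close>
    obtain w where w: "w \<in> Hom C S Y" "w \<cdot> q = u \<ominus> v"
      using cokernel_factor[OF assms(2) Diff_Hom[OF uv(1,2)] zero[OF d(2) uv(4)]] .
    have "w = Zero C S Y"
    proof (rule deflation_epi[OF c(9,3) w(1) Zero_Hom[OF c(7) Y]])
      show "w \<cdot> q' = Zero C S Y \<cdot> q'"
        using Comp_assoc[OF b d(3) w(1)] qb w(2) zero[OF b uv(3)] Comp_Zero_left[OF c(3) Y] by simp
    qed
    then have "u \<ominus> v = Zero C B Y" using w(2) Comp_Zero_left[OF d(3) Y] by simp
    then show "u = v" using Diff_eq_Zero_iff[OF uv(1,2)] by simp
  qed
qed

end

section \<open>Transfinite sequences\<close>

locale category_in_universe = ordinal_universe U + category C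
  for U :: "'u::wellorder itself" and C :: "('o, 'm, 'z) cat_scheme" (structure)
begin

section \<open>Colimits of systems indexed by an ordinal\<close>

lemma direct_systemD:
  assumes "direct_system C \<Lambda> X i"
  shows "\<alpha> < \<Lambda> \<Longrightarrow> X \<alpha> \<in> Obj C" "\<alpha> < \<Lambda> \<Longrightarrow> i \<alpha> \<alpha> = Id C (X \<alpha>)"
    "\<beta> < \<Lambda> \<Longrightarrow> \<alpha> \<le> \<beta> \<Longrightarrow> i \<alpha> \<beta> \<in> Hom C (X \<alpha>) (X \<beta>)"
    "\<gamma> < \<Lambda> \<Longrightarrow> \<beta> \<le> \<gamma> \<Longrightarrow> \<alpha> \<le> \<beta> \<Longrightarrow> i \<beta> \<gamma> \<cdot> i \<alpha> \<beta> = i \<alpha> \<gamma>"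
  using assms unfolding direct_system_def by auto

lemma is_coconeD:
  assumes "is_cocone C \<Lambda> X i Y c"
  shows "Y \<in> Obj C" "\<alpha> < \<Lambda> \<Longrightarrow> c \<alpha> \<in> Hom C (X \<alpha>) Y"
    "\<beta> < \<Lambda> \<Longrightarrow> \<alpha> \<le> \<beta> \<Longrightarrow> c \<beta> \<cdot> i \<alpha> \<beta> = c \<alpha>"
  using assms unfolding is_cocone_def by auto

lemma is_cocone_cong:
  fixes \<Lambda> :: 'u
  assumes "\<And>\<alpha>. \<alpha> < \<Lambda> \<Longrightarrow> X \<alpha> = X' \<alpha>" "\<And>\<alpha> \<beta>. \<alpha> \<le> \<beta> \<Longrightarrow> \<beta> < \<Lambda> \<Longrightarrow> i \<alpha> \<beta> = i' \<alpha> \<beta>"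
    "\<And>\<alpha>. \<alpha> < \<Lambda> \<Longrightarrow> c \<alpha> = c' \<alpha>"
  shows "is_cocone C \<Lambda> X i Y c \<longleftrightarrow> is_cocone C \<Lambda> X' i' Y c'"
proof -
  have "c \<beta> \<cdot> i \<alpha> \<beta> = c \<alpha> \<longleftrightarrow> c' \<beta> \<cdot> i' \<alpha> \<beta> = c' \<alpha>" if "\<beta> < \<Lambda>" "\<alpha> \<le> \<beta>" for \<alpha> \<beta>
    using assms that le_less_trans[of \<alpha> \<beta> \<Lambda>] by simp
  then show ?thesis using assms unfolding is_cocone_def by auto
qed

lemma is_colimit_cong:
  fixes \<Lambda> :: 'u
  assumes "\<And>\<alpha>. \<alpha> < \<Lambda> \<Longrightarrow> X \<alpha> = X' \<alpha>" "\<And>\<alpha> \<beta>. \<alpha> \<le> \<beta> \<Longrightarrow> \<beta> < \<Lambda> \<Longrightarrow> i \<alpha> \<beta> = i' \<alpha> \<beta>"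
    "\<And>\<alpha>. \<alpha> < \<Lambda> \<Longrightarrow> c \<alpha> = c' \<alpha>"
  shows "is_colimit C \<Lambda> X i Y c \<longleftrightarrow> is_colimit C \<Lambda> X' i' Y c'"
proof -
  have "is_cocone C \<Lambda> X i Y d \<longleftrightarrow> is_cocone C \<Lambda> X' i' Y d" for Y d
    using assms(1,2) by (intro is_cocone_cong) auto
  moreover have "is_cocone C \<Lambda> X i Y c \<longleftrightarrow> is_cocone C \<Lambda> X' i' Y c'"
    using assms by (rule is_cocone_cong)
  moreover have "(\<forall>\<alpha><\<Lambda>. u \<cdot> c \<alpha> = d \<alpha>) \<longleftrightarrow> (\<forall>\<alpha><\<Lambda>. u \<cdot> c' \<alpha> = d \<alpha>)" for u d
    using assms(3) by simp
  ultimately show ?thesis unfolding is_colimit_def by simp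
qed

lemma is_colimit_cocone: "is_colimit C \<Lambda> X i Y c \<Longrightarrow> is_cocone C \<Lambda> X i Y c"
  by (simp add: is_colimit_def)

lemma colimit_factor:
  assumes "is_colimit C \<Lambda> X i Y c" "is_cocone C \<Lambda> X i Y' c'"
  obtains u where "u \<in> Hom C Y Y'" "\<And>\<alpha>. \<alpha> < \<Lambda> \<Longrightarrow> u \<cdot> c \<alpha> = c' \<alpha>"
  using assms unfolding is_colimit_def by blast

lemma cocone_Comp:
  fixes \<Lambda> :: 'u
  assumes "is_cocone C \<Lambda> X i Y c" "direct_system C \<Lambda> X i" "u \<in> Hom C Y Y'"
  shows "is_cocone C \<Lambda> X i Y' (\<lambda>\<alpha>. u \<cdot> c \<alpha>)"
proof -
  note k = is_coconeD[OF assms(1)] and d = direct_systemD[OF assms(2)]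
  have "(u \<cdot> c \<beta>) \<cdot> i \<alpha> \<beta> = u \<cdot> c \<alpha>" if "\<beta> < \<Lambda>" "\<alpha> \<le> \<beta>" for \<alpha> \<beta>
    using Comp_assoc[OF d(3)[OF that] k(2)[OF that(1)] assms(3)] k(3)[OF that] by simp
  then show ?thesis
    using k(2) assms(3) HomD(5)[OF assms(3)] unfolding is_cocone_def by (blast intro: Comp_Hom)
qed

lemma colimit_unique:
  fixes \<Lambda> :: 'u
  assumes "is_colimit C \<Lambda> X i Y c" "direct_system C \<Lambda> X i" "u \<in> Hom C Y Y'" "v \<in> Hom C Y Y'"
    and "\<And>\<alpha>. \<alpha> < \<Lambda> \<Longrightarrow> u \<cdot> c \<alpha> = v \<cdot> c \<alpha>"
  shows "u = v"
proof -
  have "is_cocone C \<Lambda> X i Y' (\<lambda>\<alpha>. v \<cdot> c \<alpha>)"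
    using assms(1,2,4) is_colimit_cocone by (blast intro: cocone_Comp)
  then have "\<exists>!u. u \<in> Hom C Y Y' \<and> (\<forall>\<alpha><\<Lambda>. u \<cdot> c \<alpha> = v \<cdot> c \<alpha>)"
    using assms(1) unfolding is_colimit_def by blast
  then show ?thesis using assms(3-5) by blast
qed

lemma colimitI:
  fixes \<Lambda> :: 'u
  assumes "is_cocone C \<Lambda> X i Y c"
    and "\<And>Y' c'. is_cocone C \<Lambda> X i Y' c' \<Longrightarrow> \<exists>u\<in>Hom C Y Y'. \<forall>\<alpha><\<Lambda>. u \<cdot> c \<alpha> = c' \<alpha>"
    and "\<And>Y' u v. \<lbrakk>u \<in> Hom C Y Y'; v \<in> Hom C Y Y'; \<And>\<alpha>. \<alpha> < \<Lambda> \<Longrightarrow> u \<cdot> c \<alpha> = v \<cdot> c \<alpha>\<rbrakk> \<Longrightarrow> u = v"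
  shows "is_colimit C \<Lambda> X i Y c"
  unfolding is_colimit_def
proof (intro conjI allI impI)
  fix Y' c' assume c': "is_cocone C \<Lambda> X i Y' c'"
  show "\<exists>!u. u \<in> Hom C Y Y' \<and> (\<forall>\<alpha><\<Lambda>. u \<cdot> c \<alpha> = c' \<alpha>)"
  proof (rule ex_ex1I)
    show "\<exists>u. u \<in> Hom C Y Y' \<and> (\<forall>\<alpha><\<Lambda>. u \<cdot> c \<alpha> = c' \<alpha>)" using assms(2)[OF c'] by blast
    fix u v assume u: "u \<in> Hom C Y Y' \<and> (\<forall>\<alpha><\<Lambda>. u \<cdot> c \<alpha> = c' \<alpha>)"
      and v: "v \<in> Hom C Y Y' \<and> (\<forall>\<alpha><\<Lambda>. v \<cdot> c \<alpha> = c' \<alpha>)"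
    show "u = v" using u v by (intro assms(3)[of u Y' v]) auto
  qed
qed fact

lemma colimit_iso:
  fixes \<Lambda> :: 'u
  assumes "is_colimit C \<Lambda> X i Y c" "direct_system C \<Lambda> X i" "iso_between C h Y Y'"
  shows "is_colimit C \<Lambda> X i Y' (\<lambda>\<alpha>. h \<cdot> c \<alpha>)"
proof -
  obtain g where g: "h \<in> Hom C Y Y'" "g \<in> Hom C Y' Y" "g \<cdot> h = Id C Y" "h \<cdot> g = Id C Y'"
    using assms(3) by (rule iso_betweenE)
  have k: "is_cocone C \<Lambda> X i Y c" using assms(1) by (rule is_colimit_cocone)
  note kt = is_coconeD[OF k]
  show ?thesis
  proof (rule colimitI)
    show "is_cocone C \<Lambda> X i Y' (\<lambda>\<alpha>. h \<cdot> c \<alpha>)" using k assms(2) g(1) by (rule cocone_Comp)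
  next
    fix W d assume "is_cocone C \<Lambda> X i W d"
    then obtain u where u: "u \<in> Hom C Y W" "\<And>\<alpha>. \<alpha> < \<Lambda> \<Longrightarrow> u \<cdot> c \<alpha> = d \<alpha>"
      using colimit_factor[OF assms(1)] by blast
    have "(u \<cdot> g) \<cdot> (h \<cdot> c \<alpha>) = d \<alpha>" if "\<alpha> < \<Lambda>" for \<alpha>
      using Comp_assoc[OF Comp_Hom[OF kt(2)[OF that] g(1)] g(2) u(1)]
        Comp_assoc[OF kt(2)[OF that] g(1,2)] g(3) Id_Comp[OF kt(2)[OF that]] u(2)[OF that] by simp
    then show "\<exists>u\<in>Hom C Y' W. \<forall>\<alpha><\<Lambda>. u \<cdot> (h \<cdot> c \<alpha>) = d \<alpha>"
      using Comp_Hom[OF g(2) u(1)] by blast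
  next
    fix W u v assume uv: "u \<in> Hom C Y' W" "v \<in> Hom C Y' W" "\<And>\<alpha>. \<alpha> < \<Lambda> \<Longrightarrow> u \<cdot> (h \<cdot> c \<alpha>) = v \<cdot> (h \<cdot> c \<alpha>)"
    have "u \<cdot> h = v \<cdot> h"
    proof (rule colimit_unique[OF assms(1,2) Comp_Hom[OF g(1) uv(1)] Comp_Hom[OF g(1) uv(2)]])
      fix \<alpha> assume "\<alpha> < \<Lambda>"
      then show "u \<cdot> h \<cdot> c \<alpha> = v \<cdot> h \<cdot> c \<alpha>"
        using Comp_assoc[OF kt(2)[OF \<open>\<alpha> < \<Lambda>\<close>] g(1) uv(1)] Comp_assoc[OF kt(2)[OF \<open>\<alpha> < \<Lambda>\<close>] g(1) uv(2)] uv(3)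
        by simp
    qed
    then have "(u \<cdot> h) \<cdot> g = (v \<cdot> h) \<cdot> g" by simp
    then show "u = v"
      using Comp_assoc[OF g(2,1) uv(1)] Comp_assoc[OF g(2,1) uv(2)] g(4) Comp_Id[OF uv(1)] Comp_Id[OF uv(2)]
      by simp
  qed
qed

lemma colimit_unique_iso:
  fixes \<Lambda> :: 'u
  assumes "is_colimit C \<Lambda> X i Y c" "is_colimit C \<Lambda> X i Y' c'" "direct_system C \<Lambda> X i"
    and h: "h \<in> Hom C Y Y'" "\<And>\<alpha>. \<alpha> < \<Lambda> \<Longrightarrow> h \<cdot> c \<alpha> = c' \<alpha>"
  shows "iso_between C h Y Y'"
proof -
  note k = is_coconeD[OF is_colimit_cocone[OF assms(1)]] and k' = is_coconeD[OF is_colimit_cocone[OF assms(2)]]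
  obtain g where g: "g \<in> Hom C Y' Y" "\<And>\<alpha>. \<alpha> < \<Lambda> \<Longrightarrow> g \<cdot> c' \<alpha> = c \<alpha>"
    using colimit_factor[OF assms(2) is_colimit_cocone[OF assms(1)]] by blast
  have "g \<cdot> h = Id C Y"
  proof (rule colimit_unique[OF assms(1,3) Comp_Hom[OF h(1) g(1)] Id_Hom[OF k(1)]])
    fix \<alpha> assume "\<alpha> < \<Lambda>"
    then show "g \<cdot> h \<cdot> c \<alpha> = Id C Y \<cdot> c \<alpha>"
      using Comp_assoc[OF k(2) h(1) g(1), of \<alpha>] h(2) g(2) Id_Comp[OF k(2)] by simp
  qed
  moreover have "h \<cdot> g = Id C Y'"
  proof (rule colimit_unique[OF assms(2,3) Comp_Hom[OF g(1) h(1)] Id_Hom[OF k'(1)]])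
    fix \<alpha> assume "\<alpha> < \<Lambda>"
    then show "h \<cdot> g \<cdot> c' \<alpha> = Id C Y' \<cdot> c' \<alpha>"
      using Comp_assoc[OF k'(2) g(1) h(1), of \<alpha>] h(2) g(2) Id_Comp[OF k'(2)] by simp
  qed
  ultimately show ?thesis by (intro iso_betweenI[OF h(1) g(1)])
qed

lemma direct_system_mono:
  "direct_system C \<Lambda> X i \<Longrightarrow> \<Lambda>' \<le> \<Lambda> \<Longrightarrow> direct_system C \<Lambda>' X i"
  unfolding direct_system_def by (meson order_less_le_trans)

lemma direct_system_cocone:
  fixes \<Lambda> :: 'u
  assumes "direct_system C \<Lambda> X i" "\<gamma> < \<Lambda>" "\<Lambda>' \<le> ord_succ \<gamma>"
  shows "is_cocone C \<Lambda>' X i (X \<gamma>) (\<lambda>\<alpha>. i \<alpha> \<gamma>)"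
proof -
  have "\<beta> \<le> \<gamma>" if "\<beta> < \<Lambda>'" for \<beta>
    using less_le_trans[OF that assms(3)] by simp
  then show ?thesis
    using direct_systemD[OF assms(1)] assms(2) unfolding is_cocone_def by blast
qed

text \<open>The comparison isomorphism at a limit stage is absorbed by transporting the colimit
  along it, so that \<open>X \<gamma>\<close> with its own transition maps becomes the
  colimit.\<close>

lemma lambda_sequence_iff:
  fixes \<Lambda> :: 'u
  shows "lambda_sequence C \<Lambda> X i \<longleftrightarrow> direct_system C \<Lambda> X i \<and>
    (\<forall>\<gamma><\<Lambda>. limit_ordinal \<gamma> \<longrightarrow> is_colimit C \<gamma> X i (X \<gamma>) (\<lambda>\<alpha>. i \<alpha> \<gamma>))"
proof (intro iffI conjI allI impI)
  assume s: "lambda_sequence C \<Lambda> X i"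
  then show d: "direct_system C \<Lambda> X i" by (simp add: lambda_sequence_def)
  fix \<gamma> assume \<gamma>: "\<gamma> < \<Lambda>" "limit_ordinal \<gamma>"
  then obtain Y c h where h: "is_colimit C \<gamma> X i Y c" "iso_between C h Y (X \<gamma>)"
    "\<And>\<alpha>. \<alpha> < \<gamma> \<Longrightarrow> h \<cdot> c \<alpha> = i \<alpha> \<gamma>"
    using s unfolding lambda_sequence_def by blast
  have "is_colimit C \<gamma> X i (X \<gamma>) (\<lambda>\<alpha>. h \<cdot> c \<alpha>)"
    using colimit_iso[OF h(1) direct_system_mono[OF d] h(2)] \<gamma>(1) by simp
  then show "is_colimit C \<gamma> X i (X \<gamma>) (\<lambda>\<alpha>. i \<alpha> \<gamma>)"
    using is_colimit_cong[of \<gamma> X X i i "\<lambda>\<alpha>. h \<cdot> c \<alpha>" "\<lambda>\<alpha>. i \<alpha> \<gamma>"] h(3) by simp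
next
  assume *: "direct_system C \<Lambda> X i \<and> (\<forall>\<gamma><\<Lambda>. limit_ordinal \<gamma> \<longrightarrow> is_colimit C \<gamma> X i (X \<gamma>) (\<lambda>\<alpha>. i \<alpha> \<gamma>))"
  have "\<exists>Y c h. is_colimit C \<gamma> X i Y c \<and> iso_between C h Y (X \<gamma>) \<and> (\<forall>\<alpha><\<gamma>. h \<cdot> c \<alpha> = i \<alpha> \<gamma>)"
    if \<gamma>: "\<gamma> < \<Lambda>" "limit_ordinal \<gamma>" for \<gamma>
  proof (intro exI conjI allI impI)
    show "is_colimit C \<gamma> X i (X \<gamma>) (\<lambda>\<alpha>. i \<alpha> \<gamma>)" using * \<gamma> by blast
    show "iso_between C (Id C (X \<gamma>)) (X \<gamma>) (X \<gamma>)"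
      using * \<gamma> direct_systemD(1) iso_between_Id by blast
    fix \<alpha> assume "\<alpha> < \<gamma>"
    then show "Id C (X \<gamma>) \<cdot> i \<alpha> \<gamma> = i \<alpha> \<gamma>"
      using * \<gamma> direct_systemD(3)[of \<Lambda> X i \<gamma> \<alpha>] by (intro Id_Comp[of _ "X \<alpha>"]) simp
  qed
  then show "lambda_sequence C \<Lambda> X i" using * unfolding lambda_sequence_def by blast
qed

lemma lambda_sequence_mono:
  "lambda_sequence C (\<Lambda>::'u) X i \<Longrightarrow> \<Lambda>' \<le> \<Lambda> \<Longrightarrow> lambda_sequence C \<Lambda>' X i"
  unfolding lambda_sequence_iff using direct_system_mono by (meson order_less_le_trans)

lemma steps_in_mono: "steps_in \<Lambda> i M \<Longrightarrow> \<Lambda>' \<le> \<Lambda> \<Longrightarrow> steps_in \<Lambda>' i M"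
  unfolding steps_in_def by (meson order_less_le_trans)

lemma steps_in_subset: "steps_in \<Lambda> i M \<Longrightarrow> M \<subseteq> M' \<Longrightarrow> steps_in \<Lambda> i M'"
  unfolding steps_in_def by blast

lemma transfinite_composition_subset:
  "transfinite_composition U C M f \<Longrightarrow> M \<subseteq> M' \<Longrightarrow> transfinite_composition U C M' f"
  unfolding transfinite_composition_def using steps_in_subset by blast

text \<open>A last index is terminal, so a cocone is determined by its component there.\<close>

lemma colimit_succ:
  fixes \<Theta> :: 'u
  assumes "direct_system C (ord_succ \<Theta>) X i"
  shows "is_colimit C (ord_succ \<Theta>) X i (X \<Theta>) (\<lambda>\<alpha>. i \<alpha> \<Theta>)"
proof -
  note d = direct_systemD[OF assms]
  show ?thesis
  proof (rule colimitI)
    show "is_cocone C (ord_succ \<Theta>) X i (X \<Theta>) (\<lambda>\<alpha>. i \<alpha> \<Theta>)"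
      using direct_system_cocone[OF assms] by simp
  next
    fix Y' c' assume "is_cocone C (ord_succ \<Theta>) X i Y' c'"
    from is_coconeD[OF this] show "\<exists>u\<in>Hom C (X \<Theta>) Y'. \<forall>\<alpha><ord_succ \<Theta>. u \<cdot> i \<alpha> \<Theta> = c' \<alpha>"
      by (intro bexI[of _ "c' \<Theta>"]) simp_all
  next
    fix Y' u v assume uv: "u \<in> Hom C (X \<Theta>) Y'" "v \<in> Hom C (X \<Theta>) Y'"
      "\<And>\<alpha>. \<alpha> < ord_succ \<Theta> \<Longrightarrow> u \<cdot> i \<alpha> \<Theta> = v \<cdot> i \<alpha> \<Theta>"
    from uv(3)[of \<Theta>] show "u = v" using d(2)[of \<Theta>] Comp_Id[OF uv(1)] Comp_Id[OF uv(2)] by simp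
  qed
qed

text \<open>The chain consists of the objects \<open>X \<alpha>\<close> for \<open>\<alpha> \<le> \<Theta>\<close>.\<close>

definition chain :: "'m set \<Rightarrow> 'u \<Rightarrow> ('u \<Rightarrow> 'o) \<Rightarrow> ('u \<Rightarrow> 'u \<Rightarrow> 'm) \<Rightarrow> bool" where
  "chain M \<Theta> X i \<longleftrightarrow> lambda_sequence C (ord_succ \<Theta>) X i \<and> steps_in (ord_succ \<Theta>) i M"

lemma chainD:
  assumes "chain M \<Theta> X i"
  shows "\<alpha> \<le> \<Theta> \<Longrightarrow> X \<alpha> \<in> Obj C" "\<alpha> \<le> \<Theta> \<Longrightarrow> i \<alpha> \<alpha> = Id C (X \<alpha>)"
    "\<beta> \<le> \<Theta> \<Longrightarrow> \<alpha> \<le> \<beta> \<Longrightarrow> i \<alpha> \<beta> \<in> Hom C (X \<alpha>) (X \<beta>)"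
    "\<gamma> \<le> \<Theta> \<Longrightarrow> \<beta> \<le> \<gamma> \<Longrightarrow> \<alpha> \<le> \<beta> \<Longrightarrow> i \<beta> \<gamma> \<cdot> i \<alpha> \<beta> = i \<alpha> \<gamma>"
    "\<alpha> < \<Theta> \<Longrightarrow> i \<alpha> (ord_succ \<alpha>) \<in> M"
    "\<gamma> \<le> \<Theta> \<Longrightarrow> limit_ordinal \<gamma> \<Longrightarrow> is_colimit C \<gamma> X i (X \<gamma>) (\<lambda>\<alpha>. i \<alpha> \<gamma>)"
    "direct_system C (ord_succ \<Theta>) X i"
  using assms unfolding chain_def lambda_sequence_iff direct_system_def steps_in_def by simp_all

lemma transfinite_composition_if_chain:
  assumes "chain M \<Theta> X i"
  shows "transfinite_composition U C M (i ord_zero \<Theta>)"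
  unfolding transfinite_composition_def
  using assms colimit_succ[OF chainD(7)[OF assms]] unfolding chain_def
  by (intro exI[of _ "ord_succ \<Theta>"] exI[of _ X] exI[of _ i] exI[of _ "X \<Theta>"] exI[of _ "\<lambda>\<alpha>. i \<alpha> \<Theta>"]) simp

definition extend_transitions :: "'u \<Rightarrow> 'o \<Rightarrow> ('u \<Rightarrow> 'm) \<Rightarrow> ('u \<Rightarrow> 'u \<Rightarrow> 'm) \<Rightarrow> 'u \<Rightarrow> 'u \<Rightarrow> 'm" where
  "extend_transitions \<Lambda> Y c i \<alpha> \<beta> = (if \<beta> = \<Lambda> then if \<alpha> = \<Lambda> then Id C Y else c \<alpha> else i \<alpha> \<beta>)"

text \<open>The only new continuity condition is the one at \<Lambda>, and it concerns limit
  ordinals alone; at any other length an arbitrary cocone can be appended.\<close>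

lemma lambda_sequence_extend:
  fixes \<Lambda> :: 'u
  assumes s: "lambda_sequence C \<Lambda> X i" and k: "is_cocone C \<Lambda> X i Y c"
    and col: "limit_ordinal \<Lambda> \<Longrightarrow> is_colimit C \<Lambda> X i Y c"
  shows "lambda_sequence C (ord_succ \<Lambda>) (X(\<Lambda> := Y)) (extend_transitions \<Lambda> Y c i)"
proof -
  let ?X = "X(\<Lambda> := Y)" and ?i = "extend_transitions \<Lambda> Y c i"
  have ds: "direct_system C \<Lambda> X i" using s by (simp add: lambda_sequence_iff)
  note d = direct_systemD[OF ds] and kt = is_coconeD[OF k]
  have eq: "?X \<alpha> = X \<alpha>" "\<alpha> \<le> \<beta> \<Longrightarrow> ?i \<alpha> \<beta> = i \<alpha> \<beta>" if "\<beta> < \<Lambda>" "\<alpha> \<le> \<beta>" for \<alpha> \<beta>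
    using that by (auto simp: extend_transitions_def)
  have eq\<Lambda>: "?X \<Lambda> = Y" "?i \<Lambda> \<Lambda> = Id C Y" "\<alpha> < \<Lambda> \<Longrightarrow> ?i \<alpha> \<Lambda> = c \<alpha>" for \<alpha>
    by (auto simp: extend_transitions_def)
  have "direct_system C (ord_succ \<Lambda>) ?X ?i"
    unfolding direct_system_def
  proof (intro conjI allI impI)
    fix \<alpha> assume "\<alpha> < ord_succ \<Lambda>"
    then consider "\<alpha> < \<Lambda>" | "\<alpha> = \<Lambda>" by (metis less_ord_succ_iff order.order_iff_strict)
    then show "?X \<alpha> \<in> Obj C" "?i \<alpha> \<alpha> = Id C (?X \<alpha>)"
      by (cases; force simp: extend_transitions_def kt(1) d(1,2))+
  next
    fix \<beta> \<alpha> assume "\<beta> < ord_succ \<Lambda>" "\<alpha> \<le> \<beta>"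
    then consider "\<beta> < \<Lambda>" "\<alpha> \<le> \<beta>" | "\<beta> = \<Lambda>" "\<alpha> < \<Lambda>" | "\<alpha> = \<Lambda>" "\<beta> = \<Lambda>"
      by (metis less_ord_succ_iff order.order_iff_strict)
    then show "?i \<alpha> \<beta> \<in> Hom C (?X \<alpha>) (?X \<beta>)"
    proof cases
      case 1 then show ?thesis using d(3) by (simp only: eq order.refl)
    next
      case 2 then show ?thesis using kt(2) eq(1)[OF 2(2) order.refl] by (simp only: eq\<Lambda>)
    next
      case 3 then show ?thesis using Id_Hom kt(1) by (simp only: eq\<Lambda>)
    qed
  next
    fix \<gamma> \<beta> \<alpha> assume *: "\<gamma> < ord_succ \<Lambda>" "\<beta> \<le> \<gamma>" "\<alpha> \<le> \<beta>"
    then consider "\<gamma> < \<Lambda>" | "\<gamma> = \<Lambda>" "\<beta> < \<Lambda>" | "\<beta> = \<Lambda>" "\<gamma> = \<Lambda>" "\<alpha> < \<Lambda>" | "\<beta> = \<Lambda>" "\<gamma> = \<Lambda>" "\<alpha> = \<Lambda>"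
      by (metis less_ord_succ_iff order.order_iff_strict)
    then show "?i \<beta> \<gamma> \<cdot> ?i \<alpha> \<beta> = ?i \<alpha> \<gamma>"
    proof cases
      case 1
      then have "\<beta> < \<Lambda>" using * by auto
      then show ?thesis using d(4)[OF 1 *(2,3)] * eq(2)[OF 1] eq(2)[OF \<open>\<beta> < \<Lambda>\<close>] by auto
    next
      case 2
      then have "\<alpha> < \<Lambda>" using *(3) by simp
      then show ?thesis
        using kt(3)[OF 2(2) *(3)] eq(2)[OF 2(2) *(3) *(3)] 2 by (simp only: eq\<Lambda>)
    next
      case 3 then show ?thesis using Id_Comp[OF kt(2)] by (simp add: eq\<Lambda>)
    next
      case 4 then show ?thesis using Id_Comp[OF Id_Hom[OF kt(1)]] by (simp add: eq\<Lambda>)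
    qed
  qed
  moreover have "is_colimit C \<gamma> ?X ?i (?X \<gamma>) (\<lambda>\<alpha>. ?i \<alpha> \<gamma>)" if \<gamma>: "\<gamma> < ord_succ \<Lambda>" "limit_ordinal \<gamma>" for \<gamma>
  proof (cases "\<gamma> = \<Lambda>")
    case True
    have "is_colimit C \<Lambda> ?X ?i Y (\<lambda>\<alpha>. ?i \<alpha> \<Lambda>) \<longleftrightarrow> is_colimit C \<Lambda> X i Y c"
      by (rule is_colimit_cong) (auto simp: extend_transitions_def)
    then show ?thesis using col \<gamma> True by simp
  next
    case False
    then have "\<gamma> < \<Lambda>" using \<gamma>(1) by (simp add: order.order_iff_strict)
    then have "is_colimit C \<gamma> ?X ?i (X \<gamma>) (\<lambda>\<alpha>. ?i \<alpha> \<gamma>) \<longleftrightarrow> is_colimit C \<gamma> X i (X \<gamma>) (\<lambda>\<alpha>. i \<alpha> \<gamma>)"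
      by (intro is_colimit_cong) (auto simp: extend_transitions_def)
    then show ?thesis using s \<gamma>(2) \<open>\<gamma> < \<Lambda>\<close> unfolding lambda_sequence_iff by auto
  qed
  ultimately show ?thesis unfolding lambda_sequence_iff by blast
qed

section \<open>Chains and transfinite compositions\<close>

lemma chain_trivial:
  assumes "A \<in> Obj C"
  shows "chain M ord_zero (\<lambda>_. A) (\<lambda>_ _. Id C A)"
proof -
  have "\<not> limit_ordinal \<gamma>" if "\<gamma> < ord_succ (ord_zero :: 'u)" for \<gamma>
    using that by auto
  moreover have "direct_system C (ord_succ (ord_zero :: 'u)) (\<lambda>_. A) (\<lambda>_ _. Id C A)"
    unfolding direct_system_def using Id_Hom[OF assms] Id_Comp[OF Id_Hom[OF assms]] assms by simp
  moreover have "\<not> ord_succ \<alpha> < ord_succ (ord_zero :: 'u)" for \<alpha>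
    by (simp del: less_ord_succ_iff)
  ultimately show ?thesis
    unfolding chain_def lambda_sequence_iff steps_in_def by blast
qed

lemma chain_succ:
  assumes ch: "chain M \<Theta> X i" and m: "m \<in> M" "m \<in> Hom C (X \<Theta>) Y"
  obtains X' i' where "chain M (ord_succ \<Theta>) X' i'" "X' (ord_succ \<Theta>) = Y"
    "\<And>\<alpha>. \<alpha> \<le> \<Theta> \<Longrightarrow> X' \<alpha> = X \<alpha>" "\<And>\<alpha>. \<alpha> \<le> \<Theta> \<Longrightarrow> i' \<alpha> (ord_succ \<Theta>) = m \<cdot> i \<alpha> \<Theta>"
proof -
  let ?\<Lambda> = "ord_succ \<Theta>" and ?c = "\<lambda>\<alpha>. m \<cdot> i \<alpha> \<Theta>"
  let ?X = "X(?\<Lambda> := Y)" and ?i = "extend_transitions ?\<Lambda> Y ?c i"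
  note c = chainD[OF ch]
  have s: "lambda_sequence C ?\<Lambda> X i" "steps_in ?\<Lambda> i M" using ch by (auto simp: chain_def)
  have k: "is_cocone C ?\<Lambda> X i Y ?c"
    using cocone_Comp[OF direct_system_cocone[OF c(7)] c(7) m(2)] by simp
  have "lambda_sequence C (ord_succ ?\<Lambda>) ?X ?i"
    using lambda_sequence_extend[OF s(1) k] by simp
  moreover have "?i \<alpha> (ord_succ \<alpha>) \<in> M" if "ord_succ \<alpha> < ord_succ ?\<Lambda>" for \<alpha>
  proof (cases "\<alpha> = \<Theta>")
    case True
    moreover have "\<Theta> \<noteq> ord_succ \<Theta>" by (metis less_irrefl less_ord_succ)
    ultimately show ?thesis
      using m(1) c(2)[of \<Theta>] Comp_Id[OF m(2)] by (simp add: extend_transitions_def)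
  next
    case False
    then have "\<alpha> < \<Theta>" using that by simp
    then show ?thesis using c(5) False by (simp add: extend_transitions_def)
  qed
  ultimately have "chain M ?\<Lambda> ?X ?i" by (simp add: chain_def steps_in_def)
  moreover have "?X \<alpha> = X \<alpha>" "?i \<alpha> ?\<Lambda> = m \<cdot> i \<alpha> \<Theta>" if "\<alpha> \<le> \<Theta>" for \<alpha>
  proof -
    have "\<alpha> \<noteq> ?\<Lambda>" using that by (metis less_irrefl less_ord_succ_iff)
    then show "?X \<alpha> = X \<alpha>" "?i \<alpha> ?\<Lambda> = m \<cdot> i \<alpha> \<Theta>" by (auto simp: extend_transitions_def)
  qed
  ultimately show ?thesis by (intro that[of ?X ?i]) simp_all
qed

lemma transfinite_composition_single:
  assumes "m \<in> M" "m \<in> Hom C A B"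
  shows "transfinite_composition U C M m"
proof -
  obtain X' i' where c: "chain M (ord_succ ord_zero) X' i'"
    "i' ord_zero (ord_succ ord_zero) = m \<cdot> Id C A"
    using chain_succ[OF chain_trivial[OF HomD(4)[OF assms(2)]] assms] by (metis order.refl)
  then show ?thesis
    using transfinite_composition_if_chain[OF c(1)] Comp_Id[OF assms(2)] by simp
qed

lemma transfinite_compositionE:
  assumes "transfinite_composition U C M f" "f \<in> Hom C A B"
  obtains \<Lambda> :: 'u and X i c where "ord_zero < \<Lambda>" "lambda_sequence C \<Lambda> X i" "steps_in \<Lambda> i M"
    "is_colimit C \<Lambda> X i B c" "c ord_zero = f" "X ord_zero = A"
proof -
  obtain \<Lambda> :: 'u and X i Y c where *: "ord_zero < \<Lambda>" "lambda_sequence C \<Lambda> X i" "steps_in \<Lambda> i M"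
    "is_colimit C \<Lambda> X i Y c" "f = c ord_zero"
    using assms(1) unfolding transfinite_composition_def by blast
  have "f \<in> Hom C (X ord_zero) Y"
    using is_coconeD(2)[OF is_colimit_cocone[OF *(4)] *(1)] *(5) by simp
  then have "X ord_zero = A" "Y = B" using assms(2) by (auto simp: Hom_def)
  then show ?thesis using that * by blast
qed

lemma transfinite_composition_Arr:
  assumes "transfinite_composition U C M f"
  shows "f \<in> Arr C"
proof -
  obtain \<Lambda> :: 'u and X i Y c where *: "ord_zero < \<Lambda>" "is_colimit C \<Lambda> X i Y c" "f = c ord_zero"
    using assms unfolding transfinite_composition_def by blast
  then show ?thesis
    using is_coconeD(2)[OF is_colimit_cocone[OF *(2)] *(1)] by (simp add: Hom_def)
qed

lemma transfinite_composition_iso: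
  assumes "transfinite_composition U C M f" "iso_between C h (Cod C f) Y"
  shows "transfinite_composition U C M (h \<cdot> f)"
proof -
  have f: "f \<in> Hom C (Dom C f) (Cod C f)"
    using transfinite_composition_Arr[OF assms(1)] by (rule Arr_Hom)
  obtain \<Lambda> :: 'u and X i c where *: "ord_zero < \<Lambda>" "lambda_sequence C \<Lambda> X i" "steps_in \<Lambda> i M"
    "is_colimit C \<Lambda> X i (Cod C f) c" "c ord_zero = f"
    using assms(1) f by (rule transfinite_compositionE)
  have "is_colimit C \<Lambda> X i Y (\<lambda>\<alpha>. h \<cdot> c \<alpha>)"
    using colimit_iso[OF *(4) _ assms(2)] *(2) by (simp add: lambda_sequence_iff)
  then show ?thesis
    unfolding transfinite_composition_def using * by blast
qed

text \<open>A composition ends in a colimit outside its sequence, a chain contains its end. At a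
  limit length the colimit is appended. At a successor length the last object is already a colimit
  and is replaced by \<open>B\<close>. Length one leaves an isomorphism, which no chain of positive
  length need produce.\<close>

lemma chain_if_transfinite_composition:
  assumes tc: "transfinite_composition U C M f" and f: "f \<in> Hom C A B"
    and iso: "\<And>m h Y. m \<in> M \<Longrightarrow> iso_between C h (Cod C m) Y \<Longrightarrow> h \<cdot> m \<in> M"
  obtains "iso_between C f A B"
  | \<Theta> X i where "ord_zero < \<Theta>" "chain M \<Theta> X i" "X ord_zero = A" "X \<Theta> = B" "i ord_zero \<Theta> = f"
proof -
  obtain \<Lambda> :: 'u and X i c where *: "ord_zero < \<Lambda>" "lambda_sequence C \<Lambda> X i" "steps_in \<Lambda> i M"
    "is_colimit C \<Lambda> X i B c" "c ord_zero = f" "X ord_zero = A"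
    using tc f by (rule transfinite_compositionE)
  have ds: "direct_system C \<Lambda> X i" using *(2) by (simp add: lambda_sequence_iff)
  note k = is_coconeD[OF is_colimit_cocone[OF *(4)]] and d = direct_systemD[OF ds]
  show ?thesis
  proof (cases \<Lambda> rule: ordinal_cases)
    case zero then show ?thesis using *(1) by simp
  next
    case limit
    let ?X = "X(\<Lambda> := B)" and ?i = "extend_transitions \<Lambda> B c i"
    have "?i \<alpha> (ord_succ \<alpha>) \<in> M" if "\<alpha> < \<Lambda>" for \<alpha>
    proof -
      have "ord_succ \<alpha> < \<Lambda>" using limit that by (rule limit_ord_succ_less)
      then show ?thesis using *(3) by (auto simp: extend_transitions_def steps_in_def)
    qed
    then have "chain M \<Lambda> ?X ?i"
      using lambda_sequence_extend[OF *(2) is_colimit_cocone[OF *(4)] *(4)] unfolding chain_def steps_in_def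
      by simp
    moreover have "?X ord_zero = A" "?X \<Lambda> = B" "?i ord_zero \<Lambda> = f"
      using * by (auto simp: extend_transitions_def)
    ultimately show ?thesis using that(2)[OF *(1)] by blast
  next
    case (succ \<theta>)
    have \<theta>: "\<theta> < \<Lambda>" using succ by simp
    have "is_colimit C \<Lambda> X i (X \<theta>) (\<lambda>\<alpha>. i \<alpha> \<theta>)" using colimit_succ ds succ by blast
    then have h: "iso_between C (c \<theta>) (X \<theta>) B"
      using k(2)[OF \<theta>] k(3)[OF \<theta>] succ by (intro colimit_unique_iso[OF _ *(4) ds]) simp_all
    show ?thesis
    proof (cases "\<theta> = ord_zero")
      case True then show ?thesis using that(1) h * by simp
    next
      case False
      let ?X = "X(\<theta> := B)" and ?i = "extend_transitions \<theta> B c i"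
      have s: "lambda_sequence C \<theta> X i" using \<theta> by (intro lambda_sequence_mono[OF *(2)]) simp
      have kc: "is_cocone C \<theta> X i B c"
        using is_colimit_cocone[OF *(4)] order.strict_trans[OF _ \<theta>] unfolding is_cocone_def by simp
      have "is_colimit C \<theta> X i B c" if "limit_ordinal \<theta>"
      proof -
        have "is_colimit C \<theta> X i (X \<theta>) (\<lambda>\<alpha>. i \<alpha> \<theta>)" using *(2) \<theta> that by (simp add: lambda_sequence_iff)
        then have "is_colimit C \<theta> X i B (\<lambda>\<alpha>. c \<theta> \<cdot> i \<alpha> \<theta>)"
          using colimit_iso[OF _ _ h] s unfolding lambda_sequence_iff by simp
        moreover have "is_colimit C \<theta> X i B (\<lambda>\<alpha>. c \<theta> \<cdot> i \<alpha> \<theta>) \<longleftrightarrow> is_colimit C \<theta> X i B c"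
          using k(3)[OF \<theta>] by (intro is_colimit_cong) auto
        ultimately show ?thesis by simp
      qed
      then have "lambda_sequence C (ord_succ \<theta>) ?X ?i"
        using lambda_sequence_extend[OF s kc] by blast
      moreover have "?i \<alpha> (ord_succ \<alpha>) \<in> M" if "\<alpha> < \<theta>" for \<alpha>
      proof -
        have m: "i \<alpha> (ord_succ \<alpha>) \<in> M" using *(3) that succ by (simp add: steps_in_def)
        show ?thesis
        proof (cases "ord_succ \<alpha> = \<theta>")
          \<comment> \<open>Only the last step changes when its target is replaced by
            \<open>B\<close>: it is composed with the isomorphism \<open>c \<theta>\<close>, and
            \<open>iso\<close> keeps it in \<open>M\<close>.\<close>
          case True
          have "iso_between C (c \<theta>) (Cod C (i \<alpha> \<theta>)) B"
            using h d(3)[OF \<theta>, of \<alpha>] that by (simp add: Hom_def)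
          then have "c \<theta> \<cdot> i \<alpha> \<theta> \<in> M" using iso m True by blast
          then show ?thesis using True that less_imp_neq[OF that] k(3)[OF \<theta>, of \<alpha>] by (simp add: extend_transitions_def)
        next
          case False then show ?thesis using m by (simp add: extend_transitions_def)
        qed
      qed
      ultimately have "chain M \<theta> ?X ?i" unfolding chain_def steps_in_def by simp
      moreover have "ord_zero < \<theta>" using False by (simp add: ord_zero_less_iff)
      moreover have "?X ord_zero = A" "?X \<theta> = B" "?i ord_zero \<theta> = f"
        using * False by (auto simp: extend_transitions_def)
      ultimately show ?thesis using that(2) by blast
    qed
  qed
qed

section \<open>The right lifting property\<close>

definition has_rlp :: "'m \<Rightarrow> 'm \<Rightarrow> bool" where
  "has_rlp p f \<longleftrightarrow> (\<forall>g\<in>Hom C (Dom C f) (Dom C p). \<forall>h\<in>Hom C (Cod C f) (Cod C p). p \<cdot> g = h \<cdot> f \<longrightarrow>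
     (\<exists>l\<in>Hom C (Cod C f) (Dom C p). p \<cdot> l = h \<and> l \<cdot> f = g))"

lemma has_rlpD:
  assumes "has_rlp p f" "p \<in> Hom C E D" "f \<in> Hom C A B" "g \<in> Hom C A E" "h \<in> Hom C B D" "p \<cdot> g = h \<cdot> f"
  obtains l where "l \<in> Hom C B E" "p \<cdot> l = h" "l \<cdot> f = g"
proof -
  have "Dom C p = E" "Cod C p = D" "Dom C f = A" "Cod C f = B" using assms(2,3) by (auto simp: Hom_def)
  then show ?thesis using assms that unfolding has_rlp_def by blast
qed

text \<open>The square is restricted along the pushout and lifted against \<open>i\<close>; this
  lift and the given map on \<open>A'\<close> agree on \<open>A\<close> and glue to a map on the
  pushout.\<close>

lemma has_rlp_pushout:
  assumes "has_rlp p i" "p \<in> Hom C E D" "is_pushout C i g i' g'"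
  shows "has_rlp p i'"
proof -
  obtain A B A' B' where t: "i \<in> Hom C A B" "g \<in> Hom C A A'" "i' \<in> Hom C A' B'" "g' \<in> Hom C B B'"
    "g' \<cdot> i = i' \<cdot> g"
    using assms(3) by (rule pushoutE)
  have "\<exists>l\<in>Hom C B' E. p \<cdot> l = h \<and> l \<cdot> i' = a"
    if a: "a \<in> Hom C A' E" and h: "h \<in> Hom C B' D" and sq: "p \<cdot> a = h \<cdot> i'" for a h
  proof -
    have "p \<cdot> (a \<cdot> g) = (h \<cdot> g') \<cdot> i"
      using Comp_assoc[OF t(2) a assms(2)] sq Comp_assoc[OF t(2,3) h] Comp_assoc[OF t(1,4) h] t(5) by simp
    then obtain l where l: "l \<in> Hom C B E" "p \<cdot> l = h \<cdot> g'" "l \<cdot> i = a \<cdot> g"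
      using has_rlpD[OF assms(1,2) t(1) Comp_Hom[OF t(2) a] Comp_Hom[OF t(4) h]] by blast
    obtain u where u: "u \<in> Hom C B' E" "u \<cdot> g' = l" "u \<cdot> i' = a"
      using pushout_factor[OF assms(3) t(1,2,3) l(1) a l(3)] by blast
    have "p \<cdot> u = h"
    proof (rule pushout_unique[OF assms(3) t(3) Comp_Hom[OF u(1) assms(2)] h])
      show "p \<cdot> u \<cdot> g' = h \<cdot> g'" using Comp_assoc[OF t(4) u(1) assms(2)] u(2) l(2) by simp
      show "p \<cdot> u \<cdot> i' = h \<cdot> i'" using Comp_assoc[OF t(3) u(1) assms(2)] u(3) sq by simp
    qed
    then show ?thesis using u by blast
  qed
  moreover have "Dom C i' = A'" "Cod C i' = B'" "Dom C p = E" "Cod C p = D"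
    using t(3) assms(2) by (auto simp: Hom_def)
  ultimately show ?thesis unfolding has_rlp_def by simp
qed

text \<open>Lifts are chosen stage by stage, each extending all earlier ones. Compatibility turns
  the lifts below a limit into a cocone, so that the colimit itself provides the next lift, and
  finally the lift on \<open>B\<close>.\<close>

lemma has_rlp_transfinite_composition:
  assumes rlp: "\<And>m. m \<in> M \<Longrightarrow> has_rlp p m" and p: "p \<in> Hom C E D"
    and tc: "transfinite_composition U C M f"
  shows "has_rlp p f"
proof -
  define A B where "A = Dom C f" and "B = Cod C f"
  have f: "f \<in> Hom C A B"
    unfolding A_def B_def using transfinite_composition_Arr[OF tc] by (rule Arr_Hom)
  obtain \<Lambda> :: 'u and X i c where *: "ord_zero < \<Lambda>" "lambda_sequence C \<Lambda> X i" "steps_in \<Lambda> i M"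
    "is_colimit C \<Lambda> X i B c" "c ord_zero = f" "X ord_zero = A"
    using tc f by (rule transfinite_compositionE)
  have ds: "direct_system C \<Lambda> X i" using *(2) by (simp add: lambda_sequence_iff)
  note k = is_coconeD[OF is_colimit_cocone[OF *(4)]] and d = direct_systemD[OF ds]
  have "\<exists>u\<in>Hom C B E. p \<cdot> u = h \<and> u \<cdot> f = g"
    if g: "g \<in> Hom C A E" and h: "h \<in> Hom C B D" and sq: "p \<cdot> g = h \<cdot> f" for g h
  proof -
    \<comment> \<open>The condition at \<alpha> refers only to earlier values of \<open>l\<close>,
      as the recursion over the well-order demands; the guard makes indices outside the sequence
      harmless.\<close>
    let ?P = "\<lambda>l \<alpha> x. \<alpha> < \<Lambda> \<longrightarrow> x \<in> Hom C (X \<alpha>) E \<and> p \<cdot> x = h \<cdot> c \<alpha> \<and>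
      (\<forall>\<beta><\<alpha>. x \<cdot> i \<beta> \<alpha> = l \<beta>) \<and> (\<alpha> = ord_zero \<longrightarrow> x = g)"
    have "\<exists>l. \<forall>\<alpha>. ?P l \<alpha> (l \<alpha>)"
    proof (rule dependent_wellorder_choice)
      fix x \<alpha> and l l' :: "'u \<Rightarrow> 'm"
      assume "\<And>\<beta>. \<beta> < \<alpha> \<Longrightarrow> l \<beta> = l' \<beta>"
      then show "?P l \<alpha> x = ?P l' \<alpha> x" by simp
    next
      fix \<alpha> :: 'u and l
      assume IH: "\<And>\<beta>. \<beta> < \<alpha> \<Longrightarrow> ?P l \<beta> (l \<beta>)"
      show "\<exists>x. ?P l \<alpha> x"
      proof (cases "\<alpha> < \<Lambda>")
        case False then show ?thesis by blast
      next
        case \<alpha>: True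
        have IH': "l \<beta> \<in> Hom C (X \<beta>) E" "p \<cdot> l \<beta> = h \<cdot> c \<beta>" if "\<beta> < \<alpha>" for \<beta>
          using IH[OF that] \<alpha> that by auto
        have comp: "l \<beta> \<cdot> i \<gamma> \<beta> = l \<gamma>" if "\<beta> < \<alpha>" "\<gamma> \<le> \<beta>" for \<beta> \<gamma>
        proof (cases "\<gamma> = \<beta>")
          case True
          then show ?thesis using d(2)[of \<beta>] Comp_Id[OF IH'(1)[OF that(1)]] that(1) \<alpha> by simp
        next
          case False
          then show ?thesis using IH[OF that(1)] \<alpha> that by auto
        qed
        show ?thesis
        proof (cases \<alpha> rule: ordinal_cases)
          case zero
          then show ?thesis using g sq * by (intro exI[of _ g]) simp
        next
          case (succ \<delta>)
          then have \<delta>: "\<delta> < \<alpha>" by simp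
          note i\<delta> = d(3)[OF \<alpha> less_imp_le[OF \<delta>]]
          have hc: "h \<cdot> c \<alpha> \<in> Hom C (X \<alpha>) D" using k(2)[OF \<alpha>] h by (rule Comp_Hom)
          have "p \<cdot> l \<delta> = (h \<cdot> c \<alpha>) \<cdot> i \<delta> \<alpha>"
            using IH'(2)[OF \<delta>] Comp_assoc[OF i\<delta> k(2)[OF \<alpha>] h] k(3)[OF \<alpha>, of \<delta>] \<delta> by simp
          moreover have "i \<delta> \<alpha> \<in> M" using *(3) \<alpha> succ by (simp add: steps_in_def)
          ultimately obtain x where x: "x \<in> Hom C (X \<alpha>) E" "p \<cdot> x = h \<cdot> c \<alpha>" "x \<cdot> i \<delta> \<alpha> = l \<delta>"
            using has_rlpD[OF rlp p i\<delta> IH'(1)[OF \<delta>] hc] by blast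
          have "x \<cdot> i \<beta> \<alpha> = l \<beta>" if "\<beta> < \<alpha>" for \<beta>
          proof -
            have "\<beta> \<le> \<delta>" using that succ by simp
            then have "x \<cdot> i \<beta> \<alpha> = l \<delta> \<cdot> i \<beta> \<delta>"
              using d(4)[OF \<alpha>, of \<delta> \<beta>] Comp_assoc[OF d(3) i\<delta> x(1), of \<beta>] x(3) \<delta> \<alpha> by simp
            then show ?thesis using comp[OF \<delta> \<open>\<beta> \<le> \<delta>\<close>] by simp
          qed
          then show ?thesis using x succ by auto
        next
          case limit
          have "is_cocone C \<alpha> X i E l"
            using IH'(1) comp HomD(4)[OF p] unfolding is_cocone_def by blast
          moreover have col: "is_colimit C \<alpha> X i (X \<alpha>) (\<lambda>\<beta>. i \<beta> \<alpha>)"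
            using *(2) \<alpha> limit by (simp add: lambda_sequence_iff)
          ultimately obtain x where x: "x \<in> Hom C (X \<alpha>) E" "\<And>\<beta>. \<beta> < \<alpha> \<Longrightarrow> x \<cdot> i \<beta> \<alpha> = l \<beta>"
            using colimit_factor by blast
          have "p \<cdot> x = h \<cdot> c \<alpha>"
          proof (rule colimit_unique[OF col direct_system_mono[OF ds less_imp_le[OF \<alpha>]]
                Comp_Hom[OF x(1) p] Comp_Hom[OF k(2)[OF \<alpha>] h]])
            fix \<beta> assume \<beta>: "\<beta> < \<alpha>"
            note i\<beta> = d(3)[OF \<alpha> less_imp_le[OF \<beta>]]
            show "p \<cdot> x \<cdot> i \<beta> \<alpha> = h \<cdot> c \<alpha> \<cdot> i \<beta> \<alpha>"
              using Comp_assoc[OF i\<beta> x(1) p] x(2)[OF \<beta>] IH'(2)[OF \<beta>]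
                Comp_assoc[OF i\<beta> k(2)[OF \<alpha>] h] k(3)[OF \<alpha> less_imp_le[OF \<beta>]] by simp
          qed
          then show ?thesis using x limit by auto
        qed
      qed
    qed
    then obtain l where l: "\<And>\<alpha>. ?P l \<alpha> (l \<alpha>)" by blast
    have "l \<beta> \<cdot> i \<gamma> \<beta> = l \<gamma>" if "\<beta> < \<Lambda>" "\<gamma> \<le> \<beta>" for \<beta> \<gamma>
    proof (cases "\<gamma> = \<beta>")
      case True
      have "l \<beta> \<in> Hom C (X \<beta>) E" using l that(1) by blast
      then show ?thesis using d(2)[of \<beta>] Comp_Id that(1) True by simp
    next
      case False
      then show ?thesis using l[of \<beta>] that by auto
    qed
    then have "is_cocone C \<Lambda> X i E l"
      using l HomD(4)[OF p] unfolding is_cocone_def by blast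
    then obtain u where u: "u \<in> Hom C B E" "\<And>\<alpha>. \<alpha> < \<Lambda> \<Longrightarrow> u \<cdot> c \<alpha> = l \<alpha>"
      using colimit_factor[OF *(4)] by blast
    have "p \<cdot> u = h"
    proof (rule colimit_unique[OF *(4) ds Comp_Hom[OF u(1) p] h])
      fix \<alpha> assume "\<alpha> < \<Lambda>"
      then show "p \<cdot> u \<cdot> c \<alpha> = h \<cdot> c \<alpha>"
        using Comp_assoc[OF k(2)[OF \<open>\<alpha> < \<Lambda>\<close>] u(1) p] u(2) l by simp
    qed
    moreover have "u \<cdot> f = g" using u(2)[OF *(1)] *(5) l *(1) by auto
    ultimately show ?thesis using u(1) by blast
  qed
  then show ?thesis
    using p HomD(2,3)[OF p] unfolding has_rlp_def A_def B_def by auto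
qed

end

section \<open>Construction of sequences by recursion and by pushouts\<close>

context category_in_universe
begin

text \<open>
  \<open>Q\<close> constrains the step from \<open>X \<delta>\<close> to its successor in terms of the part of the chain
  constructed so far.
\<close>

lemma transfinite_construction:
  fixes Q :: "'u \<Rightarrow> ('u \<Rightarrow> 'o) \<Rightarrow> ('u \<Rightarrow> 'u \<Rightarrow> 'm) \<Rightarrow> ('u \<Rightarrow> 'm) \<Rightarrow> 'm \<Rightarrow> 'm \<Rightarrow> bool"
  assumes p0: "p0 \<in> Hom C A N"
    and colim: "\<And>(\<Lambda>::'u) X i. \<lbrakk>limit_ordinal \<Lambda>; lambda_sequence C \<Lambda> X i; steps_in \<Lambda> i M\<rbrakk>
      \<Longrightarrow> \<exists>Y c. is_colimit C \<Lambda> X i Y c"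
    and cong: "\<And>\<delta> X i p X' i' p' s t. \<lbrakk>\<And>\<alpha>. \<alpha> \<le> \<delta> \<Longrightarrow> X \<alpha> = X' \<alpha>;
        \<And>\<alpha> \<beta>. \<alpha> \<le> \<beta> \<Longrightarrow> \<beta> \<le> \<delta> \<Longrightarrow> i \<alpha> \<beta> = i' \<alpha> \<beta>; \<And>\<alpha>. \<alpha> \<le> \<delta> \<Longrightarrow> p \<alpha> = p' \<alpha>\<rbrakk>
      \<Longrightarrow> Q \<delta> X i p s t = Q \<delta> X' i' p' s t"
    and step: "\<And>\<delta> X i p. \<lbrakk>chain M \<delta> X i; is_cocone C (ord_succ \<delta>) X i N p; X ord_zero = A\<rbrakk>
      \<Longrightarrow> \<exists>Y. \<exists>s\<in>M \<inter> Hom C (X \<delta>) Y. \<exists>t\<in>Hom C Y N. t \<cdot> s = p \<delta> \<and> Q \<delta> X i p s t"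
  obtains X i p where "X ord_zero = A" "p ord_zero = p0" "\<And>\<Theta>. chain M \<Theta> X i"
    "\<And>\<Lambda>. is_cocone C \<Lambda> X i N p" "\<And>\<delta>. Q \<delta> X i p (i \<delta> (ord_succ \<delta>)) (p (ord_succ \<delta>))"
proof -
  have AN: "A \<in> Obj C" "N \<in> Obj C" using HomD[OF p0] by auto
  \<comment> \<open>One recursion has to produce objects and maps together. The value at a stage is
    therefore a triple: its object, the transition maps into it from all earlier stages, and its map
    to \<open>N\<close>. The three functions decode this.\<close>
  define X where "X F \<alpha> = fst (F \<alpha>)" for F :: "'u \<Rightarrow> 'o \<times> ('u \<Rightarrow> 'm) \<times> 'm" and \<alpha>
  define I where "I F \<alpha> \<beta> = fst (snd (F \<beta>)) \<alpha>" for F :: "'u \<Rightarrow> 'o \<times> ('u \<Rightarrow> 'm) \<times> 'm" and \<alpha> \<beta>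
  define p where "p F \<alpha> = snd (snd (F \<alpha>))" for F :: "'u \<Rightarrow> 'o \<times> ('u \<Rightarrow> 'm) \<times> 'm" and \<alpha>
  \<comment> \<open>The condition on the triple \<open>d\<close> refers to \<open>F\<close> below
    \<alpha> only; for the part \<open>Q\<close> this is guaranteed by \<open>cong\<close>. The
    clauses for zero, successors and limits exclude each other.\<close>
  define P where "P F \<alpha> d \<longleftrightarrow> (case d of (Y, j, q) \<Rightarrow>
     Y \<in> Obj C \<and> j \<alpha> = Id C Y \<and> q \<in> Hom C Y N \<and>
     (\<forall>\<beta><\<alpha>. j \<beta> \<in> Hom C (X F \<beta>) Y \<and> q \<cdot> j \<beta> = p F \<beta> \<and> (\<forall>\<gamma>\<le>\<beta>. j \<beta> \<cdot> I F \<gamma> \<beta> = j \<gamma>)) \<and>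
     (\<alpha> = ord_zero \<longrightarrow> Y = A \<and> q = p0) \<and>
     (\<forall>\<delta>. \<alpha> = ord_succ \<delta> \<longrightarrow> j \<delta> \<in> M \<and> Q \<delta> (X F) (I F) (p F) (j \<delta>) q) \<and>
     (limit_ordinal \<alpha> \<longrightarrow> is_colimit C \<alpha> (X F) (I F) Y j))" for F \<alpha> d
  have good: "X F \<alpha> \<in> Obj C" "I F \<alpha> \<alpha> = Id C (X F \<alpha>)" "p F \<alpha> \<in> Hom C (X F \<alpha>) N"
      "\<beta> < \<alpha> \<Longrightarrow> I F \<beta> \<alpha> \<in> Hom C (X F \<beta>) (X F \<alpha>)" "\<beta> < \<alpha> \<Longrightarrow> p F \<alpha> \<cdot> I F \<beta> \<alpha> = p F \<beta>"
      "\<beta> < \<alpha> \<Longrightarrow> \<gamma> \<le> \<beta> \<Longrightarrow> I F \<beta> \<alpha> \<cdot> I F \<gamma> \<beta> = I F \<gamma> \<alpha>"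
      "\<alpha> = ord_zero \<Longrightarrow> X F \<alpha> = A \<and> p F \<alpha> = p0"
      "\<alpha> = ord_succ \<delta> \<Longrightarrow> I F \<delta> \<alpha> \<in> M \<and> Q \<delta> (X F) (I F) (p F) (I F \<delta> \<alpha>) (p F \<alpha>)"
      "limit_ordinal \<alpha> \<Longrightarrow> is_colimit C \<alpha> (X F) (I F) (X F \<alpha>) (\<lambda>\<beta>. I F \<beta> \<alpha>)"
    if "P F \<alpha> (F \<alpha>)" for F \<alpha> \<beta> \<gamma> \<delta>
  proof -
    obtain Y j q where d: "F \<alpha> = (Y, j, q)" by (metis prod_cases3)
    have X: "X F \<alpha> = Y" and I: "\<And>\<beta>. I F \<beta> \<alpha> = j \<beta>" and q: "p F \<alpha> = q"
      using d by (simp_all add: X_def I_def p_def)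
    note that[unfolded P_def d prod.case]
    then show "X F \<alpha> \<in> Obj C" "I F \<alpha> \<alpha> = Id C (X F \<alpha>)" "p F \<alpha> \<in> Hom C (X F \<alpha>) N"
      "\<beta> < \<alpha> \<Longrightarrow> I F \<beta> \<alpha> \<in> Hom C (X F \<beta>) (X F \<alpha>)" "\<beta> < \<alpha> \<Longrightarrow> p F \<alpha> \<cdot> I F \<beta> \<alpha> = p F \<beta>"
      "\<beta> < \<alpha> \<Longrightarrow> \<gamma> \<le> \<beta> \<Longrightarrow> I F \<beta> \<alpha> \<cdot> I F \<gamma> \<beta> = I F \<gamma> \<alpha>"
      "\<alpha> = ord_zero \<Longrightarrow> X F \<alpha> = A \<and> p F \<alpha> = p0"
      "\<alpha> = ord_succ \<delta> \<Longrightarrow> I F \<delta> \<alpha> \<in> M \<and> Q \<delta> (X F) (I F) (p F) (I F \<delta> \<alpha>) (p F \<alpha>)"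
      "limit_ordinal \<alpha> \<Longrightarrow> is_colimit C \<alpha> (X F) (I F) (X F \<alpha>) (\<lambda>\<beta>. I F \<beta> \<alpha>)"
      unfolding X q I by blast+
  qed
  have sys: "lambda_sequence C \<Lambda> (X F) (I F)" "steps_in \<Lambda> (I F) M" "is_cocone C \<Lambda> (X F) (I F) N (p F)"
    if F: "\<And>\<alpha>. \<alpha> < \<Lambda> \<Longrightarrow> P F \<alpha> (F \<alpha>)" for F and \<Lambda> :: 'u
  proof -
    note g = good[OF F]
    have hom: "I F \<alpha> \<beta> \<in> Hom C (X F \<alpha>) (X F \<beta>)" if "\<beta> < \<Lambda>" "\<alpha> \<le> \<beta>" for \<alpha> \<beta>
    proof (cases "\<alpha> = \<beta>")
      case True then show ?thesis using g(1)[OF that(1)] g(2)[OF that(1)] Id_Hom by simp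
    next
      case False then show ?thesis using g(4)[OF that(1), of \<alpha>] that(2) by simp
    qed
    have comp: "I F \<beta> \<gamma> \<cdot> I F \<alpha> \<beta> = I F \<alpha> \<gamma>" if "\<gamma> < \<Lambda>" "\<beta> \<le> \<gamma>" "\<alpha> \<le> \<beta>" for \<alpha> \<beta> \<gamma>
    proof (cases "\<beta> = \<gamma>")
      case True
      then show ?thesis using g(2)[OF that(1)] Id_Comp[OF hom[OF that(1), of \<alpha>]] that by simp
    next
      case False
      then have "\<beta> < \<gamma>" using that(2) by simp
      then show ?thesis using g(6)[OF that(1) _ that(3)] by blast
    qed
    have "direct_system C \<Lambda> (X F) (I F)"
      unfolding direct_system_def using g(1,2) hom comp by blast
    then show "lambda_sequence C \<Lambda> (X F) (I F)"
      unfolding lambda_sequence_iff using g(9) by blast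
    show "steps_in \<Lambda> (I F) M" unfolding steps_in_def using g(8) by blast
    have "p F \<beta> \<cdot> I F \<alpha> \<beta> = p F \<alpha>" if "\<beta> < \<Lambda>" "\<alpha> \<le> \<beta>" for \<alpha> \<beta>
    proof (cases "\<alpha> = \<beta>")
      case True then show ?thesis using g(2)[OF that(1)] Comp_Id[OF g(3)[OF that(1)]] by simp
    next
      case False then show ?thesis using g(5)[OF that(1), of \<alpha>] that(2) by simp
    qed
    then show "is_cocone C \<Lambda> (X F) (I F) N (p F)"
      unfolding is_cocone_def using AN(2) g(3) by blast
  qed
  have "\<exists>F. \<forall>\<alpha>. P F \<alpha> (F \<alpha>)"
  proof (rule dependent_wellorder_choice)
    fix d :: "'o \<times> ('u \<Rightarrow> 'm) \<times> 'm" and \<alpha> and F G :: "'u \<Rightarrow> 'o \<times> ('u \<Rightarrow> 'm) \<times> 'm"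
    assume FG: "\<And>\<beta>. \<beta> < \<alpha> \<Longrightarrow> F \<beta> = G \<beta>"
    have eq: "X F \<beta> = X G \<beta>" "I F \<gamma> \<beta> = I G \<gamma> \<beta>" "p F \<beta> = p G \<beta>" if "\<beta> < \<alpha>" for \<beta> \<gamma>
      using FG[OF that] by (auto simp: X_def I_def p_def)
    obtain Y j q where d: "d = (Y, j, q)" by (metis prod_cases3)
    have 1: "is_colimit C \<alpha> (X F) (I F) Y j \<longleftrightarrow> is_colimit C \<alpha> (X G) (I G) Y j"
      using eq by (intro is_colimit_cong) auto
    have Q: "Q \<delta> (X F) (I F) (p F) (j \<delta>) q \<longleftrightarrow> Q \<delta> (X G) (I G) (p G) (j \<delta>) q" if "\<alpha> = ord_succ \<delta>" for \<delta>
      using eq that by (intro cong) auto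
    have below: "(j \<beta> \<in> Hom C (X F \<beta>) Y \<and> q \<cdot> j \<beta> = p F \<beta> \<and> (\<forall>\<gamma>\<le>\<beta>. j \<beta> \<cdot> I F \<gamma> \<beta> = j \<gamma>)) \<longleftrightarrow>
        (j \<beta> \<in> Hom C (X G \<beta>) Y \<and> q \<cdot> j \<beta> = p G \<beta> \<and> (\<forall>\<gamma>\<le>\<beta>. j \<beta> \<cdot> I G \<gamma> \<beta> = j \<gamma>))" if "\<beta> < \<alpha>" for \<beta>
      using eq[OF that] by simp
    have 2: "(\<forall>\<delta>. \<alpha> = ord_succ \<delta> \<longrightarrow> j \<delta> \<in> M \<and> Q \<delta> (X F) (I F) (p F) (j \<delta>) q) \<longleftrightarrow>
        (\<forall>\<delta>. \<alpha> = ord_succ \<delta> \<longrightarrow> j \<delta> \<in> M \<and> Q \<delta> (X G) (I G) (p G) (j \<delta>) q)"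
      using Q by simp
    have 3: "(\<forall>\<beta><\<alpha>. j \<beta> \<in> Hom C (X F \<beta>) Y \<and> q \<cdot> j \<beta> = p F \<beta> \<and> (\<forall>\<gamma>\<le>\<beta>. j \<beta> \<cdot> I F \<gamma> \<beta> = j \<gamma>)) \<longleftrightarrow>
        (\<forall>\<beta><\<alpha>. j \<beta> \<in> Hom C (X G \<beta>) Y \<and> q \<cdot> j \<beta> = p G \<beta> \<and> (\<forall>\<gamma>\<le>\<beta>. j \<beta> \<cdot> I G \<gamma> \<beta> = j \<gamma>))"
      using below by simp
    show "P F \<alpha> d = P G \<alpha> d"
      unfolding P_def d prod.case by (simp only: 1 2 3)
  next
    fix \<alpha> F assume IH: "\<And>\<beta>. \<beta> < \<alpha> \<Longrightarrow> P F \<beta> (F \<beta>)"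
    note s = sys[OF IH, of \<alpha>]
    show "\<exists>d. P F \<alpha> d"
    proof (cases \<alpha> rule: ordinal_cases)
      case zero
      then have "P F \<alpha> (A, (\<lambda>_. Id C A), p0)" using AN p0 by (simp add: P_def)
      then show ?thesis ..
    next
      case (succ \<delta>)
      have ch: "chain M \<delta> (X F) (I F)" using s(1,2) succ by (simp add: chain_def)
      have k: "is_cocone C (ord_succ \<delta>) (X F) (I F) N (p F)" using s(3) succ by simp
      have "X F ord_zero = A" using good(7)[OF IH, of ord_zero] succ by simp
      then obtain Y u t where ut: "u \<in> M" "u \<in> Hom C (X F \<delta>) Y" "t \<in> Hom C Y N" "t \<cdot> u = p F \<delta>"
        "Q \<delta> (X F) (I F) (p F) u t"
        using step[OF ch k] by blast
      note c = chainD[OF ch] and kt = is_coconeD[OF k]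
      define j where "j \<beta> = (if \<beta> = \<alpha> then Id C Y else u \<cdot> I F \<beta> \<delta>)" for \<beta>
      have j: "j \<beta> = u \<cdot> I F \<beta> \<delta>" if "\<beta> < \<alpha>" for \<beta> using that by (auto simp: j_def)
      have "j \<beta> \<in> Hom C (X F \<beta>) Y \<and> t \<cdot> j \<beta> = p F \<beta> \<and> (\<forall>\<gamma>\<le>\<beta>. j \<beta> \<cdot> I F \<gamma> \<beta> = j \<gamma>)"
        if \<beta>: "\<beta> < \<alpha>" for \<beta>
      proof (intro conjI allI impI)
        have b: "\<beta> \<le> \<delta>" using \<beta> succ by simp
        note i = c(3)[OF order.refl b]
        show "j \<beta> \<in> Hom C (X F \<beta>) Y" using i ut(2) unfolding j[OF \<beta>] by (rule Comp_Hom)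
        show "t \<cdot> j \<beta> = p F \<beta>"
          unfolding j[OF \<beta>] using Comp_assoc[OF i ut(2,3)] ut(4) kt(3)[of \<delta> \<beta>] b by simp
        fix \<gamma> assume g: "\<gamma> \<le> \<beta>"
        show "j \<beta> \<cdot> I F \<gamma> \<beta> = j \<gamma>"
          using Comp_assoc[OF c(3)[OF b g] i ut(2)] c(4)[OF order.refl b g]
          unfolding j[OF \<beta>] j[OF le_less_trans[OF g \<beta>]] by simp
      qed
      moreover have "j \<delta> = u" using j[of \<delta>] c(2)[of \<delta>] Comp_Id[OF ut(2)] succ by simp
      moreover have "j \<alpha> = Id C Y" by (simp add: j_def)
      ultimately have "P F \<alpha> (Y, j, t)"
        unfolding P_def prod.case using ut HomD[OF ut(2)] succ by auto
      then show ?thesis ..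
    next
      case limit
      obtain Y c where c: "is_colimit C \<alpha> (X F) (I F) Y c"
        using colim[OF limit s(1,2)] by blast
      \<comment> \<open>At a limit the map to \<open>N\<close> is not a choice: the maps constructed
        so far form a cocone.\<close>
      obtain t where t: "t \<in> Hom C Y N" "\<And>\<beta>. \<beta> < \<alpha> \<Longrightarrow> t \<cdot> c \<beta> = p F \<beta>"
        using colimit_factor[OF c s(3)] by blast
      note k = is_coconeD[OF is_colimit_cocone[OF c]]
      define j where "j \<beta> = (if \<beta> = \<alpha> then Id C Y else c \<beta>)" for \<beta>
      have j: "j \<beta> = c \<beta>" if "\<beta> < \<alpha>" for \<beta> using that by (auto simp: j_def)
      have "is_colimit C \<alpha> (X F) (I F) Y j \<longleftrightarrow> is_colimit C \<alpha> (X F) (I F) Y c"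
        using j by (intro is_colimit_cong) auto
      moreover have "j \<beta> \<in> Hom C (X F \<beta>) Y \<and> t \<cdot> j \<beta> = p F \<beta> \<and> (\<forall>\<gamma>\<le>\<beta>. j \<beta> \<cdot> I F \<gamma> \<beta> = j \<gamma>)"
        if \<beta>: "\<beta> < \<alpha>" for \<beta>
        using k(2,3)[OF \<beta>] t(2)[OF \<beta>] j[OF le_less_trans[OF _ \<beta>]] by simp
      moreover have "j \<alpha> = Id C Y" by (simp add: j_def)
      moreover have "\<alpha> \<noteq> ord_zero" "\<And>\<delta>. \<alpha> \<noteq> ord_succ \<delta>" using limit by auto
      ultimately have "P F \<alpha> (Y, j, t)"
        unfolding P_def prod.case using c t(1) k(1) by simp
      then show ?thesis ..
    qed
  qed
  then obtain F where F: "\<And>\<alpha>. P F \<alpha> (F \<alpha>)" by blast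
  show ?thesis
  proof
    show "X F ord_zero = A" "p F ord_zero = p0" using good(7)[OF F] by auto
    show "chain M \<Theta> (X F) (I F)" for \<Theta> unfolding chain_def using sys[OF F] by blast
    show "is_cocone C \<Lambda> (X F) (I F) N (p F)" for \<Lambda> using sys[OF F] by blast
    show "Q \<delta> (X F) (I F) (p F) (I F \<delta> (ord_succ \<delta>)) (p F (ord_succ \<delta>))" for \<delta>
      using good(8)[OF F] by blast
  qed
qed

text \<open>Each initial composition, from the start to stage \<alpha>, is pushed out along
  \<open>g\<close>. The transition maps between these pushouts are pushouts of the steps by
  cancellation, and pushouts commute with colimits. The hypothesis \<open>ex\<close> supplies the
  pushouts of the initial compositions, which are compositions of \<open>M\<close> and not
  themselves steps.\<close>

lemma pushout_transfinite_composition: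
  assumes tc: "transfinite_composition U C M f" and po: "is_pushout C f g f' g'"
    and ex: "\<And>k. \<lbrakk>transfinite_composition U C M k; Dom C k = Dom C f\<rbrakk> \<Longrightarrow> \<exists>k' g''. is_pushout C k g k' g''"
  shows "transfinite_composition U C (pushouts_of C M) f'"
proof -
  obtain A B A' B' where t: "f \<in> Hom C A B" "g \<in> Hom C A A'" "f' \<in> Hom C A' B'" "g' \<in> Hom C B B'"
    "g' \<cdot> f = f' \<cdot> g"
    using po by (rule pushoutE)
  have A': "A' \<in> Obj C" "A \<in> Obj C" using HomD[OF t(2)] by auto
  obtain \<Lambda> :: 'u and X i c where *: "ord_zero < \<Lambda>" "lambda_sequence C \<Lambda> X i" "steps_in \<Lambda> i M"
    "is_colimit C \<Lambda> X i B c" "c ord_zero = f" "X ord_zero = A"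
    using tc t(1) by (rule transfinite_compositionE)
  have ds: "direct_system C \<Lambda> X i" using *(2) by (simp add: lambda_sequence_iff)
  note d = direct_systemD[OF ds] and k = is_coconeD[OF is_colimit_cocone[OF *(4)]]
  \<comment> \<open>At index zero the trivial pushout is chosen, so that the new sequence starts at
    \<open>A'\<close> itself, with the identity as its leg.\<close>
  have "\<exists>F G. is_pushout C (i ord_zero \<alpha>) g F G \<and> (\<alpha> = ord_zero \<longrightarrow> F = Id C A' \<and> G = g)" if \<alpha>: "\<alpha> < \<Lambda>" for \<alpha>
  proof (cases "\<alpha> = ord_zero")
    case True
    have "is_pushout C (Id C A) g (Id C A') g"
    proof (rule pushoutI[OF Id_Hom t(2) Id_Hom t(2)])
      show "g \<cdot> Id C A = Id C A' \<cdot> g" using Id_Comp[OF t(2)] Comp_Id[OF t(2)] by simp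
    next
      fix Y a b assume ab: "a \<in> Hom C A Y" "b \<in> Hom C A' Y" "a \<cdot> Id C A = b \<cdot> g"
      then show "\<exists>u\<in>Hom C A' Y. u \<cdot> g = a \<and> u \<cdot> Id C A' = b"
        using Comp_Id[OF ab(1)] Comp_Id[OF ab(2)] by auto
    next
      fix Y u v assume "u \<in> Hom C A' Y" "v \<in> Hom C A' Y" "u \<cdot> Id C A' = v \<cdot> Id C A'"
      then show "u = v" using Comp_Id by simp
    qed (use A' in auto)
    then show ?thesis using True d(2)[OF \<alpha>] *(6) by auto
  next
    case False
    have "chain M \<alpha> X i"
      unfolding chain_def using lambda_sequence_mono[OF *(2)] steps_in_mono[OF *(3)] \<alpha> by simp
    then have "transfinite_composition U C M (i ord_zero \<alpha>)" by (rule transfinite_composition_if_chain)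
    moreover have "Dom C (i ord_zero \<alpha>) = Dom C f"
      using HomD(2)[OF d(3)[OF \<alpha> ord_zero_le]] HomD(2)[OF t(1)] *(6) by simp
    ultimately show ?thesis using ex False by blast
  qed
  then obtain F G where FG: "\<And>\<alpha>. \<alpha> < \<Lambda> \<Longrightarrow> is_pushout C (i ord_zero \<alpha>) g (F \<alpha>) (G \<alpha>)"
    and FG0: "F ord_zero = Id C A'" "G ord_zero = g"
    using *(1) by metis
  define X' where "X' \<alpha> = Cod C (F \<alpha>)" for \<alpha>
  have i0: "i ord_zero \<alpha> \<in> Hom C A (X \<alpha>)" if "\<alpha> < \<Lambda>" for \<alpha>
    using d(3)[OF that ord_zero_le] *(6) by simp
  have F: "F \<alpha> \<in> Hom C A' (X' \<alpha>)" and G: "G \<alpha> \<in> Hom C (X \<alpha>) (X' \<alpha>)"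
    and FGsq: "G \<alpha> \<cdot> i ord_zero \<alpha> = F \<alpha> \<cdot> g" if "\<alpha> < \<Lambda>" for \<alpha>
    using pushout_Hom[OF FG[OF that] i0[OF that] t(2)] by (auto simp: X'_def)
  have X'0: "X' ord_zero = A'" using FG0(1) A' by (simp add: X'_def Id_Arr)
  have factor: "\<exists>t\<in>Hom C (X' \<alpha>) W. t \<cdot> G \<alpha> = a \<and> t \<cdot> F \<alpha> = b"
    if "\<alpha> < \<Lambda>" "a \<in> Hom C (X \<alpha>) W" "b \<in> Hom C A' W" "a \<cdot> i ord_zero \<alpha> = b \<cdot> g" for \<alpha> W a b
    using pushout_factor[OF FG[OF that(1)] i0[OF that(1)] t(2) F[OF that(1)] that(2-4)] .
  have unique: "u = v" if "\<alpha> < \<Lambda>" "u \<in> Hom C (X' \<alpha>) W" "v \<in> Hom C (X' \<alpha>) W"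
    "u \<cdot> G \<alpha> = v \<cdot> G \<alpha>" "u \<cdot> F \<alpha> = v \<cdot> F \<alpha>" for \<alpha> W u v
    using pushout_unique[OF FG[OF that(1)] F[OF that(1)] that(2-5)] .
  define T where
    "T \<alpha> \<beta> = (SOME t. t \<in> Hom C (X' \<alpha>) (X' \<beta>) \<and> t \<cdot> G \<alpha> = G \<beta> \<cdot> i \<alpha> \<beta> \<and> t \<cdot> F \<alpha> = F \<beta>)"
    for \<alpha> \<beta>
  have T: "T \<alpha> \<beta> \<in> Hom C (X' \<alpha>) (X' \<beta>)" and TG: "T \<alpha> \<beta> \<cdot> G \<alpha> = G \<beta> \<cdot> i \<alpha> \<beta>"
    and TF: "T \<alpha> \<beta> \<cdot> F \<alpha> = F \<beta>"
    if "\<beta> < \<Lambda>" "\<alpha> \<le> \<beta>" for \<alpha> \<beta>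
  proof -
    have \<alpha>: "\<alpha> < \<Lambda>" using that by simp
    have "(G \<beta> \<cdot> i \<alpha> \<beta>) \<cdot> i ord_zero \<alpha> = F \<beta> \<cdot> g"
      using Comp_assoc[OF i0[OF \<alpha>] d(3)[OF that] G[OF that(1)]] d(4)[OF that ord_zero_le] FGsq[OF that(1)] by simp
    then have "\<exists>t. t \<in> Hom C (X' \<alpha>) (X' \<beta>) \<and> t \<cdot> G \<alpha> = G \<beta> \<cdot> i \<alpha> \<beta> \<and> t \<cdot> F \<alpha> = F \<beta>"
      using factor[OF \<alpha> Comp_Hom[OF d(3)[OF that] G[OF that(1)]] F[OF that(1)]] by blast
    from someI_ex[OF this] show "T \<alpha> \<beta> \<in> Hom C (X' \<alpha>) (X' \<beta>)" "T \<alpha> \<beta> \<cdot> G \<alpha> = G \<beta> \<cdot> i \<alpha> \<beta>"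
      "T \<alpha> \<beta> \<cdot> F \<alpha> = F \<beta>"
      unfolding T_def by blast+
  qed
  have X'Obj: "X' \<alpha> \<in> Obj C" if "\<alpha> < \<Lambda>" for \<alpha> using F[OF that] by (rule HomD)
  have ds': "direct_system C \<Lambda> X' T"
    unfolding direct_system_def
  proof (intro conjI allI impI)
    fix \<alpha> assume \<alpha>: "\<alpha> < \<Lambda>"
    show "X' \<alpha> \<in> Obj C" using X'Obj[OF \<alpha>] .
    show "T \<alpha> \<alpha> = Id C (X' \<alpha>)"
      using TG[OF \<alpha> order.refl] TF[OF \<alpha> order.refl] d(2)[OF \<alpha>] Comp_Id[OF G[OF \<alpha>]] Id_Comp[OF G[OF \<alpha>]]
        Id_Comp[OF F[OF \<alpha>]]
      by (intro unique[OF \<alpha> T[OF \<alpha> order.refl] Id_Hom[OF X'Obj[OF \<alpha>]]]) simp_all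
  next
    fix \<alpha> \<beta> assume "\<beta> < \<Lambda>" "\<alpha> \<le> \<beta>"
    then show "T \<alpha> \<beta> \<in> Hom C (X' \<alpha>) (X' \<beta>)" by (rule T)
  next
    fix \<gamma> \<beta> \<alpha> assume g: "\<gamma> < \<Lambda>" "\<beta> \<le> \<gamma>" "\<alpha> \<le> \<beta>"
    have b: "\<beta> < \<Lambda>" "\<alpha> < \<Lambda>" "\<alpha> \<le> \<gamma>" using g by auto
    note T1 = T[OF b(1) g(3)] and T2 = T[OF g(1,2)] and T3 = T[OF g(1) b(3)]
    show "T \<beta> \<gamma> \<cdot> T \<alpha> \<beta> = T \<alpha> \<gamma>"
    proof (rule unique[OF b(2) Comp_Hom[OF T1 T2] T3])
      show "T \<beta> \<gamma> \<cdot> T \<alpha> \<beta> \<cdot> G \<alpha> = T \<alpha> \<gamma> \<cdot> G \<alpha>"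
        using Comp_assoc[OF G[OF b(2)] T1 T2] TG[OF b(1) g(3)] Comp_assoc[OF d(3)[OF b(1) g(3)] G[OF b(1)] T2]
          TG[OF g(1,2)] Comp_assoc[OF d(3)[OF b(1) g(3)] d(3)[OF g(1,2)] G[OF g(1)]] d(4)[OF g] TG[OF g(1) b(3)]
        by simp
      show "T \<beta> \<gamma> \<cdot> T \<alpha> \<beta> \<cdot> F \<alpha> = T \<alpha> \<gamma> \<cdot> F \<alpha>"
        using Comp_assoc[OF F[OF b(2)] T1 T2] TF[OF b(1) g(3)] TF[OF g(1,2)] TF[OF g(1) b(3)] by simp
    qed
  qed
  \<comment> \<open>Pushouts commute with colimits. The statement covers both uses: continuity at
    limit stages, and the colimit \<open>B'\<close> of the whole sequence.\<close>
  have colim: "is_colimit C \<gamma> X' T W' s"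
    if \<gamma>: "ord_zero < \<gamma>" "\<gamma> \<le> \<Lambda>" and col: "is_colimit C \<gamma> X i W w"
      and pw: "is_pushout C (w ord_zero) g Fw Gw" and Fw: "Fw \<in> Hom C A' W'"
      and s: "\<And>\<alpha>. \<alpha> < \<gamma> \<Longrightarrow> s \<alpha> \<in> Hom C (X' \<alpha>) W' \<and> s \<alpha> \<cdot> G \<alpha> = Gw \<cdot> w \<alpha> \<and> s \<alpha> \<cdot> F \<alpha> = Fw"
    for \<gamma> W w Fw Gw W' s
  proof -
    note kw = is_coconeD[OF is_colimit_cocone[OF col]]
    have lt: "\<alpha> < \<Lambda>" if "\<alpha> < \<gamma>" for \<alpha> using that \<gamma>(2) by simp
    have w0: "w ord_zero \<in> Hom C A W" using kw(2)[OF \<gamma>(1)] *(6) by simp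
    have Gw: "Gw \<in> Hom C W W'" using pushout_Hom(2)[OF pw w0 t(2)] HomD(3)[OF Fw] by simp
    have W': "W' \<in> Obj C" using Fw by (rule HomD)
    have dsg: "direct_system C \<gamma> X i" using ds \<gamma>(2) by (rule direct_system_mono)
    show ?thesis
    proof (rule colimitI)
      have "s \<beta> \<cdot> T \<alpha> \<beta> = s \<alpha>" if b: "\<beta> < \<gamma>" "\<alpha> \<le> \<beta>" for \<alpha> \<beta>
      proof -
        have a: "\<alpha> < \<gamma>" using b by simp
        note Tb = T[OF lt[OF b(1)] b(2)]
        have sb: "s \<beta> \<in> Hom C (X' \<beta>) W'" and sa: "s \<alpha> \<in> Hom C (X' \<alpha>) W'" using s b(1) a by auto
        show ?thesis
        proof (rule unique[OF lt[OF a] Comp_Hom[OF Tb sb] sa])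
          show "s \<beta> \<cdot> T \<alpha> \<beta> \<cdot> G \<alpha> = s \<alpha> \<cdot> G \<alpha>"
            using Comp_assoc[OF G[OF lt[OF a]] Tb sb] TG[OF lt[OF b(1)] b(2)] s[OF a] s[OF b(1)]
              Comp_assoc[OF d(3)[OF lt[OF b(1)] b(2)] G[OF lt[OF b(1)]] sb]
              Comp_assoc[OF d(3)[OF lt[OF b(1)] b(2)] kw(2)[OF b(1)] Gw] kw(3)[OF b] by simp
          show "s \<beta> \<cdot> T \<alpha> \<beta> \<cdot> F \<alpha> = s \<alpha> \<cdot> F \<alpha>"
            using Comp_assoc[OF F[OF lt[OF a]] Tb sb] TF[OF lt[OF b(1)] b(2)] s[OF a] s[OF b(1)] by simp
        qed
      qed
      then show "is_cocone C \<gamma> X' T W' s" unfolding is_cocone_def using W' s by blast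
    next
      fix Y e assume e: "is_cocone C \<gamma> X' T Y e"
      note ke = is_coconeD[OF e]
      have "(e \<beta> \<cdot> G \<beta>) \<cdot> i \<alpha> \<beta> = e \<alpha> \<cdot> G \<alpha>" if b: "\<beta> < \<gamma>" "\<alpha> \<le> \<beta>" for \<alpha> \<beta>
      proof -
        have a: "\<alpha> < \<gamma>" using b by simp
        show ?thesis
          using Comp_assoc[OF d(3)[OF lt[OF b(1)] b(2)] G[OF lt[OF b(1)]] ke(2)[OF b(1)]] TG[OF lt[OF b(1)] b(2)]
            Comp_assoc[OF G[OF lt[OF a]] T[OF lt[OF b(1)] b(2)] ke(2)[OF b(1)]] ke(3)[OF b] by simp
      qed
      then have "is_cocone C \<gamma> X i Y (\<lambda>\<alpha>. e \<alpha> \<cdot> G \<alpha>)"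
        unfolding is_cocone_def using ke(1,2) G lt Comp_Hom by blast
      then obtain u where u: "u \<in> Hom C W Y" "\<And>\<alpha>. \<alpha> < \<gamma> \<Longrightarrow> u \<cdot> w \<alpha> = e \<alpha> \<cdot> G \<alpha>"
        using colimit_factor[OF col] by blast
      have e0: "e ord_zero \<in> Hom C A' Y" using ke(2)[OF \<gamma>(1)] X'0 by simp
      have "u \<cdot> w ord_zero = e ord_zero \<cdot> g" using u(2)[OF \<gamma>(1)] FG0(2) by simp
      then obtain v where v: "v \<in> Hom C W' Y" "v \<cdot> Gw = u" "v \<cdot> Fw = e ord_zero"
        using pushout_factor[OF pw w0 t(2) Fw u(1) e0] by blast
      have "v \<cdot> s \<alpha> = e \<alpha>" if a: "\<alpha> < \<gamma>" for \<alpha>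
      proof -
        have sa: "s \<alpha> \<in> Hom C (X' \<alpha>) W'" using s a by blast
        \<comment> \<open>The legs \<open>F \<alpha>\<close> are the transition maps from the start,
          so a cocone on the new sequence is automatically compatible with them.\<close>
        have "T ord_zero \<alpha> = F \<alpha>"
          using TF[OF lt[OF a] ord_zero_le] FG0(1) Comp_Id[OF T[OF lt[OF a] ord_zero_le]] X'0 by simp
        then have ea: "e \<alpha> \<cdot> F \<alpha> = e ord_zero" using ke(3)[OF a ord_zero_le] by simp
        show ?thesis
        proof (rule unique[OF lt[OF a] Comp_Hom[OF sa v(1)] ke(2)[OF a]])
          show "v \<cdot> s \<alpha> \<cdot> G \<alpha> = e \<alpha> \<cdot> G \<alpha>"
            using Comp_assoc[OF G[OF lt[OF a]] sa v(1)] s[OF a] Comp_assoc[OF kw(2)[OF a] Gw v(1)] v(2) u(2)[OF a]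
            by simp
          show "v \<cdot> s \<alpha> \<cdot> F \<alpha> = e \<alpha> \<cdot> F \<alpha>"
            using Comp_assoc[OF F[OF lt[OF a]] sa v(1)] s[OF a] v(3) ea by simp
        qed
      qed
      then show "\<exists>u\<in>Hom C W' Y. \<forall>\<alpha><\<gamma>. u \<cdot> s \<alpha> = e \<alpha>" using v(1) by blast
    next
      fix Y u v assume uv: "u \<in> Hom C W' Y" "v \<in> Hom C W' Y" "\<And>\<alpha>. \<alpha> < \<gamma> \<Longrightarrow> u \<cdot> s \<alpha> = v \<cdot> s \<alpha>"
      have "u \<cdot> Gw = v \<cdot> Gw"
      proof (rule colimit_unique[OF col dsg Comp_Hom[OF Gw uv(1)] Comp_Hom[OF Gw uv(2)]])
        fix \<alpha> assume a: "\<alpha> < \<gamma>"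
        have sa: "s \<alpha> \<in> Hom C (X' \<alpha>) W'" using s a by blast
        have "x \<cdot> Gw \<cdot> w \<alpha> = (x \<cdot> s \<alpha>) \<cdot> G \<alpha>" if "x \<in> Hom C W' Y" for x
          using Comp_assoc[OF kw(2)[OF a] Gw that] Comp_assoc[OF G[OF lt[OF a]] sa that] s[OF a] by simp
        then show "u \<cdot> Gw \<cdot> w \<alpha> = v \<cdot> Gw \<cdot> w \<alpha>" using uv(3)[OF a] uv(1,2) by simp
      qed
      moreover have "s ord_zero = Fw"
        using s[OF \<gamma>(1)] FG0(1) X'0 Comp_Id by metis
      ultimately show "u = v"
        using uv(3)[OF \<gamma>(1)] by (intro pushout_unique[OF pw Fw uv(1,2)]) simp_all
    qed
  qed
  have "lambda_sequence C \<Lambda> X' T"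
    unfolding lambda_sequence_iff
  proof (intro conjI allI impI)
    fix \<gamma> assume \<gamma>: "\<gamma> < \<Lambda>" "limit_ordinal \<gamma>"
    have col: "is_colimit C \<gamma> X i (X \<gamma>) (\<lambda>\<alpha>. i \<alpha> \<gamma>)" using *(2) \<gamma> by (simp add: lambda_sequence_iff)
    show "is_colimit C \<gamma> X' T (X' \<gamma>) (\<lambda>\<alpha>. T \<alpha> \<gamma>)"
      using T[OF \<gamma>(1)] TG[OF \<gamma>(1)] TF[OF \<gamma>(1)]
      by (intro colim[OF limit_ord_zero_less[OF \<gamma>(2)] less_imp_le[OF \<gamma>(1)] col FG[OF \<gamma>(1)] F[OF \<gamma>(1)]]) simp
  qed (rule ds')
  moreover have "steps_in \<Lambda> T (pushouts_of C M)"
    unfolding steps_in_def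
  proof (intro allI impI)
    fix \<alpha> assume \<alpha>: "ord_succ \<alpha> < \<Lambda>"
    have le: "\<alpha> \<le> ord_succ \<alpha>" by (simp add: less_imp_le)
    have a: "\<alpha> < \<Lambda>" using le \<alpha> by (rule le_less_trans)
    note step = d(3)[OF \<alpha> le]
    have eq: "i \<alpha> (ord_succ \<alpha>) \<cdot> i ord_zero \<alpha> = i ord_zero (ord_succ \<alpha>)"
      using d(4)[OF \<alpha> le ord_zero_le] .
    have "is_pushout C (i \<alpha> (ord_succ \<alpha>)) (G \<alpha>) (T \<alpha> (ord_succ \<alpha>)) (G (ord_succ \<alpha>))"
    proof (rule pushout_cancel[OF FG[OF a]])
      show "is_pushout C (i \<alpha> (ord_succ \<alpha>) \<cdot> i ord_zero \<alpha>) g (F (ord_succ \<alpha>)) (G (ord_succ \<alpha>))"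
        unfolding eq using FG[OF \<alpha>] .
      show "i \<alpha> (ord_succ \<alpha>) \<in> Hom C (Cod C (i ord_zero \<alpha>)) (X (ord_succ \<alpha>))"
        using step HomD(3)[OF i0[OF a]] by simp
      show "T \<alpha> (ord_succ \<alpha>) \<in> Hom C (Cod C (F \<alpha>)) (Cod C (F (ord_succ \<alpha>)))"
        using T[OF \<alpha> le] by (simp add: X'_def)
      show "T \<alpha> (ord_succ \<alpha>) \<cdot> F \<alpha> = F (ord_succ \<alpha>)"
        "T \<alpha> (ord_succ \<alpha>) \<cdot> G \<alpha> = G (ord_succ \<alpha>) \<cdot> i \<alpha> (ord_succ \<alpha>)"
        using TF[OF \<alpha> le] TG[OF \<alpha> le] by auto
    qed
    moreover have "i \<alpha> (ord_succ \<alpha>) \<in> M" using *(3) \<alpha> by (simp add: steps_in_def)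
    ultimately show "T \<alpha> (ord_succ \<alpha>) \<in> pushouts_of C M" unfolding pushouts_of_def by blast
  qed
  moreover have "\<exists>s. is_colimit C \<Lambda> X' T B' s \<and> f' = s ord_zero"
  proof -
    have "\<exists>t\<in>Hom C (X' \<alpha>) B'. t \<cdot> G \<alpha> = g' \<cdot> c \<alpha> \<and> t \<cdot> F \<alpha> = f'" if a: "\<alpha> < \<Lambda>" for \<alpha>
      using Comp_assoc[OF i0[OF a] k(2)[OF a] t(4)] k(3)[OF a ord_zero_le] *(5) t(5)
      by (intro factor[OF a Comp_Hom[OF k(2)[OF a] t(4)] t(3)]) simp
    then obtain s where s: "\<And>\<alpha>. \<alpha> < \<Lambda> \<Longrightarrow> s \<alpha> \<in> Hom C (X' \<alpha>) B' \<and> s \<alpha> \<cdot> G \<alpha> = g' \<cdot> c \<alpha> \<and> s \<alpha> \<cdot> F \<alpha> = f'"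
      by metis
    have "is_pushout C (c ord_zero) g f' g'" using po *(5) by simp
    then have "is_colimit C \<Lambda> X' T B' s"
      using s by (intro colim[OF *(1) order.refl *(4) _ t(3)])
    moreover have "s ord_zero = f'" using s[OF *(1)] FG0(1) X'0 Comp_Id by metis
    ultimately show ?thesis by blast
  qed
  ultimately show ?thesis
    unfolding transfinite_composition_def using *(1) by blast
qed

end

section \<open>Refinement of sequences\<close>

context category_in_universe
begin

text \<open>Every stage maps into a stage of the subsequence, so a cocone is determined by its
  values on the subsequence.\<close>

lemma colimit_cofinal:
  fixes \<gamma> K :: 'u
  assumes ds: "direct_system C (ord_succ \<gamma>) Z T"
    and col: "is_colimit C K (\<lambda>\<eta>. Z (s \<eta>)) (\<lambda>\<eta> \<eta>'. T (s \<eta>) (s \<eta>')) (Z \<gamma>) (\<lambda>\<eta>. T (s \<eta>) \<gamma>)"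
    and s: "\<And>\<eta>. \<eta> < K \<Longrightarrow> s \<eta> < \<gamma>" "\<And>\<eta> \<eta>'. \<eta>' < K \<Longrightarrow> \<eta> \<le> \<eta>' \<Longrightarrow> s \<eta> \<le> s \<eta>'"
    and cofinal: "\<And>\<beta>. \<beta> < \<gamma> \<Longrightarrow> \<exists>\<eta><K. \<beta> \<le> s \<eta>"
  shows "is_colimit C \<gamma> Z T (Z \<gamma>) (\<lambda>\<beta>. T \<beta> \<gamma>)"
proof -
  note d = direct_systemD[OF ds]
  have dK: "direct_system C K (\<lambda>\<eta>. Z (s \<eta>)) (\<lambda>\<eta> \<eta>'. T (s \<eta>) (s \<eta>'))"
    unfolding direct_system_def
  proof (intro conjI allI impI)
    fix \<alpha> assume "\<alpha> < K"
    then have "s \<alpha> < ord_succ \<gamma>" using s(1) by (simp add: less_imp_le)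
    then show "Z (s \<alpha>) \<in> Obj C" "T (s \<alpha>) (s \<alpha>) = Id C (Z (s \<alpha>))" using d(1,2) by auto
  next
    fix \<beta> \<alpha> assume "\<beta> < K" "\<alpha> \<le> \<beta>"
    then show "T (s \<alpha>) (s \<beta>) \<in> Hom C (Z (s \<alpha>)) (Z (s \<beta>))"
      using s by (intro d(3)) (simp_all add: less_imp_le)
  next
    fix \<gamma>' \<beta> \<alpha> assume "\<gamma>' < K" "\<beta> \<le> \<gamma>'" "\<alpha> \<le> \<beta>"
    then show "T (s \<beta>) (s \<gamma>') \<cdot> T (s \<alpha>) (s \<beta>) = T (s \<alpha>) (s \<gamma>')"
      using s by (intro d(4)) (simp_all add: less_imp_le)
  qed
  show ?thesis
  proof (rule colimitI)
    show "is_cocone C \<gamma> Z T (Z \<gamma>) (\<lambda>\<beta>. T \<beta> \<gamma>)"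
      using direct_system_cocone[OF ds, of \<gamma> \<gamma>] by (simp add: less_imp_le)
  next
    fix Y c assume c: "is_cocone C \<gamma> Z T Y c"
    note k = is_coconeD[OF c]
    have "is_cocone C K (\<lambda>\<eta>. Z (s \<eta>)) (\<lambda>\<eta> \<eta>'. T (s \<eta>) (s \<eta>')) Y (\<lambda>\<eta>. c (s \<eta>))"
      unfolding is_cocone_def using k s by blast
    then obtain u where u: "u \<in> Hom C (Z \<gamma>) Y" "\<And>\<eta>. \<eta> < K \<Longrightarrow> u \<cdot> T (s \<eta>) \<gamma> = c (s \<eta>)"
      using colimit_factor[OF col] by blast
    have "u \<cdot> T \<beta> \<gamma> = c \<beta>" if \<beta>: "\<beta> < \<gamma>" for \<beta>
    proof -
      obtain \<eta> where \<eta>: "\<eta> < K" "\<beta> \<le> s \<eta>" using cofinal[OF \<beta>] by blast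
      note ss = s(1)[OF \<eta>(1)]
      have t: "T \<beta> (s \<eta>) \<in> Hom C (Z \<beta>) (Z (s \<eta>))" "T (s \<eta>) \<gamma> \<in> Hom C (Z (s \<eta>)) (Z \<gamma>)"
        "T (s \<eta>) \<gamma> \<cdot> T \<beta> (s \<eta>) = T \<beta> \<gamma>"
        using d(3)[OF _ \<eta>(2)] d(3)[of \<gamma> "s \<eta>"] d(4)[of \<gamma> "s \<eta>" \<beta>] ss \<eta>(2) by (simp_all add: less_imp_le)
      show ?thesis
        using Comp_assoc[OF t(1,2) u(1)] t(3) u(2)[OF \<eta>(1)] k(3)[OF ss \<eta>(2)] by simp
    qed
    then show "\<exists>u\<in>Hom C (Z \<gamma>) Y. \<forall>\<alpha><\<gamma>. u \<cdot> T \<alpha> \<gamma> = c \<alpha>" using u(1) by blast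
  next
    fix Y u v assume uv: "u \<in> Hom C (Z \<gamma>) Y" "v \<in> Hom C (Z \<gamma>) Y" "\<And>\<alpha>. \<alpha> < \<gamma> \<Longrightarrow> u \<cdot> T \<alpha> \<gamma> = v \<cdot> T \<alpha> \<gamma>"
    show "u = v" using uv(3) s(1) by (intro colimit_unique[OF col dK uv(1,2)]) blast
  qed
qed

text \<open>
  The refined chain runs through the pairs \<open>(\<alpha>, \<xi>)\<close> with \<open>\<xi> < \<theta> \<alpha>\<close> in lexicographic order, where
  \<open>\<theta> \<Lambda> = 1\<close> provides the top element; the end \<open>X \<alpha> (\<theta> \<alpha>)\<close> of the inner chain at \<open>\<alpha>\<close> reappears as
  the start of the next one.
\<close>

lemma chain_refine:
  assumes outer: "chain N \<Lambda> P j"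
    and inner: "\<And>n. n \<in> N \<Longrightarrow>
      \<exists>\<Theta> X i. ord_zero < \<Theta> \<and> chain M \<Theta> X i \<and> X ord_zero = Dom C n \<and> X \<Theta> = Cod C n \<and> i ord_zero \<Theta> = n"
  obtains \<Theta> X i where "chain M \<Theta> X i" "X ord_zero = P ord_zero" "X \<Theta> = P \<Lambda>" "i ord_zero \<Theta> = j ord_zero \<Lambda>"
proof -
  note o = chainD[OF outer]
  \<comment> \<open>At the top index there is no step to refine. A block of length one stands in, of
    which only the start will occur; its single map is unrestricted, hence the weaker condition
    \<open>chain UNIV\<close> for all blocks and \<open>chain M\<close> only below
    \<Lambda>.\<close>
  have "\<exists>\<Theta> X i. ord_zero < \<Theta> \<and> chain UNIV \<Theta> X i \<and> X ord_zero = P \<alpha> \<and>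
      (\<alpha> < \<Lambda> \<longrightarrow> chain M \<Theta> X i \<and> X \<Theta> = P (ord_succ \<alpha>) \<and> i ord_zero \<Theta> = j \<alpha> (ord_succ \<alpha>)) \<and>
      (\<alpha> = \<Lambda> \<longrightarrow> \<Theta> = ord_succ ord_zero)"
    if \<alpha>: "\<alpha> \<le> \<Lambda>" for \<alpha>
  proof (cases "\<alpha> = \<Lambda>")
    case True
    have P: "P \<Lambda> \<in> Obj C" using o(1)[of \<Lambda>] by simp
    obtain X i where "chain UNIV (ord_succ ord_zero) X i" "X ord_zero = P \<Lambda>"
      using chain_succ[OF chain_trivial[OF P] UNIV_I Id_Hom[OF P]] by (metis order.refl)
    then show ?thesis using True by (intro exI[of _ "ord_succ ord_zero"] exI[of _ X] exI[of _ i]) simp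
  next
    case False
    then have \<alpha>: "\<alpha> < \<Lambda>" using \<alpha> by simp
    have "j \<alpha> (ord_succ \<alpha>) \<in> Hom C (P \<alpha>) (P (ord_succ \<alpha>))"
      using o(3)[of "ord_succ \<alpha>" \<alpha>] \<alpha> by (simp add: less_imp_le)
    then obtain \<Theta> X i where "ord_zero < \<Theta>" "chain M \<Theta> X i" "X ord_zero = P \<alpha>" "X \<Theta> = P (ord_succ \<alpha>)"
      "i ord_zero \<Theta> = j \<alpha> (ord_succ \<alpha>)"
      using inner[OF o(5)[OF \<alpha>]] by (auto simp: Hom_def)
    moreover then have "chain UNIV \<Theta> X i" unfolding chain_def using steps_in_subset by blast
    ultimately show ?thesis using \<alpha> by blast
  qed
  then have "\<forall>\<alpha>. \<exists>\<Theta> X i. \<alpha> \<le> \<Lambda> \<longrightarrow> ord_zero < \<Theta> \<and> chain UNIV \<Theta> X i \<and> X ord_zero = P \<alpha> \<and>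
      (\<alpha> < \<Lambda> \<longrightarrow> chain M \<Theta> X i \<and> X \<Theta> = P (ord_succ \<alpha>) \<and> i ord_zero \<Theta> = j \<alpha> (ord_succ \<alpha>)) \<and>
      (\<alpha> = \<Lambda> \<longrightarrow> \<Theta> = ord_succ ord_zero)"
    by blast
  then obtain \<theta> X i where *: "\<And>\<alpha>. \<alpha> \<le> \<Lambda> \<longrightarrow> ord_zero < \<theta> \<alpha> \<and> chain UNIV (\<theta> \<alpha>) (X \<alpha>) (i \<alpha>) \<and> X \<alpha> ord_zero = P \<alpha> \<and>
      (\<alpha> < \<Lambda> \<longrightarrow> chain M (\<theta> \<alpha>) (X \<alpha>) (i \<alpha>) \<and> X \<alpha> (\<theta> \<alpha>) = P (ord_succ \<alpha>) \<and>
        i \<alpha> ord_zero (\<theta> \<alpha>) = j \<alpha> (ord_succ \<alpha>)) \<and>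
      (\<alpha> = \<Lambda> \<longrightarrow> \<theta> \<alpha> = ord_succ ord_zero)"
    unfolding choice_iff by blast
  have pos: "ord_zero < \<theta> \<alpha>" and ch: "chain UNIV (\<theta> \<alpha>) (X \<alpha>) (i \<alpha>)" and X0: "X \<alpha> ord_zero = P \<alpha>" if "\<alpha> \<le> \<Lambda>" for \<alpha>
    using * that by auto
  have chM: "chain M (\<theta> \<alpha>) (X \<alpha>) (i \<alpha>)" and X1: "X \<alpha> (\<theta> \<alpha>) = P (ord_succ \<alpha>)"
    and i1: "i \<alpha> ord_zero (\<theta> \<alpha>) = j \<alpha> (ord_succ \<alpha>)" if "\<alpha> < \<Lambda>" for \<alpha>
    using * that less_imp_le by auto
  have top: "\<theta> \<Lambda> = ord_succ ord_zero" using * by auto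
  note c = chainD[OF ch]
  define W where "W = (SIGMA \<alpha>:{..\<Lambda>}. {..<\<theta> \<alpha>})"
  define less where "less v w \<longleftrightarrow> fst v < fst w \<or> fst v = fst w \<and> snd v < snd w" for v w :: "'u \<times> 'u"
  have "small U W" unfolding W_def by (intro small_Sigma small_atMost small_initial)
  moreover have "wfp less"
  proof -
    have "{(v, w). less v w} = {(x, y). x < (y::'u)} <*lex*> {(x, y). x < y}"
      by (auto simp: less_def)
    then show ?thesis unfolding wfp_def by (simp add: wf wf_lex_prod)
  qed
  moreover have "less v w \<or> less w v" if "v \<noteq> w" for v w
    using that by (auto simp: less_def prod_eq_iff)
  ultimately obtain \<Theta> :: 'u and e where e: "bij_betw e {..<\<Theta>} W"
    and e_less: "\<And>\<alpha> \<beta>. \<alpha> < \<Theta> \<Longrightarrow> \<beta> < \<Theta> \<Longrightarrow> less (e \<alpha>) (e \<beta>) \<longleftrightarrow> \<alpha> < \<beta>"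
    by (rule ordinal_enumeration[of W less]) auto
  define Z where "Z w = X (fst w) (snd w)" for w
  \<comment> \<open>Between different blocks the map runs to the end of the first block, along the
    outer chain to the start of the second, and from there into the second block.\<close>
  define T where "T v w = (if fst v = fst w then i (fst v) (snd v) (snd w)
    else i (fst w) ord_zero (snd w) \<cdot> (j (ord_succ (fst v)) (fst w) \<cdot> i (fst v) (snd v) (\<theta> (fst v))))" for v w
  have W: "fst w \<le> \<Lambda>" "snd w < \<theta> (fst w)" if "w \<in> W" for w
    using that by (auto simp: W_def)
  define le where "le v w \<longleftrightarrow> v = w \<or> less v w" for v w
  have in_Hom: "i (fst w) ord_zero (snd w) \<in> Hom C (P (fst w)) (Z w)" if "w \<in> W" for w
    using c(3)[OF W(1)[OF that] less_imp_le[OF W(2)[OF that]] ord_zero_le] X0[OF W(1)[OF that]]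
    by (simp add: Z_def)
  have out_Hom: "i (fst w) (snd w) (\<theta> (fst w)) \<in> Hom C (Z w) (P (ord_succ (fst w)))"
    if "w \<in> W" "fst w < \<Lambda>" for w
    using c(3)[OF W(1)[OF that(1)] order.refl less_imp_le[OF W(2)[OF that(1)]]] X1[OF that(2)]
    by (simp add: Z_def)
  have j_Hom: "j (ord_succ \<alpha>) \<beta> \<in> Hom C (P (ord_succ \<alpha>)) (P \<beta>)" if "\<beta> \<le> \<Lambda>" "\<alpha> < \<beta>" for \<alpha> \<beta>
    using o(3)[OF that(1), of "ord_succ \<alpha>"] that(2) by simp
  have T_Hom: "T v w \<in> Hom C (Z v) (Z w)" if "v \<in> W" "w \<in> W" "le v w" for v w
  proof (cases "fst v = fst w")
    case True
    then have "snd v \<le> snd w" using that(3) by (auto simp: le_def less_def)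
    then show ?thesis
      using c(3)[OF W(1)[OF that(2)] less_imp_le[OF W(2)[OF that(2)]], of "snd v"] True by (simp add: T_def Z_def)
  next
    case False
    then have lt: "fst v < fst w" using that(3) by (auto simp: le_def less_def)
    then have v: "fst v < \<Lambda>" using W(1)[OF that(2)] by simp
    show ?thesis
      using Comp_Hom[OF Comp_Hom[OF out_Hom[OF that(1) v] j_Hom[OF W(1)[OF that(2)] lt]] in_Hom[OF that(2)]] False
      by (simp add: T_def)
  qed
  have T_Id: "T w w = Id C (Z w)" if "w \<in> W" for w
    using c(2)[OF W(1)[OF that] less_imp_le[OF W(2)[OF that]]] by (simp add: T_def Z_def)
  have T_Comp: "T v w \<cdot> T u v = T u w" if uvw: "u \<in> W" "v \<in> W" "w \<in> W" "le u v" "le v w" for u v w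
  proof -
    note Wu = W[OF uvw(1)] and Wv = W[OF uvw(2)] and Ww = W[OF uvw(3)]
    have le: "fst u \<le> fst v" "fst v \<le> fst w" "fst u = fst v \<Longrightarrow> snd u \<le> snd v" "fst v = fst w \<Longrightarrow> snd v \<le> snd w"
      using uvw(4,5) by (auto simp: le_def less_def)
    consider (same) "fst u = fst v" "fst v = fst w" | (left) "fst u = fst v" "fst v < fst w"
      | (right) "fst u < fst v" "fst v = fst w" | (none) "fst u < fst v" "fst v < fst w"
      using le(1,2) by (meson order.order_iff_strict)
    then show ?thesis
    proof cases
      case same
      then show ?thesis
        using c(4)[OF Wu(1), of "snd w" "snd v" "snd u"] le Ww(2) by (simp add: T_def)
    next
      case left
      then have v: "fst v < \<Lambda>" using Ww(1) by simp
      have uv: "T u v \<in> Hom C (Z u) (Z v)" using uvw(1,2,4) by (rule T_Hom)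
      have eq: "i (fst v) (snd v) (\<theta> (fst v)) \<cdot> T u v = i (fst u) (snd u) (\<theta> (fst u))"
        using c(4)[OF Wu(1) order.refl, of "snd v" "snd u"] left(1) le(3) Wv(2) by (simp add: T_def)
      note jw = j_Hom[OF Ww(1) left(2)]
      show ?thesis
        using Comp_assoc[OF uv Comp_Hom[OF out_Hom[OF uvw(2) v] jw] in_Hom[OF uvw(3)]]
          Comp_assoc[OF uv out_Hom[OF uvw(2) v] jw] eq left less_imp_neq[OF left(2)] by (simp add: T_def)
    next
      case right
      then have u: "fst u < \<Lambda>" using Ww(1) by simp
      have vw: "T v w \<in> Hom C (Z v) (Z w)" using uvw(2,3,5) by (rule T_Hom)
      have eq: "T v w \<cdot> i (fst v) ord_zero (snd v) = i (fst w) ord_zero (snd w)"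
        using c(4)[OF Wv(1), of "snd w" "snd v" ord_zero] right(2) le(4) Ww(2) by (simp add: T_def)
      note ju = Comp_Hom[OF out_Hom[OF uvw(1) u] j_Hom[OF Wv(1) right(1)]]
      show ?thesis
        using Comp_assoc[OF ju in_Hom[OF uvw(2)] vw] eq right less_imp_neq[OF right(1)] by (simp add: T_def)
    next
      \<comment> \<open>The two pieces that meet in the middle block compose to the whole inner
        chain there, which is an outer step; the rest is functoriality of \<open>j\<close>.\<close>
      case none
      then have u: "fst u < \<Lambda>" and v: "fst v < \<Lambda>" using Ww(1) by auto
      note ou = out_Hom[OF uvw(1) u] and ov = out_Hom[OF uvw(2) v]
      note ju = j_Hom[OF Wv(1) none(1)] and jv = j_Hom[OF Ww(1) none(2)]
      note iv = in_Hom[OF uvw(2)] and iw = in_Hom[OF uvw(3)]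
      have jv1: "j (fst v) (ord_succ (fst v)) \<in> Hom C (P (fst v)) (P (ord_succ (fst v)))"
        using o(3)[of "ord_succ (fst v)" "fst v"] v by (simp add: less_imp_le)
      have io: "i (fst v) (snd v) (\<theta> (fst v)) \<cdot> i (fst v) ord_zero (snd v) = j (fst v) (ord_succ (fst v))"
        using c(4)[OF Wv(1) order.refl less_imp_le[OF Wv(2)] ord_zero_le] i1[OF v] by simp
      have jj1: "j (fst v) (ord_succ (fst v)) \<cdot> j (ord_succ (fst u)) (fst v) = j (ord_succ (fst u)) (ord_succ (fst v))"
        using o(4)[of "ord_succ (fst v)" "fst v" "ord_succ (fst u)"] v none(1) by (simp add: less_imp_le)
      have jj2: "j (ord_succ (fst v)) (fst w) \<cdot> j (ord_succ (fst u)) (ord_succ (fst v)) = j (ord_succ (fst u)) (fst w)"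
        using o(4)[OF Ww(1), of "ord_succ (fst v)" "ord_succ (fst u)"] none by (simp add: less_imp_le)
      have "(j (ord_succ (fst v)) (fst w) \<cdot> i (fst v) (snd v) (\<theta> (fst v))) \<cdot>
          (i (fst v) ord_zero (snd v) \<cdot> (j (ord_succ (fst u)) (fst v) \<cdot> i (fst u) (snd u) (\<theta> (fst u)))) =
        j (ord_succ (fst u)) (fst w) \<cdot> i (fst u) (snd u) (\<theta> (fst u))"
        using Comp_assoc[OF Comp_Hom[OF Comp_Hom[OF ou ju] iv] ov jv] Comp_assoc[OF Comp_Hom[OF ou ju] iv ov] io
          Comp_assoc[OF ou ju jv1] jj1 Comp_assoc[OF ou Comp_Hom[OF ju jv1] jv] jj2 by simp
      then show ?thesis
        using Comp_assoc[OF Comp_Hom[OF Comp_Hom[OF ou ju] iv] Comp_Hom[OF ov jv] iw] less_imp_neq[OF none(1)]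
          less_imp_neq[OF none(2)] less_imp_neq[OF less_trans[OF none]] by (simp add: T_def)
    qed
  qed
  have eW: "e \<alpha> \<in> W" if "\<alpha> < \<Theta>" for \<alpha> using e that by (auto simp: bij_betw_def)
  have e_le: "le (e \<alpha>) (e \<beta>)" if "\<beta> < \<Theta>" "\<alpha> \<le> \<beta>" for \<alpha> \<beta>
    using e_less[OF le_less_trans[OF that(2,1)] that(1)] that(2)
    by (auto simp: le_def order.order_iff_strict)
  have "\<exists>\<alpha><\<Theta>. e \<alpha> = w" if "w \<in> W" for w using e that by (auto simp: bij_betw_def)
  then obtain r where r: "\<And>w. w \<in> W \<Longrightarrow> r w < \<Theta> \<and> e (r w) = w" by metis
  have r_less: "r v < r w" if "v \<in> W" "w \<in> W" "less v w" for v w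
    using e_less[of "r v" "r w"] r that by auto
  have r_le: "r v \<le> r w" if "v \<in> W" "w \<in> W" "le v w" for v w
    using r_less[OF that(1,2)] that(3) by (auto simp: le_def)
  have re: "r (e \<alpha>) = \<alpha>" if "\<alpha> < \<Theta>" for \<alpha>
    using e r[OF eW[OF that]] that by (auto simp: bij_betw_def inj_on_def)
  \<comment> \<open>The pair \<open>(\<Lambda>, ord_zero)\<close> is the greatest of all, so the
    refined chain ends at its index.\<close>
  define \<tau> where "\<tau> = r (\<Lambda>, ord_zero)"
  have topW: "(\<Lambda>, ord_zero) \<in> W" and botW: "(ord_zero, ord_zero) \<in> W"
    using pos by (auto simp: W_def)
  have \<tau>: "\<tau> < \<Theta>" "e \<tau> = (\<Lambda>, ord_zero)" using r[OF topW] by (auto simp: \<tau>_def)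
  have \<tau>_max: "\<alpha> \<le> \<tau>" if "\<alpha> < \<Theta>" for \<alpha>
  proof -
    have "le (e \<alpha>) (\<Lambda>, ord_zero)"
      using W[OF eW[OF that]] top by (cases "fst (e \<alpha>) = \<Lambda>") (auto simp: le_def less_def prod_eq_iff)
    then show ?thesis using r_le[OF eW[OF that] topW] re[OF that] by (simp add: \<tau>_def)
  qed
  have e0: "e ord_zero = (ord_zero, ord_zero)"
  proof -
    have "\<not> less (e (ord_zero)) (ord_zero, ord_zero)" by (simp add: less_def)
    moreover have "\<not> r (ord_zero, ord_zero) < ord_zero" by simp
    moreover have "less (ord_zero, ord_zero) w \<or> (ord_zero, ord_zero) = w" for w :: "'u \<times> 'u"
      by (cases w) (auto simp: less_def ord_zero_less_iff)
    moreover have "ord_zero < \<Theta>" using \<tau>(1) ord_zero_le le_less_trans by blast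
    ultimately show ?thesis using r_less[OF botW eW, of ord_zero] re[of ord_zero] by fastforce
  qed
  define ZZ where "ZZ \<alpha> = Z (e \<alpha>)" for \<alpha>
  define TT where "TT \<alpha> \<beta> = T (e \<alpha>) (e \<beta>)" for \<alpha> \<beta>
  have below: "\<alpha> < \<Theta>" if "\<alpha> < ord_succ \<tau>" for \<alpha> using that \<tau>(1) by simp
  have ds: "direct_system C (ord_succ \<tau>) ZZ TT"
    unfolding direct_system_def ZZ_def TT_def
  proof (intro conjI allI impI)
    fix \<alpha> assume \<alpha>: "\<alpha> < ord_succ \<tau>"
    show "T (e \<alpha>) (e \<alpha>) = Id C (Z (e \<alpha>))" using T_Id[OF eW[OF below[OF \<alpha>]]] .
    show "Z (e \<alpha>) \<in> Obj C" using in_Hom[OF eW[OF below[OF \<alpha>]]] by (rule HomD)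
  next
    fix \<beta> \<alpha> assume b: "\<beta> < ord_succ \<tau>" "\<alpha> \<le> \<beta>"
    show "T (e \<alpha>) (e \<beta>) \<in> Hom C (Z (e \<alpha>)) (Z (e \<beta>))"
      using b by (intro T_Hom eW e_le below) auto
  next
    fix \<gamma> \<beta> \<alpha> assume g: "\<gamma> < ord_succ \<tau>" "\<beta> \<le> \<gamma>" "\<alpha> \<le> \<beta>"
    show "T (e \<beta>) (e \<gamma>) \<cdot> T (e \<alpha>) (e \<beta>) = T (e \<alpha>) (e \<gamma>)"
      using g by (intro T_Comp eW e_le below) auto
  qed
  \<comment> \<open>A pair at a limit index has no immediate predecessor: the index after that of
    \<open>v\<close> is still below \<gamma>, and its pair lies strictly in between.\<close>
  have no_pred: False
    if g: "\<gamma> < \<Theta>" "limit_ordinal \<gamma>" and v: "v \<in> W" "less v (e \<gamma>)"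
      and imm: "\<And>u. u \<in> W \<Longrightarrow> less v u \<Longrightarrow> \<not> less u (e \<gamma>)" for \<gamma> v
  proof -
    have "r v < \<gamma>" using r_less[OF v(1) eW[OF g(1)] v(2)] re[OF g(1)] by simp
    then have s: "ord_succ (r v) < \<gamma>" using g(2) limit_ord_succ_less by blast
    then have s\<Theta>: "ord_succ (r v) < \<Theta>" using g(1) by simp
    have "less v (e (ord_succ (r v)))" using e_less[of "r v" "ord_succ (r v)"] r[OF v(1)] s\<Theta> by simp
    moreover have "less (e (ord_succ (r v))) (e \<gamma>)" using e_less[OF s\<Theta> g(1)] s by simp
    ultimately show False using imm eW[OF s\<Theta>] by blast
  qed
  have colim: "is_colimit C \<gamma> ZZ TT (ZZ \<gamma>) (\<lambda>\<beta>. TT \<beta> \<gamma>)"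
    if g: "\<gamma> < ord_succ \<tau>" "limit_ordinal \<gamma>" for \<gamma>
  proof -
    have g\<Theta>: "\<gamma> < \<Theta>" using g(1) by (rule below)
    have ds\<gamma>: "direct_system C (ord_succ \<gamma>) ZZ TT" using ds g(1) by (intro direct_system_mono[OF ds]) simp
    obtain \<alpha> \<xi> where w: "e \<gamma> = (\<alpha>, \<xi>)" by (cases "e \<gamma>")
    have wW: "(\<alpha>, \<xi>) \<in> W" using eW[OF g\<Theta>] w by simp
    have \<alpha>: "\<alpha> \<le> \<Lambda>" "\<xi> < \<theta> \<alpha>" using W[OF wW] by auto
    have r\<gamma>: "r (\<alpha>, \<xi>) = \<gamma>" using re[OF g\<Theta>] w by simp
    have cofinal: "\<exists>\<eta><K. \<beta> \<le> r (f \<eta>)"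
      if \<beta>: "\<beta> < \<gamma>" and f: "\<And>\<eta>. \<eta> < K \<Longrightarrow> f \<eta> \<in> W"
        "\<And>v. v \<in> W \<Longrightarrow> less v (\<alpha>, \<xi>) \<Longrightarrow> \<exists>\<eta><K. le v (f \<eta>)" for \<beta> K and f :: "'u \<Rightarrow> 'u \<times> 'u"
    proof -
      have b\<Theta>: "\<beta> < \<Theta>" using \<beta> g\<Theta> by simp
      have "less (e \<beta>) (\<alpha>, \<xi>)" using e_less[OF b\<Theta> g\<Theta>] \<beta> w by simp
      then obtain \<eta> where \<eta>: "\<eta> < K" "le (e \<beta>) (f \<eta>)" using f(2)[OF eW[OF b\<Theta>]] by blast
      then show ?thesis using r_le[OF eW[OF b\<Theta>] f(1)[OF \<eta>(1)] \<eta>(2)] re[OF b\<Theta>] by auto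
    qed
    \<comment> \<open>It suffices to find a monotone family of pairs, cofinal below
      \<open>(\<alpha>, \<xi>)\<close>, along which the colimit is known.\<close>
    have reduce: ?thesis
      if f: "\<And>\<eta>. \<eta> < K \<Longrightarrow> f \<eta> \<in> W \<and> less (f \<eta>) (\<alpha>, \<xi>)"
        "\<And>\<eta> \<eta>'. \<eta>' < K \<Longrightarrow> \<eta> \<le> \<eta>' \<Longrightarrow> le (f \<eta>) (f \<eta>')"
        "\<And>v. v \<in> W \<Longrightarrow> less v (\<alpha>, \<xi>) \<Longrightarrow> \<exists>\<eta><K. le v (f \<eta>)"
      and col: "is_colimit C K (\<lambda>\<eta>. Z (f \<eta>)) (\<lambda>\<eta> \<eta>'. T (f \<eta>) (f \<eta>')) (Z (\<alpha>, \<xi>)) (\<lambda>\<eta>. T (f \<eta>) (\<alpha>, \<xi>))"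
      for K and f :: "'u \<Rightarrow> 'u \<times> 'u"
    proof (rule colimit_cofinal[OF ds\<gamma>, of K "\<lambda>\<eta>. r (f \<eta>)"])
      have er: "e (r (f \<eta>)) = f \<eta>" if "\<eta> < K" for \<eta> using r f(1) that by blast
      have "is_colimit C K (\<lambda>\<eta>. ZZ (r (f \<eta>))) (\<lambda>\<eta> \<eta>'. TT (r (f \<eta>)) (r (f \<eta>'))) (ZZ \<gamma>) (\<lambda>\<eta>. TT (r (f \<eta>)) \<gamma>) \<longleftrightarrow>
          is_colimit C K (\<lambda>\<eta>. Z (f \<eta>)) (\<lambda>\<eta> \<eta>'. T (f \<eta>) (f \<eta>')) (ZZ \<gamma>) (\<lambda>\<eta>. T (f \<eta>) (\<alpha>, \<xi>))"
        using er w by (intro is_colimit_cong) (auto simp: ZZ_def TT_def)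
      then show "is_colimit C K (\<lambda>\<eta>. ZZ (r (f \<eta>))) (\<lambda>\<eta> \<eta>'. TT (r (f \<eta>)) (r (f \<eta>'))) (ZZ \<gamma>) (\<lambda>\<eta>. TT (r (f \<eta>)) \<gamma>)"
        using col w by (simp add: ZZ_def)
      show "r (f \<eta>) < \<gamma>" if "\<eta> < K" for \<eta> using r_less[OF _ wW] f(1)[OF that] r\<gamma> by simp
      show "r (f \<eta>) \<le> r (f \<eta>')" if "\<eta>' < K" "\<eta> \<le> \<eta>'" for \<eta> \<eta>'
        using r_le f(1)[OF that(1)] f(1)[OF le_less_trans[OF that(2,1)]] f(2)[OF that] by blast
      show "\<exists>\<eta><K. \<beta> \<le> r (f \<eta>)" if "\<beta> < \<gamma>" for \<beta>
        using cofinal[OF that] f by blast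
    qed
    \<comment> \<open>A pair at a limit index is of one of three kinds. If \<xi> is a limit, the
      inner chain is continuous there. If \<xi> is zero and \<alpha> follows a block of limit
      length, the pair is the end of that block. If \<xi> is zero and \<alpha> is a limit, the outer
      chain is continuous there. Any other pair is the least one or has an immediate
      predecessor.\<close>
    show ?thesis
    proof (cases \<xi> rule: ordinal_cases)
      case limit
      have fW: "(\<alpha>, \<eta>) \<in> W" if "\<eta> < \<xi>" for \<eta> using that \<alpha> by (simp add: W_def)
      show ?thesis
      proof (rule reduce[of \<xi> "\<lambda>\<eta>. (\<alpha>, \<eta>)"])
        show "is_colimit C \<xi> (\<lambda>\<eta>. Z (\<alpha>, \<eta>)) (\<lambda>\<eta> \<eta>'. T (\<alpha>, \<eta>) (\<alpha>, \<eta>')) (Z (\<alpha>, \<xi>)) (\<lambda>\<eta>. T (\<alpha>, \<eta>) (\<alpha>, \<xi>))"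
          using c(6)[OF \<alpha>(1) less_imp_le[OF \<alpha>(2)] limit] by (simp add: Z_def T_def)
        fix v assume v: "v \<in> W" "less v (\<alpha>, \<xi>)"
        show "\<exists>\<eta><\<xi>. le v (\<alpha>, \<eta>)"
        proof (cases "fst v = \<alpha>")
          case True then show ?thesis using v by (intro exI[of _ "snd v"]) (auto simp: le_def less_def prod_eq_iff)
        next
          case False then show ?thesis using v limit_ord_zero_less[OF limit]
            by (intro exI[of _ ord_zero]) (auto simp: le_def less_def)
        qed
      qed (use fW in \<open>auto simp: le_def less_def\<close>)
    next
      case (succ \<eta>)
      have False
      proof (rule no_pred[OF g\<Theta> g(2), of "(\<alpha>, \<eta>)"])
        show "(\<alpha>, \<eta>) \<in> W" using \<alpha> succ by (auto simp: W_def intro: order.strict_trans[OF less_ord_succ])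
      qed (use w succ in \<open>auto simp: less_def\<close>)
      then show ?thesis ..
    next
      case zero
      show ?thesis
      proof (cases \<alpha> rule: ordinal_cases)
        case z: zero
        have "less (e ord_zero) (e \<gamma>)"
          using e_less[of ord_zero \<gamma>] g\<Theta> limit_ord_zero_less[OF g(2)] by (simp add: less_trans)
        then show ?thesis using e0 w zero z by (simp add: less_def)
      next
        case (succ \<beta>)
        then have \<beta>: "\<beta> < \<Lambda>" using \<alpha>(1) by simp
        have \<beta>': "\<beta> \<le> \<Lambda>" using \<beta> by simp
        have fW: "(\<beta>, \<eta>) \<in> W" if "\<eta> < \<theta> \<beta>" for \<eta> using that \<beta>' by (simp add: W_def)
        have Tw: "T (\<beta>, \<eta>) (\<alpha>, \<xi>) = i \<beta> \<eta> (\<theta> \<beta>)" if "\<eta> < \<theta> \<beta>" for \<eta>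
        proof -
          have h: "i \<beta> \<eta> (\<theta> \<beta>) \<in> Hom C (X \<beta> \<eta>) (P \<alpha>)"
            using out_Hom[OF fW[OF that]] \<beta> succ by (simp add: Z_def)
          have "\<beta> \<noteq> \<alpha>" using succ by (metis less_irrefl less_ord_succ)
          moreover have "j (ord_succ \<beta>) \<alpha> = Id C (P \<alpha>)" using o(2)[OF \<alpha>(1)] succ by simp
          moreover have "i \<alpha> ord_zero ord_zero = Id C (P \<alpha>)" using c(2)[OF \<alpha>(1) ord_zero_le] X0[OF \<alpha>(1)] by simp
          ultimately show ?thesis using Id_Comp[OF h] zero by (simp add: T_def)
        qed
        show ?thesis
        proof (cases "\<theta> \<beta>" rule: ordinal_cases)
          case zero then show ?thesis using pos[OF \<beta>'] by simp
        next
          case limit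
          show ?thesis
          proof (rule reduce[of "\<theta> \<beta>" "\<lambda>\<eta>. (\<beta>, \<eta>)"])
            have Zw: "Z (\<alpha>, \<xi>) = X \<beta> (\<theta> \<beta>)" using X1[OF \<beta>] X0[OF \<alpha>(1)] zero succ by (simp add: Z_def)
            have "is_colimit C (\<theta> \<beta>) (\<lambda>\<eta>. Z (\<beta>, \<eta>)) (\<lambda>\<eta> \<eta>'. T (\<beta>, \<eta>) (\<beta>, \<eta>')) (X \<beta> (\<theta> \<beta>)) (\<lambda>\<eta>. T (\<beta>, \<eta>) (\<alpha>, \<xi>)) \<longleftrightarrow>
              is_colimit C (\<theta> \<beta>) (X \<beta>) (i \<beta>) (X \<beta> (\<theta> \<beta>)) (\<lambda>\<eta>. i \<beta> \<eta> (\<theta> \<beta>))"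
              using Tw by (intro is_colimit_cong) (simp_all add: Z_def T_def)
            then show "is_colimit C (\<theta> \<beta>) (\<lambda>\<eta>. Z (\<beta>, \<eta>)) (\<lambda>\<eta> \<eta>'. T (\<beta>, \<eta>) (\<beta>, \<eta>')) (Z (\<alpha>, \<xi>)) (\<lambda>\<eta>. T (\<beta>, \<eta>) (\<alpha>, \<xi>))"
              using c(6)[OF \<beta>' order.refl limit] Zw by simp
            fix v assume v: "v \<in> W" "less v (\<alpha>, \<xi>)"
            then have fv: "fst v \<le> \<beta>" using zero succ by (auto simp: less_def)
            show "\<exists>\<eta><\<theta> \<beta>. le v (\<beta>, \<eta>)"
            proof (cases "fst v = \<beta>")
              case True then show ?thesis using W(2)[OF v(1)]
                by (intro exI[of _ "snd v"]) (auto simp: le_def less_def prod_eq_iff)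
            next
              case False then show ?thesis using fv pos[OF \<beta>']
                by (intro exI[of _ ord_zero]) (auto simp: le_def less_def)
            qed
          qed (use fW succ in \<open>auto simp: le_def less_def\<close>)
        next
          case s: (succ \<eta>)
          have False
          proof (rule no_pred[OF g\<Theta> g(2), of "(\<beta>, \<eta>)"])
            show "(\<beta>, \<eta>) \<in> W" using fW s by simp
            show "less (\<beta>, \<eta>) (e \<gamma>)" using w succ by (simp add: less_def)
            fix u assume u: "u \<in> W" "less (\<beta>, \<eta>) u"
            show "\<not> less u (e \<gamma>)"
              using u W(2)[OF u(1)] w succ zero s by (auto simp: less_def)
          qed
          then show ?thesis ..
        qed
      next
        case limit
        have fW: "(\<beta>, ord_zero) \<in> W" if "\<beta> < \<alpha>" for \<beta>
          using that \<alpha>(1) pos[of \<beta>] by (simp add: W_def)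
        have T0: "T (\<beta>, ord_zero) (\<beta>', ord_zero) = j \<beta> \<beta>'" if b: "\<beta>' \<le> \<Lambda>" "\<beta> \<le> \<beta>'" for \<beta> \<beta>'
        proof (cases "\<beta> = \<beta>'")
          case True then show ?thesis using c(2)[OF b(1) ord_zero_le] X0[OF b(1)] o(2)[OF b(1)] by (simp add: T_def)
        next
          case False
          then have lt: "\<beta> < \<beta>'" using b(2) by simp
          have \<beta>: "\<beta> < \<Lambda>" using lt b(1) by simp
          have jb: "j \<beta> \<beta>' \<in> Hom C (P \<beta>) (P \<beta>')" using o(3)[OF b] .
          have "j (ord_succ \<beta>) \<beta>' \<cdot> j \<beta> (ord_succ \<beta>) = j \<beta> \<beta>'"
            using o(4)[OF b(1), of "ord_succ \<beta>" \<beta>] lt by (simp add: less_imp_le)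
          moreover have "i \<beta>' ord_zero ord_zero = Id C (P \<beta>')" using c(2)[OF b(1) ord_zero_le] X0[OF b(1)] by simp
          ultimately show ?thesis using Id_Comp[OF jb] i1[OF \<beta>] False by (simp add: T_def)
        qed
        have Z0: "Z (\<beta>, ord_zero) = P \<beta>" if "\<beta> \<le> \<Lambda>" for \<beta> using X0[OF that] by (simp add: Z_def)
        show ?thesis
        proof (rule reduce[of \<alpha> "\<lambda>\<beta>. (\<beta>, ord_zero)"])
          have "is_colimit C \<alpha> (\<lambda>\<eta>. Z (\<eta>, ord_zero)) (\<lambda>\<eta> \<eta>'. T (\<eta>, ord_zero) (\<eta>', ord_zero)) (P \<alpha>)
              (\<lambda>\<eta>. T (\<eta>, ord_zero) (\<alpha>, \<xi>)) \<longleftrightarrow> is_colimit C \<alpha> P j (P \<alpha>) (\<lambda>\<eta>. j \<eta> \<alpha>)"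
            using T0 Z0 \<alpha>(1) zero by (intro is_colimit_cong) (simp_all add: less_imp_le)
          then show "is_colimit C \<alpha> (\<lambda>\<eta>. Z (\<eta>, ord_zero)) (\<lambda>\<eta> \<eta>'. T (\<eta>, ord_zero) (\<eta>', ord_zero)) (Z (\<alpha>, \<xi>))
              (\<lambda>\<eta>. T (\<eta>, ord_zero) (\<alpha>, \<xi>))"
            using o(6)[OF \<alpha>(1) limit] Z0[OF \<alpha>(1)] zero by simp
          fix v assume v: "v \<in> W" "less v (\<alpha>, \<xi>)"
          then have "fst v < \<alpha>" using zero by (auto simp: less_def)
          then have "ord_succ (fst v) < \<alpha>" "le v (ord_succ (fst v), ord_zero)"
            using limit_ord_succ_less[OF limit] by (auto simp: le_def less_def)
          then show "\<exists>\<eta><\<alpha>. le v (\<eta>, ord_zero)" by blast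
        qed (use fW in \<open>auto simp: le_def less_def\<close>)
      qed
    qed
  qed
  have steps: "TT \<alpha> (ord_succ \<alpha>) \<in> M" if "ord_succ \<alpha> < ord_succ \<tau>" for \<alpha>
  proof -
    have \<alpha>\<Theta>: "\<alpha> < \<Theta>" "ord_succ \<alpha> < \<Theta>" "\<alpha> < \<tau>" using that below[OF that] \<tau>(1) by auto
    obtain \<beta> \<xi> where w: "e \<alpha> = (\<beta>, \<xi>)" by (cases "e \<alpha>")
    have wW: "(\<beta>, \<xi>) \<in> W" using eW[OF \<alpha>\<Theta>(1)] w by simp
    have next_eq: "e (ord_succ \<alpha>) = v" if v: "v \<in> W" "less (\<beta>, \<xi>) v"
      and imm: "\<And>u. u \<in> W \<Longrightarrow> less (\<beta>, \<xi>) u \<Longrightarrow> \<not> less u v" for v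
    proof -
      have "\<alpha> < r v" using r_less[OF wW v] re[OF \<alpha>\<Theta>(1)] w by simp
      then have "ord_succ \<alpha> \<le> r v" by simp
      moreover have "\<not> ord_succ \<alpha> < r v"
      proof
        assume "ord_succ \<alpha> < r v"
        then have "less (e (ord_succ \<alpha>)) v" using e_less[OF \<alpha>\<Theta>(2), of "r v"] r[OF v(1)] by auto
        moreover have "less (\<beta>, \<xi>) (e (ord_succ \<alpha>))" using e_less[OF \<alpha>\<Theta>(1,2)] w by simp
        ultimately show False using imm eW[OF \<alpha>\<Theta>(2)] by blast
      qed
      ultimately have "ord_succ \<alpha> = r v" by (metis order.order_iff_strict)
      then show ?thesis using r[OF v(1)] by simp
    qed
    have "\<beta> \<noteq> \<Lambda>"
    proof
      assume "\<beta> = \<Lambda>"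
      then have "e \<alpha> = e \<tau>" using W(2)[OF wW] top w \<tau>(2) by simp
      then have "r (e \<alpha>) = r (e \<tau>)" by (rule arg_cong)
      then have "\<alpha> = \<tau>" unfolding re[OF \<alpha>\<Theta>(1)] re[OF \<tau>(1)] .
      then show False using \<alpha>\<Theta>(3) by blast
    qed
    then have \<beta>: "\<beta> < \<Lambda>" "\<xi> < \<theta> \<beta>" using W[OF wW] by auto
    have M: "i \<beta> \<xi> (ord_succ \<xi>) \<in> M" using chainD(5)[OF chM[OF \<beta>(1)] \<beta>(2)] .
    show ?thesis
    proof (cases "ord_succ \<xi> = \<theta> \<beta>")
      case False
      then have "ord_succ \<xi> < \<theta> \<beta>" using \<beta>(2) by (simp add: order.strict_iff_order)
      then have "(\<beta>, ord_succ \<xi>) \<in> W" using \<beta>(1) by (simp add: W_def)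
      then have "e (ord_succ \<alpha>) = (\<beta>, ord_succ \<xi>)"
        by (rule next_eq) (auto simp: less_def)
      then show ?thesis using M w by (simp add: TT_def T_def)
    next
      \<comment> \<open>The end of a block is not a pair of its own but the start of the next block,
        so the last inner step of a block leads there.\<close>
      case True
      have sW: "(ord_succ \<beta>, ord_zero) \<in> W" using \<beta>(1) pos[of "ord_succ \<beta>"] by (simp add: W_def)
      then have en: "e (ord_succ \<alpha>) = (ord_succ \<beta>, ord_zero)"
      proof (rule next_eq)
        show "less (\<beta>, \<xi>) (ord_succ \<beta>, ord_zero)" by (simp add: less_def)
        fix u assume u: "u \<in> W" "less (\<beta>, \<xi>) u"
        show "\<not> less u (ord_succ \<beta>, ord_zero)"
          using u W(2)[OF u(1)] True[symmetric] by (auto simp: less_def)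
      qed
      have s\<Lambda>: "ord_succ \<beta> \<le> \<Lambda>" using \<beta>(1) by simp
      have h: "i \<beta> \<xi> (\<theta> \<beta>) \<in> Hom C (X \<beta> \<xi>) (P (ord_succ \<beta>))"
        using out_Hom[OF wW] \<beta>(1) by (simp add: Z_def)
      have "\<beta> \<noteq> ord_succ \<beta>" by (metis less_irrefl less_ord_succ)
      moreover have "j (ord_succ \<beta>) (ord_succ \<beta>) = Id C (P (ord_succ \<beta>))" using o(2)[OF s\<Lambda>] .
      moreover have "i (ord_succ \<beta>) ord_zero ord_zero = Id C (P (ord_succ \<beta>))"
        using c(2)[OF s\<Lambda> ord_zero_le] X0[OF s\<Lambda>] by simp
      ultimately have "T (\<beta>, \<xi>) (ord_succ \<beta>, ord_zero) = i \<beta> \<xi> (\<theta> \<beta>)"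
        using Id_Comp[OF h] by (simp add: T_def)
      then show ?thesis using M True w en by (simp add: TT_def)
    qed
  qed
  have "chain M \<tau> ZZ TT"
    unfolding chain_def lambda_sequence_iff steps_in_def using ds colim steps by blast
  moreover have "ZZ ord_zero = P ord_zero" "ZZ \<tau> = P \<Lambda>"
    using e0 \<tau>(2) X0 by (simp_all add: ZZ_def Z_def)
  moreover have "TT ord_zero \<tau> = j ord_zero \<Lambda>"
  proof (cases "\<Lambda> = ord_zero")
    case True
    then show ?thesis
      using e0 \<tau>(2) c(2)[of ord_zero ord_zero] X0[of ord_zero] o(2)[of ord_zero] by (simp add: TT_def T_def)
  next
    case False
    then have lt: "ord_zero < \<Lambda>" by (simp add: ord_zero_less_iff)
    have j0: "j ord_zero \<Lambda> \<in> Hom C (P ord_zero) (P \<Lambda>)" using o(3)[of \<Lambda> ord_zero] by simp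
    have "j (ord_succ ord_zero) \<Lambda> \<cdot> j ord_zero (ord_succ ord_zero) = j ord_zero \<Lambda>"
      using o(4)[of \<Lambda> "ord_succ ord_zero" ord_zero] lt by simp
    moreover have "i \<Lambda> ord_zero ord_zero = Id C (P \<Lambda>)" using c(2)[of \<Lambda> ord_zero] X0[of \<Lambda>] by simp
    ultimately show ?thesis
      using e0 \<tau>(2) i1[OF lt] Id_Comp[OF j0] False by (simp add: TT_def T_def)
  qed
  ultimately show ?thesis by (rule that)
qed

end

section \<open>The small object argument\<close>

locale efficient_category = ordinal_universe U + exact_category C
  for U :: "'u::wellorder itself" and C :: "('o, 'm, 'z) exact_cat_scheme" (structure) +
  assumes locally_small: "locally_small U C"
    and transfinite_inflations: "inflations_closed_under_transfinite_compositions U C"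
    and objects_small: "\<forall>X\<in>Obj C. small_relative_to U C (inflations C) X"

sublocale efficient_category \<subseteq> category_in_universe U C
  by unfold_locales

context efficient_category
begin

lemma transfinite_composition_inflation:
  "transfinite_composition U C (inflations C) f \<Longrightarrow> f \<in> inflations C"
  using transfinite_inflations unfolding inflations_closed_under_transfinite_compositions_def by blast

lemma ex_colimit:
  fixes \<Lambda> :: 'u
  assumes "limit_ordinal \<Lambda>" "lambda_sequence C \<Lambda> X i" "steps_in \<Lambda> i (inflations C)"
  shows "\<exists>Y c. is_colimit C \<Lambda> X i Y c"
  using transfinite_inflations limit_ord_zero_less[OF assms(1)] assms(2,3)
  unfolding inflations_closed_under_transfinite_compositions_def by blast

text \<open>Compositions of maps in \<open>M\<close> are inflations by Ax1 and therefore have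
  pushouts; the steps of the pushed-out sequence stay in \<open>M\<close> by its closure.\<close>

lemma transfinite_composition_pushout:
  assumes "transfinite_composition U C M f" "is_pushout C f g f' g'"
    and "M \<subseteq> inflations C" "pushouts_of C M \<subseteq> M"
  shows "transfinite_composition U C M f'"
proof -
  have g: "g \<in> Arr C" "Dom C g = Dom C f" using assms(2) by (auto simp: is_pushout_def)
  have "transfinite_composition U C (pushouts_of C M) f'"
  proof (rule pushout_transfinite_composition[OF assms(1,2)])
    fix k assume k: "transfinite_composition U C M k" "Dom C k = Dom C f"
    then have "k \<in> inflations C"
      using transfinite_composition_subset[OF k(1) assms(3)] transfinite_composition_inflation by blast
    then show "\<exists>k' g''. is_pushout C k g k' g''"
      using inflation_pushout g k(2) by metis
  qed
  then show ?thesis using assms(4) by (rule transfinite_composition_subset)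
qed

text \<open>The surjective half of smallness: a map into the colimit is the value at some class, and
  a representative of that class is the factor.\<close>

lemma kappa_small_factor:
  fixes \<Lambda> \<kappa> :: 'u
  assumes small: "kappa_small C (inflations C) \<kappa> A" and \<Lambda>: "\<kappa> \<le> cofinality \<Lambda>" "limit_ordinal \<Lambda>"
    and ch: "chain (inflations C) \<Lambda> X i" and g: "g \<in> Hom C A (X \<Lambda>)"
  obtains \<beta> g' where "\<beta> < \<Lambda>" "g' \<in> Hom C A (X \<beta>)" "i \<beta> \<Lambda> \<cdot> g' = g"
proof -
  note c = chainD[OF ch]
  let ?c = "\<lambda>\<alpha>. i \<alpha> \<Lambda>"
  have "lambda_sequence C \<Lambda> X i \<and> steps_in \<Lambda> i (inflations C)"
    using ch lambda_sequence_mono[of "ord_succ \<Lambda>" X i \<Lambda>] steps_in_mono[of "ord_succ \<Lambda>" i _ \<Lambda>]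
    by (simp add: chain_def less_imp_le)
  moreover have "is_colimit C \<Lambda> X i (X \<Lambda>) ?c" using c(6)[OF order.refl \<Lambda>(2)] .
  ultimately have "bij_betw (hom_colim_map C ?c) (hom_colim C A \<Lambda> X i) (Hom C A (X \<Lambda>))"
    using small \<Lambda>(1) unfolding kappa_small_def by blast
  from bij_betw_imp_surj_on[OF this] g
  have "g \<in> hom_colim_map C ?c ` hom_colim C A \<Lambda> X i"
    by simp
  then obtain E where E: "E \<in> hom_colim C A \<Lambda> X i" "hom_colim_map C ?c E = g"
    by (elim imageE) simp
  obtain \<beta> f where f: "\<beta> < \<Lambda>" "f \<in> Hom C A (X \<beta>)" "E = hom_colim_rel C A \<Lambda> X i `` {(\<beta>, f)}"
    using E(1) unfolding hom_colim_def by (elim quotientE) auto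
  have refl: "(\<beta>, f) \<in> E"
    using f unfolding hom_colim_rel_def by auto
  \<comment> \<open>\<open>hom_colim_map\<close> picks the sole element of an image, so its value at
    \<open>E\<close> is known only once all representatives are shown to induce the same
    map.\<close>
  have all: "?c \<alpha> \<cdot> h = ?c \<beta> \<cdot> f" if "(\<alpha>, h) \<in> E" for \<alpha> h
  proof -
    obtain \<gamma> where \<gamma>: "\<alpha> < \<Lambda>" "h \<in> Hom C A (X \<alpha>)" "\<gamma> < \<Lambda>" "\<beta> \<le> \<gamma>" "\<alpha> \<le> \<gamma>" "i \<beta> \<gamma> \<cdot> f = i \<alpha> \<gamma> \<cdot> h"
      using \<open>(\<alpha>, h) \<in> E\<close> f(3) unfolding hom_colim_rel_def by auto
    have lift: "?c \<delta> \<cdot> x = ?c \<gamma> \<cdot> (i \<delta> \<gamma> \<cdot> x)" if "\<delta> \<le> \<gamma>" "x \<in> Hom C A (X \<delta>)" for \<delta> x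
      using Comp_assoc[OF that(2) c(3)[OF less_imp_le[OF \<gamma>(3)] that(1)] c(3)[OF order.refl less_imp_le[OF \<gamma>(3)]]]
        c(4)[OF order.refl less_imp_le[OF \<gamma>(3)] that(1)] by simp
    show ?thesis using lift[OF \<gamma>(5,2)] lift[OF \<gamma>(4) f(2)] \<gamma>(6) by simp
  qed
  have "(\<lambda>(\<alpha>, h). ?c \<alpha> \<cdot> h) ` E = {?c \<beta> \<cdot> f}"
  proof
    show "(\<lambda>(\<alpha>, h). ?c \<alpha> \<cdot> h) ` E \<subseteq> {?c \<beta> \<cdot> f}" using all by auto
    show "{?c \<beta> \<cdot> f} \<subseteq> (\<lambda>(\<alpha>, h). ?c \<alpha> \<cdot> h) ` E" using imageI[OF refl, of "\<lambda>(\<alpha>, h). ?c \<alpha> \<cdot> h"] by simp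
  qed
  then have "g = ?c \<beta> \<cdot> f" using E(2) unfolding hom_colim_map_def by simp
  then show ?thesis using that f by blast
qed

text \<open>
  Instead of attaching all cells at once, each step attaches one cell, for a lifting problem
  \<open>(k, g, h)\<close> at the least possible stage \<open>\<beta>\<close> that is not yet solved.  Since a stage has only a
  small set of lifting problems, all of them are solved eventually.
\<close>

lemma small_object_argument:
  assumes I: "\<I> \<subseteq> inflations C" "small U \<I>" and p0: "p0 \<in> Hom C A N"
  obtains \<Theta> X i p where "chain (pushouts_of C \<I>) \<Theta> X i" "X ord_zero = A"
    "p \<in> Hom C (X \<Theta>) N" "p \<cdot> i ord_zero \<Theta> = p0" "\<And>k. k \<in> \<I> \<Longrightarrow> has_rlp p k"
proof -
  have AN: "A \<in> Obj C" "N \<in> Obj C" using HomD[OF p0] by auto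
  define problems where
    "problems Y q = {(k, g, h). k \<in> \<I> \<and> g \<in> Hom C (Dom C k) Y \<and> h \<in> Hom C (Cod C k) N \<and> q \<cdot> g = h \<cdot> k}" for Y q
  \<comment> \<open>A problem posed at one stage may be solved at a later one: \<open>t\<close> is
    the transition map between the two, and the solution lives at the later stage.\<close>
  define solved where
    "solved Y' q' t x \<longleftrightarrow> (case x of (k, g, h) \<Rightarrow> \<exists>l\<in>Hom C (Cod C k) Y'. l \<cdot> k = t \<cdot> g \<and> q' \<cdot> l = h)" for Y' q' t x
  define unsolved where
    "unsolved X i p \<beta> \<delta> = {x \<in> problems (X \<beta>) (p \<beta>). \<not> solved (X \<delta>) (p \<delta>) (i \<beta> \<delta>) x}"
    for X :: "'u \<Rightarrow> 'o" and i p and \<beta> \<delta> :: 'u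
  \<comment> \<open>The step must attach a cell as long as some problem is open. Otherwise it is
    unconstrained, and the identity keeps the recursion going; the chain will be cut off before the
    first such step.\<close>
  define Q where "Q \<delta> X i p s t \<longleftrightarrow> (\<exists>\<beta>\<le>\<delta>. unsolved X i p \<beta> \<delta> \<noteq> {}) \<longrightarrow> s \<in> pushouts_of C \<I> \<and>
     (\<exists>\<beta>\<le>\<delta>. \<exists>x. x \<in> unsolved X i p \<beta> \<delta> \<and> (\<forall>\<beta>'<\<beta>. unsolved X i p \<beta>' \<delta> = {}) \<and>
       solved (Cod C s) t (s \<cdot> i \<beta> \<delta>) x)"
    for \<delta> :: 'u and X i p s t
  obtain X i p where X0: "X ord_zero = A" and p0': "p ord_zero = p0"
    and ch: "\<And>\<Theta>. chain (inflations C) \<Theta> X i" and k: "\<And>\<Lambda>. is_cocone C \<Lambda> X i N p"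
    and Q: "\<And>\<delta>. Q \<delta> X i p (i \<delta> (ord_succ \<delta>)) (p (ord_succ \<delta>))"
  proof (rule transfinite_construction[OF p0 ex_colimit, where Q = Q])
    fix \<delta> and s t :: 'm and X X' :: "'u \<Rightarrow> 'o" and i i' :: "'u \<Rightarrow> 'u \<Rightarrow> 'm" and p p' :: "'u \<Rightarrow> 'm"
    assume eq: "\<And>\<alpha>. \<alpha> \<le> \<delta> \<Longrightarrow> X \<alpha> = X' \<alpha>" "\<And>\<alpha> \<beta>. \<alpha> \<le> \<beta> \<Longrightarrow> \<beta> \<le> \<delta> \<Longrightarrow> i \<alpha> \<beta> = i' \<alpha> \<beta>"
      "\<And>\<alpha>. \<alpha> \<le> \<delta> \<Longrightarrow> p \<alpha> = p' \<alpha>"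
    have un: "unsolved X i p \<beta> \<delta> = unsolved X' i' p' \<beta> \<delta>" if "\<beta> \<le> \<delta>" for \<beta>
      unfolding unsolved_def using eq that by simp
    have un': "(\<forall>\<beta>'<\<beta>. unsolved X i p \<beta>' \<delta> = {}) \<longleftrightarrow> (\<forall>\<beta>'<\<beta>. unsolved X' i' p' \<beta>' \<delta> = {})" if "\<beta> \<le> \<delta>" for \<beta>
    proof -
      have "unsolved X i p \<beta>' \<delta> = unsolved X' i' p' \<beta>' \<delta>" if "\<beta>' < \<beta>" for \<beta>'
        using less_le_trans[OF that \<open>\<beta> \<le> \<delta>\<close>] by (intro un) simp
      then show ?thesis by simp
    qed
    show "Q \<delta> X i p s t = Q \<delta> X' i' p' s t"
      unfolding Q_def using un un' eq(2) by (simp cong: conj_cong)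
  next
    fix \<delta> and X :: "'u \<Rightarrow> 'o" and i p
    assume ch: "chain (inflations C) \<delta> X i" and k: "is_cocone C (ord_succ \<delta>) X i N p"
    note c = chainD[OF ch] and kt = is_coconeD[OF k]
    have X\<delta>: "X \<delta> \<in> Obj C" and p\<delta>: "p \<delta> \<in> Hom C (X \<delta>) N" using c(1)[of \<delta>] kt(2)[of \<delta>] by auto
    show "\<exists>Y. \<exists>s\<in>inflations C \<inter> Hom C (X \<delta>) Y. \<exists>t\<in>Hom C Y N. t \<cdot> s = p \<delta> \<and> Q \<delta> X i p s t"
    proof (cases "\<exists>\<beta>\<le>\<delta>. unsolved X i p \<beta> \<delta> \<noteq> {}")
      case False
      then have "Q \<delta> X i p (Id C (X \<delta>)) (p \<delta>)" unfolding Q_def by blast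
      then show ?thesis
        using Id_inflation[OF X\<delta>] Id_Hom[OF X\<delta>] p\<delta> Comp_Id[OF p\<delta>] by blast
    next
      case True
      define \<beta> where "\<beta> = (LEAST \<beta>. unsolved X i p \<beta> \<delta> \<noteq> {})"
      have "\<exists>\<beta>. unsolved X i p \<beta> \<delta> \<noteq> {}" using True by blast
      then have ne: "unsolved X i p \<beta> \<delta> \<noteq> {}" unfolding \<beta>_def by (rule LeastI_ex)
      obtain \<beta>\<^sub>0 where \<beta>\<^sub>0: "\<beta>\<^sub>0 \<le> \<delta>" "unsolved X i p \<beta>\<^sub>0 \<delta> \<noteq> {}" using True by blast
      have "\<beta> \<le> \<beta>\<^sub>0" unfolding \<beta>_def using \<beta>\<^sub>0(2) by (rule Least_le)
      then have \<beta>: "\<beta> \<le> \<delta>" using \<beta>\<^sub>0(1) by simp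
      have least: "unsolved X i p \<beta>' \<delta> = {}" if "\<beta>' < \<beta>" for \<beta>'
        using not_less_Least[of \<beta>' "\<lambda>\<beta>. unsolved X i p \<beta> \<delta> \<noteq> {}"] that unfolding \<beta>_def by blast
      obtain m g h where x: "(m, g, h) \<in> unsolved X i p \<beta> \<delta>" using ne by fast
      then have m: "m \<in> \<I>" and g: "g \<in> Hom C (Dom C m) (X \<beta>)" and h: "h \<in> Hom C (Cod C m) N"
        and sq: "p \<beta> \<cdot> g = h \<cdot> m"
        by (auto simp: unsolved_def problems_def)
      have mi: "m \<in> inflations C" using m I(1) by blast
      note mh = inflation_Hom[OF mi]
      have ib: "i \<beta> \<delta> \<in> Hom C (X \<beta>) (X \<delta>)" using c(3)[OF order.refl \<beta>] .
      have ig: "i \<beta> \<delta> \<cdot> g \<in> Hom C (Dom C m) (X \<delta>)" using g ib by (rule Comp_Hom)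
      then obtain s l where po: "is_pushout C m (i \<beta> \<delta> \<cdot> g) s l"
        using inflation_pushout[OF mi HomD(1)[OF ig] HomD(2)[OF ig]] by blast
      note t = pushout_Hom[OF po mh ig]
      have pi: "p \<delta> \<cdot> i \<beta> \<delta> = p \<beta>" using kt(3)[of \<delta> \<beta>] \<beta> by simp
      have "h \<cdot> m = p \<delta> \<cdot> (i \<beta> \<delta> \<cdot> g)"
        using Comp_assoc[OF g ib p\<delta>] pi sq by simp
      then obtain u where u: "u \<in> Hom C (Cod C s) N" "u \<cdot> l = h" "u \<cdot> s = p \<delta>"
        using pushout_factor[OF po mh ig t(1) h p\<delta>] by blast
      have sI: "s \<in> inflations C" using po mi by (rule pushout_inflation)
      have "s \<in> pushouts_of C \<I>" unfolding pushouts_of_def using po m by blast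
      moreover have "solved (Cod C s) u (s \<cdot> i \<beta> \<delta>) (m, g, h)"
        unfolding solved_def using t(2,3) u(2) Comp_assoc[OF g ib t(1)] by auto
      ultimately have "Q \<delta> X i p s u" unfolding Q_def using \<beta> x least by blast
      then show ?thesis using sI t(1) u by blast
    qed
  next
    fix X i p
    assume "X ord_zero = A" "p ord_zero = p0" "\<And>\<Theta>. chain (inflations C) \<Theta> X i" "\<And>\<Lambda>. is_cocone C \<Lambda> X i N p"
      "\<And>\<delta>. Q \<delta> X i p (i \<delta> (ord_succ \<delta>)) (p (ord_succ \<delta>))"
    then show thesis by (rule that)
  qed
  note c = chainD[OF ch] and kt = is_coconeD[OF k]
  have XObj: "X \<alpha> \<in> Obj C" for \<alpha> using c(1)[of \<alpha> \<alpha>] by simp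
  have iHom: "i \<alpha> \<beta> \<in> Hom C (X \<alpha>) (X \<beta>)" if "\<alpha> \<le> \<beta>" for \<alpha> \<beta> using c(3)[OF order.refl that] .
  have iComp: "i \<beta> \<gamma> \<cdot> i \<alpha> \<beta> = i \<alpha> \<gamma>" if "\<alpha> \<le> \<beta>" "\<beta> \<le> \<gamma>" for \<alpha> \<beta> \<gamma> using c(4)[OF order.refl that(2,1)] .
  have pHom: "p \<alpha> \<in> Hom C (X \<alpha>) N" for \<alpha> using kt(2)[of \<alpha> "ord_succ \<alpha>"] by simp
  have pComp: "p \<beta> \<cdot> i \<alpha> \<beta> = p \<alpha>" if "\<alpha> \<le> \<beta>" for \<alpha> \<beta> using kt(3)[of \<beta> "ord_succ \<beta>" \<alpha>] that by simp
  let ?un = "unsolved X i p"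
  have small_problems: "small U (problems (X \<beta>) (p \<beta>))" for \<beta>
  proof -
    have "small U (Hom C Y Y')" if "Y \<in> Obj C" "Y' \<in> Obj C" for Y Y'
      using locally_small that by (simp add: locally_small_def)
    moreover have "Dom C k \<in> Obj C" "Cod C k \<in> Obj C" if "k \<in> \<I>" for k
      using inflation_Hom[of k] I(1) that HomD(4,5) by blast+
    ultimately have "small U (SIGMA k:\<I>. Hom C (Dom C k) (X \<beta>) \<times> Hom C (Cod C k) N)"
      using I(2) XObj AN(2) by (intro small_Sigma) auto
    then show ?thesis
      by (rule small_subset) (auto simp: problems_def)
  qed
  have persist: "solved (X \<gamma>) (p \<gamma>) (i \<beta> \<gamma>) x"
    if "solved (X \<delta>) (p \<delta>) (i \<beta> \<delta>) x" "x \<in> problems (X \<beta>) (p \<beta>)" "\<beta> \<le> \<delta>" "\<delta> \<le> \<gamma>" for \<beta> \<gamma> \<delta> x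
  proof -
    note solved\<delta> = that(1)
    obtain m g h where x: "x = (m, g, h)" by (cases x)
    have m: "m \<in> Hom C (Dom C m) (Cod C m)" and g: "g \<in> Hom C (Dom C m) (X \<beta>)"
      using that(2) I(1) inflation_Hom unfolding x problems_def by auto
    obtain l where l: "l \<in> Hom C (Cod C m) (X \<delta>)" "l \<cdot> m = i \<beta> \<delta> \<cdot> g" "p \<delta> \<cdot> l = h"
      using solved\<delta> unfolding x solved_def by auto
    have "(i \<delta> \<gamma> \<cdot> l) \<cdot> m = i \<beta> \<gamma> \<cdot> g"
      using Comp_assoc[OF m l(1) iHom[OF that(4)]] l(2) Comp_assoc[OF g iHom[OF that(3)] iHom[OF that(4)]]
        iComp[OF that(3,4)] by simp
    moreover have "p \<gamma> \<cdot> (i \<delta> \<gamma> \<cdot> l) = h"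
      using Comp_assoc[OF l(1) iHom[OF that(4)] pHom] pComp[OF that(4)] l(3) by simp
    ultimately show ?thesis unfolding x solved_def using Comp_Hom[OF l(1) iHom[OF that(4)]] by auto
  qed
  have persist': "?un \<beta> \<gamma> = {}" if "?un \<beta> \<delta> = {}" "\<beta> \<le> \<delta>" "\<delta> \<le> \<gamma>" for \<beta> \<gamma> \<delta>
    using that persist unfolding unsolved_def by blast
  \<comment> \<open>While stage \<beta> has open problems, the choice of the least stage makes every
    step solve a problem posed at some stage up to \<beta>. Solved problems stay solved, so
    different steps solve different problems, and all later ordinals would inject into a small
    set.\<close>
  have eventually_solved: "\<exists>\<sigma>\<ge>\<beta>. ?un \<beta> \<sigma> = {}" for \<beta>
  proof (rule ccontr)
    assume never: "\<not> (\<exists>\<sigma>\<ge>\<beta>. ?un \<beta> \<sigma> = {})"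
    have "\<exists>\<alpha> x. \<alpha> \<le> \<beta> \<and> \<alpha> \<le> \<sigma> \<and> x \<in> ?un \<alpha> \<sigma> \<and> solved (X (ord_succ \<sigma>)) (p (ord_succ \<sigma>)) (i \<alpha> (ord_succ \<sigma>)) x"
      if \<sigma>: "\<beta> \<le> \<sigma>" for \<sigma>
    proof -
      have "\<exists>\<beta>\<le>\<sigma>. ?un \<beta> \<sigma> \<noteq> {}" using never \<sigma> by blast
      then obtain \<alpha> x where \<alpha>: "\<alpha> \<le> \<sigma>" "x \<in> ?un \<alpha> \<sigma>" "\<forall>\<beta>'<\<alpha>. ?un \<beta>' \<sigma> = {}"
        "solved (Cod C (i \<sigma> (ord_succ \<sigma>))) (p (ord_succ \<sigma>)) (i \<sigma> (ord_succ \<sigma>) \<cdot> i \<alpha> \<sigma>) x"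
        using Q[of \<sigma>] unfolding Q_def by blast
      have "\<alpha> \<le> \<beta>" using \<alpha>(3) never \<sigma> by (meson linorder_not_less)
      have s: "\<sigma> \<le> ord_succ \<sigma>" by (simp add: less_imp_le)
      have "solved (X (ord_succ \<sigma>)) (p (ord_succ \<sigma>)) (i \<alpha> (ord_succ \<sigma>)) x"
        using \<alpha>(4) iComp[OF \<alpha>(1) s] HomD(3)[OF iHom[OF s]] by simp
      then show ?thesis using \<alpha>(1,2) \<open>\<alpha> \<le> \<beta>\<close> by blast
    qed
    then obtain a y where ay: "\<And>\<sigma>. \<beta> \<le> \<sigma> \<Longrightarrow> a \<sigma> \<le> \<beta> \<and> a \<sigma> \<le> \<sigma> \<and> y \<sigma> \<in> ?un (a \<sigma>) \<sigma> \<and>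
      solved (X (ord_succ \<sigma>)) (p (ord_succ \<sigma>)) (i (a \<sigma>) (ord_succ \<sigma>)) (y \<sigma>)"
      by metis
    define f where "f \<sigma> = (a \<sigma>, y \<sigma>)" for \<sigma>
    have f: "fst (f \<sigma>) \<le> \<beta> \<and> fst (f \<sigma>) \<le> \<sigma> \<and> snd (f \<sigma>) \<in> ?un (fst (f \<sigma>)) \<sigma> \<and>
      solved (X (ord_succ \<sigma>)) (p (ord_succ \<sigma>)) (i (fst (f \<sigma>)) (ord_succ \<sigma>)) (snd (f \<sigma>))" if "\<beta> \<le> \<sigma>" for \<sigma>
      using ay[OF that] by (simp add: f_def)
    have ne: "f \<sigma> \<noteq> f \<sigma>'" if "\<beta> \<le> \<sigma>" "\<sigma> < \<sigma>'" for \<sigma> \<sigma>'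
    proof
      assume eq: "f \<sigma> = f \<sigma>'"
      have "fst (f \<sigma>) \<le> ord_succ \<sigma>" using f[OF that(1)] le_less_trans[OF _ less_ord_succ[of \<sigma>]] less_imp_le by blast
      moreover have "ord_succ \<sigma> \<le> \<sigma>'" using that(2) by simp
      moreover have "snd (f \<sigma>) \<in> problems (X (fst (f \<sigma>))) (p (fst (f \<sigma>)))"
        using f[OF that(1)] by (simp add: unsolved_def)
      ultimately have "solved (X \<sigma>') (p \<sigma>') (i (fst (f \<sigma>)) \<sigma>') (snd (f \<sigma>))"
        using persist f[OF that(1)] by blast
      moreover have "\<beta> \<le> \<sigma>'" using that by simp
      ultimately show False using f[OF \<open>\<beta> \<le> \<sigma>'\<close>] eq by (simp add: unsolved_def)
    qed
    have "inj_on f {\<beta>..}"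
    proof (rule inj_onI, rule ccontr)
      fix \<sigma> \<sigma>' assume a: "\<sigma> \<in> {\<beta>..}" "\<sigma>' \<in> {\<beta>..}" "f \<sigma> = f \<sigma>'" "\<sigma> \<noteq> \<sigma>'"
      then show False using ne[of \<sigma> \<sigma>'] ne[of \<sigma>' \<sigma>] by (cases \<sigma> \<sigma>' rule: linorder_cases) auto
    qed
    moreover have "f ` {\<beta>..} \<subseteq> (SIGMA \<alpha>:{..\<beta>}. problems (X \<alpha>) (p \<alpha>))"
    proof (rule image_subsetI)
      fix \<sigma> assume "\<sigma> \<in> {\<beta>..}"
      then show "f \<sigma> \<in> (SIGMA \<alpha>:{..\<beta>}. problems (X \<alpha>) (p \<alpha>))"
        using ay[of \<sigma>] by (simp add: f_def unsolved_def)
    qed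
    moreover have "small U (SIGMA \<alpha>:{..\<beta>}. problems (X \<alpha>) (p \<alpha>))"
      using small_problems by (intro small_Sigma small_atMost)
    ultimately have "small U {\<beta>..}"
      using small_lepoll unfolding lepoll_def by blast
    then obtain \<gamma> where "\<And>\<alpha>. \<alpha> \<in> {\<beta>..} \<Longrightarrow> \<alpha> < \<gamma>" by (rule small_bounded) blast
    then have "\<beta> < \<gamma>" "\<not> \<beta> \<le> \<gamma>" by auto
    then show False by simp
  qed
  have ex_F: "\<exists>\<sigma>. \<forall>\<alpha>\<le>\<beta>. \<alpha> \<le> \<sigma> \<and> ?un \<alpha> \<sigma> = {}" for \<beta>
  proof -
    obtain s where s: "\<And>\<alpha>. \<alpha> \<le> s \<alpha> \<and> ?un \<alpha> (s \<alpha>) = {}" using eventually_solved by metis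
    obtain \<sigma> where "\<And>\<gamma>. \<gamma> \<in> s ` {..\<beta>} \<Longrightarrow> \<gamma> < \<sigma>" using small_bounded[OF small_image[OF small_atMost]] by blast
    then have "s \<alpha> \<le> \<sigma>" if "\<alpha> \<le> \<beta>" for \<alpha> using that by (simp add: less_imp_le)
    then show ?thesis using s persist' by (meson order.trans)
  qed
  \<comment> \<open>From stage \<open>F \<beta>\<close> on, all problems posed up to \<beta> are
    solved. Taking all stages up to \<beta> into account makes \<open>F\<close> monotone, which is
    what the choice of a closed ordinal requires.\<close>
  define F where "F \<beta> = (LEAST \<sigma>. \<forall>\<alpha>\<le>\<beta>. \<alpha> \<le> \<sigma> \<and> ?un \<alpha> \<sigma> = {})" for \<beta>
  have F: "\<alpha> \<le> F \<beta> \<and> ?un \<alpha> (F \<beta>) = {}" if "\<alpha> \<le> \<beta>" for \<alpha> \<beta>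
    using LeastI_ex[OF ex_F[of \<beta>]] that unfolding F_def by blast
  have "mono F"
  proof (rule monoI)
    fix \<alpha> \<beta> :: 'u assume "\<alpha> \<le> \<beta>"
    then have "\<forall>\<gamma>\<le>\<alpha>. \<gamma> \<le> F \<beta> \<and> ?un \<gamma> (F \<beta>) = {}" using F by (meson order.trans)
    then show "F \<alpha> \<le> F \<beta>" unfolding F_def[of \<alpha>] by (rule Least_le)
  qed
  have "\<exists>\<kappa>::'u. kappa_small C (inflations C) \<kappa> (Dom C m)" if "m \<in> \<I>" for m
  proof -
    have "Dom C m \<in> Obj C" using inflation_Hom[of m] I(1) that HomD(4) by blast
    then show ?thesis using objects_small unfolding small_relative_to_def by blast
  qed
  then obtain \<kappa> :: "'m \<Rightarrow> 'u" where \<kappa>: "\<And>m. m \<in> \<I> \<Longrightarrow> kappa_small C (inflations C) (\<kappa> m) (Dom C m)"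
    by metis
  obtain \<mu>0 where \<mu>0: "\<And>\<alpha>. \<alpha> \<in> \<kappa> ` \<I> \<Longrightarrow> \<alpha> < \<mu>0" using small_bounded[OF small_image[OF I(2)]] by blast
  \<comment> \<open>One \<Lambda> has to serve the domains of all maps in \<open>\<I>\<close>, so
    \<mu> exceeds all their smallness bounds; it is infinite so that \<Lambda> becomes a
    limit.\<close>
  obtain \<mu> where \<mu>: "infinite {..<\<mu>}" "\<mu>0 \<le> \<mu>" using ex_infinite_initial by blast
  obtain \<Lambda> where \<Lambda>: "\<mu> \<le> cofinality \<Lambda>" "\<And>\<beta>. \<beta> < \<Lambda> \<Longrightarrow> F \<beta> < \<Lambda>"
    using ex_closed_ordinal_of_large_cofinality[OF \<open>mono F\<close>] by blast
  have lim: "limit_ordinal \<Lambda>" using \<mu>(1) \<Lambda>(1) by (rule limit_if_cofinality_infinite)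
  \<comment> \<open>By smallness a problem at \<Lambda> comes from a problem at some \<beta> <
    \<Lambda>, which is solved at \<open>F \<beta>\<close> and thus before \<Lambda>.\<close>
  have "?un \<Lambda> \<Lambda> = {}"
  proof -
    have "solved (X \<Lambda>) (p \<Lambda>) (i \<Lambda> \<Lambda>) (m, g, h)" if x: "(m, g, h) \<in> problems (X \<Lambda>) (p \<Lambda>)" for m g h
    proof -
      have m: "m \<in> \<I>" and g: "g \<in> Hom C (Dom C m) (X \<Lambda>)" and h: "h \<in> Hom C (Cod C m) N"
        and sq: "p \<Lambda> \<cdot> g = h \<cdot> m"
        using x by (auto simp: problems_def)
      have "\<kappa> m \<le> cofinality \<Lambda>" using \<mu>0[of "\<kappa> m"] m \<mu>(2) \<Lambda>(1) by (meson imageI less_imp_le order.trans)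
      then obtain \<beta> g' where g': "\<beta> < \<Lambda>" "g' \<in> Hom C (Dom C m) (X \<beta>)" "i \<beta> \<Lambda> \<cdot> g' = g"
        using kappa_small_factor[OF \<kappa>[OF m] _ lim ch g] by blast
      note b = less_imp_le[OF g'(1)]
      have "p \<beta> \<cdot> g' = h \<cdot> m" using Comp_assoc[OF g'(2) iHom[OF b] pHom] pComp[OF b] g'(3) sq by simp
      then have x': "(m, g', h) \<in> problems (X \<beta>) (p \<beta>)" using m g'(2) h by (simp add: problems_def)
      then have "solved (X (F \<beta>)) (p (F \<beta>)) (i \<beta> (F \<beta>)) (m, g', h)"
        using F[of \<beta> \<beta>] by (auto simp: unsolved_def)
      then have "solved (X \<Lambda>) (p \<Lambda>) (i \<beta> \<Lambda>) (m, g', h)"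
        using persist[OF _ x'] F[of \<beta> \<beta>] \<Lambda>(2)[OF g'(1)] by (simp add: less_imp_le)
      then show ?thesis
        using g'(3) c(2)[of \<Lambda> \<Lambda>] Id_Comp[OF g] by (simp add: solved_def)
    qed
    then show ?thesis by (auto simp: unsolved_def)
  qed
  \<comment> \<open>The chain is cut off at the first stage that has solved its own problems. Every
    stage before has an open problem, so each step up to \<Theta> attaches a cell and none is a mere
    filler.\<close>
  define \<Theta> where "\<Theta> = (LEAST \<Theta>. ?un \<Theta> \<Theta> = {})"
  have \<Theta>: "?un \<Theta> \<Theta> = {}" unfolding \<Theta>_def using \<open>?un \<Lambda> \<Lambda> = {}\<close> by (rule LeastI)
  have before: "?un \<delta> \<delta> \<noteq> {}" if "\<delta> < \<Theta>" for \<delta>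
    using not_less_Least[of \<delta> "\<lambda>\<Theta>. ?un \<Theta> \<Theta> = {}"] that unfolding \<Theta>_def by blast
  have "chain (pushouts_of C \<I>) \<Theta> X i"
    using ch[of \<Theta>] before Q unfolding chain_def steps_in_def Q_def by auto
  moreover have "has_rlp (p \<Theta>) m" if m: "m \<in> \<I>" for m
  proof -
    have "\<exists>l\<in>Hom C (Cod C m) (X \<Theta>). p \<Theta> \<cdot> l = h \<and> l \<cdot> m = g"
      if g: "g \<in> Hom C (Dom C m) (X \<Theta>)" and h: "h \<in> Hom C (Cod C m) N" and sq: "p \<Theta> \<cdot> g = h \<cdot> m" for g h
    proof -
      have "(m, g, h) \<in> problems (X \<Theta>) (p \<Theta>)" using m g h sq by (simp add: problems_def)
      then have "solved (X \<Theta>) (p \<Theta>) (i \<Theta> \<Theta>) (m, g, h)" using \<Theta> by (auto simp: unsolved_def)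
      then show ?thesis using c(2)[of \<Theta> \<Theta>] Id_Comp[OF g] by (auto simp: solved_def)
    qed
    then show ?thesis using HomD(2,3)[OF pHom[of \<Theta>]] unfolding has_rlp_def by simp
  qed
  ultimately show ?thesis
    using that[of \<Theta> X i "p \<Theta>"] X0 pHom pComp[of ord_zero \<Theta>] p0' by simp
qed

end

section \<open>Cell complexes and filtrations\<close>

context category
begin

lemma pushout_trivial:
  assumes "m \<in> Hom C A B"
  shows "is_pushout C m (Id C A) m (Id C B)"
proof (rule pushoutI[OF assms Id_Hom assms Id_Hom])
  show "Id C B \<cdot> m = m \<cdot> Id C A" using Id_Comp[OF assms] Comp_Id[OF assms] by simp
next
  fix Y a b assume ab: "a \<in> Hom C B Y" "b \<in> Hom C A Y" "a \<cdot> m = b \<cdot> Id C A"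
  then show "\<exists>u\<in>Hom C B Y. u \<cdot> Id C B = a \<and> u \<cdot> m = b"
    using Comp_Id[OF ab(1)] Comp_Id[OF ab(2)] by auto
next
  fix Y u v assume "u \<in> Hom C B Y" "v \<in> Hom C B Y" "u \<cdot> Id C B = v \<cdot> Id C B"
  then show "u = v" using Comp_Id by simp
qed (use HomD(4,5)[OF assms] in auto)

text \<open>A map is a pushout of itself along an identity, and an isomorphism of the target turns a
  pushout into a pushout.\<close>

lemma iso_if_pushout_closed:
  assumes "pushouts_of C M \<subseteq> M" "m \<in> M" "m \<in> Arr C" "iso_between C h (Cod C m) Y"
  shows "h \<cdot> m \<in> M"
proof -
  have "m \<in> pushouts_of C M"
    using pushout_trivial[OF Arr_Hom[OF assms(3)]] assms(2) unfolding pushouts_of_def by blast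
  then show ?thesis using pushouts_of_iso[OF _ assms(4)] assms(1) by blast
qed

section \<open>Coproducts\<close>

lemma coproductD:
  assumes "is_coproduct C J F P e"
  shows "P \<in> Obj C" "j \<in> J \<Longrightarrow> e j \<in> Hom C (F j) P"
  using assms unfolding is_coproduct_def by auto

lemma coproduct_factor:
  assumes "is_coproduct C J F P e" "Y \<in> Obj C" "\<And>j. j \<in> J \<Longrightarrow> f j \<in> Hom C (F j) Y"
  obtains u where "u \<in> Hom C P Y" "\<And>j. j \<in> J \<Longrightarrow> u \<cdot> e j = f j"
proof -
  have "\<exists>!u. u \<in> Hom C P Y \<and> (\<forall>j\<in>J. u \<cdot> e j = f j)"
    using assms unfolding is_coproduct_def by blast
  then show ?thesis using that by blast
qed

lemma coproduct_unique:
  assumes "is_coproduct C J F P e" "u \<in> Hom C P Y" "v \<in> Hom C P Y" "\<And>j. j \<in> J \<Longrightarrow> u \<cdot> e j = v \<cdot> e j"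
  shows "u = v"
proof -
  have ve: "v \<cdot> e j \<in> Hom C (F j) Y" if "j \<in> J" for j
    using coproductD(2)[OF assms(1) that] assms(3) by (rule Comp_Hom)
  have Y: "Y \<in> Obj C" using assms(2) by (rule HomD)
  have all: "\<forall>f. (\<forall>j\<in>J. f j \<in> Hom C (F j) Y) \<longrightarrow> (\<exists>!u. u \<in> Hom C P Y \<and> (\<forall>j\<in>J. u \<cdot> e j = f j))"
    using assms(1) Y unfolding is_coproduct_def by (elim conjE) (erule bspec)
  have "\<exists>!u. u \<in> Hom C P Y \<and> (\<forall>j\<in>J. u \<cdot> e j = v \<cdot> e j)"
    using spec[OF all, of "\<lambda>j. v \<cdot> e j"] ve by simp
  then obtain w where "\<And>x. x \<in> Hom C P Y \<and> (\<forall>j\<in>J. x \<cdot> e j = v \<cdot> e j) \<Longrightarrow> x = w"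
    by (elim ex1E) blast
  from this[of u] this[of v] show ?thesis using assms(2-4) by simp
qed

lemma coproductI:
  assumes "P \<in> Obj C" "\<And>j. j \<in> J \<Longrightarrow> e j \<in> Hom C (F j) P"
    and "\<And>Y f. Y \<in> Obj C \<Longrightarrow> (\<And>j. j \<in> J \<Longrightarrow> f j \<in> Hom C (F j) Y) \<Longrightarrow> \<exists>u\<in>Hom C P Y. \<forall>j\<in>J. u \<cdot> e j = f j"
    and "\<And>Y u v. u \<in> Hom C P Y \<Longrightarrow> v \<in> Hom C P Y \<Longrightarrow> (\<And>j. j \<in> J \<Longrightarrow> u \<cdot> e j = v \<cdot> e j) \<Longrightarrow> u = v"
  shows "is_coproduct C J F P e"
  unfolding is_coproduct_def
proof (intro conjI ballI allI impI)
  fix Y f assume Y: "Y \<in> Obj C" and f: "\<forall>j\<in>J. f j \<in> Hom C (F j) Y"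
  show "\<exists>!u. u \<in> Hom C P Y \<and> (\<forall>j\<in>J. u \<cdot> e j = f j)"
  proof (rule ex_ex1I)
    show "\<exists>u. u \<in> Hom C P Y \<and> (\<forall>j\<in>J. u \<cdot> e j = f j)" using assms(3)[OF Y] f by blast
    show "u = v" if "u \<in> Hom C P Y \<and> (\<forall>j\<in>J. u \<cdot> e j = f j)" "v \<in> Hom C P Y \<and> (\<forall>j\<in>J. v \<cdot> e j = f j)" for u v
      using that by (intro assms(4)[of u Y v]) auto
  qed
qed (use assms(1,2) HomD(4) in blast)+

lemma coproduct_reindex:
  assumes P: "is_coproduct C J F P e" and b: "bij_betw b K J'" and J': "J' \<subseteq> J"
    and zero: "\<And>j. j \<in> J - J' \<Longrightarrow> zero_object C (F j)"
  shows "is_coproduct C K (\<lambda>k. F (b k)) P (\<lambda>k. e (b k))"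
proof (rule coproductI)
  have bK: "b k \<in> J'" if "k \<in> K" for k using b that by (auto simp: bij_betw_def)
  show "P \<in> Obj C" using coproductD(1)[OF P] .
  show "e (b k) \<in> Hom C (F (b k)) P" if "k \<in> K" for k
    using coproductD(2)[OF P] bK[OF that] J' by blast
  {
    fix Y f assume Y: "Y \<in> Obj C" and f: "\<And>k. k \<in> K \<Longrightarrow> f k \<in> Hom C (F (b k)) Y"
    \<comment> \<open>On the dropped summands the choice picks the only map there is.\<close>
    define g where "g j = (if j \<in> J' then f (inv_into K b j) else SOME x. x \<in> Hom C (F j) Y)" for j
    have "g j \<in> Hom C (F j) Y" if "j \<in> J" for j
    proof (cases "j \<in> J'")
      case True
      then have "inv_into K b j \<in> K" "b (inv_into K b j) = j"
        using b by (auto simp: bij_betw_def intro: inv_into_into f_inv_into_f)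
      then show ?thesis using f[of "inv_into K b j"] True by (simp add: g_def)
    next
      case False
      then have "\<exists>x. x \<in> Hom C (F j) Y" using zero_object_ex[OF zero Y] that by blast
      from someI_ex[OF this] show ?thesis using False by (simp add: g_def)
    qed
    then obtain u where u: "u \<in> Hom C P Y" "\<And>j. j \<in> J \<Longrightarrow> u \<cdot> e j = g j"
      using coproduct_factor[OF P Y] by metis
    have "g (b k) = f k" if "k \<in> K" for k
      using b bK[OF that] that by (simp add: g_def bij_betw_def)
    then have "u \<cdot> e (b k) = f k" if "k \<in> K" for k using u(2) bK[OF that] J' that by auto
    then show "\<exists>u\<in>Hom C P Y. \<forall>k\<in>K. u \<cdot> e (b k) = f k" using u(1) by blast
  next
    fix Y u v assume uv: "u \<in> Hom C P Y" "v \<in> Hom C P Y" "\<And>k. k \<in> K \<Longrightarrow> u \<cdot> e (b k) = v \<cdot> e (b k)"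
    show "u = v"
    proof (rule coproduct_unique[OF P uv(1,2)])
      fix j assume j: "j \<in> J"
      note ej = coproductD(2)[OF P j]
      show "u \<cdot> e j = v \<cdot> e j"
      proof (cases "j \<in> J'")
        case True
        then obtain k where "k \<in> K" "b k = j" using b by (auto simp: bij_betw_def)
        then show ?thesis using uv(3) by blast
      next
        case False
        then have "zero_object C (F j)" using zero j by blast
        then show ?thesis using zero_object_unique(1) Comp_Hom[OF ej uv(1)] Comp_Hom[OF ej uv(2)] by blast
      qed
    qed
  }
qed

lemma zero_object_iso:
  assumes "zero_object C Z" "iso_between C f Z P"
  shows "zero_object C P"
proof -
  obtain g where f: "f \<in> Hom C Z P" "g \<in> Hom C P Z" "g \<cdot> f = Id C Z" "f \<cdot> g = Id C P"
    using assms(2) by (rule iso_betweenE)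
  show ?thesis
    unfolding zero_object_def
  proof (intro conjI ballI)
    show "P \<in> Obj C" using f(1) by (rule HomD)
    fix X assume X: "X \<in> Obj C"
    obtain a b where ab: "a \<in> Hom C Z X" "b \<in> Hom C X Z" using zero_object_ex[OF assms(1) X] .
    show "\<exists>!h. h \<in> Hom C P X"
    proof (rule ex_ex1I)
      show "\<exists>h. h \<in> Hom C P X" using Comp_Hom[OF f(2) ab(1)] by blast
      fix u v assume u: "u \<in> Hom C P X" and v: "v \<in> Hom C P X"
      have "u \<cdot> f = v \<cdot> f" using zero_object_unique(1)[OF assms(1) Comp_Hom[OF f(1) u] Comp_Hom[OF f(1) v]] .
      then have "(u \<cdot> f) \<cdot> g = (v \<cdot> f) \<cdot> g" by simp
      then show "u = v"
        using Comp_assoc[OF f(2,1) u] Comp_assoc[OF f(2,1) v] f(4) Comp_Id[OF u] Comp_Id[OF v] by simp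
    qed
    show "\<exists>!h. h \<in> Hom C X P"
    proof (rule ex_ex1I)
      show "\<exists>h. h \<in> Hom C X P" using Comp_Hom[OF ab(2) f(1)] by blast
      fix u v assume u: "u \<in> Hom C X P" and v: "v \<in> Hom C X P"
      have "g \<cdot> u = g \<cdot> v" using zero_object_unique(2)[OF assms(1) Comp_Hom[OF u f(2)] Comp_Hom[OF v f(2)]] .
      then have "f \<cdot> (g \<cdot> u) = f \<cdot> (g \<cdot> v)" by simp
      then show "u = v"
        using Comp_assoc[OF u f(2,1)] Comp_assoc[OF v f(2,1)] f(4) Id_Comp[OF u] Id_Comp[OF v] by simp
    qed
  qed
qed

end

context exact_category
begin

section \<open>Inflations with prescribed cokernels\<close>

lemma cokernel_inclusions:
  "j \<in> inflations_with_cokernel_in C \<S> \<longleftrightarrow> (\<exists>A B q Q. conflation A j B q Q \<and> Q \<in> \<S>)"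
proof
  assume "j \<in> inflations_with_cokernel_in C \<S>"
  then obtain q where "(j, q) \<in> Confl C" "Cod C q \<in> \<S>" unfolding inflations_with_cokernel_in_def by blast
  then show "\<exists>A B q Q. conflation A j B q Q \<and> Q \<in> \<S>" using conflation_Confl by blast
next
  assume "\<exists>A B q Q. conflation A j B q Q \<and> Q \<in> \<S>"
  then obtain A B q Q where c: "conflation A j B q Q" "Q \<in> \<S>" by blast
  have "Cod C q = Q" using conflationD(3)[OF c(1)] by (simp add: Hom_def)
  then show "j \<in> inflations_with_cokernel_in C \<S>"
    using conflationD(1)[OF c(1)] c(2) unfolding inflations_with_cokernel_in_def by blast
qed

lemma inflations_with_cokernel_in_subset: "inflations_with_cokernel_in C \<S> \<subseteq> inflations C"
  using cokernel_inclusions conflationD(8) by blast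

lemma pushouts_of_inflations: "M \<subseteq> inflations C \<Longrightarrow> pushouts_of C M \<subseteq> inflations C"
  unfolding pushouts_of_def using pushout_inflation by blast

text \<open>Pushing out an inflation leaves its cokernel unchanged.\<close>

lemma pushouts_of_inflations_with_cokernel_in:
  "pushouts_of C (inflations_with_cokernel_in C \<S>) \<subseteq> inflations_with_cokernel_in C \<S>"
proof
  fix j assume "j \<in> pushouts_of C (inflations_with_cokernel_in C \<S>)"
  then obtain i g g' where i: "i \<in> inflations_with_cokernel_in C \<S>" and po: "is_pushout C i g j g'"
    unfolding pushouts_of_def by blast
  obtain A B q Q where c: "conflation A i B q Q" "Q \<in> \<S>" using i cokernel_inclusions by blast
  note t = conflationD(2)[OF c(1)]
  have "Dom C g = A" "g \<in> Arr C" using po t by (auto simp: is_pushout_def Hom_def)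
  then have g: "g \<in> Hom C A (Cod C g)" by (simp add: Hom_def)
  obtain p' where "conflation (Cod C g) j (Cod C j) p' Q"
    using pushout_conflation[OF c(1) po g] pushout_Hom[OF po t g] by blast
  then show "j \<in> inflations_with_cokernel_in C \<S>" using c(2) cokernel_inclusions by blast
qed

lemma isomorphic_refl: "X \<in> Obj C \<Longrightarrow> isomorphic C X X"
  unfolding isomorphic_def using iso_between_Id by blast

lemma pushouts_of_subset_inflations_with_cokernel_in:
  assumes "\<I> \<subseteq> inflations C"
  shows "pushouts_of C \<I> \<subseteq> inflations_with_cokernel_in C (Coker C \<I>)"
proof -
  have "\<I> \<subseteq> inflations_with_cokernel_in C (Coker C \<I>)"
  proof
    fix i assume i: "i \<in> \<I>"
    then obtain p S where c: "conflation (Dom C i) i (Cod C i) p S"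
      using conflation_if_inflation inflation_Hom assms by blast
    note d = conflationD[OF c]
    have "Cod C p = S" using d(3) by (simp add: Hom_def)
    then have "S \<in> Coker C \<I>"
      unfolding Coker_def using i d(10) isomorphic_refl[OF d(7)] by blast
    then show "i \<in> inflations_with_cokernel_in C (Coker C \<I>)" using c cokernel_inclusions by blast
  qed
  then have "pushouts_of C \<I> \<subseteq> pushouts_of C (inflations_with_cokernel_in C (Coker C \<I>))"
    unfolding pushouts_of_def by blast
  then show ?thesis using pushouts_of_inflations_with_cokernel_in by blast
qed

text \<open>In the diagram that a strongly homological set provides, the map of cokernels is an
  identity, so the left square is a pushout.\<close>

lemma inflations_with_cokernel_in_subset_pushouts_of:
  assumes "strongly_homological U C \<I>"
  shows "inflations_with_cokernel_in C (Coker C \<I>) \<subseteq> pushouts_of C \<I>"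
proof
  fix j assume "j \<in> inflations_with_cokernel_in C (Coker C \<I>)"
  then obtain q where q: "(j, q) \<in> Confl C" "Cod C q \<in> Coker C \<I>"
    unfolding inflations_with_cokernel_in_def by blast
  then obtain i q' a b where i: "i \<in> \<I>" "(i, q') \<in> Confl C" "Cod C q' = Cod C q"
    "a \<in> Hom C (Dom C i) (Dom C j)" "b \<in> Hom C (Cod C i) (Cod C j)" "b \<cdot> i = j \<cdot> a" "q \<cdot> b = q'"
    using assms unfolding strongly_homological_def by metis
  have "is_pushout C i a j b"
    using pushout_if_same_cokernel[OF conflation_Confl[OF i(2), unfolded i(3)] conflation_Confl[OF q(1)] i(4-7)] .
  then show "j \<in> pushouts_of C \<I>" using i(1) unfolding pushouts_of_def by blast
qed

lemma Coker_Obj: "S \<in> Coker C \<I> \<Longrightarrow> S \<in> Obj C"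
  unfolding Coker_def isomorphic_def iso_between_def using HomD(4) by blast

text \<open>A cokernel of \<open>i\<close> is a pushout of \<open>i\<close> along the map to zero,
  so up to isomorphism \<open>S\<close> is obtained from zero by attaching a single cell.\<close>

lemma Coker_pushout:
  assumes "S \<in> Coker C \<I>" "zero_object C Z"
  shows "Zero C Z S \<in> pushouts_of C \<I>"
proof -
  obtain i p h where i: "i \<in> \<I>" "is_cokernel C i p" "iso_between C h S (Cod C p)"
    using assms(1) unfolding Coker_def isomorphic_def by blast
  note t = cokernel_Hom[OF i(2)]
  have "Zero C Z (Cod C p) \<in> pushouts_of C \<I>"
    using cokernel_pushout[OF i(2) t assms(2)] i(1) unfolding pushouts_of_def by blast
  moreover obtain h' where h': "iso_between C h' (Cod C p) S" using i(3) by (rule iso_betweenE)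
  moreover have P: "Cod C p \<in> Obj C" "Z \<in> Obj C" "S \<in> Obj C"
    using HomD(5)[OF t(2)] zero_object_Obj[OF assms(2)] HomD(5)[OF iso_between_Hom[OF h']] by auto
  ultimately have "h' \<cdot> Zero C Z (Cod C p) \<in> pushouts_of C \<I>"
    using pushouts_of_iso[of "Zero C Z (Cod C p)"] by (simp add: Zero_Arr)
  then show ?thesis using Comp_Zero_right[OF iso_between_Hom[OF h'] P(2)] by simp
qed

section \<open>Orthogonal classes\<close>

lemma right_perpD: "T \<in> right_perp C \<S> \<Longrightarrow> T \<in> Obj C" "T \<in> right_perp C \<S> \<Longrightarrow> S \<in> \<S> \<Longrightarrow> Ext1_vanishes C S T"
  by (auto simp: right_perp_def)

lemma left_perpD: "X \<in> left_perp C \<T> \<Longrightarrow> X \<in> Obj C" "X \<in> left_perp C \<T> \<Longrightarrow> T \<in> \<T> \<Longrightarrow> Ext1_vanishes C X T"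
  by (auto simp: left_perp_def)

lemma right_perp_antimono: "\<S> \<subseteq> \<S>' \<Longrightarrow> right_perp C \<S>' \<subseteq> right_perp C \<S>"
  by (auto simp: right_perp_def)

lemma Ext1_vanishesI:
  assumes "X \<in> Obj C" "T \<in> Obj C"
    and "\<And>k E p. conflation T k E p X \<Longrightarrow> \<exists>s\<in>Hom C X E. p \<cdot> s = Id C X"
  shows "Ext1_vanishes C X T"
  using assms Ext1_vanishes_iff by blast

text \<open>The coprojections lift to the middle term one by one, and the lifts assemble to a
  section.\<close>

lemma Ext1_vanishes_coproduct:
  assumes P: "is_coproduct C J F P e" and "T \<in> Obj C" and vanish: "\<And>j. j \<in> J \<Longrightarrow> Ext1_vanishes C (F j) T"
  shows "Ext1_vanishes C P T"
proof (rule Ext1_vanishesI[OF coproductD(1)[OF P] \<open>T \<in> Obj C\<close>])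
  fix k E p assume c: "conflation T k E p P"
  note d = conflationD[OF c]
  have "\<exists>l\<in>Hom C (F j) E. p \<cdot> l = e j" if j: "j \<in> J" for j
    using lift_if_Ext1_vanishes[OF c vanish[OF j] coproductD(2)[OF P j]] by blast
  then obtain l where l: "\<And>j. j \<in> J \<Longrightarrow> l j \<in> Hom C (F j) E \<and> p \<cdot> l j = e j" by metis
  obtain u where u: "u \<in> Hom C P E" "\<And>j. j \<in> J \<Longrightarrow> u \<cdot> e j = l j"
    using coproduct_factor[OF P d(6), of l] l by blast
  have "p \<cdot> u = Id C P"
  proof (rule coproduct_unique[OF P Comp_Hom[OF u(1) d(3)] Id_Hom[OF d(7)]])
    fix j assume j: "j \<in> J"
    note ej = coproductD(2)[OF P j]
    show "p \<cdot> u \<cdot> e j = Id C P \<cdot> e j"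
      using Comp_assoc[OF ej u(1) d(3)] u(2)[OF j] l[OF j] Id_Comp[OF ej] by simp
  qed
  then show "\<exists>s\<in>Hom C P E. p \<cdot> s = Id C P" using u(1) by blast
qed

text \<open>A section is found in two stages: over \<open>P\<close> by vanishing for
  \<open>P\<close>, then extended along the inflation \<open>x\<close> by vanishing for its
  cokernel.\<close>

lemma Ext1_vanishes_extension:
  assumes c: "conflation P x X q S" and "T \<in> Obj C" "Ext1_vanishes C P T" "Ext1_vanishes C S T"
  shows "Ext1_vanishes C X T"
proof (rule Ext1_vanishesI[OF conflationD(6)[OF c] \<open>T \<in> Obj C\<close>])
  fix k E p assume e: "conflation T k E p X"
  note d = conflationD[OF c]
  obtain l where l: "l \<in> Hom C P E" "p \<cdot> l = x"
    using lift_if_Ext1_vanishes[OF e assms(3) d(2)] .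
  have "p \<cdot> l = Id C X \<cdot> x" using l(2) Id_Comp[OF d(2)] by simp
  then obtain s where "s \<in> Hom C X E" "p \<cdot> s = Id C X"
    using lifting[OF e c assms(4) l(1) Id_Hom[OF d(6)]] by blast
  then show "\<exists>s\<in>Hom C X E. p \<cdot> s = Id C X" by blast
qed

text \<open>The projection \<open>p1\<close> lifts to the middle term, and restricting the lift
  along \<open>i1\<close> gives the section.\<close>

lemma Ext1_vanishes_summand:
  assumes "direct_summand C X F" "T \<in> Obj C" "Ext1_vanishes C F T"
  shows "Ext1_vanishes C X T"
proof -
  obtain Y i1 i2 p1 p2 where b: "i1 \<in> Hom C X F" "p1 \<in> Hom C F X" "p1 \<cdot> i1 = Id C X"
    using assms(1) unfolding direct_summand_def is_biproduct_def by blast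
  show ?thesis
  proof (rule Ext1_vanishesI[OF HomD(4)[OF b(1)] assms(2)])
    fix k E p assume c: "conflation T k E p X"
    obtain l where l: "l \<in> Hom C F E" "p \<cdot> l = p1" using lift_if_Ext1_vanishes[OF c assms(3) b(2)] .
    have "p \<cdot> (l \<cdot> i1) = Id C X" using Comp_assoc[OF b(1) l(1) conflationD(3)[OF c]] l(2) b(3) by simp
    then show "\<exists>s\<in>Hom C X E. p \<cdot> s = Id C X" using Comp_Hom[OF b(1) l(1)] by blast
  qed
qed

lemma direct_summand_if_section:
  assumes "conflation T k E p X" "s \<in> Hom C X E" "p \<cdot> s = Id C X"
  shows "direct_summand C X E"
proof -
  note d = conflationD[OF assms(1)]
  obtain r where "r \<in> Hom C E T" "r \<cdot> k = Id C T" "r \<cdot> s = Zero C X T" "(s \<cdot> p) \<oplus> (k \<cdot> r) = Id C E"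
    using retraction_if_section[OF assms] .
  then have "is_biproduct C X T E s k p r"
    using assms d unfolding is_biproduct_def by simp
  then show ?thesis unfolding direct_summand_def using d(5) by blast
qed

end

section \<open>Cellular objects\<close>

context efficient_category
begin

text \<open>Common form of cell complexes and filtered objects, so that their closure properties are
  proved once for a class \<open>M\<close> closed under pushouts.\<close>

definition cellular_objects :: "'m set \<Rightarrow> 'o set" where
  "cellular_objects M = {X. \<exists>Z f. zero_object C Z \<and> f \<in> Hom C Z X \<and> transfinite_composition U C M f}"

lemma Cells_eq: "Cells U C \<I> = cellular_objects (pushouts_of C \<I>)"
  by (simp add: Cells_def cellular_objects_def relative_cell_complex_def)

lemma Filt_eq: "Filt U C \<S> = cellular_objects (inflations_with_cokernel_in C \<S>)"
  by (simp add: Filt_def cellular_objects_def)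

lemma cellular_objects_Obj: "X \<in> cellular_objects M \<Longrightarrow> X \<in> Obj C"
  unfolding cellular_objects_def using HomD(5) by blast

lemma cellular_objects_mono: "M \<subseteq> M' \<Longrightarrow> cellular_objects M \<subseteq> cellular_objects M'"
  unfolding cellular_objects_def using transfinite_composition_subset by blast

text \<open>A square that starts at a zero object commutes automatically, so lifting against 0 -> X
  means lifting a map out of \<open>X\<close>.\<close>

lemma cellular_lift:
  assumes "X \<in> cellular_objects M" "\<And>m. m \<in> M \<Longrightarrow> has_rlp p m" "p \<in> Hom C E D" "h \<in> Hom C X D"
  obtains l where "l \<in> Hom C X E" "p \<cdot> l = h"
proof -
  obtain Z f where Z: "zero_object C Z" "f \<in> Hom C Z X" "transfinite_composition U C M f"
    using assms(1) unfolding cellular_objects_def by blast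
  note ED = HomD(4,5)[OF assms(3)] and ZO = zero_object_Obj[OF Z(1)]
  have g: "Zero C Z E \<in> Hom C Z E" using ZO ED(1) by (rule Zero_Hom)
  have "p \<cdot> Zero C Z E = h \<cdot> f"
    using zero_object_unique(1)[OF Z(1) Comp_Hom[OF g assms(3)] Comp_Hom[OF Z(2) assms(4)]] .
  then show ?thesis
    using has_rlpD[OF has_rlp_transfinite_composition[OF assms(2,3) Z(3)] assms(3) Z(2) g assms(4)] that by blast
qed

text \<open>Eklof's lemma: the section of an extension is a lift of the identity of
  \<open>X\<close>.\<close>

lemma Ext1_vanishes_if_filtered:
  assumes "T \<in> right_perp C \<S>" "X \<in> Filt U C \<S>"
  shows "Ext1_vanishes C X T"
proof (rule Ext1_vanishesI)
  show X: "X \<in> Obj C" using assms(2) cellular_objects_Obj unfolding Filt_eq by blast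
  show "T \<in> Obj C" using assms(1) by (rule right_perpD)
  fix k E p assume c: "conflation T k E p X"
  note d = conflationD[OF c]
  have "has_rlp p m" if "m \<in> inflations_with_cokernel_in C \<S>" for m
  proof -
    obtain A B q Q where m: "conflation A m B q Q" "Q \<in> \<S>" using \<open>m \<in> _\<close> cokernel_inclusions by blast
    have "\<exists>l\<in>Hom C B E. p \<cdot> l = h \<and> l \<cdot> m = g"
      if "g \<in> Hom C A E" "h \<in> Hom C B X" "p \<cdot> g = h \<cdot> m" for g h
      using lifting[OF c m(1) right_perpD(2)[OF assms(1) m(2)] that] by blast
    then show ?thesis
      using conflationD(2)[OF m(1)] d(3) unfolding has_rlp_def by (simp add: HomD(2,3)[OF conflationD(2)[OF m(1)]] HomD(2,3)[OF d(3)])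
  qed
  then show "\<exists>s\<in>Hom C X E. p \<cdot> s = Id C X"
    using cellular_lift[OF assms(2)[unfolded Filt_eq] _ d(3) Id_Hom[OF X]] by blast
qed

text \<open>
  Isomorphisms are excluded because \<open>chain_refine\<close> needs inner chains of positive length.
\<close>

definition proper_compositions :: "'m set \<Rightarrow> 'm set" where
  "proper_compositions M = {n. transfinite_composition U C M n \<and> \<not> iso_between C n (Dom C n) (Cod C n)}"

text \<open>Properness rules out the isomorphism alternative of
  \<open>chain_if_transfinite_composition\<close>, so each step of the chain expands to an inner
  chain of positive length.\<close>

lemma transfinite_composition_refine:
  assumes M: "M \<subseteq> inflations C" "pushouts_of C M \<subseteq> M" and ch: "chain (proper_compositions M) \<Lambda> P j"
  shows "transfinite_composition U C M (j ord_zero \<Lambda>)"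
proof -
  have inner: "\<exists>\<Theta> X i. ord_zero < \<Theta> \<and> chain M \<Theta> X i \<and> X ord_zero = Dom C n \<and> X \<Theta> = Cod C n \<and> i ord_zero \<Theta> = n"
    if "n \<in> proper_compositions M" for n
  proof -
    have n: "transfinite_composition U C M n" "\<not> iso_between C n (Dom C n) (Cod C n)"
      using that by (auto simp: proper_compositions_def)
    have iso: "h \<cdot> m \<in> M" if "m \<in> M" "iso_between C h (Cod C m) Y" for m h Y
    proof -
      have "m \<in> Arr C" using that(1) M(1) inflation_Hom HomD(1) by blast
      then show ?thesis using iso_if_pushout_closed[OF M(2) that(1) _ that(2)] by blast
    qed
    show ?thesis
    proof (rule chain_if_transfinite_composition[OF n(1) Arr_Hom[OF transfinite_composition_Arr[OF n(1)]]])
      show "h \<cdot> m \<in> M" if "m \<in> M" "iso_between C h (Cod C m) Y" for m h Y using that by (rule iso)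
    qed (use n(2) in blast)+
  qed
  obtain \<Theta> X i where "chain M \<Theta> X i" "i ord_zero \<Theta> = j ord_zero \<Lambda>"
    using chain_refine[OF ch inner] by metis
  then show ?thesis using transfinite_composition_if_chain by metis
qed

text \<open>The maps 0 -> P -> X form a chain with two steps, which is refined. If \<open>g\<close>
  is an isomorphism it is absorbed into the composition 0 -> P; if 0 -> P is one, then
  \<open>P\<close> is itself zero and \<open>g\<close> already presents \<open>X\<close>.\<close>

lemma cellular_objects_extend:
  assumes M: "M \<subseteq> inflations C" "pushouts_of C M \<subseteq> M"
    and P: "P \<in> cellular_objects M" and g: "transfinite_composition U C M g" "g \<in> Hom C P X"
  shows "X \<in> cellular_objects M"
proof -
  obtain Z f where Z: "zero_object C Z" "f \<in> Hom C Z P" "transfinite_composition U C M f"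
    using P unfolding cellular_objects_def by blast
  have gf: "g \<cdot> f \<in> Hom C Z X" using Z(2) g(2) by (rule Comp_Hom)
  consider (iso_g) "iso_between C g P X" | (iso_f) "iso_between C f Z P"
    | (none) "f \<in> proper_compositions M" "g \<in> proper_compositions M"
    using Z(2,3) g HomD(2,3)[OF Z(2)] HomD(2,3)[OF g(2)] unfolding proper_compositions_def by auto
  then show ?thesis
  proof cases
    case iso_g
    then have "transfinite_composition U C M (g \<cdot> f)"
      using transfinite_composition_iso[OF Z(3)] HomD(3)[OF Z(2)] by simp
    then show ?thesis unfolding cellular_objects_def using Z(1) gf by blast
  next
    case iso_f
    then have "zero_object C P" by (rule zero_object_iso[OF Z(1)])
    then show ?thesis unfolding cellular_objects_def using g by blast
  next
    case none
    let ?N = "proper_compositions M" and ?o = "ord_succ ord_zero :: 'u"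
    obtain P1 j1 where c1: "chain ?N ?o P1 j1" "P1 ?o = P" "j1 ord_zero ?o = f \<cdot> Id C Z"
      using chain_succ[OF chain_trivial[OF zero_object_Obj[OF Z(1)]] none(1) Z(2)] by (metis order.refl)
    have g1: "g \<in> Hom C (P1 ?o) X" using g(2) c1(2) by simp
    obtain P2 j2 where c2: "chain ?N (ord_succ ?o) P2 j2" "j2 ord_zero (ord_succ ?o) = g \<cdot> j1 ord_zero ?o"
      using chain_succ[OF c1(1) none(2) g1] by (metis ord_zero_le)
    have "transfinite_composition U C M (g \<cdot> f)"
      using transfinite_composition_refine[OF M c2(1)] c2(2) c1(3) Comp_Id[OF Z(2)] by simp
    then show ?thesis unfolding cellular_objects_def using Z(1) gf by blast
  qed
qed

text \<open>The summands are attached one after another: each step pushes 0 -> G \<delta> out along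
  the zero map, which adds \<open>G \<delta>\<close> as a direct summand. The resulting chain of
  compositions is refined, and its end is identified with the coproduct.\<close>

lemma cellular_objects_coproduct:
  fixes J :: "'u set"
  assumes M: "M \<subseteq> inflations C" "pushouts_of C M \<subseteq> M"
    and "small U J" "is_coproduct C J F P e" and F: "\<And>j. j \<in> J \<Longrightarrow> F j \<in> cellular_objects M"
  shows "P \<in> cellular_objects M"
proof -
  \<comment> \<open>Attaching a zero summand would be an isomorphism, which the refinement cannot
    accommodate.\<close>
  define J' where "J' = {j \<in> J. \<not> zero_object C (F j)}"
  have "small U J'" using \<open>small U J\<close> by (rule small_subset) (auto simp: J'_def)
  moreover have "wfp ((<) :: 'u \<Rightarrow> 'u \<Rightarrow> bool)" unfolding wfp_def by (rule wf)
  ultimately obtain \<Lambda> :: 'u and b where b: "bij_betw b {..<\<Lambda>} J'"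
    by (rule ordinal_enumeration) auto
  define G E where "G k = F (b k)" and "E k = e (b k)" for k
  have co: "is_coproduct C {..<\<Lambda>} G P E"
    using coproduct_reindex[OF assms(4) b] unfolding G_def E_def J'_def by blast
  note P = coproductD(1)[OF co]
  have bJ: "b k \<in> J'" if "k < \<Lambda>" for k using b that by (auto simp: bij_betw_def)
  have G: "G k \<in> cellular_objects M" "\<not> zero_object C (G k)" if "k < \<Lambda>" for k
    using bJ[OF that] F by (auto simp: G_def J'_def)
  have E: "E k \<in> Hom C (G k) P" if "k < \<Lambda>" for k using coproductD(2)[OF co] that by simp
  have "\<exists>Z f. zero_object C Z \<and> f \<in> Hom C Z (G k) \<and> transfinite_composition U C M f" if "k < \<Lambda>" for k
    using G(1)[OF that] unfolding cellular_objects_def by blast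
  then obtain Z f where Z: "\<And>k. k < \<Lambda> \<Longrightarrow> zero_object C (Z k)" and f: "\<And>k. k < \<Lambda> \<Longrightarrow> f k \<in> Hom C (Z k) (G k)"
    and tc: "\<And>k. k < \<Lambda> \<Longrightarrow> transfinite_composition U C M (f k)"
    by metis
  have fI: "f k \<in> inflations C" if "k < \<Lambda>" for k
    using transfinite_composition_subset[OF tc[OF that] M(1)] by (rule transfinite_composition_inflation)
  obtain A where A: "zero_object C A" using ex_zero_object by blast
  \<comment> \<open>The step attaches the summand with index \<delta>, and the map to
    \<open>P\<close> restricts to the coprojection on it; from \<Lambda> on the steps are
    unconstrained.\<close>
  define Q where "Q \<delta> X (i :: 'u \<Rightarrow> 'u \<Rightarrow> 'm) (p :: 'u \<Rightarrow> 'm) s t \<longleftrightarrow> (\<delta> < \<Lambda> \<longrightarrow>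
      (\<exists>w. is_pushout C (f \<delta>) (Zero C (Z \<delta>) (X \<delta>)) s w \<and> t \<cdot> w = E \<delta>))" for \<delta> X i p s t
  obtain X i p where X0: "X ord_zero = A" and p0: "p ord_zero = Zero C A P"
    and ch: "\<And>\<Theta>. chain (inflations C) \<Theta> X i" and k: "\<And>\<Lambda>. is_cocone C \<Lambda> X i P p"
    and Q: "\<And>\<delta>. Q \<delta> X i p (i \<delta> (ord_succ \<delta>)) (p (ord_succ \<delta>))"
  proof (rule transfinite_construction[OF Zero_Hom[OF zero_object_Obj[OF A] P] ex_colimit, where Q = Q])
    fix \<delta> and s t :: 'm and X X' :: "'u \<Rightarrow> 'o" and i i' :: "'u \<Rightarrow> 'u \<Rightarrow> 'm" and p p' :: "'u \<Rightarrow> 'm"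
    assume "\<And>\<alpha>. \<alpha> \<le> \<delta> \<Longrightarrow> X \<alpha> = X' \<alpha>"
    from this[of \<delta>] show "Q \<delta> X i p s t = Q \<delta> X' i' p' s t" by (simp add: Q_def)
  next
    fix \<delta> and X :: "'u \<Rightarrow> 'o" and i p
    assume ch: "chain (inflations C) \<delta> X i" and k: "is_cocone C (ord_succ \<delta>) X i P p"
    have X\<delta>: "X \<delta> \<in> Obj C" and p\<delta>: "p \<delta> \<in> Hom C (X \<delta>) P"
      using chainD(1)[OF ch, of \<delta>] is_coconeD(2)[OF k, of \<delta>] by auto
    show "\<exists>Y. \<exists>s\<in>inflations C \<inter> Hom C (X \<delta>) Y. \<exists>t\<in>Hom C Y P. t \<cdot> s = p \<delta> \<and> Q \<delta> X i p s t"
    proof (cases "\<delta> < \<Lambda>")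
      case False
      then show ?thesis
        using Id_inflation[OF X\<delta>] Id_Hom[OF X\<delta>] p\<delta> Comp_Id[OF p\<delta>] unfolding Q_def by blast
    next
      case \<delta>: True
      have z: "Zero C (Z \<delta>) (X \<delta>) \<in> Hom C (Z \<delta>) (X \<delta>)" using zero_object_Obj[OF Z[OF \<delta>]] X\<delta> by (rule Zero_Hom)
      have "Dom C (Zero C (Z \<delta>) (X \<delta>)) = Dom C (f \<delta>)" using HomD(2)[OF z] HomD(2)[OF f[OF \<delta>]] by simp
      then obtain s w where po: "is_pushout C (f \<delta>) (Zero C (Z \<delta>) (X \<delta>)) s w"
        using inflation_pushout[OF fI[OF \<delta>] HomD(1)[OF z]] by blast
      note t = pushout_Hom[OF po f[OF \<delta>] z]
      have "E \<delta> \<cdot> f \<delta> = p \<delta> \<cdot> Zero C (Z \<delta>) (X \<delta>)"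
        using zero_object_unique(1)[OF Z[OF \<delta>] Comp_Hom[OF f[OF \<delta>] E[OF \<delta>]] Comp_Hom[OF z p\<delta>]] .
      then obtain u where u: "u \<in> Hom C (Cod C s) P" "u \<cdot> w = E \<delta>" "u \<cdot> s = p \<delta>"
        using pushout_factor[OF po f[OF \<delta>] z t(1) E[OF \<delta>] p\<delta>] by blast
      have "s \<in> inflations C" using po fI[OF \<delta>] by (rule pushout_inflation)
      moreover have "Q \<delta> X i p s u" unfolding Q_def using po u(2) by blast
      ultimately show ?thesis using t(1) u by blast
    qed
  next
    fix X i p
    assume "X ord_zero = A" "p ord_zero = Zero C A P" "\<And>\<Theta>. chain (inflations C) \<Theta> X i"
      "\<And>\<Lambda>. is_cocone C \<Lambda> X i P p" "\<And>\<delta>. Q \<delta> X i p (i \<delta> (ord_succ \<delta>)) (p (ord_succ \<delta>))"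
    then show thesis by (rule that)
  qed
  note c = chainD[OF ch] and kt = is_coconeD[OF k]
  have XObj: "X \<alpha> \<in> Obj C" for \<alpha> using c(1)[of \<alpha> \<alpha>] by simp
  have iHom: "i \<alpha> \<beta> \<in> Hom C (X \<alpha>) (X \<beta>)" if "\<alpha> \<le> \<beta>" for \<alpha> \<beta> using c(3)[OF order.refl that] .
  have iComp: "i \<beta> \<gamma> \<cdot> i \<alpha> \<beta> = i \<alpha> \<gamma>" if "\<alpha> \<le> \<beta>" "\<beta> \<le> \<gamma>" for \<alpha> \<beta> \<gamma> using c(4)[OF order.refl that(2,1)] .
  have pHom: "p \<alpha> \<in> Hom C (X \<alpha>) P" for \<alpha> using kt(2)[of \<alpha> "ord_succ \<alpha>"] by simp
  have pComp: "p \<beta> \<cdot> i \<alpha> \<beta> = p \<alpha>" if "\<alpha> \<le> \<beta>" for \<alpha> \<beta> using kt(3)[of \<beta> "ord_succ \<beta>" \<alpha>] that by simp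
  have le_succ: "\<delta> \<le> ord_succ \<delta>" for \<delta> :: 'u by (simp add: less_imp_le)
  obtain w where po: "\<And>\<delta>. \<delta> < \<Lambda> \<Longrightarrow> is_pushout C (f \<delta>) (Zero C (Z \<delta>) (X \<delta>)) (i \<delta> (ord_succ \<delta>)) (w \<delta>)"
    and pw: "\<And>\<delta>. \<delta> < \<Lambda> \<Longrightarrow> p (ord_succ \<delta>) \<cdot> w \<delta> = E \<delta>"
    using Q unfolding Q_def by metis
  have z: "Zero C (Z \<delta>) (X \<delta>) \<in> Hom C (Z \<delta>) (X \<delta>)" if "\<delta> < \<Lambda>" for \<delta>
    using zero_object_Obj[OF Z[OF that]] XObj by (rule Zero_Hom)
  have wHom: "w \<delta> \<in> Hom C (G \<delta>) (X (ord_succ \<delta>))" if "\<delta> < \<Lambda>" for \<delta>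
    using pushout_Hom(2)[OF po[OF that] f[OF that] z[OF that]] HomD(3)[OF iHom[OF le_succ]] by simp
  have proper: "i \<delta> (ord_succ \<delta>) \<in> proper_compositions M" if \<delta>: "\<delta> < \<Lambda>" for \<delta>
  proof -
    note s = iHom[OF le_succ, of \<delta>]
    have GO: "G \<delta> \<in> Obj C" using f[OF \<delta>] by (rule HomD)
    note zX = Zero_Hom[OF XObj GO, of \<delta>]
    have "transfinite_composition U C M (i \<delta> (ord_succ \<delta>))"
      using tc[OF \<delta>] po[OF \<delta>] M by (rule transfinite_composition_pushout)
    moreover have False if iso: "iso_between C (i \<delta> (ord_succ \<delta>)) (X \<delta>) (X (ord_succ \<delta>))"
    proof -
      obtain i' where i': "i' \<in> Hom C (X (ord_succ \<delta>)) (X \<delta>)" "i \<delta> (ord_succ \<delta>) \<cdot> i' = Id C (X (ord_succ \<delta>))"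
        using iso by (rule iso_betweenE)
      \<comment> \<open>The pushout retracts onto the new summand by a map \<open>r\<close> that is
        zero on the old stage. If the step were an isomorphism, \<open>r\<close> would be zero
        altogether and the summand a zero object.\<close>
      have "Id C (G \<delta>) \<cdot> f \<delta> = Zero C (X \<delta>) (G \<delta>) \<cdot> Zero C (Z \<delta>) (X \<delta>)"
        using zero_object_unique(1)[OF Z[OF \<delta>] Comp_Hom[OF f[OF \<delta>] Id_Hom[OF GO]] Comp_Hom[OF z[OF \<delta>] zX]] .
      then obtain r where r: "r \<in> Hom C (X (ord_succ \<delta>)) (G \<delta>)" "r \<cdot> w \<delta> = Id C (G \<delta>)"
        "r \<cdot> i \<delta> (ord_succ \<delta>) = Zero C (X \<delta>) (G \<delta>)"
        using pushout_factor[OF po[OF \<delta>] f[OF \<delta>] z[OF \<delta>] s Id_Hom[OF GO] zX] by blast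
      have "r = Zero C (X (ord_succ \<delta>)) (G \<delta>)"
        using Comp_assoc[OF i'(1) s r(1)] i'(2) r(3) Comp_Id[OF r(1)] Comp_Zero_left[OF i'(1) GO] by simp
      then have "Id C (G \<delta>) = Zero C (G \<delta>) (G \<delta>)" using r(2) Comp_Zero_left[OF wHom[OF \<delta>] GO] by simp
      then show False using zero_object_if_Id_eq_Zero[OF GO] G(2)[OF \<delta>] by blast
    qed
    ultimately show ?thesis
      using HomD(2,3)[OF s] by (auto simp: proper_compositions_def)
  qed
  have "chain (proper_compositions M) \<Lambda> X i"
    using ch[of \<Lambda>] proper unfolding chain_def steps_in_def by simp
  then have tcX: "transfinite_composition U C M (i ord_zero \<Lambda>)" by (rule transfinite_composition_refine[OF M])
  \<comment> \<open>These are the coprojections into the last stage; they induce the inverse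
    \<open>u\<close> of \<open>p \<Lambda>\<close>.\<close>
  define E' where "E' \<delta> = i (ord_succ \<delta>) \<Lambda> \<cdot> w \<delta>" for \<delta>
  have E': "E' \<delta> \<in> Hom C (G \<delta>) (X \<Lambda>)" if "\<delta> < \<Lambda>" for \<delta>
    unfolding E'_def using wHom[OF that] iHom[of "ord_succ \<delta>" \<Lambda>] that by (auto intro: Comp_Hom)
  have pE': "p \<Lambda> \<cdot> E' \<delta> = E \<delta>" if "\<delta> < \<Lambda>" for \<delta>
    unfolding E'_def
    using Comp_assoc[OF wHom[OF that] iHom pHom, of \<Lambda>] pComp[of "ord_succ \<delta>" \<Lambda>] pw[OF that] that by simp
  obtain u where u: "u \<in> Hom C P (X \<Lambda>)" "\<And>\<delta>. \<delta> < \<Lambda> \<Longrightarrow> u \<cdot> E \<delta> = E' \<delta>"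
    using coproduct_factor[OF co XObj, of E'] E' by (metis lessThan_iff)
  have pu: "p \<Lambda> \<cdot> u = Id C P"
  proof (rule coproduct_unique[OF co Comp_Hom[OF u(1) pHom] Id_Hom[OF P]])
    fix \<delta> assume "\<delta> \<in> {..<\<Lambda>}"
    then have \<delta>: "\<delta> < \<Lambda>" by simp
    show "p \<Lambda> \<cdot> u \<cdot> E \<delta> = Id C P \<cdot> E \<delta>"
      using Comp_assoc[OF E[OF \<delta>] u(1) pHom] u(2)[OF \<delta>] pE'[OF \<delta>] Id_Comp[OF E[OF \<delta>]] by simp
  qed
  have up: "u \<cdot> p \<Lambda> \<in> Hom C (X \<Lambda>) (X \<Lambda>)" using pHom u(1) by (rule Comp_Hom)
  \<comment> \<open>The composite is compared with the identity stage by stage: a successor stage is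
    determined by the previous stage and the new summand, a limit stage by the earlier ones.\<close>
  have "(u \<cdot> p \<Lambda>) \<cdot> i \<alpha> \<Lambda> = i \<alpha> \<Lambda>" if "\<alpha> \<le> \<Lambda>" for \<alpha>
    using that
  proof (induction \<alpha> rule: less_induct)
    case (less \<alpha>)
    note i\<alpha> = iHom[OF less.prems]
    show ?case
    proof (cases \<alpha> rule: ordinal_cases)
      case zero
      then have "zero_object C (X \<alpha>)" using A X0 by simp
      then show ?thesis using zero_object_unique(1) Comp_Hom[OF i\<alpha> up] i\<alpha> by blast
    next
      case (succ \<delta>)
      then have \<delta>: "\<delta> < \<Lambda>" using less.prems by simp
      note s = iHom[OF le_succ, of \<delta>]
      have i\<alpha>: "i (ord_succ \<delta>) \<Lambda> \<in> Hom C (X (ord_succ \<delta>)) (X \<Lambda>)" using i\<alpha> succ by simp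
      have "(u \<cdot> p \<Lambda>) \<cdot> i (ord_succ \<delta>) \<Lambda> = i (ord_succ \<delta>) \<Lambda>"
      proof (rule pushout_unique[OF po[OF \<delta>] s Comp_Hom[OF i\<alpha> up] i\<alpha>])
        have "(u \<cdot> p \<Lambda>) \<cdot> E' \<delta> = E' \<delta>"
          using Comp_assoc[OF E'[OF \<delta>] pHom u(1)] pE'[OF \<delta>] u(2)[OF \<delta>] by simp
        then show "u \<cdot> p \<Lambda> \<cdot> i (ord_succ \<delta>) \<Lambda> \<cdot> w \<delta> = i (ord_succ \<delta>) \<Lambda> \<cdot> w \<delta>"
          using Comp_assoc[OF wHom[OF \<delta>] i\<alpha> up] by (simp add: E'_def)
        have "(u \<cdot> p \<Lambda>) \<cdot> i \<delta> \<Lambda> = i \<delta> \<Lambda>" using less.IH[of \<delta>] succ \<delta> by simp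
        moreover have "i (ord_succ \<delta>) \<Lambda> \<cdot> i \<delta> (ord_succ \<delta>) = i \<delta> \<Lambda>" using iComp[OF le_succ, of \<delta> \<Lambda>] \<delta> by simp
        ultimately show "u \<cdot> p \<Lambda> \<cdot> i (ord_succ \<delta>) \<Lambda> \<cdot> i \<delta> (ord_succ \<delta>) = i (ord_succ \<delta>) \<Lambda> \<cdot> i \<delta> (ord_succ \<delta>)"
          using Comp_assoc[OF s i\<alpha> up] by simp
      qed
      then show ?thesis using succ by simp
    next
      case limit
      have ds: "direct_system C \<alpha> X i" using c(7)[of \<alpha>] by (rule direct_system_mono) (simp add: less_imp_le)
      show ?thesis
      proof (rule colimit_unique[OF c(6)[OF order.refl limit] ds Comp_Hom[OF i\<alpha> up] i\<alpha>])
        fix \<beta> assume \<beta>: "\<beta> < \<alpha>"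
        note b = less_imp_le[OF \<beta>]
        have "(u \<cdot> p \<Lambda>) \<cdot> i \<beta> \<Lambda> = i \<beta> \<Lambda>" using less.IH[OF \<beta>] less.prems b by simp
        then show "u \<cdot> p \<Lambda> \<cdot> i \<alpha> \<Lambda> \<cdot> i \<beta> \<alpha> = i \<alpha> \<Lambda> \<cdot> i \<beta> \<alpha>"
          using Comp_assoc[OF iHom[OF b] i\<alpha> up] iComp[OF b less.prems] by simp
      qed
    qed
  qed
  from this[OF order.refl] have "u \<cdot> p \<Lambda> = Id C (X \<Lambda>)"
    using c(2)[of \<Lambda> \<Lambda>] Comp_Id[OF up] by simp
  then have "iso_between C (p \<Lambda>) (X \<Lambda>) P" using pu by (intro iso_betweenI[OF pHom u(1)])
  then have "transfinite_composition U C M (p \<Lambda> \<cdot> i ord_zero \<Lambda>)"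
    using transfinite_composition_iso[OF tcX] HomD(3)[OF iHom[of ord_zero \<Lambda>]] by simp
  moreover have "p \<Lambda> \<cdot> i ord_zero \<Lambda> \<in> Hom C A P" using Comp_Hom[OF iHom pHom, of ord_zero \<Lambda>] X0 by simp
  ultimately show ?thesis unfolding cellular_objects_def using A by blast
qed

section \<open>Approximations\<close>

lemma homological_inflations: "homological U C \<I> \<Longrightarrow> \<I> \<subseteq> inflations C" "homological U C \<I> \<Longrightarrow> small U \<I>"
  by (auto simp: homological_def)

text \<open>The object at the end of the factorization of \<open>A -> 0\<close> lifts against
  \<open>\<I>\<close>, so Hom(k, T) is surjective for every \<open>k\<close> in \<open>\<I>\<close>,
  and homologicality translates this into vanishing of Ext. The cokernel of \<open>f\<close> is its
  pushout along \<open>A -> 0\<close>, hence a cell complex.\<close>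

lemma special_preenvelope:
  assumes hom: "homological U C \<I>" and A: "A \<in> Obj C"
  obtains f T q X where "conflation A f T q X" "T \<in> right_perp C (Coker C \<I>)" "X \<in> Cells U C \<I>"
    "transfinite_composition U C (pushouts_of C \<I>) f"
proof -
  note I = homological_inflations[OF hom]
  note PI = pushouts_of_inflations[OF I(1)] and PP = pushouts_of_pushouts_of[of \<I>]
  obtain Z where Z: "zero_object C Z" using ex_zero_object by blast
  note ZO = zero_object_Obj[OF Z]
  obtain \<Theta> X i p where ch: "chain (pushouts_of C \<I>) \<Theta> X i" and X0: "X ord_zero = A"
    and p: "p \<in> Hom C (X \<Theta>) Z" and rlp: "\<And>k. k \<in> \<I> \<Longrightarrow> has_rlp p k"
    using small_object_argument[OF I Zero_Hom[OF A ZO]] by metis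
  let ?f = "i ord_zero \<Theta>" and ?T = "X \<Theta>"
  have f: "?f \<in> Hom C A ?T" using chainD(3)[OF ch order.refl, of ord_zero] X0 by simp
  have T: "?T \<in> Obj C" using f by (rule HomD)
  have tc: "transfinite_composition U C (pushouts_of C \<I>) ?f" using ch by (rule transfinite_composition_if_chain)
  then have "?f \<in> inflations C"
    using transfinite_composition_subset[OF _ PI] transfinite_composition_inflation by blast
  then obtain q Y where q: "conflation A ?f ?T q Y" using conflation_if_inflation f by blast
  have "(\<lambda>g. g \<cdot> k) ` Hom C (Cod C k) ?T = Hom C (Dom C k) ?T" if k: "k \<in> \<I>" for k
  proof
    have kh: "k \<in> Hom C (Dom C k) (Cod C k)" using inflation_Hom I(1) k by blast
    show "(\<lambda>g. g \<cdot> k) ` Hom C (Cod C k) ?T \<subseteq> Hom C (Dom C k) ?T" using Comp_Hom[OF kh] by blast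
    show "Hom C (Dom C k) ?T \<subseteq> (\<lambda>g. g \<cdot> k) ` Hom C (Cod C k) ?T"
    proof
      fix g assume g: "g \<in> Hom C (Dom C k) ?T"
      have h: "Zero C (Cod C k) Z \<in> Hom C (Cod C k) Z" using HomD(5)[OF kh] ZO by (rule Zero_Hom)
      have "p \<cdot> g = Zero C (Cod C k) Z \<cdot> k"
        using zero_object_unique(2)[OF Z Comp_Hom[OF g p] Comp_Hom[OF kh h]] .
      then obtain l where "l \<in> Hom C (Cod C k) ?T" "l \<cdot> k = g"
        using has_rlpD[OF rlp[OF k] p kh g h] by blast
      then show "g \<in> (\<lambda>g. g \<cdot> k) ` Hom C (Cod C k) ?T" by blast
    qed
  qed
  then have "?T \<in> right_perp C (Coker C \<I>)"
    using hom T unfolding homological_def right_perp_def by blast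
  moreover have "Y \<in> Cells U C \<I>"
  proof -
    note d = conflationD[OF q]
    have "transfinite_composition U C (pushouts_of C \<I>) (Zero C Z Y)"
      using transfinite_composition_pushout[OF tc cokernel_pushout[OF d(10) f d(3) Z] PI PP] .
    then show ?thesis unfolding Cells_eq cellular_objects_def using Z Zero_Hom[OF ZO d(7)] by blast
  qed
  ultimately show ?thesis using that q tc by blast
qed

text \<open>Salce's trick: push the special preenvelope of the kernel of \<open>d\<close> out along the kernel.\<close>

lemma special_precover_along_deflation:
  assumes hom: "homological U C \<I>" and d: "d \<in> deflations C" "d \<in> Hom C P Y"
  obtains T y E d' x q X where "conflation T y E d' Y" "T \<in> right_perp C (Coker C \<I>)"
    "conflation P x E q X" "X \<in> Cells U C \<I>" "transfinite_composition U C (pushouts_of C \<I>) x"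
proof -
  note I = homological_inflations[OF hom]
  obtain k K where k: "conflation K k P d Y" using conflation_if_deflation[OF d] .
  note kd = conflationD[OF k]
  obtain t T q X where t: "conflation K t T q X" "T \<in> right_perp C (Coker C \<I>)" "X \<in> Cells U C \<I>"
    "transfinite_composition U C (pushouts_of C \<I>) t"
    using special_preenvelope[OF hom kd(5)] .
  note td = conflationD[OF t(1)]
  have "Dom C k = Dom C t" using HomD(2)[OF kd(2)] HomD(2)[OF td(2)] by simp
  then obtain x y where po: "is_pushout C t k x y"
    using inflation_pushout[OF td(8) HomD(1)[OF kd(2)]] by blast
  note xy = pushout_Hom[OF po td(2) kd(2)]
  obtain q' where q': "conflation P x (Cod C x) q' X"
    using pushout_conflation[OF t(1) po kd(2) xy(1,2)] .
  obtain d' where d': "conflation T y (Cod C x) d' Y"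
    using pushout_conflation[OF k pushout_sym[OF po] td(2) xy(2,1)] .
  have "transfinite_composition U C (pushouts_of C \<I>) x"
    using transfinite_composition_pushout[OF t(4) po pushouts_of_inflations[OF I(1)] pushouts_of_pushouts_of] .
  then show ?thesis using that d' t(2,3) q' by blast
qed

lemma Cells_subset_Filt:
  assumes "homological U C \<I>"
  shows "Cells U C \<I> \<subseteq> Filt U C (Coker C \<I>)"
  unfolding Cells_eq Filt_eq
  using cellular_objects_mono pushouts_of_subset_inflations_with_cokernel_in homological_inflations(1)[OF assms] by blast

lemma Coker_subset_Cells: "Coker C \<I> \<subseteq> Cells U C \<I>"
proof
  fix S assume S: "S \<in> Coker C \<I>"
  obtain Z where Z: "zero_object C Z" using ex_zero_object by blast
  have h: "Zero C Z S \<in> Hom C Z S" using zero_object_Obj[OF Z] Coker_Obj[OF S] by (rule Zero_Hom)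
  show "S \<in> Cells U C \<I>"
    unfolding Cells_eq cellular_objects_def
    using Z h transfinite_composition_single[OF Coker_pushout[OF S Z] h] by blast
qed

text \<open>The inclusions of cokernels in cell complexes and of these in filtered objects are
  reversed by the orthogonal; Eklof's lemma closes the circle.\<close>

lemma right_perp_Cells_Filt:
  assumes "homological U C \<I>"
  shows "right_perp C (Cells U C \<I>) = right_perp C (Coker C \<I>)"
    and "right_perp C (Filt U C (Coker C \<I>)) = right_perp C (Coker C \<I>)"
proof -
  have "right_perp C (Coker C \<I>) \<subseteq> right_perp C (Filt U C (Coker C \<I>))"
    using Ext1_vanishes_if_filtered right_perpD(1) unfolding right_perp_def[of _ "Filt U C _"] by blast
  moreover have "right_perp C (Filt U C (Coker C \<I>)) \<subseteq> right_perp C (Cells U C \<I>)"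
    using Cells_subset_Filt[OF assms] by (rule right_perp_antimono)
  moreover have "right_perp C (Cells U C \<I>) \<subseteq> right_perp C (Coker C \<I>)"
    using Coker_subset_Cells by (rule right_perp_antimono)
  ultimately show "right_perp C (Cells U C \<I>) = right_perp C (Coker C \<I>)"
    "right_perp C (Filt U C (Coker C \<I>)) = right_perp C (Coker C \<I>)" by auto
qed

lemma precovering_Cells:
  assumes "homological U C \<I>"
  shows "precovering C (Cells U C \<I>)"
  unfolding precovering_def
proof
  fix N assume N: "N \<in> Obj C"
  note I = homological_inflations[OF assms]
  obtain Z where Z: "zero_object C Z" using ex_zero_object by blast
  obtain \<Theta> X i p where ch: "chain (pushouts_of C \<I>) \<Theta> X i" and X0: "X ord_zero = Z"
    and p: "p \<in> Hom C (X \<Theta>) N" and rlp: "\<And>k. k \<in> \<I> \<Longrightarrow> has_rlp p k"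
    using small_object_argument[OF I Zero_Hom[OF zero_object_Obj[OF Z] N]] by metis
  have "i ord_zero \<Theta> \<in> Hom C Z (X \<Theta>)" using chainD(3)[OF ch order.refl, of ord_zero] X0 by simp
  then have X: "X \<Theta> \<in> Cells U C \<I>"
    unfolding Cells_eq cellular_objects_def using Z transfinite_composition_if_chain[OF ch] by blast
  have rlp': "has_rlp p m" if "m \<in> pushouts_of C \<I>" for m
    using that rlp has_rlp_pushout[OF _ p] unfolding pushouts_of_def by blast
  have "\<exists>l\<in>Hom C F (X \<Theta>). h = p \<cdot> l" if F: "F \<in> Cells U C \<I>" and h: "h \<in> Hom C F N" for F h
    using cellular_lift[OF F[unfolded Cells_eq] rlp' p h] by metis
  then have "is_precover C (Cells U C \<I>) N p"
    unfolding is_precover_def using HomD(1-3)[OF p] X by simp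
  then show "\<exists>f. is_precover C (Cells U C \<I>) N f" ..
qed

text \<open>In the special preenvelope the cokernel is a cell complex, on which Ext into \<T>
  vanishes; hence every map from \<open>A\<close> to an object of \<T> extends.\<close>

lemma preenveloping_right_perp:
  assumes "homological U C \<I>"
  shows "preenveloping C (right_perp C (Coker C \<I>))"
  unfolding preenveloping_def
proof
  fix A assume "A \<in> Obj C"
  then obtain f T q X where c: "conflation A f T q X" "T \<in> right_perp C (Coker C \<I>)" "X \<in> Cells U C \<I>"
    using special_preenvelope[OF assms] by metis
  note d = conflationD[OF c(1)]
  have "\<exists>g\<in>Hom C T F. h = g \<cdot> f" if F: "F \<in> right_perp C (Coker C \<I>)" and h: "h \<in> Hom C A F" for F h
  proof -
    have "Ext1_vanishes C X F"
      using Ext1_vanishes_if_filtered[OF F] c(3) Cells_subset_Filt[OF assms] by blast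
    then show ?thesis using Hom_surjective_if_Ext1_vanishes[OF c(1) _ h] by metis
  qed
  then have "is_preenvelope C (right_perp C (Coker C \<I>)) A f"
    unfolding is_preenvelope_def using HomD(1-3)[OF d(2)] c(2) by simp
  then show "\<exists>f. is_preenvelope C (right_perp C (Coker C \<I>)) A f" ..
qed

lemma Filt_subset_left_perp: "Filt U C \<S> \<subseteq> left_perp C (right_perp C \<S>)"
  using Ext1_vanishes_if_filtered cellular_objects_Obj unfolding left_perp_def Filt_eq by blast

lemma generatingE:
  assumes "generating U C \<G>" "Y \<in> Obj C"
  obtains J :: "'u set" and F P e d where "small U J" "\<forall>j\<in>J. F j \<in> \<G>"
    "is_coproduct C J F P e" "d \<in> deflations C" "d \<in> Hom C P Y"
  using bspec[OF assms(1)[unfolded generating_def] assms(2)] by (elim exE conjE) (rule that)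

text \<open>The middle term is an extension of a cell complex by a coproduct of objects of the left
  orthogonal, and that class is closed under coproducts and extensions.\<close>

lemma special_precover:
  assumes hom: "homological U C \<I>" and gen: "generating U C (left_perp C (right_perp C (Coker C \<I>)))"
    and Y: "Y \<in> Obj C"
  obtains T k E p where "conflation T k E p Y" "T \<in> right_perp C (Coker C \<I>)"
    "E \<in> left_perp C (right_perp C (Coker C \<I>))"
proof -
  let ?T = "right_perp C (Coker C \<I>)"
  obtain J :: "'u set" and F P e d where J: "\<forall>j\<in>J. F j \<in> left_perp C ?T" "is_coproduct C J F P e"
    "d \<in> deflations C" "d \<in> Hom C P Y"
    using gen Y by (rule generatingE)
  obtain T y E d' x q X where c: "conflation T y E d' Y" "T \<in> ?T" "conflation P x E q X" "X \<in> Cells U C \<I>"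
    using special_precover_along_deflation[OF hom J(3,4)] by metis
  have "Ext1_vanishes C E T'" if T': "T' \<in> ?T" for T'
  proof (rule Ext1_vanishes_extension[OF c(3) right_perpD(1)[OF T']])
    show "Ext1_vanishes C P T'"
      using Ext1_vanishes_coproduct[OF J(2) right_perpD(1)[OF T']] left_perpD(2)[OF bspec[OF J(1)] T'] by blast
    show "Ext1_vanishes C X T'"
      using Ext1_vanishes_if_filtered[OF T'] c(4) Cells_subset_Filt[OF hom] by blast
  qed
  then have "E \<in> left_perp C ?T" using conflationD(6)[OF c(1)] by (simp add: left_perp_def)
  then show ?thesis using that c(1,2) by blast
qed

text \<open>The left orthogonal contains \<open>Coker C \<I>\<close>, so its right orthogonal is no
  larger than \<T>; it also contains the cell complexes, so the special preenvelopes have cokernels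
  in the right class.\<close>

lemma complete_cotorsion_pair_left_perp:
  assumes hom: "homological U C \<I>" and gen: "generating U C (left_perp C (right_perp C (Coker C \<I>)))"
  shows "complete_cotorsion_pair C (left_perp C (right_perp C (Coker C \<I>))) (right_perp C (Coker C \<I>))"
proof -
  let ?T = "right_perp C (Coker C \<I>)"
  have sub: "Cells U C \<I> \<subseteq> left_perp C ?T"
    using Cells_subset_Filt[OF hom] Filt_subset_left_perp by blast
  have "right_perp C (left_perp C ?T) \<subseteq> ?T"
    using Coker_subset_Cells sub by (intro right_perp_antimono) blast
  moreover have "?T \<subseteq> right_perp C (left_perp C ?T)"
    using right_perpD(1) left_perpD(2) unfolding right_perp_def[of _ "left_perp C _"] by blast
  ultimately have "cotorsion_pair C (left_perp C ?T) ?T"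
    unfolding cotorsion_pair_def using left_perpD(1) right_perpD(1) by blast
  moreover have "\<exists>i p. (i, p) \<in> Confl C \<and> Dom C i \<in> ?T \<and> Cod C i \<in> left_perp C ?T \<and> Cod C p = A"
    if A: "A \<in> Obj C" for A
  proof -
    obtain T k E p where c: "conflation T k E p A" "T \<in> ?T" "E \<in> left_perp C ?T"
      using special_precover[OF hom gen A] .
    then show ?thesis using conflationD(1-3)[OF c(1)] by (auto simp: Hom_def)
  qed
  moreover have "\<exists>i p. (i, p) \<in> Confl C \<and> Dom C i = A \<and> Cod C i \<in> ?T \<and> Cod C p \<in> left_perp C ?T"
    if A: "A \<in> Obj C" for A
  proof -
    obtain f T q X where c: "conflation A f T q X" "T \<in> ?T" "X \<in> Cells U C \<I>"
      using special_preenvelope[OF hom A] by metis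
    then show ?thesis using conflationD(1-3)[OF c(1)] sub by (auto simp: Hom_def)
  qed
  ultimately show ?thesis unfolding complete_cotorsion_pair_def by blast
qed

text \<open>With filtered generators, the middle term over an object of the left orthogonal is
  obtained from a coproduct of filtered objects by a relative cell complex and is therefore
  filtered. The kernel lies in \<T>, so the deflation splits and exhibits the object as a
  summand.\<close>

lemma left_perp_eq_summands:
  assumes hom: "homological U C \<I>" and gen: "generating U C (Filt U C (Coker C \<I>))"
  shows "left_perp C (right_perp C (Coker C \<I>)) =
    {X \<in> Obj C. \<exists>F\<in>Filt U C (Coker C \<I>). direct_summand C X F}"
proof (intro equalityI subsetI)
  let ?T = "right_perp C (Coker C \<I>)" and ?M = "inflations_with_cokernel_in C (Coker C \<I>)"
  note M = inflations_with_cokernel_in_subset[of "Coker C \<I>"] pushouts_of_inflations_with_cokernel_in[of "Coker C \<I>"]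
  fix Y assume Y: "Y \<in> left_perp C ?T"
  obtain J :: "'u set" and F P e d where J: "small U J" "\<forall>j\<in>J. F j \<in> Filt U C (Coker C \<I>)"
    "is_coproduct C J F P e" "d \<in> deflations C" "d \<in> Hom C P Y"
    using gen left_perpD(1)[OF Y] by (rule generatingE)
  obtain T y E d' x q X where c: "conflation T y E d' Y" "T \<in> ?T" "conflation P x E q X"
    "transfinite_composition U C (pushouts_of C \<I>) x"
    using special_precover_along_deflation[OF hom J(4,5)] by metis
  have "P \<in> cellular_objects ?M"
    using cellular_objects_coproduct[OF M J(1,3)] J(2) unfolding Filt_eq by blast
  moreover have "transfinite_composition U C ?M x"
    using c(4) pushouts_of_subset_inflations_with_cokernel_in[OF homological_inflations(1)[OF hom]]
    by (rule transfinite_composition_subset)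
  ultimately have E: "E \<in> Filt U C (Coker C \<I>)"
    unfolding Filt_eq using cellular_objects_extend[OF M] conflationD(2)[OF c(3)] by blast
  have "Ext1_vanishes C Y T" using left_perpD(2)[OF Y c(2)] .
  then obtain s where "s \<in> Hom C Y E" "d' \<cdot> s = Id C Y"
    using c(1) Ext1_vanishes_iff[OF left_perpD(1)[OF Y] right_perpD(1)[OF c(2)]] by blast
  then show "Y \<in> {X \<in> Obj C. \<exists>F\<in>Filt U C (Coker C \<I>). direct_summand C X F}"
    using direct_summand_if_section[OF c(1)] E left_perpD(1)[OF Y] by blast
next
  fix X assume "X \<in> {X \<in> Obj C. \<exists>F\<in>Filt U C (Coker C \<I>). direct_summand C X F}"
  then obtain F where F: "X \<in> Obj C" "F \<in> Filt U C (Coker C \<I>)" "direct_summand C X F" by blast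
  have "Ext1_vanishes C X T" if T: "T \<in> right_perp C (Coker C \<I>)" for T
    using Ext1_vanishes_summand[OF F(3) right_perpD(1)[OF T] Ext1_vanishes_if_filtered[OF T F(2)]] .
  then show "X \<in> left_perp C (right_perp C (Coker C \<I>))" using F(1) by (simp add: left_perp_def)
qed

end

theorem theorem2p13:
  fixes U :: "'u::wellorder itself"
    and C :: "('o, 'm, 'z) exact_cat_scheme"
    and \<I> :: "'m set" and \<S> \<T> :: "'o set"
  assumes "inaccessible_ordinals U"
    and "exact_category C"
    and "locally_small U C"
    and Ax1: "inflations_closed_under_transfinite_compositions U C"
    and Ax2: "\<forall>X\<in>Obj C. small_relative_to U C (inflations C) X"
    and "homological U C \<I>"
    and "\<S> = Coker C \<I>"
    and "\<T> = right_perp C \<S>"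
  shows
    "precovering C (Cells U C \<I>) \<and>

     (Cells U C \<I> \<subseteq> Filt U C \<S> \<and>
      (strongly_homological U C \<I> \<longrightarrow> Cells U C \<I> = Filt U C \<S>)) \<and>

     (\<T> = right_perp C (Cells U C \<I>) \<and> \<T> = right_perp C (Filt U C \<S>)) \<and>

     (preenveloping C \<T> \<and>
      (\<forall>M\<in>Obj C. \<exists>i p. (i, p) \<in> Confl C \<and>
         Dom C i = M \<and> Cod C i \<in> \<T> \<and> Cod C p \<in> Cells U C \<I>)) \<and>

     (generating U C (left_perp C \<T>) \<longrightarrow>
      (\<forall>M\<in>Obj C. \<exists>i p. (i, p) \<in> Confl C \<and>
         Dom C i \<in> \<T> \<and> Cod C i \<in> left_perp C \<T> \<and> Cod C p = M) \<and>
      complete_cotorsion_pair C (left_perp C \<T>) \<T>) \<and>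

     (generating U C (Filt U C \<S>) \<longrightarrow>
      left_perp C \<T> = {X \<in> Obj C. \<exists>F\<in>Filt U C \<S>. direct_summand C X F})"
proof -
  interpret exact_category C by fact
  interpret efficient_category U C
    by unfold_locales (use assms(1,3) Ax1 Ax2 in auto)
  have \<T>: "\<T> = right_perp C (Coker C \<I>)" using assms(7,8) by simp
  note hom = \<open>homological U C \<I>\<close>
  have cells: "Cells U C \<I> = Filt U C \<S>" if "strongly_homological U C \<I>"
    using Cells_subset_Filt[OF hom] cellular_objects_mono[OF inflations_with_cokernel_in_subset_pushouts_of[OF that]]
    unfolding assms(7) Cells_eq Filt_eq by blast
  have preenvelope: "\<exists>i p. (i, p) \<in> Confl C \<and> Dom C i = M \<and> Cod C i \<in> \<T> \<and> Cod C p \<in> Cells U C \<I>"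
    if M: "M \<in> Obj C" for M
  proof -
    obtain f T q X where c: "conflation M f T q X" "T \<in> right_perp C (Coker C \<I>)" "X \<in> Cells U C \<I>"
      using special_preenvelope[OF hom M] by metis
    have "Dom C f = M" "Cod C f = T" "Cod C q = X"
      using conflationD(2,3)[OF c(1)] by (simp_all add: Hom_def)
    then show ?thesis
      unfolding \<T> using conflationD(1)[OF c(1)] c(2,3) by (intro exI[of _ f] exI[of _ q]) simp
  qed
  have pair: "complete_cotorsion_pair C (left_perp C \<T>) \<T>" if "generating U C (left_perp C \<T>)"
    using complete_cotorsion_pair_left_perp[OF hom] that unfolding \<T> by simp
  have precover: "\<exists>i p. (i, p) \<in> Confl C \<and> Dom C i \<in> \<T> \<and> Cod C i \<in> left_perp C \<T> \<and> Cod C p = M"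
    if "generating U C (left_perp C \<T>)" "M \<in> Obj C" for M
    using pair[OF that(1)] that(2) unfolding complete_cotorsion_pair_def by blast
  show ?thesis
    using precovering_Cells[OF hom] Cells_subset_Filt[OF hom] cells right_perp_Cells_Filt[OF hom]
      preenveloping_right_perp[OF hom] preenvelope pair precover left_perp_eq_summands[OF hom]
    unfolding \<T> assms(7) by (intro conjI ballI impI) simp_all
qed

end
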